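(* Let $X_t$, $t\in I$, be a Gaussian random field (real, stationary) with spectral density $f(\lambda)\in\mathbf L_p$. Let $S_T=\int_{t\in I_T}P_l(X_t)\,\nu(dt)$, where $P_l(X_t)$ are the univariate Appell (Hermite) polynomials and $l\ge2$. Assume that $$z:=p^{-1}\le1-\frac1l .$$ Then $$\sigma^2:=f^{( *,l)}(0)=\int_{y_1,\dots,y_{l-1}\in S}f(y_1)f(y_2-y_1)\cdots f(y_{l-1}-y_{l-2})f(-y_{l-1})\prod_{i=1}^{l-1}dy_i<\infty .$$ If, moreover, $\sigma\neq0$, then the central limit theorem holds: $T^{-d/2}S_T\to N(0,\sigma^2)$ in distribution as $T\to\infty$.
   Context: Fix $d\ge1$. Discrete case: $I=\mathbb Z^d$, $\nu$ is counting measure, $S=[-\pi,\pi]^d$ (torus, arguments of $f$ computed modulo $[-\pi,\pi]^d$) and $\mu$ is Lebesgue measure on $S$ normalized to total mass $1$. Continuous case: $I=\mathbb R^d$, $\nu$ is Lebesgue measure, $S=\mathbb R^d$, $\mu$ is Lebesgue measure, and $X_t$ is a measurable field. The domains are $I_T=[1,T]^d\cap\mathbb Z^d$ or $[-T/2,T/2]^d\cap\mathbb Z^d$ in the discrete case and $I_T=[-T/2,T/2]^d$ in the continuous case. The spectral density $f\in L_1$ is defined by $\mathrm{Cov}(X_t,X_s)=\int_S e^{i(t-s)\cdot\lambda}f(\lambda)\,\mu(d\lambda)$. The Appell polynomials associated with the distribution of $X_t$ are defined by $P_0=1$, $P_n'=nP_{n-1}$ and $\mathbb E P_n(X_t)=0$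 for $n\ge1$. $\mathbf L_p$ denotes the closure, in the $L_p(S,d\mu)$ norm, of the functions that are continuous, bounded and of bounded support ($1\le p\le\infty$).
   Formalization: The limit law is N(0, l! σ²) in the discrete case and N(0, l! (2π)^d σ²) in the continuous case, instead of N(0, σ²), with σ² = f^{( *,l)}(0) unchanged; the printed constant fails for i.i.d. N(0,1), f = 1, l = 2, where σ² = 1 but the limit variance is 2. *)

theory Defs
  imports "HOL-Probability.Probability"
begin

text \<open>
  Both cases live on \<open>real ^ 'd\<close>; the lattice of the discrete case is the set of vectors with
  integer coordinates.  Only the values \<open>X t\<close> with \<open>t \<in> index_set c\<close>, and only the values
  of a spectral density on \<open>freq_set c\<close>, are relevant.
\<close>

datatype time_case = Discrete | Continuous

definition index_set :: "time_case \<Rightarrow> (real ^ 'd::finite) set" where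
  "index_set c = (case c of Discrete \<Rightarrow> {t. \<forall>i. t $ i \<in> \<int>} | Continuous \<Rightarrow> UNIV)"

definition index_measure :: "time_case \<Rightarrow> (real ^ 'd::finite) measure" where
  "index_measure c = (case c of Discrete \<Rightarrow> count_space (index_set c) | Continuous \<Rightarrow> lborel)"

definition freq_set :: "time_case \<Rightarrow> (real ^ 'd::finite) set" where
  "freq_set c = (case c of Discrete \<Rightarrow> {x. \<forall>i. - pi \<le> x $ i \<and> x $ i \<le> pi} | Continuous \<Rightarrow> UNIV)"

definition freq_measure :: "time_case \<Rightarrow> (real ^ 'd::finite) measure" where
  "freq_measure c = (case c of Discrete \<Rightarrow> uniform_measure lborel (freq_set c) | Continuous \<Rightarrow> lborel)"

text \<open>
  Reduction of frequencies: in the discrete case each coordinate is reduced modulo \<open>2 * pi\<close>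
  to its representative in \<open>[-pi, pi)\<close>.
\<close>

definition wrap :: "time_case \<Rightarrow> real ^ 'd::finite \<Rightarrow> real ^ 'd" where
  "wrap c x = (case c of
      Discrete \<Rightarrow> (\<chi> i. x $ i - 2 * pi * of_int \<lfloor>(x $ i + pi) / (2 * pi)\<rfloor>)
    | Continuous \<Rightarrow> x)"

definition centred_box :: "time_case \<Rightarrow> real \<Rightarrow> (real ^ 'd::finite) set" where
  "centred_box c T = {t \<in> index_set c. \<forall>i. - T / 2 \<le> t $ i \<and> t $ i \<le> T / 2}"

definition corner_box :: "time_case \<Rightarrow> real \<Rightarrow> (real ^ 'd::finite) set" where
  "corner_box c T = {t \<in> index_set c. \<forall>i. 1 \<le> t $ i \<and> t $ i \<le> T}"

definition sampling_domains :: "time_case \<Rightarrow> (real \<Rightarrow> (real ^ 'd::finite) set) set" where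
  "sampling_domains c = (case c of
      Discrete \<Rightarrow> {corner_box c, centred_box c}
    | Continuous \<Rightarrow> {centred_box c})"

text \<open>The normal law with mean \<open>m\<close> and variance \<open>v\<close>; variance \<open>0\<close> gives the point mass at \<open>m\<close>.\<close>

definition normal_law :: "real \<Rightarrow> real \<Rightarrow> real measure" where
  "normal_law m v = (if v = 0 then return borel m else density lborel (normal_density m (sqrt v)))"

definition gaussian_rv :: "'w measure \<Rightarrow> ('w \<Rightarrow> real) \<Rightarrow> bool" where
  "gaussian_rv M Y \<longleftrightarrow>
     Y \<in> borel_measurable M \<and> (\<exists>m v. 0 \<le> v \<and> distr M borel Y = normal_law m v)"

definition gaussian_field :: "time_case \<Rightarrow> 'w measure \<Rightarrow> (real ^ 'd::finite \<Rightarrow> 'w \<Rightarrow> real) \<Rightarrow> bool" where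
  "gaussian_field c M X \<longleftrightarrow>
     (\<forall>t\<in>index_set c. X t \<in> borel_measurable M) \<and>
     (\<forall>J a. finite J \<longrightarrow> J \<subseteq> index_set c \<longrightarrow> gaussian_rv M (\<lambda>\<omega>. \<Sum>t\<in>J. a t * X t \<omega>))"

definition stationary_field :: "time_case \<Rightarrow> 'w measure \<Rightarrow> (real ^ 'd::finite \<Rightarrow> 'w \<Rightarrow> real) \<Rightarrow> bool" where
  "stationary_field c M X \<longleftrightarrow>
     (\<forall>J h. finite J \<longrightarrow> J \<subseteq> index_set c \<longrightarrow> h \<in> index_set c \<longrightarrow>
        distr M (\<Pi>\<^sub>M t\<in>J. borel) (\<lambda>\<omega>. \<lambda>t\<in>J. X (t + h) \<omega>) =
        distr M (\<Pi>\<^sub>M t\<in>J. borel) (\<lambda>\<omega>. \<lambda>t\<in>J. X t \<omega>))"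

text \<open>Joint measurability, needed for \<open>X\<close> to be integrated over \<open>t\<close> in the continuous case.\<close>

definition measurable_field :: "time_case \<Rightarrow> 'w measure \<Rightarrow> (real ^ 'd::finite \<Rightarrow> 'w \<Rightarrow> real) \<Rightarrow> bool" where
  "measurable_field c M X \<longleftrightarrow>
     (c = Continuous \<longrightarrow> (\<lambda>(t, \<omega>). X t \<omega>) \<in> borel_measurable (borel \<Otimes>\<^sub>M M))"

definition covariance :: "'w measure \<Rightarrow> ('w \<Rightarrow> real) \<Rightarrow> ('w \<Rightarrow> real) \<Rightarrow> real" where
  "covariance M Y Z = (LINT \<omega>|M. (Y \<omega> - integral\<^sup>L M Y) * (Z \<omega> - integral\<^sup>L M Z))"

definition has_spectral_density ::
    "time_case \<Rightarrow> 'w measure \<Rightarrow> (real ^ 'd::finite \<Rightarrow> 'w \<Rightarrow> real) \<Rightarrow> (real ^ 'd \<Rightarrow> real) \<Rightarrow> bool" where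
  "has_spectral_density c M X f \<longleftrightarrow>
     integrable (freq_measure c) f \<and>
     (\<forall>t\<in>index_set c. \<forall>s\<in>index_set c.
        complex_of_real (covariance M (X t) (X s)) =
        (LINT x|freq_measure c. exp (\<i> * complex_of_real ((t - s) \<bullet> x)) * complex_of_real (f x)))"

definition Lp_norm :: "ennreal \<Rightarrow> 'a measure \<Rightarrow> ('a \<Rightarrow> real) \<Rightarrow> ennreal" where
  "Lp_norm p M g =
     (if p = \<infinity> then esssup M (\<lambda>x. ennreal \<bar>g x\<bar>)
      else let N = (\<integral>\<^sup>+ x. ennreal (\<bar>g x\<bar> powr enn2real p) \<partial>M)
           in if N = \<infinity> then \<infinity> else ennreal (enn2real N powr (1 / enn2real p)))"

text \<open>
  Continuity of \<open>g \<circ> wrap c\<close> is continuity on the torus in the discrete case.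
\<close>

definition test_functions :: "time_case \<Rightarrow> (real ^ 'd::finite \<Rightarrow> real) set" where
  "test_functions c =
     {g. continuous_on UNIV (\<lambda>x. g (wrap c x)) \<and> bounded (g ` freq_set c) \<and>
         bounded {x \<in> freq_set c. g x \<noteq> 0}}"

definition Lp_closure :: "time_case \<Rightarrow> ennreal \<Rightarrow> (real ^ 'd::finite \<Rightarrow> real) set" where
  "Lp_closure c p =
     {f \<in> borel_measurable (freq_measure c).
        \<forall>e>0. \<exists>g\<in>test_functions c. Lp_norm p (freq_measure c) (\<lambda>x. f x - g (wrap c x)) < e}"

text \<open>The Appell polynomials of a law \<open>D\<close>; this determines \<open>P\<close> uniquely.\<close>

definition appell :: "real measure \<Rightarrow> (nat \<Rightarrow> real poly) \<Rightarrow> bool" where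
  "appell D P \<longleftrightarrow>
     P 0 = 1 \<and>
     (\<forall>n\<ge>1. pderiv (P n) = smult (of_nat n) (P (n - 1)) \<and>
            integrable D (poly (P n)) \<and> integral\<^sup>L D (poly (P n)) = 0)"

text \<open>
  The \<open>l\<close>-fold convolution of \<open>f\<close> at \<open>0\<close>: the integration variable \<open>y\<close> stands for
  \<open>(y 1, \<dots>, y (l - 1))\<close>, and \<open>dy i\<close> is the (in the discrete case normalized) measure
  \<open>freq_measure c\<close>.
\<close>

definition conv_measure :: "time_case \<Rightarrow> nat \<Rightarrow> (nat \<Rightarrow> real ^ 'd::finite) measure" where
  "conv_measure c l = (\<Pi>\<^sub>M i\<in>{1..l-1}. freq_measure c)"

definition conv_integrand ::
    "time_case \<Rightarrow> nat \<Rightarrow> (real ^ 'd::finite \<Rightarrow> real) \<Rightarrow> (nat \<Rightarrow> real ^ 'd) \<Rightarrow> real" where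
  "conv_integrand c l f y =
     f (wrap c (y 1)) * (\<Prod>i\<in>{2..l-1}. f (wrap c (y i - y (i - 1)))) * f (wrap c (- y (l - 1)))"

definition conv_at_0 :: "time_case \<Rightarrow> nat \<Rightarrow> (real ^ 'd::finite \<Rightarrow> real) \<Rightarrow> real" where
  "conv_at_0 c l f = (LINT y|conv_measure c l. conv_integrand c l f y)"

text \<open>
  With \<open>P n' = n P (n - 1)\<close> one has \<open>Cov (P l (X t), P l (X s)) = l! r(t - s) ^ l\<close> for
  \<open>r(t - s) = Cov (X t, X s)\<close>, so \<open>T ^ (-d) Var S_T\<close> tends to \<open>l! (\<integral> r ^ l d\<nu>)\<close>.  Since the
  \<open>l\<close>-fold convolution of \<open>f\<close> is the spectral density of \<open>r ^ l\<close>, Fourier inversion gives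
  \<open>(\<integral> r ^ l d\<nu>) = f^(*,l)(0)\<close> in the discrete case (normalized measure on the torus) and
  \<open>(2 pi) ^ d f^(*,l)(0)\<close> in the continuous case (unnormalized Lebesgue measure).
  With these normalizations the variance of the limit law is thus \<open>f^(*,l)(0)\<close> times the
  factor below (\<open>d\<close> is the dimension), not \<open>f^(*,l)(0)\<close> itself: for standard Gaussian white
  noise on the integers, \<open>f = 1\<close> and \<open>f^(*,2)(0) = 1\<close>, but \<open>Var (X t ^ 2 - 1) = 2\<close>.
\<close>

definition variance_factor :: "time_case \<Rightarrow> nat \<Rightarrow> nat \<Rightarrow> real" where
  "variance_factor c d l = fact l * (case c of Discrete \<Rightarrow> 1 | Continuous \<Rightarrow> (2 * pi) ^ d)"

definition field_sum ::
    "time_case \<Rightarrow> (real \<Rightarrow> (real ^ 'd::finite) set) \<Rightarrow> real poly \<Rightarrow>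
     (real ^ 'd \<Rightarrow> 'w \<Rightarrow> real) \<Rightarrow> real \<Rightarrow> 'w \<Rightarrow> real" where
  "field_sum c D Q X T \<omega> = (LINT t:D T|index_measure c. poly Q (X t \<omega>))"

text \<open>
  Convergence in distribution along a real parameter \<open>T \<rightarrow> \<infinity>\<close>, i.e. along every sequence
  tending to infinity.
\<close>

definition converges_in_law_at_top ::
    "'w measure \<Rightarrow> (real \<Rightarrow> 'w \<Rightarrow> real) \<Rightarrow> real measure \<Rightarrow> bool" where
  "converges_in_law_at_top M Y L \<longleftrightarrow>
     (\<forall>\<tau>. filterlim \<tau> at_top sequentially \<longrightarrow> weak_conv_m (\<lambda>n. distr M borel (Y (\<tau> n))) L)"

end

theory Submission
  imports Defs
begin

text \<open>
  The covariance function \<open>r\<close> is the Fourier transform of \<open>f\<close>.  As \<open>1 / p \<le> 1 - 1 / l\<close>, a Hausdorff-Young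
  argument gives \<open>r \<in> L\<^sub>l\<close>, Young's inequality for chains of convolutions makes the integral defining
  \<open>f^(*,l)(0)\<close> absolutely convergent, and Fourier inversion (first for a test function in one factor, with
  a summability kernel) identifies it with the integral of \<open>r ^ l\<close> up to the dual normalization.

  For the limit theorem, the Appell polynomials of a Gaussian law are Hermite polynomials.  Gaussian
  integration by parts gives \<open>E (S exp (i u S)) = i u E (G exp (i u S))\<close> for a weighted sum \<open>S\<close> of Hermite
  polynomials of degree \<open>l\<close>, where \<open>G\<close> has mean \<open>Var S\<close> and a variance bounded by the four-cycle sums of \<open>\<bar>r\<bar>\<close>,
  which are negligible after normalization because \<open>r \<in> L\<^sub>l\<close>.  Hence the characteristic function of
  \<open>S\<close> nearly solves \<open>\<phi>' = - u V \<phi>\<close> and is close to \<open>exp (- V u^2 / 2)\<close>.  Integrals over continuous time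
  are limits of such weighted sums, and Levy's continuity theorem concludes.
\<close>

section \<open>Times and frequencies\<close>

text \<open>One exponent governs the analysis: q = l / (l - 1), conjugate to l. The condition on p
  says that p is at least q, and a function in L_1 that is a limit of test functions in L_p is one
  in L_q; the same q serves Hausdorff-Young, Young's inequality for a cycle of l factors, and the
  density argument. The obstacle in the limit theorem is that r lies in L_l but in general not in
  L_(l-1), whereas the four-cycle sums contain the power l - 1. Put x = T^(d/l). Over a box of side
  of order T the integral of r^2 is O(x^(l-2)), and that of the power l - 1 is o(x), where Hoelder
  alone would give O(x). This gain is what makes T^(-2d) T^d x^(l-2) o(x)^2 tend to 0. The error
  bound for a finite weighted sum depends on its points only through the total weight and two
  weighted sums of powers of r, not on how many points there are; this is why it survives refinement
  to an integral over continuous time. Only moments of four Hermite factors enter, never moments of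
  all orders.\<close>

abbreviation dual_factor :: "time_case \<Rightarrow> nat \<Rightarrow> real" where
  "dual_factor c d \<equiv> (case c of Discrete \<Rightarrow> 1 | Continuous \<Rightarrow> (2 * pi) ^ d)"

text \<open>Counting measure on the lattice has the power set of the lattice as its sigma-algebra.
  Its image under inclusion is a Borel measure on the whole space, so both cases share one
  sigma-algebra and Fubini with \<open>freq_measure\<close> needs no distinction. The price is that
  statements about index times hold almost everywhere, by \<open>AE_time_measure\<close>.\<close>

definition time_measure :: "time_case \<Rightarrow> (real ^ 'd::finite) measure" where
  "time_measure c = distr (index_measure c) borel (\<lambda>t. t)"

lemma index_set_Discrete_eq:
  "index_set Discrete = (\<lambda>f::'d::finite \<Rightarrow> int. \<chi> i. real_of_int (f i)) ` UNIV"
proof (safe)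
  fix t :: "real ^ 'd" assume "t \<in> index_set Discrete"
  then have "\<forall>i. \<exists>k. t $ i = real_of_int k"
    by (auto simp: index_set_def elim!: Ints_cases)
  then obtain f where "\<And>i. t $ i = real_of_int (f i)" by metis
  then have "t = (\<chi> i. real_of_int (f i))" by (simp add: vec_eq_iff)
  then show "t \<in> range (\<lambda>f. \<chi> i. real_of_int (f i))" by blast
qed (auto simp: index_set_def)

lemma countable_index_set_Discrete: "countable (index_set Discrete :: (real ^ 'd::finite) set)"
  unfolding index_set_Discrete_eq by (intro countable_image countableI_type)

lemma index_set_borel [measurable]: "index_set c \<in> sets (borel :: (real ^ 'd::finite) measure)"
proof (cases c)
  case Discrete
  have "index_set Discrete = (\<Union>x\<in>index_set Discrete. {x :: real ^ 'd})" by auto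
  also have "\<dots> \<in> sets borel"
    by (intro sets.countable_UN'' countable_index_set_Discrete) auto
  finally show ?thesis using Discrete by simp
qed (simp add: index_set_def)

lemma sets_index_borel: "(\<lambda>t. t) \<in> index_measure c \<rightarrow>\<^sub>M (borel :: (real ^ 'd::finite) measure)"
  by (cases c) (simp_all add: index_measure_def)

lemma sets_time_measure [measurable_cong, simp]: "sets (time_measure c) = sets borel"
  by (simp add: time_measure_def)

lemma space_time_measure [simp]: "space (time_measure c) = UNIV"
  by (simp add: time_measure_def)

lemma time_measure_Continuous: "time_measure Continuous = lborel"
  unfolding time_measure_def index_measure_def
  by (simp add: distr_id2)

lemma AE_time_measure: "AE t in time_measure c. t \<in> index_set c"
  unfolding time_measure_def
  by (cases c) (auto simp: AE_distr_iff sets_index_borel index_measure_def AE_count_space index_set_def[of Continuous])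

lemma nn_integral_time_measure:
  "h \<in> borel_measurable borel \<Longrightarrow> (\<integral>\<^sup>+ t. h t \<partial>time_measure c) = (\<integral>\<^sup>+ t. h t \<partial>index_measure c)"
  unfolding time_measure_def by (subst nn_integral_distr) (auto simp: sets_index_borel)

lemma emeasure_time_Discrete:
  "A \<in> sets borel \<Longrightarrow> emeasure (time_measure Discrete) A = emeasure (count_space (index_set Discrete)) (A \<inter> index_set Discrete)"
  unfolding time_measure_def
  by (subst emeasure_distr) (auto simp: sets_index_borel index_measure_def)

lemma sigma_finite_time_measure: "sigma_finite_measure (time_measure c :: (real ^ 'd::finite) measure)"
proof (cases c)
  case Discrete
  let ?I = "index_set Discrete :: (real ^ 'd) set"
  show ?thesis
  proof
    show "\<exists>A. countable A \<and> A \<subseteq> sets (time_measure c :: (real ^ 'd) measure) \<and> \<Union> A = space (time_measure c) \<and>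
       (\<forall>a\<in>A. emeasure (time_measure c) a \<noteq> \<infinity>)"
    proof (intro exI conjI ballI)
      show "countable (insert (- ?I) ((\<lambda>t. {t}) ` ?I))"
        using countable_index_set_Discrete by auto
      fix a assume "a \<in> insert (- ?I) ((\<lambda>t. {t}) ` ?I)"
      then show "emeasure (time_measure c) a \<noteq> \<infinity>"
        unfolding Discrete by (auto simp: emeasure_time_Discrete)
    qed auto
  qed
next
  case Continuous
  then show ?thesis by (simp add: time_measure_Continuous sigma_finite_lborel)
qed

interpretation time: sigma_finite_measure "time_measure c"
  by (rule sigma_finite_time_measure)

lemma index_set_add: "s \<in> index_set c \<Longrightarrow> t \<in> index_set c \<Longrightarrow> s + t \<in> index_set c"
  and index_set_diff: "s \<in> index_set c \<Longrightarrow> t \<in> index_set c \<Longrightarrow> s - t \<in> index_set c"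
  and index_set_zero: "0 \<in> index_set c"
  and index_set_minus: "s \<in> index_set c \<Longrightarrow> - s \<in> index_set c"
  by (cases c; auto simp: index_set_def)+

text \<open>The map that sends t to a - t is a bijection of the lattice for a lattice point
  \<open>a\<close>, and an affine map with determinant of modulus 1 in the continuous case. It is
  the substitution by which double integrals are later written in time differences.\<close>

lemma nn_integral_time_reflect:
  assumes [measurable]: "h \<in> borel_measurable borel" and "a \<in> index_set c"
  shows "(\<integral>\<^sup>+ t. h (a - t) \<partial>time_measure c) = (\<integral>\<^sup>+ t. h t \<partial>time_measure c)"
proof (cases c)
  case Discrete
  have "bij_betw (\<lambda>t. a - t) (index_set c) (index_set c)"
    by (rule bij_betwI[where g="\<lambda>t. a - t"]) (use assms in \<open>auto intro: index_set_diff\<close>)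
  then show ?thesis
    by (simp add: nn_integral_time_measure)
       (simp add: Discrete index_measure_def nn_integral_bij_count_space)
next
  case Continuous
  have "(\<integral>\<^sup>+ t. h t \<partial>lborel) = (\<integral>\<^sup>+ t. h t \<partial>(density (distr lborel borel (\<lambda>x. a + (-1) *\<^sub>R x)) (\<lambda>_. ennreal 1)))"
    by (subst lborel_affine[of "-1" a]) simp_all
  also have "\<dots> = (\<integral>\<^sup>+ t. h (a - t) \<partial>lborel)"
    by (subst nn_integral_density) (simp_all add: nn_integral_distr)
  finally show ?thesis by (simp add: Continuous time_measure_Continuous)
qed

section \<open>Frequencies on the torus: fundamental domain and invariance of the measure\<close>

definition half_cube :: "(real ^ 'd::finite) set" where
  "half_cube = {x. \<forall>i. - pi \<le> x $ i \<and> x $ i < pi}"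

lemma freq_set_Discrete: "freq_set Discrete = (cbox (\<chi> i. - pi) (\<chi> i. pi) :: (real ^ 'd::finite) set)"
  by (auto simp: freq_set_def mem_box_cart)

lemma half_cube_borel [measurable]: "half_cube \<in> sets borel"
  unfolding half_cube_def by measurable

lemma freq_set_borel [measurable]: "freq_set c \<in> sets borel"
  by (cases c) (auto simp: freq_set_Discrete, simp add: freq_set_def)

lemma emeasure_freq_cube: "emeasure lborel (freq_set Discrete :: (real ^ 'd::finite) set) = ennreal ((2 * pi) ^ CARD('d))"
proof -
  have b: "(u - l) \<bullet> b = 2 * pi" if "b \<in> Basis" "u = (\<chi> i. pi)" "l = (\<chi> i. -pi)" for b l u :: "real ^ 'd"
    using that by (auto simp: Basis_vec_def inner_axis)
  show ?thesis
    unfolding freq_set_Discrete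
    by (subst emeasure_lborel_cbox) (auto simp: b, auto simp: Basis_vec_def inner_axis)
qed

lemma sets_freq_measure [measurable_cong, simp]: "sets (freq_measure c) = sets borel"
  by (cases c) (simp_all add: freq_measure_def)

lemma space_freq_measure [simp]: "space (freq_measure c) = UNIV"
  by (cases c) (simp_all add: freq_measure_def)

lemma prob_space_freq_Discrete: "prob_space (freq_measure Discrete :: (real ^ 'd::finite) measure)"
  unfolding freq_measure_def by (simp, rule prob_space_uniform_measure) (auto simp: emeasure_freq_cube)

lemma sigma_finite_freq_measure: "sigma_finite_measure (freq_measure c :: (real ^ 'd::finite) measure)"
proof (cases c)
  case Discrete
  interpret prob_space "freq_measure Discrete :: (real ^ 'd) measure" by (rule prob_space_freq_Discrete)
  show ?thesis unfolding Discrete ..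
qed (simp add: freq_measure_def sigma_finite_lborel)

interpretation freq: sigma_finite_measure "freq_measure c"
  by (rule sigma_finite_freq_measure)

lemma AE_boundary: "AE x in lborel. \<forall>i. x $ i \<noteq> (a::real)"
proof -
  have "AE x in lborel. \<not> (x :: real ^ 'd::finite) $ i = a" for i
  proof (rule AE_I')
    have "{x. x $ i = a} \<in> null_sets lebesgue"
      using negligible_hyperplane[of "axis i (1::real)" a] by (simp add: negligible_iff_null_sets inner_axis')
    moreover have "{x :: real ^ 'd. x $ i = a} \<in> sets borel" by measurable
    ultimately show "{x :: real ^ 'd. x $ i = a} \<in> null_sets lborel"
      by (simp add: null_sets_completion_iff)
  qed auto
  then show ?thesis by (subst AE_all_countable) auto
qed

text \<open>The closed cube repeats classes modulo 2 pi on its boundary, while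
  \<open>half_cube\<close> contains each class exactly once. They differ inside finitely many
  hyperplanes, a null set, and the half-open form is the one to which tiling arguments
  apply.\<close>

lemma nn_integral_freq_Discrete:
  fixes F :: "real ^ 'd::finite \<Rightarrow> ennreal"
  assumes [measurable]: "F \<in> borel_measurable borel"
  shows "(\<integral>\<^sup>+ x. F x \<partial>freq_measure Discrete) =
    (\<integral>\<^sup>+ x. F x * indicator half_cube x \<partial>lborel) / ennreal ((2 * pi) ^ CARD('d))"
proof -
  have "(\<integral>\<^sup>+ x. F x * indicator (freq_set Discrete) x \<partial>lborel) = (\<integral>\<^sup>+ x. F x * indicator half_cube x \<partial>lborel)"
  proof (rule nn_integral_cong_AE)
    show "AE x in lborel. F x * indicator (freq_set Discrete) x = F x * indicator half_cube x"
      using AE_boundary[of pi]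
    proof eventually_elim
      case (elim x)
      then have "x \<in> freq_set Discrete \<longleftrightarrow> x \<in> half_cube"
        unfolding freq_set_def half_cube_def by (auto intro: order_neq_le_trans less_imp_le)
      then show ?case by (simp add: indicator_def)
    qed
  qed
  then show ?thesis
    by (simp add: freq_measure_def nn_integral_uniform_measure emeasure_freq_cube)
qed

lemma wrap_borel [measurable]: "wrap c \<in> borel_measurable (borel :: (real ^ 'd::finite) measure)"
proof (cases c)
  case Discrete
  have "(\<lambda>x :: real ^ 'd. (\<chi> i. x $ i - 2 * pi * of_int \<lfloor>(x $ i + pi) / (2 * pi)\<rfloor>)) \<in> borel_measurable borel"
    by (subst borel_measurable_euclidean_space) (auto simp: Basis_vec_def inner_axis)
  then show ?thesis unfolding wrap_def Discrete by simp
qed (simp add: wrap_def[abs_def])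

lemma wrap_Discrete_obtain:
  obtains n where "n \<in> index_set Discrete" "wrap Discrete x = x - (2 * pi) *\<^sub>R n"
  by (rule that[of "\<chi> i. of_int \<lfloor>(x $ i + pi) / (2 * pi)\<rfloor>"])
     (auto simp: index_set_def wrap_def vec_eq_iff)

lemma wrap_Discrete_half_cube: "wrap Discrete x \<in> half_cube"
proof -
  have "- pi \<le> y - 2 * pi * of_int \<lfloor>(y + pi) / (2 * pi)\<rfloor> \<and> y - 2 * pi * of_int \<lfloor>(y + pi) / (2 * pi)\<rfloor> < pi" for y
  proof -
    have "of_int \<lfloor>(y + pi) / (2 * pi)\<rfloor> \<le> (y + pi) / (2 * pi)" "(y + pi) / (2 * pi) < of_int \<lfloor>(y + pi) / (2 * pi)\<rfloor> + 1"
      by linarith+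
    then have "of_int \<lfloor>(y + pi) / (2 * pi)\<rfloor> * (2 * pi) \<le> y + pi" "y + pi < (of_int \<lfloor>(y + pi) / (2 * pi)\<rfloor> + 1) * (2 * pi)"
      by (simp_all only: pos_le_divide_eq[symmetric] pos_divide_less_eq[symmetric] mult_pos_pos pi_gt_zero zero_less_numeral)
    then show ?thesis by (simp add: algebra_simps)
  qed
  then show ?thesis by (auto simp: half_cube_def wrap_def)
qed

lemma wrap_Discrete_eqI:
  assumes "n \<in> index_set Discrete" "x - (2 * pi) *\<^sub>R n \<in> half_cube"
  shows "wrap Discrete x = x - (2 * pi) *\<^sub>R n"
proof -
  have "of_int \<lfloor>(x $ i + pi) / (2 * pi)\<rfloor> = n $ i" for i
  proof -
    from assms obtain k where k: "n $ i = of_int k" by (auto simp: index_set_def elim!: Ints_cases)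
    moreover have "- pi \<le> x $ i - 2 * pi * n $ i" "x $ i - 2 * pi * n $ i < pi"
      using assms(2) by (auto simp: half_cube_def)
    ultimately have "\<lfloor>(x $ i + pi) / (2 * pi)\<rfloor> = k"
      by (intro floor_unique) (auto simp: field_simps)
    then show ?thesis by (simp add: k)
  qed
  then show ?thesis by (simp add: wrap_def vec_eq_iff)
qed

lemma wrap_Discrete_shift:
  assumes "n \<in> index_set Discrete"
  shows "wrap Discrete (x + (2 * pi) *\<^sub>R n) = wrap Discrete x"
proof -
  obtain m where m: "m \<in> index_set Discrete" "wrap Discrete x = x - (2 * pi) *\<^sub>R m"
    by (rule wrap_Discrete_obtain)
  have "wrap Discrete (x + (2 * pi) *\<^sub>R n) = x + (2 * pi) *\<^sub>R n - (2 * pi) *\<^sub>R (m + n)"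
  proof (rule wrap_Discrete_eqI)
    show "m + n \<in> index_set Discrete" using m assms by (simp add: index_set_add)
    show "x + (2 * pi) *\<^sub>R n - (2 * pi) *\<^sub>R (m + n) \<in> half_cube"
      using wrap_Discrete_half_cube[of x] m by (simp add: algebra_simps)
  qed
  then show ?thesis by (simp add: m algebra_simps)
qed

lemma wrap_wrap_add: "wrap c (a + wrap c x) = wrap c (a + x)"
proof (cases c)
  case Discrete
  obtain m where m: "m \<in> index_set Discrete" "wrap Discrete x = x - (2 * pi) *\<^sub>R m"
    by (rule wrap_Discrete_obtain)
  show ?thesis unfolding Discrete
    using wrap_Discrete_shift[OF index_set_minus[OF m(1)], of "a + x"] by (simp add: m algebra_simps)
qed (simp add: wrap_def)

lemma wrap_wrap [simp]: "wrap c (wrap c x) = wrap c x"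
  using wrap_wrap_add[of c 0 x] by simp

text \<open>A point and its representative differ by 2 pi times a lattice vector, and the inner
  product of that vector with a lattice time is an integer. Hence the characters at index times are
  functions on the torus.\<close>

lemma cis_wrap:
  assumes "t \<in> index_set c"
  shows "cis (t \<bullet> wrap c x) = cis (t \<bullet> x)"
proof (cases c)
  case Discrete
  obtain m where m: "m \<in> index_set Discrete" "wrap Discrete x = x - (2 * pi) *\<^sub>R m"
    by (rule wrap_Discrete_obtain)
  have "t \<bullet> m \<in> \<int>"
    using m(1) assms Discrete by (auto simp: inner_vec_def index_set_def intro!: Ints_sum Ints_mult)
  then have "cis (2 * pi * (t \<bullet> m)) = 1" by (rule cis_multiple_2pi)
  moreover have "t \<bullet> wrap c x = t \<bullet> x - 2 * pi * (t \<bullet> m)" by (simp add: Discrete m inner_diff_right)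
  ultimately show ?thesis by (simp flip: cis_divide)
qed (simp add: wrap_def)

lemma AE_wrap: "AE x in freq_measure c. wrap c x = x"
proof (cases c)
  case Discrete
  have "AE x in lborel. x \<in> freq_set Discrete \<longrightarrow> wrap Discrete x = x"
    using AE_boundary[of pi]
  proof eventually_elim
    case (elim x)
    show ?case
    proof
      assume "x \<in> freq_set Discrete"
      then have "x \<in> half_cube" using elim by (auto simp: freq_set_def half_cube_def intro: order_neq_le_trans)
      then show "wrap Discrete x = x" using wrap_Discrete_eqI[of 0 x] by (simp add: index_set_def)
    qed
  qed
  then show ?thesis unfolding Discrete freq_measure_def time_case.case
    by (intro AE_uniform_measureI) auto
qed (simp add: wrap_def)

text \<open>Unfolding: the translates of \<open>half_cube\<close> by 2 pi times the lattice tile the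
  space. Inserting this partition of unity into the integral over the shifted cube and moving each
  piece back into the original cube reassembles the unshifted integral, because the integrand is
  periodic.\<close>

lemma nn_integral_freq_shift:
  fixes F :: "real ^ 'd::finite \<Rightarrow> ennreal"
  assumes [measurable]: "F \<in> borel_measurable borel"
  shows "(\<integral>\<^sup>+ x. F (wrap c (a + x)) \<partial>freq_measure c) = (\<integral>\<^sup>+ x. F x \<partial>freq_measure c)"
proof (cases c)
  case Discrete
  define G where "G x = F (wrap Discrete x)" for x
  have [measurable]: "G \<in> borel_measurable borel" unfolding G_def by measurable
  have G: "G (x + (2 * pi) *\<^sub>R n) = G x" if "n \<in> index_set Discrete" for x n
    using that by (simp add: G_def wrap_Discrete_shift)
  have tile: "(\<integral>\<^sup>+ n. indicator half_cube (x - (2 * pi) *\<^sub>R n) \<partial>time_measure Discrete) = (1::ennreal)" for x :: "real ^ 'd"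
  proof -
    obtain m where m: "m \<in> index_set Discrete" "wrap Discrete x = x - (2 * pi) *\<^sub>R m"
      by (rule wrap_Discrete_obtain)
    have iff: "x - (2 * pi) *\<^sub>R n \<in> half_cube \<longleftrightarrow> n = m" if "n \<in> index_set Discrete" for n
      using wrap_Discrete_eqI[OF that] m wrap_Discrete_half_cube[of x] by auto
    have "(\<integral>\<^sup>+ n. indicator half_cube (x - (2 * pi) *\<^sub>R n) \<partial>time_measure Discrete)
      = (\<integral>\<^sup>+ n. indicator {m} n \<partial>count_space (index_set Discrete))"
      by (subst nn_integral_time_measure)
         (auto simp: index_measure_def indicator_def iff intro!: nn_integral_cong)
    also have "\<dots> = 1"
      using m by (subst nn_integral_indicator) auto
    finally show ?thesis .
  qed
  have shift: "(\<integral>\<^sup>+ x. H (x + b) \<partial>lborel) = (\<integral>\<^sup>+ x. H x \<partial>lborel)"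
    if [measurable]: "H \<in> borel_measurable borel" for H :: "real ^ 'd \<Rightarrow> ennreal" and b
    by (subst (2) lborel_distr_plus[symmetric, of b]) (simp add: nn_integral_distr add.commute)
  interpret pair_sigma_finite "lborel :: (real ^ 'd) measure" "time_measure Discrete :: (real ^ 'd) measure" ..
  let ?C = "indicator half_cube :: real ^ 'd \<Rightarrow> ennreal"
  have neg: "(\<integral>\<^sup>+ n. H (- n) \<partial>time_measure Discrete) = (\<integral>\<^sup>+ n. H n \<partial>time_measure Discrete)"
    if "H \<in> borel_measurable borel" for H :: "real ^ 'd \<Rightarrow> ennreal"
    using nn_integral_time_reflect[OF that, of 0 Discrete] by (simp add: index_set_zero)
  \<comment> \<open>\<open>K n\<close> is the part of the cube shifted by \<open>a\<close> that lies
    in the n-th tile, and \<open>K' n\<close> the part of the original cube that lies in the n-th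
    tile shifted by \<open>a\<close>. Translation by 2 pi n turns \<open>K n\<close> into
    \<open>K' (- n)\<close>, so summing over n exchanges the two cubes.\<close>
  define K where "K n x = G x * ?C (x - a) * ?C (x - (2 * pi) *\<^sub>R n)" for n x
  define K' where "K' n x = G x * ?C x * ?C ((x - a) - (2 * pi) *\<^sub>R n)" for n x
  have K_meas [measurable]: "(\<lambda>(x, n). K n x) \<in> borel_measurable (borel \<Otimes>\<^sub>M borel)"
    "(\<lambda>(x, n). K' n x) \<in> borel_measurable (borel \<Otimes>\<^sub>M borel)"
    "(\<lambda>(x, n). K' (- n) x) \<in> borel_measurable (borel \<Otimes>\<^sub>M borel)"
    unfolding K_def K'_def split_beta by measurable
  have K1: "K n \<in> borel_measurable borel" "(\<lambda>n. K' n x) \<in> borel_measurable borel" for n x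
    unfolding K_def K'_def by measurable
  have "(\<integral>\<^sup>+ x. G (a + x) * ?C x \<partial>lborel) = (\<integral>\<^sup>+ x. G (a + (x + - a)) * ?C (x + - a) \<partial>lborel)"
    by (rule shift[of "\<lambda>x. G (a + x) * ?C x" "- a", symmetric]) measurable
  also have "\<dots> = (\<integral>\<^sup>+ x. \<integral>\<^sup>+ n. K n x \<partial>time_measure Discrete \<partial>lborel)"
    unfolding K_def by (subst nn_integral_cmult) (auto simp: tile)
  also have "\<dots> = (\<integral>\<^sup>+ n. \<integral>\<^sup>+ x. K n x \<partial>lborel \<partial>time_measure Discrete)"
    by (rule Fubini'[symmetric]) measurable
  also have "\<dots> = (\<integral>\<^sup>+ n. \<integral>\<^sup>+ x. K n (x + (2 * pi) *\<^sub>R n) \<partial>lborel \<partial>time_measure Discrete)"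
    by (subst shift[OF K1(1)]) simp
  also have "\<dots> = (\<integral>\<^sup>+ n. \<integral>\<^sup>+ x. K' (- n) x \<partial>lborel \<partial>time_measure Discrete)"
  proof (rule nn_integral_cong_AE, use AE_time_measure[of Discrete] in eventually_elim)
    case (elim n)
    have "K n (x + (2 * pi) *\<^sub>R n) = K' (- n) x" for x
    proof -
      have "x + (2 * pi) *\<^sub>R n - (2 * pi) *\<^sub>R n = x" "x + (2 * pi) *\<^sub>R n - a = x - a - (2 * pi) *\<^sub>R (- n)"
        by simp_all
      then show ?thesis
        unfolding K_def K'_def G[OF elim] by (simp only: mult_ac)
    qed
    then show ?case by simp
  qed
  also have "\<dots> = (\<integral>\<^sup>+ x. \<integral>\<^sup>+ n. K' (- n) x \<partial>time_measure Discrete \<partial>lborel)"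
    by (rule Fubini') measurable
  also have "\<dots> = (\<integral>\<^sup>+ x. \<integral>\<^sup>+ n. K' n x \<partial>time_measure Discrete \<partial>lborel)"
    by (subst neg[OF K1(2)]) simp
  also have "\<dots> = (\<integral>\<^sup>+ x. G x * ?C x \<partial>lborel)"
    unfolding K'_def by (subst nn_integral_cmult) (auto simp: tile)
  finally have "(\<integral>\<^sup>+ x. G (a + x) \<partial>freq_measure Discrete) = (\<integral>\<^sup>+ x. G x \<partial>freq_measure Discrete)"
    by (simp add: nn_integral_freq_Discrete)
  also have "\<dots> = (\<integral>\<^sup>+ x. F x \<partial>freq_measure Discrete)"
    using AE_wrap[of Discrete] by (intro nn_integral_cong_AE) (auto simp: G_def)
  finally show ?thesis unfolding G_def Discrete .
next
  case Continuous
  then show ?thesis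
    by (simp add: freq_measure_def wrap_def)
       (subst (2) lborel_distr_plus[symmetric, of a], simp add: nn_integral_distr)
qed

lemma nn_integral_freq_reflect:
  fixes F :: "real ^ 'd::finite \<Rightarrow> ennreal"
  assumes [measurable]: "F \<in> borel_measurable borel"
  shows "(\<integral>\<^sup>+ x. F (wrap c (a - x)) \<partial>freq_measure c) = (\<integral>\<^sup>+ x. F x \<partial>freq_measure c)"
proof -
  have refl: "(\<integral>\<^sup>+ x. H x \<partial>lborel) = (\<integral>\<^sup>+ x. H (- x) \<partial>lborel)"
    if [measurable]: "H \<in> borel_measurable borel" for H :: "real ^ 'd \<Rightarrow> ennreal"
    by (subst lborel_affine[of "-1" 0], simp) (subst nn_integral_density, auto simp: nn_integral_distr)
  have refl': "(\<integral>\<^sup>+ x. H (- x) \<partial>freq_measure c) = (\<integral>\<^sup>+ x. H x \<partial>freq_measure c)"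
    if [measurable]: "H \<in> borel_measurable borel" for H :: "real ^ 'd \<Rightarrow> ennreal"
  proof (cases c)
    case Discrete
    have "- x \<in> freq_set Discrete \<longleftrightarrow> x \<in> freq_set Discrete" for x :: "real ^ 'd"
      by (auto simp: freq_set_def) (metis minus_le_iff le_minus_iff)+
    then have "(\<integral>\<^sup>+ x. H x * indicator (freq_set Discrete) x \<partial>lborel) = (\<integral>\<^sup>+ x. H (- x) * indicator (freq_set Discrete) x \<partial>lborel)"
      by (subst refl) (auto simp: indicator_def)
    then show ?thesis by (simp add: Discrete freq_measure_def nn_integral_uniform_measure)
  qed (simp add: freq_measure_def refl[symmetric])
  have "(\<integral>\<^sup>+ x. F (wrap c (a + - x)) \<partial>freq_measure c) = (\<integral>\<^sup>+ x. F (wrap c (a + x)) \<partial>freq_measure c)"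
    by (rule refl') measurable
  then show ?thesis by (simp add: nn_integral_freq_shift)
qed

lemma integer_box:
  fixes l u :: "'d::finite \<Rightarrow> int"
  defines "B \<equiv> {t \<in> index_set Discrete. \<forall>i. of_int (l i) \<le> t $ i \<and> t $ i \<le> of_int (u i)}"
  shows finite_integer_box: "finite B" and card_integer_box: "card B = (\<Prod>i\<in>UNIV. nat (u i - l i + 1))"
proof -
  let ?f = "\<lambda>f::'d \<Rightarrow> int. (\<chi> i. real_of_int (f i))"
  have inj: "inj ?f" by (auto simp: inj_on_def vec_eq_iff fun_eq_iff)
  have B: "B = ?f ` (PiE UNIV (\<lambda>i. {l i..u i}))"
    unfolding B_def index_set_Discrete_eq by (auto simp: PiE_UNIV_domain)
  show "finite B" unfolding B by (intro finite_imageI finite_PiE) auto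
  show "card B = (\<Prod>i\<in>UNIV. nat (u i - l i + 1))"
    unfolding B by (subst card_image[OF inj_on_subset[OF inj]]) (auto simp: card_PiE)
qed

lemma integrable_cis [simp]:
  fixes f :: "'a \<Rightarrow> real"
  assumes "integrable M f" and [measurable]: "h \<in> borel_measurable M"
  shows "integrable M (\<lambda>x. cis (h x) * of_real (f x))" "integrable M (\<lambda>x. of_real (f x) * cis (h x))"
proof -
  have [measurable]: "f \<in> borel_measurable M" using assms(1) by simp
  have [measurable]: "(\<lambda>x. cis (h x)) \<in> borel_measurable M"
    unfolding cis_conv_exp by measurable
  show "integrable M (\<lambda>x. cis (h x) * of_real (f x))"
    by (rule Bochner_Integration.integrable_bound[OF assms(1)]) (auto simp: norm_mult)
  then show "integrable M (\<lambda>x. of_real (f x) * cis (h x))" by (simp add: mult.commute)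
qed

lemma borel_measurable_cis [measurable (raw)]:
  "h \<in> borel_measurable M \<Longrightarrow> (\<lambda>x. cis (h x)) \<in> borel_measurable M"
  unfolding cis_conv_exp by measurable

text \<open>Invariance of nonnegative integrals, applied to indicators, says that the measure equals
  its own image under these maps. Bochner integrals and integrability then transfer through the
  image measure.\<close>

lemma integral_freq_shift:
  fixes F :: "real ^ 'd::finite \<Rightarrow> 'b::{banach, second_countable_topology}"
  assumes [measurable]: "F \<in> borel_measurable borel"
  shows "(LINT x|freq_measure c. F (wrap c (a + x))) = (LINT x|freq_measure c. F x)"
    and "(LINT x|freq_measure c. F (wrap c (a - x))) = (LINT x|freq_measure c. F x)"
    and "integrable (freq_measure c) (\<lambda>x. F (wrap c (a + x))) \<longleftrightarrow> integrable (freq_measure c) F"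
    and "integrable (freq_measure c) (\<lambda>x. F (wrap c (a - x))) \<longleftrightarrow> integrable (freq_measure c) F"
proof -
  have 1: "distr (freq_measure c) (freq_measure c) (\<lambda>x. wrap c (a + x)) = freq_measure c"
  proof (rule measure_eqI)
    fix A assume "A \<in> sets (distr (freq_measure c) (freq_measure c) (\<lambda>x. wrap c (a + x)))"
    then have [measurable]: "A \<in> sets borel" by simp
    have "emeasure (distr (freq_measure c) (freq_measure c) (\<lambda>x. wrap c (a + x))) A = (\<integral>\<^sup>+x. indicator A x \<partial>distr (freq_measure c) (freq_measure c) (\<lambda>x. wrap c (a + x)))"
      by simp
    also have "\<dots> = (\<integral>\<^sup>+x. indicator A (wrap c (a + x)) \<partial>freq_measure c)"
      by (subst nn_integral_distr) auto
    also have "\<dots> = (\<integral>\<^sup>+x. indicator A x \<partial>freq_measure c)"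
      by (rule nn_integral_freq_shift) simp
    finally show "emeasure (distr (freq_measure c) (freq_measure c) (\<lambda>x. wrap c (a + x))) A = emeasure (freq_measure c) A"
      by simp
  qed simp
  have 2: "distr (freq_measure c) (freq_measure c) (\<lambda>x. wrap c (a - x)) = freq_measure c"
  proof (rule measure_eqI)
    fix A assume "A \<in> sets (distr (freq_measure c) (freq_measure c) (\<lambda>x. wrap c (a - x)))"
    then have [measurable]: "A \<in> sets borel" by simp
    have "emeasure (distr (freq_measure c) (freq_measure c) (\<lambda>x. wrap c (a - x))) A = (\<integral>\<^sup>+x. indicator A x \<partial>distr (freq_measure c) (freq_measure c) (\<lambda>x. wrap c (a - x)))"
      by simp
    also have "\<dots> = (\<integral>\<^sup>+x. indicator A (wrap c (a - x)) \<partial>freq_measure c)"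
      by (subst nn_integral_distr) auto
    also have "\<dots> = (\<integral>\<^sup>+x. indicator A x \<partial>freq_measure c)"
      by (rule nn_integral_freq_reflect) simp
    finally show "emeasure (distr (freq_measure c) (freq_measure c) (\<lambda>x. wrap c (a - x))) A = emeasure (freq_measure c) A"
      by simp
  qed simp
  show "(LINT x|freq_measure c. F (wrap c (a + x))) = (LINT x|freq_measure c. F x)"
    by (subst (2) 1[symmetric]) (simp add: integral_distr)
  show "(LINT x|freq_measure c. F (wrap c (a - x))) = (LINT x|freq_measure c. F x)"
    by (subst (2) 2[symmetric]) (simp add: integral_distr)
  show "integrable (freq_measure c) (\<lambda>x. F (wrap c (a + x))) \<longleftrightarrow> integrable (freq_measure c) F"
    by (subst (2) 1[symmetric]) (simp add: integrable_distr_eq)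
  show "integrable (freq_measure c) (\<lambda>x. F (wrap c (a - x))) \<longleftrightarrow> integrable (freq_measure c) F"
    by (subst (2) 2[symmetric]) (simp add: integrable_distr_eq)
qed

text \<open>For nonzero \<open>k\<close> some vector \<open>a\<close> along an axis satisfies k . a
  = pi. Translation by \<open>a\<close> multiplies the character by cis pi = -1 but preserves its
  integral, which is therefore its own negative.\<close>

lemma cis_orthogonal:
  fixes k :: "real ^ 'd::finite"
  assumes "k \<in> index_set Discrete"
  shows "(LINT x|freq_measure Discrete. cis (k \<bullet> x)) = (if k = 0 then 1 else 0)"
proof (cases "k = 0")
  case True
  interpret prob_space "freq_measure Discrete :: (real ^ 'd) measure" by (rule prob_space_freq_Discrete)
  show ?thesis using True by (simp add: prob_space[simplified])
next
  case False
  then obtain i where i: "k $ i \<noteq> 0" by (auto simp: vec_eq_iff)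
  define a where "a = axis i (pi / k $ i)"
  have ka: "k \<bullet> a = pi" using i by (simp add: a_def inner_axis)
  let ?J = "LINT x|freq_measure Discrete. cis (k \<bullet> x)"
  have "?J = (LINT x|freq_measure Discrete. cis (k \<bullet> wrap Discrete (a + x)))"
    by (rule integral_freq_shift(1)[symmetric]) measurable
  also have "\<dots> = (LINT x|freq_measure Discrete. cis pi * cis (k \<bullet> x))"
    by (simp only: cis_wrap[OF assms] inner_add_right ka cis_mult)
  also have "\<dots> = cis pi * ?J" by (rule integral_mult_right_zero)
  also have "\<dots> = - ?J" by simp
  finally have "?J = - ?J" .
  then show ?thesis using False by (simp add: eq_neg_iff_add_eq_0 flip: mult_2)
qed

lemma integral_coordinate_prod:
  fixes h :: "'a::euclidean_space \<Rightarrow> real \<Rightarrow> 'b::{real_normed_field,banach,second_countable_topology}"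
  assumes "\<And>b. b \<in> Basis \<Longrightarrow> integrable lborel (h b)"
  shows "integrable lborel (\<lambda>x. \<Prod>b\<in>Basis. h b (x \<bullet> b))"
    and "(LINT x|lborel. (\<Prod>b\<in>Basis. h b (x \<bullet> b))) = (\<Prod>b\<in>Basis. (LINT x|lborel. h b x))"
proof -
  interpret product_sigma_finite "\<lambda>_::'a. lborel :: real measure" ..
  have eq: "(\<Sum>b\<in>Basis. x b *\<^sub>R b) \<bullet> b = x b" if "b \<in> Basis" for x :: "'a \<Rightarrow> real" and b
    using that by (simp add: inner_sum_left inner_Basis if_distrib cong: if_cong)
  have [measurable]: "h b \<in> borel_measurable borel" if "b \<in> Basis" for b
    using assms[OF that] by simp
  have m: "(\<lambda>x. \<Prod>b\<in>Basis. h b (x \<bullet> b)) \<in> borel_measurable borel"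
    by (intro borel_measurable_prod) measurable
  have "integrable (\<Pi>\<^sub>M b\<in>Basis. lborel) (\<lambda>x. \<Prod>b\<in>Basis. h b (x b))"
    by (rule product_integrable_prod) (auto intro: assms)
  then show "integrable lborel (\<lambda>x. \<Prod>b\<in>Basis. h b (x \<bullet> b))"
    by (subst lborel_eq, subst integrable_distr_eq) (auto simp: eq m)
  show "(LINT x|lborel. (\<Prod>b\<in>Basis. h b (x \<bullet> b))) = (\<Prod>b\<in>Basis. (LINT x|lborel. h b x))"
    by (subst lborel_eq, subst integral_distr) (auto simp: eq m product_integral_prod assms)
qed

lemma gauss_fourier_1:
  shows "integrable lborel (\<lambda>t::real. exp (- t\<^sup>2 / 2))"
    and "(LINT t|lborel. cis (t * s) * of_real (exp (- t\<^sup>2 / 2))) = of_real (sqrt (2 * pi) * exp (- s\<^sup>2 / 2))"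
proof -
  have std: "exp (- t\<^sup>2 / 2) = sqrt (2 * pi) * std_normal_density t" for t
    by (simp add: std_normal_density_def)
  show "integrable lborel (\<lambda>t::real. exp (- t\<^sup>2 / 2))"
    unfolding std by simp
  have "char std_normal_distribution s = (LINT t|lborel. std_normal_density t *\<^sub>R cis (t * s))"
    unfolding char_def by (subst integral_density) (auto simp: cis_conv_exp mult.commute)
  then have *: "(LINT t|lborel. std_normal_density t *\<^sub>R cis (t * s)) = of_real (exp (- s\<^sup>2 / 2))"
    by (simp add: char_std_normal_distribution)
  have "(LINT t|lborel. cis (t * s) * of_real (exp (- t\<^sup>2 / 2)))
      = (LINT t|lborel. of_real (sqrt (2 * pi)) * (std_normal_density t *\<^sub>R cis (t * s)))"
    unfolding std by (intro Bochner_Integration.integral_cong) (auto simp: scaleR_conv_of_real)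
  also have "\<dots> = of_real (sqrt (2 * pi)) * of_real (exp (- s\<^sup>2 / 2))"
    by (subst integral_mult_right_zero) (simp only: *)
  finally show "(LINT t|lborel. cis (t * s) * of_real (exp (- t\<^sup>2 / 2))) = of_real (sqrt (2 * pi) * exp (- s\<^sup>2 / 2))"
    by simp
qed

lemma gauss_fourier:
  fixes x :: "real ^ 'd::finite"
  shows "integrable lborel (\<lambda>t :: real ^ 'd. exp (- (t \<bullet> t) / 2))"
    and "(LINT t|lborel. cis (t \<bullet> x) * of_real (exp (- (t \<bullet> t) / 2)))
      = of_real (sqrt (2 * pi) ^ CARD('d) * exp (- (x \<bullet> x) / 2))"
proof -
  have e: "exp (- (t \<bullet> t) / 2) = (\<Prod>b\<in>Basis. exp (- (t \<bullet> b)\<^sup>2 / 2))" for t :: "real ^ 'd"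
    by (subst euclidean_inner) (simp add: sum_negf sum_divide_distrib power2_eq_square flip: exp_sum)
  have cis_sum: "cis (\<Sum>i\<in>A. g i) = (\<Prod>i\<in>A. cis (g i))" if "finite A" for A and g :: "real ^ 'd \<Rightarrow> real"
    using that by induction (auto simp: cis_mult[symmetric])
  have c: "cis (t \<bullet> x) = (\<Prod>b\<in>Basis. cis ((t \<bullet> b) * (x \<bullet> b)))" for t
    by (subst euclidean_inner) (simp add: cis_sum)
  show "integrable lborel (\<lambda>t :: real ^ 'd. exp (- (t \<bullet> t) / 2))"
    unfolding e by (rule integral_coordinate_prod) (rule gauss_fourier_1)
  have "(LINT t|lborel. cis (t \<bullet> x) * of_real (exp (- (t \<bullet> t) / 2)))
    = (LINT t|lborel. (\<Prod>b\<in>Basis. (\<lambda>b s. cis (s * (x \<bullet> b)) * of_real (exp (- s\<^sup>2 / 2))) b (t \<bullet> b)))"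
    unfolding e c by (simp add: prod.distrib)
  also have "\<dots> = (\<Prod>b\<in>Basis. (LINT s|lborel. cis (s * (x \<bullet> b)) * of_real (exp (- s\<^sup>2 / 2))))"
    by (rule integral_coordinate_prod(2)) (intro integrable_cis gauss_fourier_1, simp)
  also have "\<dots> = (\<Prod>b\<in>(Basis :: (real ^ 'd) set). of_real (sqrt (2 * pi) * exp (- (x \<bullet> b)\<^sup>2 / 2)))"
    by (simp only: gauss_fourier_1)
  also have "\<dots> = of_real (sqrt (2 * pi) ^ CARD('d) * exp (- (x \<bullet> x) / 2))"
    by (subst e) (simp add: prod.distrib)
  finally show "(LINT t|lborel. cis (t \<bullet> x) * of_real (exp (- (t \<bullet> t) / 2)))
      = of_real (sqrt (2 * pi) ^ CARD('d) * exp (- (x \<bullet> x) / 2))" .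
qed


section \<open>Lattice cubes and point masses\<close>

definition grid_cube :: "nat \<Rightarrow> (real ^ 'd::finite) set" where
  "grid_cube n = {t \<in> index_set Discrete. \<forall>i. of_int 0 \<le> t $ i \<and> t $ i \<le> of_int (int n)}"

lemma finite_grid_cube [simp]: "finite (grid_cube n)"
  unfolding grid_cube_def by (rule finite_integer_box)

lemma card_grid_cube: "card (grid_cube n :: (real ^ 'd::finite) set) = Suc n ^ CARD('d)"
  unfolding grid_cube_def by (subst card_integer_box) (simp add: nat_add_distrib)

text \<open>The Foelner property of cubes. A cube of n + 1 points per side and its translate by t
  overlap in a box with n + 1 - \<bar>k i\<bar> points in direction i, where k is the integer vector
  of t, so the overlap fraction tends to 1. The conversion \<open>nat\<close> yields 0 when the
  overlap is empty.\<close>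

lemma card_grid_cube_shift:
  fixes t :: "real ^ 'd::finite"
  assumes "t \<in> index_set Discrete"
  shows "(\<lambda>n. real (card {b \<in> grid_cube n. t + b \<in> grid_cube n}) / real (card (grid_cube n :: (real ^ 'd) set))) \<longlonglongrightarrow> 1"
proof -
  obtain k where t: "t = (\<chi> i::'d. of_int (k i))" using assms unfolding index_set_Discrete_eq by auto
  have set_eq: "{b \<in> grid_cube n. t + b \<in> grid_cube n} =
     {s \<in> index_set Discrete. \<forall>i. of_int (max 0 (- k i)) \<le> s $ i \<and> s $ i \<le> of_int (min (int n) (int n - k i))}" for n
  proof -
    have "(of_int (max 0 (- k i)) \<le> y \<and> y \<le> of_int (min (int n) (int n - k i))) \<longleftrightarrow>
        (0 \<le> y \<and> y \<le> real n \<and> 0 \<le> of_int (k i) + y \<and> of_int (k i) + y \<le> real n)" for i and y :: real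
      by (simp add: of_int_max of_int_min) linarith
    then show ?thesis
      unfolding grid_cube_def using assms by (auto simp: t intro: index_set_add)
  qed
  have "real (card {b \<in> grid_cube n. t + b \<in> grid_cube n}) / real (card (grid_cube n :: (real ^ 'd) set))
     = (\<Prod>i\<in>UNIV. real (nat (int n + 1 - \<bar>k i\<bar>)) / real (Suc n))" for n
  proof -
    have "nat (min (int n) (int n - k i) - max 0 (- k i) + 1) = nat (int n + 1 - \<bar>k i\<bar>)" for i
      by (simp add: min_def max_def abs_if algebra_simps)
    then show ?thesis
      unfolding set_eq by (subst card_integer_box) (simp add: card_grid_cube prod_dividef)
  qed
  moreover have "(\<lambda>n. real (nat (int n + 1 - \<bar>m\<bar>)) / real (Suc n)) \<longlonglongrightarrow> 1" for m :: int
  proof -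
    have "(\<lambda>n. 1 - \<bar>real_of_int m\<bar> * inverse (real (Suc n))) \<longlonglongrightarrow> 1 - \<bar>real_of_int m\<bar> * 0"
      by (intro tendsto_intros LIMSEQ_inverse_real_of_nat)
    moreover have "eventually (\<lambda>n. 1 - \<bar>real_of_int m\<bar> * inverse (real (Suc n)) = real (nat (int n + 1 - \<bar>m\<bar>)) / real (Suc n)) sequentially"
      using eventually_ge_at_top[of "nat \<bar>m\<bar>"]
    proof eventually_elim
      case (elim n)
      then have "real (nat (int n + 1 - \<bar>m\<bar>)) = real (Suc n) - \<bar>real_of_int m\<bar>" by (simp add: of_nat_nat)
      then show ?case by (simp add: field_simps)
    qed
    ultimately show ?thesis by (simp add: Lim_transform_eventually)
  qed
  then have "(\<lambda>n. \<Prod>i\<in>UNIV. real (nat (int n + 1 - \<bar>k i\<bar>)) / real (Suc n)) \<longlonglongrightarrow> (\<Prod>i\<in>(UNIV::'d set). 1)"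
    by (intro tendsto_prod)
  ultimately show ?thesis by simp
qed

lemma time_singleton:
  assumes "s \<in> index_set Discrete"
  shows "integrable (time_measure Discrete) (\<lambda>t. cis (t \<bullet> z) * of_real (indicator {s} t))"
    and "integrable (time_measure Discrete) (indicator {s} :: _ \<Rightarrow> real)"
    and "(LINT t|time_measure Discrete. cis (t \<bullet> z) * of_real (indicator {s} t)) = cis (s \<bullet> z)"
proof -
  have e: "emeasure (time_measure Discrete) {s} = 1"
    using assms by (simp add: emeasure_time_Discrete)
  show i: "integrable (time_measure Discrete) (indicator {s} :: _ \<Rightarrow> real)"
    by (simp add: e)
  show "integrable (time_measure Discrete) (\<lambda>t. cis (t \<bullet> z) * of_real (indicator {s} t))"
    by (intro integrable_cis i) measurable
  have "(LINT t|time_measure Discrete. cis (t \<bullet> z) * of_real (indicator {s} t))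
     = (LINT t|time_measure Discrete. indicat_real {s} t *\<^sub>R cis (s \<bullet> z))"
    by (intro Bochner_Integration.integral_cong) (auto simp: indicator_def)
  also have "\<dots> = cis (s \<bullet> z)"
    by (subst integral_scaleR_left) (auto simp: i e measure_def)
  finally show "(LINT t|time_measure Discrete. cis (t \<bullet> z) * of_real (indicator {s} t)) = cis (s \<bullet> z)" .
qed

section \<open>Summability kernels\<close>

text \<open>An approximate identity \<open>W\<close> presented together with its Fourier partner
  \<open>w\<close>: the Fejer kernel on the torus, the Gauss-Weierstrass kernel on Euclidean space.
  Nonnegativity of \<open>W\<close> with fixed mass gives uniform bounds, and the bounds on
  \<open>w\<close> give dominated convergence as \<open>w n\<close> tends to 1. The mass is
  \<open>dual_factor\<close>, the constant of Fourier inversion for the chosen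
  normalizations.\<close>

definition summability_kernel ::
    "time_case \<Rightarrow> (nat \<Rightarrow> real ^ 'd::finite \<Rightarrow> real) \<Rightarrow> (nat \<Rightarrow> real ^ 'd \<Rightarrow> real) \<Rightarrow> bool" where
  "summability_kernel c w W \<longleftrightarrow>
     (\<forall>n. w n \<in> borel_measurable borel \<and> W n \<in> borel_measurable borel \<and>
        (\<forall>t. 0 \<le> w n t \<and> w n t \<le> 1 \<and> 0 \<le> W n t) \<and>
        integrable (time_measure c) (w n) \<and> integrable (freq_measure c) (W n) \<and>
        (\<forall>z. (LINT t|time_measure c. cis (t \<bullet> z) * of_real (w n t)) = of_real (W n z)) \<and>
        (LINT z|freq_measure c. W n z) = dual_factor c CARD('d)) \<and>
     (\<forall>t\<in>index_set c. (\<lambda>n. w n t) \<longlonglongrightarrow> 1) \<and>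
     (\<forall>g a. continuous_on UNIV (\<lambda>x. g (wrap c x)) \<longrightarrow> bounded (range (\<lambda>x. g (wrap c x))) \<longrightarrow>
        (\<lambda>n. LINT z|freq_measure c. W n z * g (wrap c (a + z))) \<longlonglongrightarrow> dual_factor c CARD('d) * g (wrap c a))"

lemma cos_cube_small:
  assumes "0 < \<delta>" "\<delta> \<le> pi" "\<bar>x\<bar> \<le> pi" "1 - cos x < 1 - cos \<delta>"
  shows "\<bar>x\<bar> < \<delta>"
proof (rule ccontr)
  assume "\<not> \<bar>x\<bar> < \<delta>"
  then have "cos \<bar>x\<bar> \<le> cos \<delta>" using assms by (intro cos_monotone_0_pi_le) auto
  then show False using assms by simp
qed

text \<open>The Fejer kernel: \<open>W n\<close> is the squared modulus of the exponential sum over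
  a lattice cube, divided by the number of points, and its Fourier coefficients \<open>w n\<close>
  are the overlap fractions of the cube with its translates. Thus \<open>w n\<close> tends to 1 by
  the Foelner property and the mass is \<open>w n 0 = 1\<close>.\<close>

lemma summability_kernel_Discrete:
  "\<exists>w W. summability_kernel Discrete w (W :: nat \<Rightarrow> real ^ 'd::finite \<Rightarrow> real)"
proof -
  let ?A = "grid_cube :: nat \<Rightarrow> (real ^ 'd) set"
  let ?N = "\<lambda>n. real (card (?A n))"
  define w where "w n t = (\<Sum>a\<in>?A n. \<Sum>b\<in>?A n. indicator {a - b} t) / ?N n" for n and t :: "real ^ 'd"
  define W where "W n z = (cmod (\<Sum>a\<in>?A n. cis (a \<bullet> z)))\<^sup>2 / ?N n" for n and z :: "real ^ 'd"
  interpret mu: prob_space "freq_measure Discrete :: (real ^ 'd) measure" by (rule prob_space_freq_Discrete)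
  have N: "?N n > 0" for n by (simp add: card_grid_cube)
  have A: "a \<in> index_set Discrete" if "a \<in> ?A n" for a n using that by (simp add: grid_cube_def)
  have Ad: "a - b \<in> index_set Discrete" if "a \<in> ?A n" "b \<in> ?A n" for a b n
    using that A index_set_diff by blast
  have w_eq: "w n t = real (card {b \<in> ?A n. t + b \<in> ?A n}) / ?N n" for n t
  proof -
    have "(\<Sum>a\<in>?A n. \<Sum>b\<in>?A n. indicator {a - b} t) = (\<Sum>b\<in>?A n. \<Sum>a\<in>?A n. indicator {t + b} a :: real)"
      by (subst sum.swap, intro sum.cong refl) (auto simp: indicator_def algebra_simps)
    also have "\<dots> = (\<Sum>b\<in>?A n. indicator (?A n) (t + b))"
      by (intro sum.cong refl) (auto simp: indicator_def)
    also have "\<dots> = real (card {b \<in> ?A n. t + b \<in> ?A n})"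
      by (simp add: indicator_def sum.If_cases Int_def)
    finally show ?thesis by (simp add: w_def)
  qed
  have W_eq: "complex_of_real (W n z) = (\<Sum>a\<in>?A n. \<Sum>b\<in>?A n. cis ((a - b) \<bullet> z)) / ?N n" for n z
  proof -
    have "complex_of_real ((cmod (\<Sum>a\<in>?A n. cis (a \<bullet> z)))\<^sup>2) = (\<Sum>a\<in>?A n. cis (a \<bullet> z)) * cnj (\<Sum>b\<in>?A n. cis (b \<bullet> z))"
      by (rule complex_norm_square)
    also have "\<dots> = (\<Sum>a\<in>?A n. \<Sum>b\<in>?A n. cis ((a - b) \<bullet> z))"
      by (simp add: sum_product cis_cnj cis_mult inner_diff_left)
    finally show ?thesis by (simp add: W_def)
  qed
  have W_cis: "(LINT z|freq_measure Discrete. cis (s \<bullet> z) * of_real (W n z)) = of_real (w n (- s))"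
    if s: "s \<in> index_set Discrete" for n s
  proof -
    have "(LINT z|freq_measure Discrete. cis (s \<bullet> z) * of_real (W n z)) =
      (LINT z|freq_measure Discrete. (\<Sum>a\<in>?A n. \<Sum>b\<in>?A n. cis ((s + (a - b)) \<bullet> z)) / of_real (?N n))"
      by (intro Bochner_Integration.integral_cong refl)
         (simp add: W_eq sum_distrib_left cis_mult inner_add_left inner_diff_left)
    also have "\<dots> = (\<Sum>a\<in>?A n. \<Sum>b\<in>?A n. LINT z|freq_measure Discrete. cis ((s + (a - b)) \<bullet> z)) / of_real (?N n)"
    proof -
      have i: "integrable (freq_measure Discrete) (\<lambda>z. cis (v \<bullet> z))" for v :: "real ^ 'd"
        by (rule mu.integrable_const_bound[where B=1]) auto
      show ?thesis by (simp add: i)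
    qed
    also have "\<dots> = (\<Sum>a\<in>?A n. \<Sum>b\<in>?A n. of_real (indicator {a - b} (- s))) / of_real (?N n)"
      using s Ad
      by (intro arg_cong2[where f="(/)"] sum.cong refl)
         (auto simp: cis_orthogonal index_set_add indicator_def eq_neg_iff_add_eq_0 neg_eq_iff_add_eq_0 add.commute)
    also have "\<dots> = of_real (w n (- s))" by (simp add: w_def)
    finally show ?thesis .
  qed
  have [measurable]: "W n \<in> borel_measurable borel" for n unfolding W_def by measurable
  have W_bound: "\<bar>W n z\<bar> \<le> ?N n" for n z
  proof -
    have "cmod (\<Sum>a\<in>?A n. cis (a \<bullet> z)) \<le> ?N n"
      by (rule order_trans[OF norm_sum]) simp
    then have "(cmod (\<Sum>a\<in>?A n. cis (a \<bullet> z)))\<^sup>2 \<le> (?N n)\<^sup>2" by (intro power_mono) auto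
    then show ?thesis using N[of n] by (simp add: W_def divide_le_eq power2_eq_square)
  qed
  have W_int: "integrable (freq_measure Discrete) (W n)" for n
    by (rule mu.integrable_const_bound[where B="?N n"]) (auto simp: W_bound)
  have W_pos: "0 \<le> W n z" for n z by (simp add: W_def)
  have w0: "w n 0 = 1" for n using N[of n] by (auto simp: w_eq card_gt_0_iff)
  have W_total: "(LINT z|freq_measure Discrete. W n z) = 1" for n
    using W_cis[of 0 n] w0[of n] by (simp add: index_set_zero)
  \<comment> \<open>Concentration at 0 is measured by 1 - cos (z_i): it is nonnegative, it is
    bounded below away from z_i = 0 on the cube, and its integral against \<open>W n\<close> is read
    off from the Fourier coefficient at a unit vector. No pointwise estimate of the kernel
    enters.\<close>
  have W_cos: "(LINT z|freq_measure Discrete. W n z * (1 - cos (z $ i))) = 1 - w n (- axis i 1)"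
    and W_cos_int: "integrable (freq_measure Discrete) (\<lambda>z. W n z * (1 - cos (z $ i)))" for n i
  proof -
    have "axis i 1 \<in> (index_set Discrete :: (real ^ 'd) set)" by (auto simp: index_set_def axis_def)
    note * = W_cis[OF this, of n]
    have i: "integrable (freq_measure Discrete) (\<lambda>z. cis (axis i 1 \<bullet> z) * of_real (W n z))"
      by (intro integrable_cis W_int) measurable
    have "Re (LINT z|freq_measure Discrete. cis (axis i 1 \<bullet> z) * of_real (W n z)) =
      (LINT z|freq_measure Discrete. cos (z $ i) * W n z)"
      by (subst integral_Re[OF i, symmetric]) (simp add: inner_axis')
    then have c: "(LINT z|freq_measure Discrete. cos (z $ i) * W n z) = w n (- axis i 1)"
      unfolding * by simp
    have ci: "integrable (freq_measure Discrete) (\<lambda>z. cos (z $ i) * W n z)"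
      using integrable_Re[OF i] by (simp add: inner_axis')
    have e: "W n z * (1 - cos (z $ i)) = W n z - cos (z $ i) * W n z" for z by (simp add: algebra_simps)
    show "(LINT z|freq_measure Discrete. W n z * (1 - cos (z $ i))) = 1 - w n (- axis i 1)"
      unfolding e using ci W_int by (simp add: c W_total)
    show "integrable (freq_measure Discrete) (\<lambda>z. W n z * (1 - cos (z $ i)))"
      unfolding e using ci W_int by simp
  qed
  have w_lim: "(\<lambda>n. w n t) \<longlonglongrightarrow> 1" if "t \<in> index_set Discrete" for t
    unfolding w_eq by (rule card_grid_cube_shift[OF that])
  have conc: "(\<lambda>n. LINT z|freq_measure Discrete. W n z * g (wrap Discrete (a + z))) \<longlonglongrightarrow> g (wrap Discrete a)"
    if cont: "continuous_on UNIV (\<lambda>x. g (wrap Discrete x))" and bdd: "bounded (range (\<lambda>x. g (wrap Discrete x)))"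
    for g :: "real ^ 'd \<Rightarrow> real" and a
  proof -
    define h where "h z = g (wrap Discrete (a + z))" for z
    have hcont: "continuous_on UNIV h"
      unfolding h_def by (rule continuous_on_compose2[OF cont]) (auto intro: continuous_intros)
    then have [measurable]: "h \<in> borel_measurable borel" by (rule borel_measurable_continuous_onI)
    obtain B where B: "\<And>z. \<bar>g (wrap Discrete z)\<bar> \<le> B" using bdd by (auto simp: bounded_iff)
    have hB: "\<bar>h z\<bar> \<le> B" for z unfolding h_def by (rule B)
    have B0: "0 \<le> B" using hB[of 0] by linarith
    have Wh: "integrable (freq_measure Discrete) (\<lambda>z. W n z * h z)" for n
      by (rule mu.integrable_const_bound[where B="?N n * B"])
         (auto simp: abs_mult intro!: mult_mono W_bound hB AE_I2)
    have "(\<lambda>n. LINT z|freq_measure Discrete. W n z * h z) \<longlonglongrightarrow> h 0"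
    proof (rule LIMSEQ_I)
      fix e :: real assume e: "e > 0"
      obtain \<delta>0 where \<delta>0: "\<delta>0 > 0" "\<And>z. norm z < \<delta>0 \<Longrightarrow> \<bar>h z - h 0\<bar> < e / 2"
        using hcont[unfolded continuous_on_iff dist_norm, rule_format, of 0 "e / 2"] e
        by (auto simp del: less_divide_eq_numeral1)
      \<comment> \<open>The norm is at most the sum of the coordinates' moduli, so coordinates below
        \<delta>0 / (2 d) keep \<open>z\<close> within \<delta>0 of the origin; the cap at pi keeps
        cos monotone on the range in question.\<close>
      define \<delta> where "\<delta> = min pi (\<delta>0 / (2 * CARD('d)))"
      have \<delta>: "0 < \<delta>" "\<delta> \<le> pi" using \<delta>0 by (auto simp: \<delta>_def)
      define \<eta> where "\<eta> = 1 - cos \<delta>"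
      have \<eta>: "\<eta> > 0" using cos_monotone_0_pi[of 0 \<delta>] \<delta> by (simp add: \<eta>_def)
      \<comment> \<open>Markov's argument in pointwise form: near 0 continuity gives e / 2, and
        elsewhere some coordinate has 1 - cos at least \<eta>, so the trivial bound 2 B is paid by
        the sum of these moments.\<close>
      have pt: "\<bar>h z - h 0\<bar> \<le> e / 2 + (2 * B / \<eta>) * (\<Sum>i\<in>UNIV. 1 - cos (z $ i))" if z: "z \<in> freq_set Discrete" for z
      proof (cases "\<forall>i. 1 - cos (z $ i) < \<eta>")
        case True
        have zi: "\<bar>z $ i\<bar> < \<delta>" for i
          using cos_cube_small[OF \<delta>, of "z $ i"] True z by (auto simp: \<eta>_def freq_set_def abs_le_iff) (metis minus_le_iff)+
        have "norm z \<le> (\<Sum>i\<in>UNIV. \<bar>z $ i\<bar>)" by (rule norm_le_l1_cart)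
        also have "\<dots> \<le> (\<Sum>i\<in>(UNIV::'d set). \<delta>)" by (intro sum_mono less_imp_le zi)
        also have "\<dots> \<le> \<delta>0 / 2" using \<delta>0 by (auto simp: \<delta>_def min_def field_simps)
        also have "\<dots> < \<delta>0" using \<delta>0 by simp
        finally have "\<bar>h z - h 0\<bar> < e / 2" by (rule \<delta>0)
        moreover have "0 \<le> (2 * B / \<eta>) * (\<Sum>i\<in>UNIV. 1 - cos (z $ i))"
          using \<eta> B0 by (intro mult_nonneg_nonneg sum_nonneg) auto
        ultimately show ?thesis by linarith
      next
        case False
        then obtain i where "\<eta> \<le> 1 - cos (z $ i)" by (auto simp: not_less)
        also have "\<dots> \<le> (\<Sum>i\<in>UNIV. 1 - cos (z $ i))"
          by (rule member_le_sum) auto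
        finally have "(2 * B / \<eta>) * \<eta> \<le> (2 * B / \<eta>) * (\<Sum>i\<in>UNIV. 1 - cos (z $ i))"
          using \<eta> B0 by (intro mult_left_mono) auto
        then have "2 * B \<le> (2 * B / \<eta>) * (\<Sum>i\<in>UNIV. 1 - cos (z $ i))" using \<eta> by simp
        moreover have "\<bar>h z - h 0\<bar> \<le> 2 * B" using hB[of z] hB[of 0] by linarith
        ultimately show ?thesis using e by linarith
      qed
      have bound: "\<bar>(LINT z|freq_measure Discrete. W n z * h z) - h 0\<bar> \<le> e / 2 + (2 * B / \<eta>) * (\<Sum>i\<in>UNIV. 1 - w n (- axis i 1))" for n
      proof -
        have "(LINT z|freq_measure Discrete. W n z * h z) - h 0 = (LINT z|freq_measure Discrete. W n z * h z - W n z * h 0)"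
          using Wh W_int by (subst Bochner_Integration.integral_diff) (auto simp: W_total)
        also have "\<bar>\<dots>\<bar> \<le> (LINT z|freq_measure Discrete. \<bar>W n z * h z - W n z * h 0\<bar>)" by simp
        also have "\<dots> \<le> (LINT z|freq_measure Discrete. (e / 2) * W n z + (2 * B / \<eta>) * (\<Sum>i\<in>UNIV. W n z * (1 - cos (z $ i))))"
        proof (rule integral_mono_AE)
          have "AE z in freq_measure Discrete. (z :: real ^ 'd) \<in> freq_set Discrete"
            unfolding freq_measure_def time_case.case by (rule AE_uniform_measureI) auto
          then show "AE z in freq_measure Discrete. \<bar>W n z * h z - W n z * h 0\<bar> \<le> (e / 2) * W n z + (2 * B / \<eta>) * (\<Sum>i\<in>UNIV. W n z * (1 - cos (z $ i)))"
          proof eventually_elim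
            case (elim z)
            have "\<bar>W n z * h z - W n z * h 0\<bar> = W n z * \<bar>h z - h 0\<bar>"
              using W_pos[of n z] by (simp add: abs_mult flip: right_diff_distrib)
            also have "\<dots> \<le> W n z * (e / 2 + (2 * B / \<eta>) * (\<Sum>i\<in>UNIV. 1 - cos (z $ i)))"
              by (intro mult_left_mono pt elim W_pos)
            also have "\<dots> = (e / 2) * W n z + (2 * B / \<eta>) * (\<Sum>i\<in>UNIV. W n z * (1 - cos (z $ i)))"
              unfolding sum_distrib_left[symmetric] by (simp only: distrib_left mult_ac)
            finally show ?case .
          qed
        qed (use Wh W_int W_cos_int in auto)
        also have "\<dots> = e / 2 + (2 * B / \<eta>) * (\<Sum>i\<in>UNIV. 1 - w n (- axis i 1))"
          using W_int W_cos_int by (subst Bochner_Integration.integral_add) (auto simp: W_total W_cos Bochner_Integration.integral_sum)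
        finally show ?thesis .
      qed
      have "(\<lambda>n. (2 * B / \<eta>) * (\<Sum>i\<in>UNIV. 1 - w n (- axis i 1))) \<longlonglongrightarrow> (2 * B / \<eta>) * (\<Sum>i\<in>(UNIV::'d set). 1 - 1)"
        by (intro tendsto_intros w_lim index_set_minus) (auto simp: index_set_def axis_def)
      then have "(\<lambda>n. (2 * B / \<eta>) * (\<Sum>i\<in>UNIV. 1 - w n (- axis i 1))) \<longlonglongrightarrow> 0" by simp
      from LIMSEQ_D[OF this, of "e / 2"] e obtain no where no: "\<And>n. n \<ge> no \<Longrightarrow> \<bar>(2 * B / \<eta>) * (\<Sum>i\<in>UNIV. 1 - w n (- axis i 1))\<bar> < e / 2"
        by auto
      show "\<exists>no. \<forall>n\<ge>no. norm ((LINT z|freq_measure Discrete. W n z * h z) - h 0) < e"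
      proof (intro exI allI impI)
        fix n assume "n \<ge> no"
        from no[OF this] bound[of n] show "norm ((LINT z|freq_measure Discrete. W n z * h z) - h 0) < e"
          by (simp only: real_norm_def)
      qed
    qed
    then show ?thesis by (simp add: h_def)
  qed
  have w_int: "integrable (time_measure Discrete) (w n)" for n
    unfolding w_def by (intro integrable_divide Bochner_Integration.integrable_sum time_singleton Ad) auto
  have w_fourier: "(LINT t|time_measure Discrete. cis (t \<bullet> z) * of_real (w n t)) = of_real (W n z)" for n z
  proof -
    have "(LINT t|time_measure Discrete. cis (t \<bullet> z) * of_real (w n t)) =
      (LINT t|time_measure Discrete. (\<Sum>a\<in>?A n. \<Sum>b\<in>?A n. cis (t \<bullet> z) * of_real (indicator {a - b} t)) / of_real (?N n))"
      by (intro Bochner_Integration.integral_cong refl) (simp add: w_def sum_distrib_left)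
    also have "\<dots> = (\<Sum>a\<in>?A n. \<Sum>b\<in>?A n. cis ((a - b) \<bullet> z)) / of_real (?N n)"
      using Ad by (simp add: time_singleton Bochner_Integration.integral_sum Bochner_Integration.integrable_sum)
    finally show ?thesis by (simp add: W_eq)
  qed
  have w01: "0 \<le> w n t \<and> w n t \<le> 1" for n t
    using N[of n] card_mono[of "?A n" "{b \<in> ?A n. t + b \<in> ?A n}"] by (auto simp: w_eq divide_le_eq)
  have [measurable]: "w n \<in> borel_measurable borel" for n unfolding w_def by measurable
  have "summability_kernel Discrete w W"
    unfolding summability_kernel_def using w01 W_pos w_int W_int w_fourier W_total w_lim conc by auto
  then show ?thesis by blast
qed

lemma lborel_scale:
  fixes F :: "'d::euclidean_space \<Rightarrow> 'x::{banach, second_countable_topology}"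
  assumes [measurable]: "F \<in> borel_measurable borel" and k: "k \<noteq> 0"
  shows lborel_scale_integral: "(LINT t|lborel. F t) = \<bar>k\<bar> ^ DIM('d) *\<^sub>R (LINT t|lborel. F (k *\<^sub>R t))"
    and lborel_scale_integrable: "integrable lborel (\<lambda>t. F (k *\<^sub>R t)) \<longleftrightarrow> integrable lborel F"
proof -
  have l: "lborel = density (distr lborel borel (\<lambda>x :: 'd. k *\<^sub>R x)) (\<lambda>_. ennreal (\<bar>k\<bar> ^ DIM('d)))"
    using lborel_affine[of k "0 :: 'd"] k by (simp add: ennreal_power)
  show "(LINT t|lborel. F t) = \<bar>k\<bar> ^ DIM('d) *\<^sub>R (LINT t|lborel. F (k *\<^sub>R t))"
    by (subst l, subst integral_density) (auto simp: integral_distr)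
  show "integrable lborel (\<lambda>t. F (k *\<^sub>R t)) \<longleftrightarrow> integrable lborel F"
  proof
    assume "integrable lborel F"
    then have "integrable lborel (\<lambda>t. \<bar>k\<bar> ^ DIM('d) *\<^sub>R F (k *\<^sub>R t))"
      by (subst (asm) l, subst (asm) integrable_density) (auto simp: integrable_distr_eq)
    from integrable_scaleR_right[OF this, of "inverse (\<bar>k\<bar> ^ DIM('d))"]
    show "integrable lborel (\<lambda>t. F (k *\<^sub>R t))" using k by simp
  next
    assume "integrable lborel (\<lambda>t. F (k *\<^sub>R t))"
    then show "integrable lborel F"
      by (subst l, subst integrable_density) (auto simp: integrable_distr_eq)
  qed
qed

text \<open>\<open>w n\<close> is a Gaussian of width n + 1 and \<open>W n\<close> its transform,
  the dilation of the fixed density \<open>V\<close>. One factor (2 pi)^(d/2) comes from the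
  transform and another from the mass of the Gaussian; together they give the constant (2 pi)^d.
  Concentration is dominated convergence after undoing the dilation.\<close>

lemma summability_kernel_Continuous:
  "\<exists>w W. summability_kernel Continuous w (W :: nat \<Rightarrow> real ^ 'd::finite \<Rightarrow> real)"
proof -
  define w where "w n t = exp (- (((1 / real (Suc n)) *\<^sub>R t) \<bullet> ((1 / real (Suc n)) *\<^sub>R t)) / 2)" for n and t :: "real ^ 'd"
  define V where "V z = sqrt (2 * pi) ^ CARD('d) * exp (- (z \<bullet> z) / 2)" for z :: "real ^ 'd"
  define W where "W n z = real (Suc n) ^ CARD('d) * V (real (Suc n) *\<^sub>R z)" for n and z :: "real ^ 'd"
  have g1: "integrable lborel (\<lambda>t :: real ^ 'd. exp (- (t \<bullet> t) / 2))" by (rule gauss_fourier(1))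
  have [measurable]: "V \<in> borel_measurable borel" "w n \<in> borel_measurable borel" "W n \<in> borel_measurable borel" for n
    unfolding W_def V_def w_def by measurable
  have V_int: "integrable lborel V" unfolding V_def by (intro integrable_mult_right g1)
  have V_total: "(LINT z|lborel. V z) = (2 * pi) ^ CARD('d)"
  proof -
    have "(LINT t|lborel. complex_of_real (exp (- (t \<bullet> (t :: real ^ 'd)) / 2))) = of_real (sqrt (2 * pi) ^ CARD('d))"
      using gauss_fourier(2)[of "0 :: real ^ 'd"] by simp
    then have *: "(LINT t|lborel. exp (- (t \<bullet> (t :: real ^ 'd)) / 2)) = sqrt (2 * pi) ^ CARD('d)"
      by (simp only: integral_complex_of_real of_real_eq_iff)
    have "(LINT z|lborel. V z) = sqrt (2 * pi) ^ CARD('d) * sqrt (2 * pi) ^ CARD('d)"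
      unfolding V_def by (simp only: integral_mult_right_zero *)
    also have "\<dots> = (2 * pi) ^ CARD('d)"
      by (simp only: power_mult_distrib[symmetric] real_sqrt_mult_self abs_of_nonneg zero_le_mult_iff pi_ge_zero) simp
    finally show ?thesis .
  qed
  have W_int: "integrable lborel (W n)" for n
    unfolding W_def using V_int by (intro integrable_mult_right) (simp add: lborel_scale_integrable)
  have W_total: "(LINT z|lborel. W n z) = (2 * pi) ^ CARD('d)" for n
    using lborel_scale_integral[of V "real (Suc n)"] by (simp add: W_def V_total)
  have w_int: "integrable lborel (w n)" for n
    unfolding w_def using lborel_scale_integrable[of "\<lambda>t :: real ^ 'd. exp (- (t \<bullet> t) / 2)" "1 / real (Suc n)"] g1 by simp
  have w_fourier: "(LINT t|lborel. cis (t \<bullet> z) * of_real (w n t)) = of_real (W n z)" for n z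
  proof -
    let ?m = "real (Suc n)"
    have "(LINT t|lborel. cis (t \<bullet> z) * of_real (w n t)) =
       ?m ^ CARD('d) *\<^sub>R (LINT t|lborel. cis ((?m *\<^sub>R t) \<bullet> z) * of_real (w n (?m *\<^sub>R t)))"
      by (subst lborel_scale_integral[of _ "?m"]) auto
    also have "(LINT t|lborel. cis ((?m *\<^sub>R t) \<bullet> z) * of_real (w n (?m *\<^sub>R t))) = of_real (V (?m *\<^sub>R z))"
      unfolding V_def gauss_fourier(2)[symmetric] by (simp add: w_def)
    finally show ?thesis by (simp add: W_def scaleR_conv_of_real)
  qed
  have w_lim: "(\<lambda>n. w n t) \<longlonglongrightarrow> 1" for t
  proof -
    have "(\<lambda>n. exp (- (((1 / real (Suc n)) *\<^sub>R t) \<bullet> ((1 / real (Suc n)) *\<^sub>R t)) / 2)) \<longlonglongrightarrow> exp (- ((0 *\<^sub>R t) \<bullet> (0 *\<^sub>R t)) / 2)"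
      using LIMSEQ_inverse_real_of_nat by (intro tendsto_intros) (auto simp: inverse_eq_divide)
    then show ?thesis by (simp add: w_def)
  qed
  have conc: "(\<lambda>n. LINT z|lborel. W n z * g (a + z)) \<longlonglongrightarrow> (2 * pi) ^ CARD('d) * g a"
    if cont: "continuous_on UNIV g" and bdd: "bounded (range g)" for g :: "real ^ 'd \<Rightarrow> real" and a
  proof -
    have [measurable]: "g \<in> borel_measurable borel" using cont by (rule borel_measurable_continuous_onI)
    obtain B where B: "\<And>z. \<bar>g z\<bar> \<le> B" using bdd by (auto simp: bounded_iff)
    have eq: "(LINT z|lborel. W n z * g (a + z)) = (LINT z|lborel. V z * g (a + (1 / real (Suc n)) *\<^sub>R z))" for n
    proof -
      have "(LINT z|lborel. V z * g (a + (1 / real (Suc n)) *\<^sub>R z)) = real (Suc n) ^ CARD('d) *\<^sub>R (LINT z|lborel. V (real (Suc n) *\<^sub>R z) * g (a + z))"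
        by (subst lborel_scale_integral[of _ "real (Suc n)"]) auto
      then show ?thesis by (simp add: W_def mult.assoc)
    qed
    have "(\<lambda>n. LINT z|lborel. V z * g (a + (1 / real (Suc n)) *\<^sub>R z)) \<longlonglongrightarrow> (LINT z|lborel. V z * g a)"
    proof (rule integral_dominated_convergence[where w="\<lambda>z. V z * B"])
      show "AE z in lborel. (\<lambda>n. V z * g (a + (1 / real (Suc n)) *\<^sub>R z)) \<longlonglongrightarrow> V z * g a"
      proof (intro AE_I2 tendsto_intros)
        fix z :: "real ^ 'd"
        have "(\<lambda>n. a + (1 / real (Suc n)) *\<^sub>R z) \<longlonglongrightarrow> a + 0 *\<^sub>R z"
          using LIMSEQ_inverse_real_of_nat by (intro tendsto_intros) (auto simp: inverse_eq_divide)
        moreover have "isCont g (a + 0 *\<^sub>R z)" using cont by (simp add: continuous_on_eq_continuous_at)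
        ultimately have "(\<lambda>n. g (a + (1 / real (Suc n)) *\<^sub>R z)) \<longlonglongrightarrow> g (a + 0 *\<^sub>R z)"
          by (rule isCont_tendsto_compose[rotated])
        then show "(\<lambda>n. g (a + (1 / real (Suc n)) *\<^sub>R z)) \<longlonglongrightarrow> g a" by simp
      qed
      show "AE z in lborel. norm (V z * g (a + (1 / real (Suc n)) *\<^sub>R z)) \<le> V z * B" for n
        using B by (auto simp: abs_mult V_def intro!: mult_mono)
    qed (use V_int in auto)
    then show ?thesis by (simp add: eq V_total)
  qed
  have w01: "0 \<le> w n t \<and> w n t \<le> 1" and W_pos: "0 \<le> W n t" for n t
    by (simp_all add: w_def W_def V_def)
  have "summability_kernel Continuous w W"
    unfolding summability_kernel_def time_measure_Continuous freq_measure_def time_case.case wrap_def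
    using w01 W_pos w_int W_int w_fourier W_total w_lim conc by auto
  then show ?thesis by blast
qed

lemma summability_kernel_exists: "\<exists>w W. summability_kernel c w (W :: nat \<Rightarrow> real ^ 'd::finite \<Rightarrow> real)"
  by (cases c) (auto intro: summability_kernel_Discrete summability_kernel_Continuous)

section \<open>Bessel and Hausdorff-Young inequalities\<close>

definition fourier :: "time_case \<Rightarrow> (real ^ 'd::finite \<Rightarrow> real) \<Rightarrow> real ^ 'd \<Rightarrow> complex" where
  "fourier c f t = (LINT x|freq_measure c. cis (t \<bullet> x) * of_real (f x))"

lemma fourier_borel [measurable]:
  assumes [measurable]: "f \<in> borel_measurable borel"
  shows "fourier c f \<in> borel_measurable borel"
  unfolding fourier_def
  by (rule freq.borel_measurable_lebesgue_integral) measurable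

lemma norm_fourier_le: "cmod (fourier c f t) \<le> (LINT x|freq_measure c. \<bar>f x\<bar>)"
  unfolding fourier_def by (rule order_trans[OF integral_norm_bound]) (simp add: norm_mult)

lemma fourier_add:
  assumes "integrable (freq_measure c) f" "integrable (freq_measure c) g"
  shows "fourier c (\<lambda>x. f x + g x) t = fourier c f t + fourier c g t"
  unfolding fourier_def using assms
  by (subst Bochner_Integration.integral_add[symmetric]) (auto intro!: Bochner_Integration.integral_cong simp: algebra_simps)

lemma fourier_diff:
  assumes "integrable (freq_measure c) f" "integrable (freq_measure c) g"
  shows "fourier c (\<lambda>x. f x - g x) t = fourier c f t - fourier c g t"
  unfolding fourier_def using assms
  by (subst Bochner_Integration.integral_diff[symmetric]) (auto intro!: Bochner_Integration.integral_cong simp: algebra_simps)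

lemma (in pair_sigma_finite) integrable_pair_mult:
  fixes g h :: "_ \<Rightarrow> 'x::{real_normed_field,banach,second_countable_topology}"
  assumes "integrable M1 g" "integrable M2 h"
  shows "integrable (M1 \<Otimes>\<^sub>M M2) (\<lambda>p. g (fst p) * h (snd p))"
proof (rule Fubini_integrable)
  have [measurable]: "g \<in> borel_measurable M1" "h \<in> borel_measurable M2" using assms by auto
  show "(\<lambda>p. g (fst p) * h (snd p)) \<in> borel_measurable (M1 \<Otimes>\<^sub>M M2)" by measurable
  show "integrable M1 (\<lambda>x. \<integral>y. norm (g (fst (x, y)) * h (snd (x, y))) \<partial>M2)"
    using assms by (simp add: norm_mult)
qed (use assms in simp)

interpretation freq2: pair_sigma_finite "freq_measure c" "freq_measure c'" ..
interpretation time_freq: pair_sigma_finite "time_measure c" "freq_measure c'" ..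

lemma sets_pair_freq [measurable_cong]: "sets (freq_measure c \<Otimes>\<^sub>M freq_measure c') = sets (borel \<Otimes>\<^sub>M borel)"
  by (intro sets_pair_measure_cong) auto

lemma sigma_finite_freq2: "sigma_finite_measure (freq_measure c \<Otimes>\<^sub>M freq_measure c')"
  by (rule sigma_finite_pair_measure) (rule sigma_finite_freq_measure)+

text \<open>The kernel turns the weighted energy of a Fourier transform into a quadratic form in
  \<open>f\<close> with a positive convolution kernel of total mass \<open>\<kappa>\<close>.\<close>

lemma bessel:
  fixes f :: "real ^ 'd::finite \<Rightarrow> real"
  assumes [measurable]: "f \<in> borel_measurable borel" and f: "integrable (freq_measure c) f"
  shows "(\<integral>\<^sup>+ t. ennreal ((cmod (fourier c f t))\<^sup>2) \<partial>time_measure c)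
    \<le> ennreal (dual_factor c CARD('d)) * (\<integral>\<^sup>+ x. ennreal ((f x)\<^sup>2) \<partial>freq_measure c)"
proof -
  obtain w W :: "nat \<Rightarrow> real ^ 'd \<Rightarrow> real" where K: "summability_kernel c w W"
    using summability_kernel_exists by blast
  let ?\<mu> = "freq_measure c :: (real ^ 'd) measure" and ?\<nu> = "time_measure c :: (real ^ 'd) measure"
  let ?\<kappa> = "dual_factor c CARD('d)"
  let ?\<mu>2 = "?\<mu> \<Otimes>\<^sub>M ?\<mu>"
  let ?F = "fourier c f"
  have [measurable]: "w n \<in> borel_measurable borel" "W n \<in> borel_measurable borel" for n
    using K by (auto simp: summability_kernel_def)
  have w: "0 \<le> w n t" "w n t \<le> 1" "integrable ?\<nu> (w n)" for n t
    using K by (auto simp: summability_kernel_def)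
  have W: "0 \<le> W n z" "integrable ?\<mu> (W n)" "(LINT z|?\<mu>. W n z) = ?\<kappa>"
    "(LINT t|?\<nu>. cis (t \<bullet> z) * of_real (w n t)) = of_real (W n z)" for n z
    using K by (auto simp: summability_kernel_def)
  \<comment> \<open>\<open>W n\<close> is an integral of characters at index times and hence
    periodic. This brings its argument into the reduced form required by the invariance
    lemmas.\<close>
  have W_wrap: "W n (wrap c z) = W n z" for n z
  proof -
    have "complex_of_real (W n (wrap c z)) = of_real (W n z)"
      unfolding W(4)[symmetric] using AE_time_measure[of c]
      by (intro integral_cong_AE) (auto simp: cis_wrap)
    then show ?thesis by simp
  qed
  interpret P: sigma_finite_measure "?\<mu> \<Otimes>\<^sub>M ?\<mu>" by (rule sigma_finite_freq2)
  interpret T: pair_sigma_finite ?\<nu> "?\<mu> \<Otimes>\<^sub>M ?\<mu>" ..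
  have ff: "integrable (?\<mu> \<Otimes>\<^sub>M ?\<mu>) (\<lambda>p. f (fst p) * f (snd p))"
    by (rule freq2.integrable_pair_mult[OF f f])
  have W_mass: "(\<integral>\<^sup>+ z. ennreal (W n z) \<partial>?\<mu>) = ennreal ?\<kappa>" for n
    using W by (subst nn_integral_eq_integral) auto
  have key: "(\<integral>\<^sup>+ t. ennreal (w n t * (cmod (?F t))\<^sup>2) \<partial>?\<nu>) \<le> ennreal ?\<kappa> * (\<integral>\<^sup>+ x. ennreal ((f x)\<^sup>2) \<partial>?\<mu>)" for n
  proof -
    define H where "H t p = (cis (t \<bullet> (fst p - snd p)) * of_real (f (fst p) * f (snd p))) * of_real (w n t)" for t p
    have [measurable]: "(\<lambda>(t, p). H t p) \<in> borel_measurable (?\<nu> \<Otimes>\<^sub>M (?\<mu> \<Otimes>\<^sub>M ?\<mu>))"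
      unfolding H_def split_beta by measurable
    have H_int: "integrable (?\<nu> \<Otimes>\<^sub>M (?\<mu> \<Otimes>\<^sub>M ?\<mu>)) (\<lambda>(t, p). H t p)"
      by (rule Bochner_Integration.integrable_bound[OF T.integrable_pair_mult[OF w(3)[of n] ff]])
         (auto simp: H_def norm_mult abs_mult mult_ac)
    have sq: "of_real (w n t * (cmod (?F t))\<^sup>2) = (LINT p|?\<mu>2. H t p)" for t
    proof -
      have i: "integrable ?\<mu> (\<lambda>x. cis (t \<bullet> x) * of_real (f x))"
        by (intro integrable_cis f) measurable
      then have ic: "integrable ?\<mu> (\<lambda>x. cnj (cis (t \<bullet> x) * of_real (f x)))"
        by (rule integrable_cnj)
      have "of_real ((cmod (?F t))\<^sup>2) = ?F t * cnj (?F t)" by (rule complex_norm_square)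
      also have "cnj (?F t) = (LINT x|?\<mu>. cnj (cis (t \<bullet> x) * of_real (f x)))"
        unfolding fourier_def by (rule Bochner_Integration.integral_cnj[symmetric])
      also have "?F t * \<dots> = (LINT x|?\<mu>. (LINT y|?\<mu>. (cis (t \<bullet> x) * of_real (f x)) * cnj (cis (t \<bullet> y) * of_real (f y))))"
        by (simp only: integral_mult_right_zero integral_mult_left_zero fourier_def)
      also have "\<dots> = (LINT p|?\<mu>2. (cis (t \<bullet> fst p) * of_real (f (fst p))) * cnj (cis (t \<bullet> snd p) * of_real (f (snd p))))"
        using freq2.integral_fst'[OF freq2.integrable_pair_mult[OF i ic]] by simp
      finally have "of_real (w n t * (cmod (?F t))\<^sup>2) =
         (LINT p|?\<mu>2. (cis (t \<bullet> fst p) * of_real (f (fst p))) * cnj (cis (t \<bullet> snd p) * of_real (f (snd p)))) * of_real (w n t)"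
        by simp
      also have "\<dots> = (LINT p|?\<mu>2. (cis (t \<bullet> fst p) * of_real (f (fst p))) * cnj (cis (t \<bullet> snd p) * of_real (f (snd p))) * of_real (w n t))"
        by (rule integral_mult_left_zero[symmetric])
      also have "\<dots> = (LINT p|?\<mu>2. H t p)"
      proof (intro Bochner_Integration.integral_cong refl)
        fix p :: "(real ^ 'd) \<times> (real ^ 'd)"
        have "cis (t \<bullet> (fst p - snd p)) = cis (t \<bullet> fst p) * cis (- (t \<bullet> snd p))"
          by (simp add: cis_mult inner_diff_right)
        then show "(cis (t \<bullet> fst p) * of_real (f (fst p))) * cnj (cis (t \<bullet> snd p) * of_real (f (snd p))) * of_real (w n t) = H t p"
          by (simp add: H_def cis_cnj mult_ac del: cis_mult)
      qed
      finally show ?thesis .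
    qed
    have inner: "(LINT t|?\<nu>. H t p) = of_real (f (fst p) * f (snd p) * W n (fst p - snd p))" for p
    proof -
      have "(LINT t|?\<nu>. H t p) = (LINT t|?\<nu>. of_real (f (fst p) * f (snd p)) * (cis (t \<bullet> (fst p - snd p)) * of_real (w n t)))"
        by (intro Bochner_Integration.integral_cong refl) (simp add: H_def mult_ac)
      also have "\<dots> = of_real (f (fst p) * f (snd p)) * of_real (W n (fst p - snd p))"
        by (simp only: integral_mult_right_zero W(4))
      finally show ?thesis by simp
    qed
    let ?L = "LINT t|?\<nu>. w n t * (cmod (?F t))\<^sup>2"
    have Fint: "integrable ?\<nu> (\<lambda>t. w n t * (cmod (?F t))\<^sup>2)"
    proof (rule Bochner_Integration.integrable_bound[OF integrable_mult_left[OF w(3)[of n]]])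
      show "AE t in ?\<nu>. norm (w n t * (cmod (?F t))\<^sup>2) \<le> norm (w n t * (LINT x|?\<mu>. \<bar>f x\<bar>)\<^sup>2)"
        using norm_fourier_le[of c f] w by (intro AE_I2) (auto simp: abs_mult intro!: mult_left_mono power_mono)
    qed measurable
    have "complex_of_real ?L = (LINT t|?\<nu>. of_real (w n t * (cmod (?F t))\<^sup>2))"
      by (rule integral_complex_of_real[symmetric])
    also have "\<dots> = (LINT t|?\<nu>. (LINT p|?\<mu>2. H t p))" by (simp only: sq)
    also have "\<dots> = (LINT p|?\<mu>2. (LINT t|?\<nu>. H t p))"
      by (rule T.Fubini_integral[symmetric, OF H_int])
    also have "\<dots> = of_real (LINT p|?\<mu>2. f (fst p) * f (snd p) * W n (fst p - snd p))"
      by (simp only: inner integral_complex_of_real)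
    finally have L: "?L = (LINT p|?\<mu>2. f (fst p) * f (snd p) * W n (fst p - snd p))"
      by (simp only: of_real_eq_iff)
    have "integrable (?\<mu> \<Otimes>\<^sub>M ?\<mu>) (\<lambda>p. (LINT t|?\<nu>. H t p))"
      using T.integrable_snd[OF H_int] .
    then have fW: "integrable (?\<mu> \<Otimes>\<^sub>M ?\<mu>) (\<lambda>p. f (fst p) * f (snd p) * W n (fst p - snd p))"
      by (simp only: inner complex_of_real_integrable_eq)
    have "(\<integral>\<^sup>+ t. ennreal (w n t * (cmod (?F t))\<^sup>2) \<partial>?\<nu>) = ennreal ?L"
      using w Fint by (subst nn_integral_eq_integral) auto
    also have "\<dots> \<le> ennreal (LINT p|?\<mu>2. norm (f (fst p) * f (snd p) * W n (fst p - snd p)))"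
      unfolding L by (rule ennreal_leI, rule order_trans[OF abs_ge_self], simp only: real_norm_def, rule integral_abs_bound)
    also have "\<dots> = (\<integral>\<^sup>+ p. ennreal (norm (f (fst p) * f (snd p) * W n (fst p - snd p))) \<partial>(?\<mu> \<Otimes>\<^sub>M ?\<mu>))"
      using fW by (subst nn_integral_eq_integral) auto
    \<comment> \<open>Schur's test for the positive kernel: the product of two values of
      \<open>f\<close> is at most half the sum of their squares, and in each of the two terms the
      other variable integrates the kernel to its mass \<kappa>.\<close>
    also have "\<dots> \<le> (\<integral>\<^sup>+ p. ennreal ((f (fst p))\<^sup>2 / 2) * ennreal (W n (fst p - snd p)) + ennreal ((f (snd p))\<^sup>2 / 2) * ennreal (W n (fst p - snd p)) \<partial>(?\<mu> \<Otimes>\<^sub>M ?\<mu>))"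
    proof (rule nn_integral_mono)
      fix p :: "(real ^ 'd) \<times> (real ^ 'd)"
      have "\<bar>f (fst p)\<bar> * \<bar>f (snd p)\<bar> \<le> (f (fst p))\<^sup>2 / 2 + (f (snd p))\<^sup>2 / 2"
        using sum_squares_bound[of "\<bar>f (fst p)\<bar>" "\<bar>f (snd p)\<bar>"] by (simp add: field_simps)
      then have "norm (f (fst p) * f (snd p) * W n (fst p - snd p)) \<le> ((f (fst p))\<^sup>2 / 2 + (f (snd p))\<^sup>2 / 2) * W n (fst p - snd p)"
        using W(1) by (simp add: abs_mult mult_right_mono)
      then show "ennreal (norm (f (fst p) * f (snd p) * W n (fst p - snd p))) \<le> ennreal ((f (fst p))\<^sup>2 / 2) * ennreal (W n (fst p - snd p)) + ennreal ((f (snd p))\<^sup>2 / 2) * ennreal (W n (fst p - snd p))"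
        using W(1) by (simp add: algebra_simps ennreal_leI flip: ennreal_mult ennreal_plus)
    qed
    also have "\<dots> = (\<integral>\<^sup>+ p. ennreal ((f (fst p))\<^sup>2 / 2) * ennreal (W n (fst p - snd p)) \<partial>(?\<mu> \<Otimes>\<^sub>M ?\<mu>)) + (\<integral>\<^sup>+ p. ennreal ((f (snd p))\<^sup>2 / 2) * ennreal (W n (fst p - snd p)) \<partial>(?\<mu> \<Otimes>\<^sub>M ?\<mu>))"
      by (rule nn_integral_add) measurable
    also have "(\<integral>\<^sup>+ p. ennreal ((f (fst p))\<^sup>2 / 2) * ennreal (W n (fst p - snd p)) \<partial>(?\<mu> \<Otimes>\<^sub>M ?\<mu>)) = (\<integral>\<^sup>+ x. ennreal ((f x)\<^sup>2 / 2) \<partial>?\<mu>) * ennreal ?\<kappa>"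
    proof -
      have "(\<integral>\<^sup>+ p. ennreal ((f (fst p))\<^sup>2 / 2) * ennreal (W n (fst p - snd p)) \<partial>(?\<mu> \<Otimes>\<^sub>M ?\<mu>)) = (\<integral>\<^sup>+ x. \<integral>\<^sup>+ y. ennreal ((f x)\<^sup>2 / 2) * ennreal (W n (x - y)) \<partial>?\<mu> \<partial>?\<mu>)"
        by (subst freq.nn_integral_fst[symmetric]) auto
      also have "\<dots> = (\<integral>\<^sup>+ x. ennreal ((f x)\<^sup>2 / 2) * (\<integral>\<^sup>+ y. ennreal (W n (wrap c (x - y))) \<partial>?\<mu>) \<partial>?\<mu>)"
        by (intro nn_integral_cong) (simp add: nn_integral_cmult W_wrap)
      also have "\<dots> = (\<integral>\<^sup>+ x. ennreal ((f x)\<^sup>2 / 2) * ennreal ?\<kappa> \<partial>?\<mu>)"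
        by (subst nn_integral_freq_reflect[of "\<lambda>z. ennreal (W n z)"]) (auto simp: W_mass)
      finally show ?thesis by (simp add: nn_integral_multc)
    qed
    also have "(\<integral>\<^sup>+ p. ennreal ((f (snd p))\<^sup>2 / 2) * ennreal (W n (fst p - snd p)) \<partial>(?\<mu> \<Otimes>\<^sub>M ?\<mu>)) = (\<integral>\<^sup>+ x. ennreal ((f x)\<^sup>2 / 2) \<partial>?\<mu>) * ennreal ?\<kappa>"
    proof -
      have "(\<integral>\<^sup>+ p. ennreal ((f (snd p))\<^sup>2 / 2) * ennreal (W n (fst p - snd p)) \<partial>(?\<mu> \<Otimes>\<^sub>M ?\<mu>)) = (\<integral>\<^sup>+ y. \<integral>\<^sup>+ x. ennreal ((f y)\<^sup>2 / 2) * ennreal (W n (x - y)) \<partial>?\<mu> \<partial>?\<mu>)"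
        by (subst freq2.nn_integral_snd[symmetric]) auto
      also have "\<dots> = (\<integral>\<^sup>+ y. ennreal ((f y)\<^sup>2 / 2) * (\<integral>\<^sup>+ x. ennreal (W n (wrap c (- y + x))) \<partial>?\<mu>) \<partial>?\<mu>)"
        by (intro nn_integral_cong) (simp add: nn_integral_cmult W_wrap)
      also have "\<dots> = (\<integral>\<^sup>+ x. ennreal ((f x)\<^sup>2 / 2) * ennreal ?\<kappa> \<partial>?\<mu>)"
        by (subst nn_integral_freq_shift[of "\<lambda>z. ennreal (W n z)"]) (auto simp: W_mass)
      finally show ?thesis by (simp add: nn_integral_multc)
    qed
    also have "(\<integral>\<^sup>+ x. ennreal ((f x)\<^sup>2 / 2) \<partial>?\<mu>) * ennreal ?\<kappa> + (\<integral>\<^sup>+ x. ennreal ((f x)\<^sup>2 / 2) \<partial>?\<mu>) * ennreal ?\<kappa>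
       = ennreal ?\<kappa> * (\<integral>\<^sup>+ x. ennreal ((f x)\<^sup>2 / 2) + ennreal ((f x)\<^sup>2 / 2) \<partial>?\<mu>)"
      by (subst nn_integral_add) (auto simp: algebra_simps)
    also have "\<dots> = ennreal ?\<kappa> * (\<integral>\<^sup>+ x. ennreal ((f x)\<^sup>2) \<partial>?\<mu>)"
      by (simp flip: ennreal_plus)
    finally show ?thesis .
  qed
  have "(\<integral>\<^sup>+ t. ennreal ((cmod (?F t))\<^sup>2) \<partial>?\<nu>) = (\<integral>\<^sup>+ t. liminf (\<lambda>n. ennreal (w n t * (cmod (?F t))\<^sup>2)) \<partial>?\<nu>)"
  proof (rule nn_integral_cong_AE, use AE_time_measure[of c] in eventually_elim)
    case (elim t)
    have "(\<lambda>n. w n t * (cmod (?F t))\<^sup>2) \<longlonglongrightarrow> 1 * (cmod (?F t))\<^sup>2"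
      using K elim by (intro tendsto_intros) (auto simp: summability_kernel_def)
    then have "(\<lambda>n. ennreal (w n t * (cmod (?F t))\<^sup>2)) \<longlonglongrightarrow> ennreal ((cmod (?F t))\<^sup>2)"
      by (intro tendsto_ennrealI) simp
    then show ?case by (intro lim_imp_Liminf[symmetric]) auto
  qed
  \<comment> \<open>Fatou is the right passage here, since integrability of the unweighted square is
    what is being established.\<close>
  also have "\<dots> \<le> liminf (\<lambda>n. \<integral>\<^sup>+ t. ennreal (w n t * (cmod (?F t))\<^sup>2) \<partial>?\<nu>)"
    by (rule nn_integral_liminf) measurable
  also have "\<dots> \<le> liminf (\<lambda>n::nat. ennreal ?\<kappa> * (\<integral>\<^sup>+ x. ennreal ((f x)\<^sup>2) \<partial>?\<mu>))"
    by (intro Liminf_mono always_eventually allI key)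
  also have "\<dots> = ennreal ?\<kappa> * (\<integral>\<^sup>+ x. ennreal ((f x)\<^sup>2) \<partial>?\<mu>)"
    by (simp add: Liminf_const)
  finally show ?thesis .
qed


text \<open>The levels run only up to \<open>y / 2\<close>, whence the factor 2^l. In the
  interpolation a level \<open>a\<close> then stands for values at least 2 a, which leaves room to
  split a transform into two parts, one of them bounded by \<open>a\<close>.\<close>

lemma layer_cake:
  fixes y :: real
  assumes "0 \<le> y" "0 < l"
  shows "ennreal (y ^ l) = (\<integral>\<^sup>+ a. ennreal (real l * 2 ^ l * a ^ (l - 1)) * indicator {0..y / 2} a \<partial>lborel)"
proof -
  have "(\<integral>\<^sup>+ a. ennreal (real l * 2 ^ l * a ^ (l - 1)) * indicator {0..y / 2} a \<partial>lborel) = ennreal (2 ^ l * (y / 2) ^ l - 2 ^ l * 0 ^ l)"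
    using assms by (intro nn_integral_FTC_Icc[where F="\<lambda>a. 2 ^ l * a ^ l"]) (auto intro!: derivative_eq_intros)
  then show ?thesis using assms by (simp add: power_divide power_0_left)
qed

text \<open>Marcinkiewicz interpolation between the trivial bound from \<open>L\<^sub>1\<close> and Bessel's
  inequality.  At level \<open>a\<close> the function is cut at height \<open>(N / a) ^ (l - 1)\<close>, which makes the
  transform of the unbounded part at most \<open>a\<close>.\<close>

lemma hausdorff_young:
  fixes c :: time_case and l :: nat
  assumes l: "2 \<le> l"
  obtains C where "0 \<le> C"
    "\<And>f :: real ^ 'd::finite \<Rightarrow> real. \<And>N. f \<in> borel_measurable borel \<Longrightarrow> integrable (freq_measure c) f \<Longrightarrow> 0 < N \<Longrightarrow>
      (\<integral>\<^sup>+ x. ennreal (\<bar>f x\<bar> powr (real l / (real l - 1))) \<partial>freq_measure c) \<le> ennreal N \<Longrightarrow>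
      (\<integral>\<^sup>+ t. ennreal (cmod (fourier c f t) ^ l) \<partial>time_measure c) \<le> ennreal (C * N ^ (l - 1))"
proof (cases "l = 2")
  \<comment> \<open>For l = 2 Bessel's inequality is already the claim, and the interpolation below
    would fail: its weight a^(l-3) is not integrable at 0.\<close>
  case True
  show ?thesis
  proof (rule that)
    show "0 \<le> dual_factor c CARD('d)" by (cases c) auto
    fix f :: "real ^ 'd \<Rightarrow> real" and N :: real
    assume f: "f \<in> borel_measurable borel" "integrable (freq_measure c) f"
      and N: "0 < N" "(\<integral>\<^sup>+ x. ennreal (\<bar>f x\<bar> powr (real l / (real l - 1))) \<partial>freq_measure c) \<le> ennreal N"
    have "ennreal (\<bar>f x\<bar> powr (real l / (real l - 1))) = ennreal ((f x)\<^sup>2)" for x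
      using powr_realpow'[of "\<bar>f x\<bar>" 2] by (simp add: True)
    then have "(\<integral>\<^sup>+ t. ennreal ((cmod (fourier c f t))\<^sup>2) \<partial>time_measure c) \<le> ennreal (dual_factor c CARD('d)) * ennreal N"
      using N by (intro order_trans[OF bessel[OF f]] mult_left_mono) simp_all
    then show "(\<integral>\<^sup>+ t. ennreal (cmod (fourier c f t) ^ l) \<partial>time_measure c) \<le> ennreal (dual_factor c CARD('d) * N ^ (l - 1))"
      using N by (cases c) (simp_all add: True ennreal_mult')
  qed
next
  case False
  define m where "m = l - 1"
  have m: "2 \<le> m" "l = Suc m" using False l by (auto simp: m_def)
  define q where "q = real l / (real l - 1)"
  have q: "q = 1 + 1 / real m" using m by (simp add: q_def field_simps)
  define K where "K = real l * 2 ^ l"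
  have K: "0 \<le> K" by (simp add: K_def)
  have kap: "0 \<le> dual_factor c CARD('d)" by (cases c) auto
  show ?thesis
  proof (rule that)
    show "0 \<le> dual_factor c CARD('d) * K" using kap K by simp
    fix f :: "real ^ 'd \<Rightarrow> real" and N :: real
    assume f_meas [measurable]: "f \<in> borel_measurable borel" and f_int: "integrable (freq_measure c) f"
      and N: "0 < N" and "(\<integral>\<^sup>+ x. ennreal (\<bar>f x\<bar> powr (real l / (real l - 1))) \<partial>freq_measure c) \<le> ennreal N"
    then have fq: "(\<integral>\<^sup>+ x. ennreal (\<bar>f x\<bar> powr q) \<partial>freq_measure c) \<le> ennreal N" by (simp add: q_def)
    let ?\<mu> = "freq_measure c :: (real ^ 'd) measure" and ?\<nu> = "time_measure c :: (real ^ 'd) measure"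
    let ?\<kappa> = "dual_factor c CARD('d)"
    let ?F = "fourier c f"
    define D where "D a = (\<integral>\<^sup>+ x. ennreal ((f x)\<^sup>2) * indicator {0<..} a * indicator {x. \<bar>f x\<bar> * a ^ m \<le> N ^ m} x \<partial>?\<mu>)" for a :: real
    have level: "(\<integral>\<^sup>+ t. indicator {0..cmod (?F t) / 2} a \<partial>?\<nu>) \<le> ennreal (1 / a\<^sup>2) * (ennreal ?\<kappa> * D a)" if a: "0 < a" for a
    proof -
      define s where "s = (N / a) ^ m"
      have s: "0 < s" using N a by (simp add: s_def)
      define f1 where "f1 x = f x * indicator {x. s < \<bar>f x\<bar>} x" for x
      define f2 where "f2 x = f x * indicator {x. \<bar>f x\<bar> \<le> s} x" for x
      have [measurable]: "f1 \<in> borel_measurable borel" "f2 \<in> borel_measurable borel"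
        unfolding f1_def f2_def by measurable
      have split: "f x = f1 x + f2 x" for x by (auto simp: f1_def f2_def indicator_def)
      have i1: "integrable ?\<mu> f1" and i2: "integrable ?\<mu> f2"
        by (rule Bochner_Integration.integrable_bound[OF f_int]; auto simp: f1_def f2_def indicator_def)+
      have F: "?F t = fourier c f1 t + fourier c f2 t" for t
        using fourier_add[OF i1 i2, of t] by (simp flip: split)
      have s_root: "s powr (1 / real m) = N / a"
        using N a m unfolding s_def by (simp add: powr_powr flip: powr_realpow)
      \<comment> \<open>As q - 1 = 1 / m and s^(1/m) = N / a, above the cut height one has 1 \<le>
        (a / N) \<bar>f x\<bar>^(q-1). Integrating, the bound N on the q-th moment becomes the bound
        \<open>a\<close> on the L_1 norm of \<open>f1\<close>, hence on its transform.\<close>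
      have "\<bar>f1 x\<bar> \<le> (a / N) * \<bar>f x\<bar> powr q" for x
      proof (cases "s < \<bar>f x\<bar>")
        case True
        then have fx: "0 < \<bar>f x\<bar>" using s by linarith
        have "(a / N) * \<bar>f x\<bar> powr q = \<bar>f x\<bar> * ((a / N) * \<bar>f x\<bar> powr (1 / real m))"
          using fx by (simp add: q powr_add)
        moreover have "N / a \<le> \<bar>f x\<bar> powr (1 / real m)"
          unfolding s_root[symmetric] using True s by (intro powr_mono2) auto
        then have "1 \<le> (a / N) * \<bar>f x\<bar> powr (1 / real m)" using N a by (simp add: field_simps)
        ultimately have "\<bar>f x\<bar> * 1 \<le> (a / N) * \<bar>f x\<bar> powr q"
          by (simp only:) (intro mult_left_mono, simp_all)
        then show ?thesis using True by (simp add: f1_def)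
      qed (use N a in \<open>simp add: f1_def\<close>)
      then have "(\<integral>\<^sup>+ x. ennreal \<bar>f1 x\<bar> \<partial>?\<mu>) \<le> (\<integral>\<^sup>+ x. ennreal (a / N) * ennreal (\<bar>f x\<bar> powr q) \<partial>?\<mu>)"
        using N a by (intro nn_integral_mono) (simp add: ennreal_leI flip: ennreal_mult)
      also have "\<dots> \<le> ennreal (a / N) * ennreal N"
        by (subst nn_integral_cmult) (auto intro!: mult_left_mono fq)
      also have "\<dots> = ennreal a" using N a by (simp flip: ennreal_mult)
      finally have "ennreal (LINT x|?\<mu>. \<bar>f1 x\<bar>) \<le> ennreal a"
        using i1 by (subst nn_integral_eq_integral[symmetric]) auto
      then have "(LINT x|?\<mu>. \<bar>f1 x\<bar>) \<le> a" using a by simp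
      then have F1: "cmod (fourier c f1 t) \<le> a" for t using norm_fourier_le[of c f1 t] by linarith
      have "(\<integral>\<^sup>+ t. indicator {0..cmod (?F t) / 2} a \<partial>?\<nu>) \<le> (\<integral>\<^sup>+ t. ennreal (1 / a\<^sup>2) * ennreal ((cmod (fourier c f2 t))\<^sup>2) \<partial>?\<nu>)"
      proof (rule nn_integral_mono)
        fix t
        show "indicator {0..cmod (?F t) / 2} a \<le> ennreal (1 / a\<^sup>2) * ennreal ((cmod (fourier c f2 t))\<^sup>2)"
        proof (cases "a \<le> cmod (?F t) / 2")
          case True
          \<comment> \<open>Where the whole transform is at least 2 a, the bounded part must
            contribute at least \<open>a\<close>; Chebyshev and Bessel for \<open>f2\<close> then
            bound the measure of the level set.\<close>
          have "a \<le> cmod (fourier c f2 t)"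
            using True F1[of t] norm_triangle_ineq[of "fourier c f1 t" "fourier c f2 t"] by (simp add: F)
          then have "1 \<le> 1 / a\<^sup>2 * (cmod (fourier c f2 t))\<^sup>2"
            using a by (simp add: field_simps power_mono)
          then have "ennreal 1 \<le> ennreal (1 / a\<^sup>2 * (cmod (fourier c f2 t))\<^sup>2)" by (rule ennreal_leI)
          then have "1 \<le> ennreal (1 / a\<^sup>2) * ennreal ((cmod (fourier c f2 t))\<^sup>2)"
            by (subst (asm) ennreal_mult) simp_all
          then show ?thesis using True a by simp
        qed (use a in simp)
      qed
      also have "\<dots> \<le> ennreal (1 / a\<^sup>2) * (ennreal ?\<kappa> * (\<integral>\<^sup>+ x. ennreal ((f2 x)\<^sup>2) \<partial>?\<mu>))"
        by (subst nn_integral_cmult) (auto intro!: mult_left_mono bessel i2)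
      also have "(\<integral>\<^sup>+ x. ennreal ((f2 x)\<^sup>2) \<partial>?\<mu>) = D a"
        unfolding D_def
        by (intro nn_integral_cong) (use a N in \<open>auto simp: f2_def s_def indicator_def field_simps\<close>)
      finally show ?thesis .
    qed
    \<comment> \<open>For fixed x the cut retains \<open>f x\<close> only at levels up to b = N
      \<bar>f x\<bar>^(-1/m). Integrating a^(l-3) up to b gives at most b^(l-2), and 2 - (l - 2) / m
      = q produces exactly the q-th power of \<bar>f x\<bar>.\<close>
    have inner: "(\<integral>\<^sup>+ a. ennreal (a ^ (l - 3)) * (ennreal ((f x)\<^sup>2) * indicator {0<..} a * indicator {x. \<bar>f x\<bar> * a ^ m \<le> N ^ m} x) \<partial>lborel)
        \<le> ennreal (N ^ (l - 2)) * ennreal (\<bar>f x\<bar> powr q)" for x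
    proof (cases "f x = 0")
      case False
      define b where "b = N * \<bar>f x\<bar> powr (- (1 / real m))"
      have b: "0 < b" using N False by (simp add: b_def)
      have bm: "b ^ m = N ^ m / \<bar>f x\<bar>"
      proof -
        have "(\<bar>f x\<bar> powr (- (1 / real m))) ^ m = inverse \<bar>f x\<bar>"
          using False m by (simp add: powr_power powr_minus_divide power_divide inverse_eq_divide)
        then show ?thesis by (simp add: b_def power_mult_distrib field_simps)
      qed
      have "a \<le> b" if "0 < a" "\<bar>f x\<bar> * a ^ m \<le> N ^ m" for a
      proof -
        have "a ^ m \<le> b ^ m" using that False by (simp add: bm field_simps)
        then show ?thesis using b m power_mono_iff[of a b m] that by simp
      qed
      then have "(\<integral>\<^sup>+ a. ennreal (a ^ (l - 3)) * (ennreal ((f x)\<^sup>2) * indicator {0<..} a * indicator {x. \<bar>f x\<bar> * a ^ m \<le> N ^ m} x) \<partial>lborel)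
        \<le> (\<integral>\<^sup>+ a. ennreal ((f x)\<^sup>2) * (ennreal (a ^ (l - 3)) * indicator {0..b} a) \<partial>lborel)"
        by (intro nn_integral_mono) (auto simp: indicator_def mult_ac)
      also have "\<dots> = ennreal ((f x)\<^sup>2) * (\<integral>\<^sup>+ a. ennreal (a ^ (l - 3)) * indicator {0..b} a \<partial>lborel)"
        by (rule nn_integral_cmult) measurable
      also have "(\<integral>\<^sup>+ a. ennreal (a ^ (l - 3)) * indicator {0..b} a \<partial>lborel) = ennreal (b ^ (l - 2) / real (l - 2) - 0 ^ (l - 2) / real (l - 2))"
      proof (rule nn_integral_FTC_Icc[where F="\<lambda>a. a ^ (l - 2) / real (l - 2)"])
        fix a :: real
        have e: "l - 2 = Suc (l - 3)" using m by auto
        show "((\<lambda>a. a ^ (l - 2) / real (l - 2)) has_real_derivative a ^ (l - 3)) (at a)"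
          unfolding e using DERIV_cdivide[OF DERIV_pow[of "Suc (l - 3)" a UNIV], of "real (Suc (l - 3))"]
          by (simp del: of_nat_Suc power_Suc)
      qed (use b in auto)
      also have "\<dots> \<le> ennreal (b ^ (l - 2))"
      proof (rule ennreal_leI)
        have "1 \<le> real (l - 2)" using m by simp
        then show "b ^ (l - 2) / real (l - 2) - 0 ^ (l - 2) / real (l - 2) \<le> b ^ (l - 2)"
          using b m by (simp add: divide_le_eq power_0_left)
      qed
      also have "ennreal ((f x)\<^sup>2) * ennreal (b ^ (l - 2)) = ennreal (N ^ (l - 2)) * ennreal (\<bar>f x\<bar> powr q)"
      proof -
        have "(f x)\<^sup>2 = \<bar>f x\<bar> powr 2" using powr_realpow'[of "\<bar>f x\<bar>" 2] by simp
        moreover have "b ^ (l - 2) = N ^ (l - 2) * \<bar>f x\<bar> powr (- (1 / real m) * real (l - 2))"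
          using False m by (simp add: b_def power_mult_distrib powr_powr flip: powr_realpow')
        moreover have "2 + - (1 / real m) * real (l - 2) = q" using m by (simp add: q of_nat_diff field_simps)
        ultimately have "(f x)\<^sup>2 * b ^ (l - 2) = N ^ (l - 2) * \<bar>f x\<bar> powr q"
          by (metis mult.left_commute powr_add)
        then show ?thesis using b N by (simp flip: ennreal_mult)
      qed
      finally show ?thesis by (simp add: mult_left_mono)
    qed simp
    interpret pair_sigma_finite "lborel :: real measure" ?\<nu> ..
    interpret L: pair_sigma_finite "lborel :: real measure" ?\<mu> ..
    have "(\<integral>\<^sup>+ t. ennreal (cmod (?F t) ^ l) \<partial>?\<nu>) = (\<integral>\<^sup>+ t. \<integral>\<^sup>+ a. ennreal (K * a ^ m) * indicator {0..cmod (?F t) / 2} a \<partial>lborel \<partial>?\<nu>)"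
      using m by (subst layer_cake) (auto simp: K_def)
    also have "\<dots> = (\<integral>\<^sup>+ a. \<integral>\<^sup>+ t. ennreal (K * a ^ m) * indicator {0..cmod (?F t) / 2} a \<partial>?\<nu> \<partial>lborel)"
    proof (rule Fubini')
      have "(\<lambda>(a, t). ennreal (K * a ^ m) * indicator {z. 0 \<le> fst z \<and> fst z \<le> cmod (?F (snd z)) / 2} (a, t)) \<in> borel_measurable (lborel \<Otimes>\<^sub>M ?\<nu>)"
        by measurable
      then show "(\<lambda>(a, t). ennreal (K * a ^ m) * indicator {0..cmod (?F t) / 2} a) \<in> borel_measurable (lborel \<Otimes>\<^sub>M ?\<nu>)"
        by (simp add: indicator_def)
    qed
    also have "\<dots> \<le> (\<integral>\<^sup>+ a. ennreal (?\<kappa> * K) * (ennreal (a ^ (l - 3)) * D a) \<partial>lborel)"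
    proof (rule nn_integral_mono)
      fix a :: real
      have "(\<integral>\<^sup>+ t. ennreal (K * a ^ m) * indicator {0..cmod (?F t) / 2} a \<partial>?\<nu>) = ennreal (K * a ^ m) * (\<integral>\<^sup>+ t. indicator {0..cmod (?F t) / 2} a \<partial>?\<nu>)"
      proof (rule nn_integral_cmult)
        have "(\<lambda>t. indicator {t. 0 \<le> a \<and> a \<le> cmod (?F t) / 2} t :: ennreal) \<in> borel_measurable ?\<nu>" by measurable
        then show "(\<lambda>t. indicator {0..cmod (?F t) / 2} a :: ennreal) \<in> borel_measurable ?\<nu>"
          by (simp add: indicator_def)
      qed
      also have "\<dots> \<le> ennreal (?\<kappa> * K) * (ennreal (a ^ (l - 3)) * D a)"
      proof (cases "0 < a")
        case True
        have "ennreal (K * a ^ m) * (\<integral>\<^sup>+ t. indicator {0..cmod (?F t) / 2} a \<partial>?\<nu>) \<le> ennreal (K * a ^ m) * (ennreal (1 / a\<^sup>2) * (ennreal ?\<kappa> * D a))"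
          by (intro mult_left_mono level True) simp
        also have "\<dots> = (ennreal (K * a ^ m) * ennreal (1 / a\<^sup>2) * ennreal ?\<kappa>) * D a" by (simp add: mult_ac)
        also have "ennreal (K * a ^ m) * ennreal (1 / a\<^sup>2) * ennreal ?\<kappa> = ennreal (?\<kappa> * K) * ennreal (a ^ (l - 3))"
        proof -
          have "l - 3 + 2 = m" using m by simp
          then have "a ^ m = a ^ (l - 3) * a\<^sup>2" by (metis power_add)
          then have "K * a ^ m * (1 / a\<^sup>2) * ?\<kappa> = (?\<kappa> * K) * a ^ (l - 3)" using True by simp
          then show ?thesis using True K kap by (simp only: ennreal_mult[symmetric] mult_nonneg_nonneg zero_le_power less_imp_le zero_le_divide_1_iff zero_le_power2)
        qed
        finally show ?thesis by (simp only: mult.assoc)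
      next
        case False
        then consider "a = 0" | "a < 0" by linarith
        then show ?thesis using m by cases (auto simp: power_0_left)
      qed
      finally show "(\<integral>\<^sup>+ t. ennreal (K * a ^ m) * indicator {0..cmod (?F t) / 2} a \<partial>?\<nu>) \<le> ennreal (?\<kappa> * K) * (ennreal (a ^ (l - 3)) * D a)" .
    qed
    also have "\<dots> = ennreal (?\<kappa> * K) * (\<integral>\<^sup>+ a. \<integral>\<^sup>+ x. ennreal (a ^ (l - 3)) * (ennreal ((f x)\<^sup>2) * indicator {0<..} a * indicator {x. \<bar>f x\<bar> * a ^ m \<le> N ^ m} x) \<partial>?\<mu> \<partial>lborel)"
      unfolding D_def by (simp add: nn_integral_cmult)
    also have "(\<integral>\<^sup>+ a. \<integral>\<^sup>+ x. ennreal (a ^ (l - 3)) * (ennreal ((f x)\<^sup>2) * indicator {0<..} a * indicator {x. \<bar>f x\<bar> * a ^ m \<le> N ^ m} x) \<partial>?\<mu> \<partial>lborel) =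
       (\<integral>\<^sup>+ x. \<integral>\<^sup>+ a. ennreal (a ^ (l - 3)) * (ennreal ((f x)\<^sup>2) * indicator {0<..} a * indicator {x. \<bar>f x\<bar> * a ^ m \<le> N ^ m} x) \<partial>lborel \<partial>?\<mu>)"
    proof (rule L.Fubini'[symmetric])
      have "(\<lambda>(a, x). ennreal (a ^ (l - 3)) * (ennreal ((f x)\<^sup>2) * indicator {0<..} a * indicator {z. \<bar>f (snd z)\<bar> * fst z ^ m \<le> N ^ m} (a, x))) \<in> borel_measurable (lborel \<Otimes>\<^sub>M ?\<mu>)"
        by measurable
      then show "(\<lambda>(a, x). ennreal (a ^ (l - 3)) * (ennreal ((f x)\<^sup>2) * indicator {0<..} a * indicator {x. \<bar>f x\<bar> * a ^ m \<le> N ^ m} x)) \<in> borel_measurable (lborel \<Otimes>\<^sub>M ?\<mu>)"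
        by (simp add: indicator_def)
    qed
    also have "ennreal (?\<kappa> * K) * \<dots> \<le> ennreal (?\<kappa> * K) * (\<integral>\<^sup>+ x. ennreal (N ^ (l - 2)) * ennreal (\<bar>f x\<bar> powr q) \<partial>?\<mu>)"
      by (intro mult_left_mono nn_integral_mono inner) simp
    also have "\<dots> \<le> ennreal (?\<kappa> * K) * (ennreal (N ^ (l - 2)) * ennreal N)"
      by (subst nn_integral_cmult) (auto intro!: mult_left_mono fq)
    also have "\<dots> = ennreal (?\<kappa> * K * N ^ (l - 1))"
    proof -
      have "N ^ (l - 1) = N ^ (l - 2) * N" using m by (simp flip: power_Suc2)
      then show ?thesis using N K kap by (simp add: ennreal_mult' mult.assoc)
    qed
    finally show "(\<integral>\<^sup>+ t. ennreal (cmod (?F t) ^ l) \<partial>?\<nu>) \<le> ennreal (?\<kappa> * K * N ^ (l - 1))" .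
  qed
qed

section \<open>Convolution chains\<close>

text \<open>The chain variables are the partial sums \<open>y i\<close> of the frequencies, with \<open>y 0 = 0\<close>.\<close>

definition node :: "(nat \<Rightarrow> 'a::zero) \<Rightarrow> nat \<Rightarrow> 'a" where
  "node y i = (if i = 0 then 0 else y i)"

definition edge :: "time_case \<Rightarrow> (nat \<Rightarrow> real ^ 'd::finite) \<Rightarrow> nat \<Rightarrow> real ^ 'd" where
  "edge c y i = wrap c (node y i - node y (i - 1))"

abbreviation freq_power :: "time_case \<Rightarrow> nat \<Rightarrow> (nat \<Rightarrow> real ^ 'd::finite) measure" where
  "freq_power c m \<equiv> (\<Pi>\<^sub>M i\<in>{1..m}. freq_measure c)"

interpretation freq_prod: product_sigma_finite "\<lambda>i::nat. freq_measure c"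
  by standard

lemma node_upd [simp]: "i \<le> m \<Longrightarrow> node (y(Suc m := z)) i = node y i" "node (y(Suc m := z)) (Suc m) = z"
  by (auto simp: node_def)

lemma edge_upd [simp]: "i \<le> m \<Longrightarrow> edge c (y(Suc m := z)) i = edge c y i"
  "edge c (y(Suc m := z)) (Suc m) = wrap c (z - node y m)"
  by (auto simp: edge_def)

lemma node_measurable [measurable]:
  "i \<le> m \<Longrightarrow> (\<lambda>y. node y i) \<in> freq_power c m \<rightarrow>\<^sub>M (borel :: (real ^ 'd::finite) measure)"
  unfolding node_def by (cases "i = 0") auto

lemma edge_measurable [measurable]:
  "i \<le> m \<Longrightarrow> (\<lambda>y. edge c y i) \<in> freq_power c m \<rightarrow>\<^sub>M (borel :: (real ^ 'd::finite) measure)"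
  unfolding edge_def by measurable

lemmas node_measurable' [measurable] = node_measurable[unfolded One_nat_def]
lemmas edge_measurable' [measurable] = edge_measurable[unfolded One_nat_def]

lemma emeasure_freq_power_0 [simp]:
  "emeasure (Pi\<^sub>M {} (\<lambda>i::nat. freq_measure c)) (space (Pi\<^sub>M {} (\<lambda>i. freq_measure c))) = 1"
  using freq_prod.emeasure_PiM[of "{}" "\<lambda>_. UNIV" c] by (simp add: space_PiM)

lemma atLeast1_atMost_Suc: "{1..Suc m} = insert (Suc m) {1..m}"
  by auto

text \<open>Given the earlier nodes, the last increment is a translate of the last variable, so its
  integral factors out by invariance. The reduced increments thus behave like independent
  frequencies under the product measure.\<close>

lemma nn_integral_chain:
  fixes Q :: "nat \<Rightarrow> real ^ 'd::finite \<Rightarrow> ennreal"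
  assumes Q [measurable]: "\<And>i. Q i \<in> borel_measurable borel"
  shows "(\<integral>\<^sup>+ y. (\<Prod>i\<in>{1..m}. Q i (edge c y i)) \<partial>freq_power c m) = (\<Prod>i\<in>{1..m}. \<integral>\<^sup>+ x. Q i x \<partial>freq_measure c)"
proof (induction m)
  case 0
  show ?case by (simp add: freq_prod.nn_integral_empty)
next
  case (Suc m)
  have "(\<integral>\<^sup>+ y. (\<Prod>i\<in>{1..Suc m}. Q i (edge c y i)) \<partial>freq_power c (Suc m)) =
    (\<integral>\<^sup>+ y. \<integral>\<^sup>+ z. (\<Prod>i\<in>{1..Suc m}. Q i (edge c (y(Suc m := z)) i)) \<partial>freq_measure c \<partial>freq_power c m)"
  proof -
    have "(\<lambda>y. \<Prod>i\<in>{1..Suc m}. Q i (edge c y i)) \<in> borel_measurable (freq_power c (Suc m))"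
      by (intro borel_measurable_prod_ennreal measurable_compose[OF edge_measurable Q]) simp
    then show ?thesis
      unfolding atLeast1_atMost_Suc by (intro freq_prod.product_nn_integral_insert) simp_all
  qed
  also have "\<dots> = (\<integral>\<^sup>+ y. \<integral>\<^sup>+ z. (\<Prod>i\<in>{1..m}. Q i (edge c y i)) * Q (Suc m) (wrap c (- node y m + z)) \<partial>freq_measure c \<partial>freq_power c m)"
    by (intro nn_integral_cong) (simp add: mult.commute)
  also have "\<dots> = (\<integral>\<^sup>+ y. (\<Prod>i\<in>{1..m}. Q i (edge c y i)) * (\<integral>\<^sup>+ x. Q (Suc m) x \<partial>freq_measure c) \<partial>freq_power c m)"
    by (intro nn_integral_cong) (subst nn_integral_cmult, measurable, simp only: nn_integral_freq_shift[OF Q])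
  also have "\<dots> = (\<Prod>i\<in>{1..m}. \<integral>\<^sup>+ x. Q i x \<partial>freq_measure c) * (\<integral>\<^sup>+ x. Q (Suc m) x \<partial>freq_measure c)"
  proof -
    have "(\<lambda>y. \<Prod>i\<in>{1..m}. Q i (edge c y i)) \<in> borel_measurable (freq_power c m)"
      by (intro borel_measurable_prod_ennreal measurable_compose[OF edge_measurable Q]) simp
    then show ?thesis by (simp only: nn_integral_multc Suc)
  qed
  finally show ?case by (simp add: mult.commute)
qed

text \<open>Deleting one edge of the cycle through \<open>0\<close> and \<open>x\<close> leaves two independent chains.\<close>

lemma nn_integral_deleted_chain:
  fixes Q :: "nat \<Rightarrow> real ^ 'd::finite \<Rightarrow> ennreal"
  assumes Q [measurable]: "\<And>i. Q i \<in> borel_measurable borel"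
  shows "j \<in> {1..Suc m} \<Longrightarrow>
    (\<integral>\<^sup>+ y. (\<Prod>i\<in>{1..m} - {j}. Q i (edge c y i)) * (if j = Suc m then 1 else Q (Suc m) (wrap c (x - node y m))) \<partial>freq_power c m)
    = (\<Prod>i\<in>{1..Suc m} - {j}. \<integral>\<^sup>+ x. Q i x \<partial>freq_measure c)"
proof (induction m arbitrary: x)
  case 0
  then show ?case by (simp add: freq_prod.nn_integral_empty)
next
  case (Suc m)
  let ?N = "\<lambda>i. \<integral>\<^sup>+ x. Q i x \<partial>freq_measure c"
  show ?case
  proof (cases "j = Suc (Suc m)")
    case True
    have "{1..Suc m} - {j} = {1..Suc m}" "{1..Suc (Suc m)} - {j} = {1..Suc m}" using True by auto
    then show ?thesis using True nn_integral_chain[of Q "Suc m" c] by simp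
  next
    case False
    then have j: "j \<in> {1..Suc m}" using Suc.prems by auto
    have m1: "(\<lambda>y. Q i (edge c y i)) \<in> borel_measurable (freq_power c (Suc m))" if "i \<in> {1..Suc m} - {j}" for i
      using that by (intro measurable_compose[OF edge_measurable Q]) auto
    have m2: "(\<lambda>y. (\<Prod>i\<in>{1..Suc m} - {j}. Q i (edge c y i)) * Q (Suc (Suc m)) (wrap c (x - node y (Suc m)))) \<in> borel_measurable (freq_power c (Suc m))"
      using m1 by measurable
    \<comment> \<open>The last node z is integrated last. For fixed z the remaining edges form the
      shorter chain with endpoint z in place of x, which is why the endpoint is arbitrary in the
      induction. When the edge into z is the deleted one, its factor is 1.\<close>
    have pr: "(\<Prod>i\<in>{1..Suc m} - {j}. Q i (edge c (y(Suc m := z)) i)) =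
      (\<Prod>i\<in>{1..m} - {j}. Q i (edge c y i)) * (if j = Suc m then 1 else Q (Suc m) (wrap c (z - node y m)))" for y z
    proof (cases "j = Suc m")
      case True
      then have "{1..Suc m} - {j} = {1..m} - {j}" by auto
      then show ?thesis using True by (auto intro!: prod.cong)
    next
      case False
      then have "{1..Suc m} - {j} = insert (Suc m) ({1..m} - {j})" by auto
      then show ?thesis using False by (auto simp: mult.commute intro!: prod.cong)
    qed
    have "(\<integral>\<^sup>+ y. (\<Prod>i\<in>{1..Suc m} - {j}. Q i (edge c y i)) * Q (Suc (Suc m)) (wrap c (x - node y (Suc m))) \<partial>freq_power c (Suc m))
      = (\<integral>\<^sup>+ z. \<integral>\<^sup>+ y. (\<Prod>i\<in>{1..Suc m} - {j}. Q i (edge c (y(Suc m := z)) i)) * Q (Suc (Suc m)) (wrap c (x - node (y(Suc m := z)) (Suc m))) \<partial>freq_power c m \<partial>freq_measure c)"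
      using m2 unfolding atLeast1_atMost_Suc
      by (intro freq_prod.product_nn_integral_insert_rev) auto
    also have "\<dots> = (\<integral>\<^sup>+ z. \<integral>\<^sup>+ y. ((\<Prod>i\<in>{1..m} - {j}. Q i (edge c y i)) * (if j = Suc m then 1 else Q (Suc m) (wrap c (z - node y m)))) * Q (Suc (Suc m)) (wrap c (x - z)) \<partial>freq_power c m \<partial>freq_measure c)"
      unfolding pr by simp
    also have "\<dots> = (\<integral>\<^sup>+ z. (\<Prod>i\<in>{1..Suc m} - {j}. ?N i) * Q (Suc (Suc m)) (wrap c (x - z)) \<partial>freq_measure c)"
    proof (intro nn_integral_cong)
      fix z
      have m3: "(\<lambda>y. Q i (edge c y i)) \<in> borel_measurable (freq_power c m)" if "i \<in> {1..m} - {j}" for i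
        using that by (intro measurable_compose[OF edge_measurable Q]) auto
      have "(\<lambda>y. (\<Prod>i\<in>{1..m} - {j}. Q i (edge c y i)) * (if j = Suc m then 1 else Q (Suc m) (wrap c (z - node y m)))) \<in> borel_measurable (freq_power c m)"
        using m3 by measurable
      then show "(\<integral>\<^sup>+ y. ((\<Prod>i\<in>{1..m} - {j}. Q i (edge c y i)) * (if j = Suc m then 1 else Q (Suc m) (wrap c (z - node y m)))) * Q (Suc (Suc m)) (wrap c (x - z)) \<partial>freq_power c m) =
        (\<Prod>i\<in>{1..Suc m} - {j}. ?N i) * Q (Suc (Suc m)) (wrap c (x - z))"
        by (subst nn_integral_multc) (simp_all only: Suc.IH[OF j] Q measurable)
    qed
    also have "\<dots> = (\<Prod>i\<in>{1..Suc m} - {j}. ?N i) * ?N (Suc (Suc m))"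
      by (subst nn_integral_cmult) (auto simp: nn_integral_freq_reflect)
    also have "\<dots> = (\<Prod>i\<in>{1..Suc (Suc m)} - {j}. ?N i)"
    proof -
      have "{1..Suc (Suc m)} - {j} = insert (Suc (Suc m)) ({1..Suc m} - {j})" using False by auto
      then show ?thesis by (simp add: mult.commute)
    qed
    finally show ?thesis using False by simp
  qed
qed

text \<open>Let a_j be the smallest factor. Writing a_j as the product of m copies of a_j^(1/m) and
  enlarging each copy to a_i^(1/m), one distributes a_j over the others and reaches the exponent 1 +
  1/m. The index of the smallest factor varies from point to point, so all choices are summed. This
  takes the place of Hoelder's inequality.\<close>

lemma prod_le_deleted:
  fixes a :: "'i \<Rightarrow> real"
  assumes S: "finite S" "card S = Suc m" "1 \<le> m" and a: "\<And>i. i \<in> S \<Longrightarrow> 0 \<le> a i"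
  shows "(\<Prod>i\<in>S. a i) \<le> (\<Sum>j\<in>S. \<Prod>i\<in>S - {j}. a i powr (real (Suc m) / real m))"
proof -
  let ?q = "real (Suc m) / real m"
  have "S \<noteq> {}" using S by auto
  then obtain j where j: "j \<in> S" "\<And>i. i \<in> S \<Longrightarrow> a j \<le> a i"
    using ex_min_if_finite[of "a ` S"] S by (metis arg_min_if_finite(1) arg_min_least)
  have card: "card (S - {j}) = m" using S j by simp
  have "a j = (\<Prod>i\<in>S - {j}. a j powr (1 / real m))"
  proof -
    have "(a j powr (1 / real m)) ^ m = a j"
      using S a[OF j(1)] by (cases "a j = 0") (auto simp: powr_power)
    then show ?thesis using a[OF j(1)] S by (simp add: card)
  qed
  also have "\<dots> \<le> (\<Prod>i\<in>S - {j}. a i powr (1 / real m))"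
    using a j by (intro prod_mono) (auto intro!: powr_mono2)
  finally have "a j * (\<Prod>i\<in>S - {j}. a i) \<le> (\<Prod>i\<in>S - {j}. a i powr (1 / real m)) * (\<Prod>i\<in>S - {j}. a i)"
    using a by (intro mult_right_mono prod_nonneg) auto
  also have "\<dots> = (\<Prod>i\<in>S - {j}. a i powr ?q)"
    unfolding prod.distrib[symmetric]
  proof (rule prod.cong[OF refl])
    fix i assume "i \<in> S - {j}"
    then have "0 \<le> a i" using a by auto
    moreover have "?q = 1 / real m + 1" using S by (simp add: field_simps)
    ultimately show "a i powr (1 / real m) * a i = a i powr ?q"
      by (simp add: powr_add)
  qed
  also have "\<dots> \<le> (\<Sum>j\<in>S. \<Prod>i\<in>S - {j}. a i powr ?q)"
    using j S by (intro member_le_sum[of j S "\<lambda>j. \<Prod>i\<in>S - {j}. a i powr ?q"] prod_nonneg) auto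
  finally show ?thesis using S j by (simp add: prod.remove)
qed

text \<open>The integrand is a product over the m + 1 edges of the closed walk from 0 to x,
  \<open>g\<close> sitting on the last edge. After \<open>prod_le_deleted\<close> each summand
  misses one edge, so the walk is cut and its integral factors. Deleting one of the m edges carrying
  \<open>f\<close> leaves A^(m-1) B, deleting that of \<open>g\<close> leaves A^m. The bound is not
  homogeneous in \<open>g\<close>; applications rescale \<open>g\<close> first.\<close>

lemma young_chain:
  fixes f g :: "real ^ 'd::finite \<Rightarrow> real"
  assumes [measurable]: "f \<in> borel_measurable borel" "g \<in> borel_measurable borel" and m: "1 \<le> m"
    and A: "(\<integral>\<^sup>+ x. ennreal (\<bar>f x\<bar> powr (real (Suc m) / real m)) \<partial>freq_measure c) \<le> ennreal A" "0 \<le> A"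
    and B: "(\<integral>\<^sup>+ x. ennreal (\<bar>g x\<bar> powr (real (Suc m) / real m)) \<partial>freq_measure c) \<le> ennreal B" "0 \<le> B"
  shows "(\<integral>\<^sup>+ y. ennreal ((\<Prod>i\<in>{1..m}. \<bar>f (edge c y i)\<bar>) * \<bar>g (wrap c (x - node y m))\<bar>) \<partial>freq_power c m)
    \<le> ennreal (real m * A ^ (m - 1) * B + A ^ m)"
proof -
  let ?q = "real (Suc m) / real m"
  define h where "h i = (if i = Suc m then g else f)" for i
  define e where "e y i = (if i = Suc m then wrap c (x - node y m) else edge c y i)" for y i
  define Q where "Q i z = ennreal (\<bar>h i z\<bar> powr ?q)" for i z
  have [measurable]: "h i \<in> borel_measurable borel" for i by (simp add: h_def)
  have Q_meas [measurable]: "Q i \<in> borel_measurable borel" for i unfolding Q_def by measurable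
  have "(\<integral>\<^sup>+ y. ennreal ((\<Prod>i\<in>{1..m}. \<bar>f (edge c y i)\<bar>) * \<bar>g (wrap c (x - node y m))\<bar>) \<partial>freq_power c m)
    = (\<integral>\<^sup>+ y. ennreal (\<Prod>i\<in>{1..Suc m}. \<bar>h i (e y i)\<bar>) \<partial>freq_power c m)"
    by (intro nn_integral_cong arg_cong[where f=ennreal]) (simp add: e_def h_def atLeastAtMostSuc_conv mult.commute)
  also have "\<dots> \<le> (\<integral>\<^sup>+ y. (\<Sum>j\<in>{1..Suc m}. \<Prod>i\<in>{1..Suc m} - {j}. Q i (e y i)) \<partial>freq_power c m)"
  proof (intro nn_integral_mono)
    fix y
    have "ennreal (\<Prod>i\<in>{1..Suc m}. \<bar>h i (e y i)\<bar>) \<le> ennreal (\<Sum>j\<in>{1..Suc m}. \<Prod>i\<in>{1..Suc m} - {j}. \<bar>h i (e y i)\<bar> powr ?q)"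
      using m by (intro ennreal_leI prod_le_deleted) auto
    also have "\<dots> = (\<Sum>j\<in>{1..Suc m}. \<Prod>i\<in>{1..Suc m} - {j}. Q i (e y i))"
      by (simp add: Q_def sum_ennreal prod_ennreal prod_nonneg del: sum.cl_ivl_Suc)
    finally show "ennreal (\<Prod>i\<in>{1..Suc m}. \<bar>h i (e y i)\<bar>) \<le> (\<Sum>j\<in>{1..Suc m}. \<Prod>i\<in>{1..Suc m} - {j}. Q i (e y i))" .
  qed
  also have "\<dots> = (\<Sum>j\<in>{1..Suc m}. \<integral>\<^sup>+ y. (\<Prod>i\<in>{1..Suc m} - {j}. Q i (e y i)) \<partial>freq_power c m)"
  proof (rule nn_integral_sum)
    fix j
    have "(\<lambda>y. e y i) \<in> freq_power c m \<rightarrow>\<^sub>M borel" if "i \<in> {1..Suc m}" for i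
      using that unfolding e_def by (cases "i = Suc m") auto
    then show "(\<lambda>y. \<Prod>i\<in>{1..Suc m} - {j}. Q i (e y i)) \<in> borel_measurable (freq_power c m)"
      by (intro borel_measurable_prod_ennreal measurable_compose[OF _ Q_meas]) auto
  qed
  also have "\<dots> = (\<Sum>j\<in>{1..Suc m}. \<Prod>i\<in>{1..Suc m} - {j}. \<integral>\<^sup>+ z. Q i z \<partial>freq_measure c)"
  proof (rule sum.cong[OF refl])
    fix j assume j: "j \<in> {1..Suc m}"
    have "(\<Prod>i\<in>{1..Suc m} - {j}. Q i (e y i)) = (\<Prod>i\<in>{1..m} - {j}. Q i (edge c y i)) * (if j = Suc m then 1 else Q (Suc m) (wrap c (x - node y m)))" for y
    proof (cases "j = Suc m")
      case True
      then have "{1..Suc m} - {j} = {1..m} - {j}" by auto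
      then show ?thesis using True by (auto intro!: prod.cong simp: e_def)
    next
      case False
      then have "{1..Suc m} - {j} = insert (Suc m) ({1..m} - {j})" by auto
      then show ?thesis using False by (auto simp: mult.commute e_def intro!: prod.cong)
    qed
    then show "(\<integral>\<^sup>+ y. (\<Prod>i\<in>{1..Suc m} - {j}. Q i (e y i)) \<partial>freq_power c m) = (\<Prod>i\<in>{1..Suc m} - {j}. \<integral>\<^sup>+ z. Q i z \<partial>freq_measure c)"
      using nn_integral_deleted_chain[of Q, OF Q_meas j, of c x] by simp
  qed
  also have "\<dots> \<le> (\<Sum>j\<in>{1..Suc m}. \<Prod>i\<in>{1..Suc m} - {j}. ennreal (if i = Suc m then B else A))"
    using A B by (intro sum_mono prod_mono_ennreal) (auto simp: Q_def h_def)
  also have "\<dots> = ennreal (\<Sum>j\<in>{1..Suc m}. \<Prod>i\<in>{1..Suc m} - {j}. if i = Suc m then B else A)"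
    using A B by (simp add: sum_ennreal prod_ennreal prod_nonneg del: sum.cl_ivl_Suc)
  also have "(\<Sum>j\<in>{1..Suc m}. \<Prod>i\<in>{1..Suc m} - {j}. if i = Suc m then B else A) = (\<Sum>j\<in>{1..m}. A ^ (m - 1) * B) + A ^ m"
  proof -
    have "(\<Prod>i\<in>{1..Suc m} - {j}. if i = Suc m then B else A) = A ^ (m - 1) * B" if "j \<in> {1..m}" for j
    proof -
      have "{1..Suc m} - {j} = insert (Suc m) ({1..m} - {j})" using that by auto
      moreover have "(\<Prod>i\<in>{1..m} - {j}. if i = Suc m then B else A) = (\<Prod>i\<in>{1..m} - {j}. A)"
        by (intro prod.cong) auto
      ultimately show ?thesis using that by simp
    qed
    moreover have "(\<Prod>i\<in>{1..Suc m} - {Suc m}. if i = Suc m then B else A) = A ^ m"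
    proof -
      have "{1..Suc m} - {Suc m} = {1..m}" by auto
      moreover have "(\<Prod>i\<in>{1..m}. if i = Suc m then B else A) = (\<Prod>i\<in>{1..m}. A)" by (intro prod.cong) auto
      ultimately show ?thesis by simp
    qed
    ultimately show ?thesis by (simp add: atLeastAtMostSuc_conv add.commute)
  qed
  finally show ?thesis by (simp add: mult.assoc)
qed

lemma integrable_chain:
  fixes f :: "real ^ 'd::finite \<Rightarrow> real"
  assumes [measurable]: "f \<in> borel_measurable borel" and f: "integrable (freq_measure c) f"
  shows "integrable (freq_power c m) (\<lambda>y. \<Prod>i\<in>{1..m}. f (edge c y i))"
proof (rule integrableI_bounded)
  show "(\<lambda>y. \<Prod>i\<in>{1..m}. f (edge c y i)) \<in> borel_measurable (freq_power c m)"
    by (intro borel_measurable_prod measurable_compose[OF edge_measurable]) auto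
  have "(\<integral>\<^sup>+ y. ennreal (norm (\<Prod>i\<in>{1..m}. f (edge c y i))) \<partial>freq_power c m) = (\<Prod>i\<in>{1..m}. \<integral>\<^sup>+ x. ennreal \<bar>f x\<bar> \<partial>freq_measure c)"
    by (subst nn_integral_chain[symmetric]) (auto simp: abs_prod prod_ennreal)
  also have "\<dots> < \<infinity>"
    using f by (simp add: power_less_top_ennreal integrable_iff_bounded)
  finally show "(\<integral>\<^sup>+ y. ennreal (norm (\<Prod>i\<in>{1..m}. f (edge c y i))) \<partial>freq_power c m) < \<infinity>" .
qed

text \<open>The last node is, modulo 2 pi, the sum of the edges, so at an index time the character
  of the last node is the product of the characters of the edges. Integrating the last variable
  splits off one transform at a time.\<close>

lemma fourier_power:
  fixes f :: "real ^ 'd::finite \<Rightarrow> real"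
  assumes f_meas [measurable]: "f \<in> borel_measurable borel" and f: "integrable (freq_measure c) f" and t: "t \<in> index_set c"
  shows "fourier c f t ^ m = (LINT y|freq_power c m. cis (t \<bullet> node y m) * of_real (\<Prod>i\<in>{1..m}. f (edge c y i)))"
proof (induction m)
  case 0
  have "(LINT y|freq_power c 0. (1::complex)) = 1"
    using freq_prod.product_integral_prod[of "{}" c "\<lambda>_ _. 1 :: complex"] by simp
  then show ?case by (simp add: node_def)
next
  case (Suc m)
  define F where "F x = cis (t \<bullet> x) * of_real (f x)" for x
  have F_meas: "F \<in> borel_measurable borel" unfolding F_def by measurable
  have int: "integrable (freq_power c (Suc m)) (\<lambda>y. cis (t \<bullet> node y (Suc m)) * of_real (\<Prod>i\<in>{1..Suc m}. f (edge c y i)))"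
    by (intro integrable_cis integrable_chain f) measurable
  have "(LINT y|freq_power c (Suc m). cis (t \<bullet> node y (Suc m)) * of_real (\<Prod>i\<in>{1..Suc m}. f (edge c y i))) =
    (LINT y|freq_power c m. (LINT z|freq_measure c. cis (t \<bullet> node (y(Suc m := z)) (Suc m)) * of_real (\<Prod>i\<in>{1..Suc m}. f (edge c (y(Suc m := z)) i))))"
    using int unfolding atLeast1_atMost_Suc
    by (intro freq_prod.product_integral_insert) auto
  also have "\<dots> = (LINT y|freq_power c m. (cis (t \<bullet> node y m) * of_real (\<Prod>i\<in>{1..m}. f (edge c y i))) * fourier c f t)"
  proof (intro Bochner_Integration.integral_cong refl)
    fix y
    have "(LINT z|freq_measure c. cis (t \<bullet> node (y(Suc m := z)) (Suc m)) * of_real (\<Prod>i\<in>{1..Suc m}. f (edge c (y(Suc m := z)) i)))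
      = (LINT z|freq_measure c. (cis (t \<bullet> node y m) * of_real (\<Prod>i\<in>{1..m}. f (edge c y i))) * F (wrap c (- node y m + z)))"
    proof (intro Bochner_Integration.integral_cong refl)
      fix z
      have "cis (t \<bullet> z) = cis (t \<bullet> node y m) * cis (t \<bullet> wrap c (- node y m + z))"
        by (simp add: cis_wrap[OF t] cis_mult inner_diff_right)
      then show "cis (t \<bullet> node (y(Suc m := z)) (Suc m)) * of_real (\<Prod>i\<in>{1..Suc m}. f (edge c (y(Suc m := z)) i)) =
        (cis (t \<bullet> node y m) * of_real (\<Prod>i\<in>{1..m}. f (edge c y i))) * F (wrap c (- node y m + z))"
        by (simp add: F_def atLeastAtMostSuc_conv mult_ac del: cis_mult)
    qed
    also have "\<dots> = (cis (t \<bullet> node y m) * of_real (\<Prod>i\<in>{1..m}. f (edge c y i))) * (LINT z|freq_measure c. F (wrap c (- node y m + z)))"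
      by (rule integral_mult_right_zero)
    also have "(LINT z|freq_measure c. F (wrap c (- node y m + z))) = fourier c f t"
      unfolding integral_freq_shift(1)[OF F_meas] by (simp only: F_def[abs_def] fourier_def)
    finally show "(LINT z|freq_measure c. cis (t \<bullet> node (y(Suc m := z)) (Suc m)) * of_real (\<Prod>i\<in>{1..Suc m}. f (edge c (y(Suc m := z)) i)))
      = (cis (t \<bullet> node y m) * of_real (\<Prod>i\<in>{1..m}. f (edge c y i))) * fourier c f t" .
  qed
  also have "\<dots> = fourier c f t ^ m * fourier c f t"
    by (simp only: integral_mult_left_zero Suc)
  finally show ?case by (simp add: mult.commute)
qed

lemma sigma_finite_freq_power: "sigma_finite_measure (freq_power c m :: (nat \<Rightarrow> real ^ 'd::finite) measure)"
  by (rule freq_prod.sigma_finite) simp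

section \<open>Fourier inversion\<close>

text \<open>With the weight \<open>w n\<close> inserted, Fubini applies and the time integral
  becomes \<open>W n\<close> evaluated at the sum of all frequencies. As n grows the kernel forces
  this sum to be 0, which closes the cycle. Continuity of the last factor is what makes the
  concentration hold at every point.\<close>

lemma fourier_inversion_test:
  fixes f g :: "real ^ 'd::finite \<Rightarrow> real"
  assumes f_meas [measurable]: "f \<in> borel_measurable borel" and f: "integrable (freq_measure c) f"
    and g: "continuous_on UNIV (\<lambda>x. g (wrap c x))" "bounded (range (\<lambda>x. g (wrap c x)))"
      "integrable (freq_measure c) (\<lambda>x. g (wrap c x))"
    and int: "integrable (time_measure c) (\<lambda>t. cmod (fourier c f t ^ m * fourier c (\<lambda>x. g (wrap c x)) t))"
  shows "(LINT t|time_measure c. fourier c f t ^ m * fourier c (\<lambda>x. g (wrap c x)) t) =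
    of_real (dual_factor c CARD('d) * (LINT y|freq_power c m. (\<Prod>i\<in>{1..m}. f (edge c y i)) * g (wrap c (- node y m))))"
proof -
  obtain w W :: "nat \<Rightarrow> real ^ 'd \<Rightarrow> real" where K: "summability_kernel c w W"
    using summability_kernel_exists by blast
  let ?\<mu> = "freq_measure c :: (real ^ 'd) measure" and ?\<nu> = "time_measure c :: (real ^ 'd) measure"
  define P where "P = (freq_power c m :: (nat \<Rightarrow> real ^ 'd) measure)"
  let ?\<kappa> = "dual_factor c CARD('d)"
  define h where "h x = g (wrap c x)" for x
  have h_meas [measurable]: "h \<in> borel_measurable borel"
    using g(1) unfolding h_def[abs_def] by (rule borel_measurable_continuous_onI)
  have h_int: "integrable ?\<mu> h" using g(3) by (simp add: h_def[abs_def])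
  obtain B where B: "\<And>x. \<bar>h x\<bar> \<le> B" using g(2) by (auto simp: bounded_iff h_def)
  have B0: "0 \<le> B" using B[of 0] by linarith
  have [measurable]: "w n \<in> borel_measurable borel" "W n \<in> borel_measurable borel" for n
    using K by (auto simp: summability_kernel_def)
  have w: "0 \<le> w n t" "w n t \<le> 1" "integrable ?\<nu> (w n)" for n t
    using K by (auto simp: summability_kernel_def)
  have W: "0 \<le> W n z" "integrable ?\<mu> (W n)" "(LINT z|?\<mu>. W n z) = ?\<kappa>"
    "(LINT t|?\<nu>. cis (t \<bullet> z) * of_real (w n t)) = of_real (W n z)" for n z
    using K by (auto simp: summability_kernel_def)
  have W_wrap: "W n (wrap c z) = W n z" for n z
  proof -
    have "complex_of_real (W n (wrap c z)) = of_real (W n z)"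
      unfolding W(4)[symmetric] using AE_time_measure[of c]
      by (intro integral_cong_AE) (auto simp: cis_wrap)
    then show ?thesis by simp
  qed
  define ch where "ch y = (\<Prod>i\<in>{1..m}. f (edge c y i))" for y
  have ch_int: "integrable P ch" unfolding ch_def P_def by (rule integrable_chain[OF f_meas f])
  have [measurable]: "ch \<in> borel_measurable P" using ch_int by simp
  interpret P: sigma_finite_measure P unfolding P_def by (rule sigma_finite_freq_power)
  interpret Pm: pair_sigma_finite P ?\<mu> ..
  interpret Q: sigma_finite_measure "P \<Otimes>\<^sub>M ?\<mu>"
    by (rule sigma_finite_pair_measure[OF P.sigma_finite_measure_axioms sigma_finite_freq_measure])
  interpret T: pair_sigma_finite ?\<nu> "P \<Otimes>\<^sub>M ?\<mu>" ..
  let ?Q = "P \<Otimes>\<^sub>M ?\<mu>"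
  have node_m [measurable]: "(\<lambda>y. node y m) \<in> P \<rightarrow>\<^sub>M (borel :: (real ^ 'd) measure)" unfolding P_def by measurable
  let ?G = "\<lambda>t. fourier c f t ^ m * fourier c h t"
  \<comment> \<open>After substituting u for the sum of the last node and the last frequency,
    \<open>J n y\<close> is the average of the test function near the closing frequency -
    \<open>node y m\<close>, weighted by the kernel. It tends to \<kappa> times the value there and
    is bounded uniformly in n and y.\<close>
  define J where "J n y = (LINT u|?\<mu>. W n u * h (- node y m + u))" for n and y :: "nat \<Rightarrow> real ^ 'd"
  have prod_int: "integrable ?Q (\<lambda>p. ch (fst p) * h (snd p))"
    by (rule Pm.integrable_pair_mult[OF ch_int h_int])
  have key: "(LINT t|?\<nu>. of_real (w n t) * ?G t) = of_real (LINT y|P. ch y * J n y)" for n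
  proof -
    define H where "H t p = cis (t \<bullet> (node (fst p) m + snd p)) * of_real (ch (fst p) * h (snd p)) * of_real (w n t)" for t p
    have [measurable]: "(\<lambda>(t, p). H t p) \<in> borel_measurable (?\<nu> \<Otimes>\<^sub>M ?Q)"
      unfolding H_def split_beta by measurable
    have H_int: "integrable (?\<nu> \<Otimes>\<^sub>M ?Q) (\<lambda>(t, p). H t p)"
      by (rule Bochner_Integration.integrable_bound[OF T.integrable_pair_mult[OF w(3)[of n] prod_int]])
         (auto simp: H_def norm_mult abs_mult mult_ac)
    have 1: "of_real (w n t) * ?G t = (LINT p|?Q. H t p)" if t: "t \<in> index_set c" for t
    proof -
      have i1: "integrable P (\<lambda>y. cis (t \<bullet> node y m) * of_real (ch y))"
        by (intro integrable_cis ch_int) measurable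
      have i2: "integrable ?\<mu> (\<lambda>x. cis (t \<bullet> x) * of_real (h x))"
        by (intro integrable_cis h_int) measurable
      have "?G t = (LINT y|P. cis (t \<bullet> node y m) * of_real (ch y)) * (LINT x|?\<mu>. cis (t \<bullet> x) * of_real (h x))"
        unfolding fourier_power[OF f_meas f t] ch_def P_def by (simp add: fourier_def)
      also have "\<dots> = (LINT y|P. (LINT x|?\<mu>. (cis (t \<bullet> node y m) * of_real (ch y)) * (cis (t \<bullet> x) * of_real (h x))))"
        by (simp only: integral_mult_right_zero integral_mult_left_zero)
      also have "\<dots> = (LINT p|?Q. (cis (t \<bullet> node (fst p) m) * of_real (ch (fst p))) * (cis (t \<bullet> snd p) * of_real (h (snd p))))"
        using Pm.integral_fst'[OF Pm.integrable_pair_mult[OF i1 i2]] by simp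
      finally have eq: "?G t = (LINT p|?Q. (cis (t \<bullet> node (fst p) m) * of_real (ch (fst p))) * (cis (t \<bullet> snd p) * of_real (h (snd p))))" .
      have "?G t * of_real (w n t) = (LINT p|?Q. (cis (t \<bullet> node (fst p) m) * of_real (ch (fst p))) * (cis (t \<bullet> snd p) * of_real (h (snd p)))) * of_real (w n t)" unfolding eq ..
      also have "\<dots> = (LINT p|?Q. (cis (t \<bullet> node (fst p) m) * of_real (ch (fst p))) * (cis (t \<bullet> snd p) * of_real (h (snd p))) * of_real (w n t))"
        by (rule integral_mult_left_zero[symmetric])
      also have "\<dots> = (LINT p|?Q. H t p)"
      proof (intro Bochner_Integration.integral_cong refl)
        fix p :: "(nat \<Rightarrow> real ^ 'd) \<times> (real ^ 'd)"
        have "cis (t \<bullet> (node (fst p) m + snd p)) = cis (t \<bullet> node (fst p) m) * cis (t \<bullet> snd p)"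
          by (simp add: cis_mult inner_add_right)
        then show "(cis (t \<bullet> node (fst p) m) * of_real (ch (fst p))) * (cis (t \<bullet> snd p) * of_real (h (snd p))) * of_real (w n t) = H t p"
          by (simp add: H_def mult_ac del: cis_mult)
      qed
      finally show ?thesis by (simp add: mult.commute)
    qed
    have 2: "(LINT t|?\<nu>. H t p) = of_real (ch (fst p) * h (snd p) * W n (node (fst p) m + snd p))" for p
    proof -
      have "(LINT t|?\<nu>. H t p) = (LINT t|?\<nu>. of_real (ch (fst p) * h (snd p)) * (cis (t \<bullet> (node (fst p) m + snd p)) * of_real (w n t)))"
        by (intro Bochner_Integration.integral_cong refl) (simp add: H_def mult_ac)
      also have "\<dots> = of_real (ch (fst p) * h (snd p)) * of_real (W n (node (fst p) m + snd p))"
        by (simp only: integral_mult_right_zero W(4))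
      finally show ?thesis by simp
    qed
    have "integrable ?Q (\<lambda>p. (LINT t|?\<nu>. H t p))" using T.integrable_snd[OF H_int] .
    then have int2: "integrable ?Q (\<lambda>p. ch (fst p) * h (snd p) * W n (node (fst p) m + snd p))"
      by (simp only: 2 complex_of_real_integrable_eq)
    have "(LINT t|?\<nu>. of_real (w n t) * ?G t) = (LINT t|?\<nu>. (LINT p|?Q. H t p))"
    proof (rule integral_cong_AE)
      show "AE t in ?\<nu>. of_real (w n t) * ?G t = (LINT p|?Q. H t p)"
        using AE_time_measure[of c] by eventually_elim (rule 1)
      show "(\<lambda>t. LINT p|?Q. H t p) \<in> borel_measurable ?\<nu>"
        using T.integrable_fst[OF H_int] by simp
    qed measurable
    also have "\<dots> = (LINT p|?Q. (LINT t|?\<nu>. H t p))"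
      by (rule T.Fubini_integral[symmetric, OF H_int])
    also have "\<dots> = of_real (LINT p|?Q. ch (fst p) * h (snd p) * W n (node (fst p) m + snd p))"
      by (simp only: 2 integral_complex_of_real)
    also have "(LINT p|?Q. ch (fst p) * h (snd p) * W n (node (fst p) m + snd p)) = (LINT y|P. (LINT z|?\<mu>. ch y * h z * W n (node y m + z)))"
      using Pm.integral_fst'[OF int2] by simp
    also have "\<dots> = (LINT y|P. ch y * J n y)"
    proof (intro Bochner_Integration.integral_cong refl)
      fix y :: "nat \<Rightarrow> real ^ 'd"
      have m: "(\<lambda>u. h (- node y m + u) * W n u) \<in> borel_measurable borel" by measurable
      have "(LINT z|?\<mu>. ch y * h z * W n (node y m + z)) = (LINT z|?\<mu>. ch y * (h (- node y m + wrap c (node y m + z)) * W n (wrap c (node y m + z))))"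
      proof (intro Bochner_Integration.integral_cong refl)
        fix z
        have "h (- node y m + wrap c (node y m + z)) = h z"
          using arg_cong[OF wrap_wrap_add[of c "- node y m" "node y m + z"], of g] by (simp add: h_def)
        then show "ch y * h z * W n (node y m + z) = ch y * (h (- node y m + wrap c (node y m + z)) * W n (wrap c (node y m + z)))"
          by (simp add: W_wrap)
      qed
      also have "\<dots> = ch y * (LINT z|?\<mu>. h (- node y m + wrap c (node y m + z)) * W n (wrap c (node y m + z)))"
        by (rule integral_mult_right_zero)
      also have "(LINT z|?\<mu>. h (- node y m + wrap c (node y m + z)) * W n (wrap c (node y m + z))) = (LINT u|?\<mu>. h (- node y m + u) * W n u)"
        by (rule integral_freq_shift(1)[OF m])
      finally show "(LINT z|?\<mu>. ch y * h z * W n (node y m + z)) = ch y * J n y"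
        by (simp only: J_def mult.commute)
    qed
    finally show ?thesis .
  qed
  have J_lim: "(\<lambda>n. J n y) \<longlonglongrightarrow> ?\<kappa> * h (- node y m)" for y
    using K g(1,2) unfolding J_def h_def summability_kernel_def by blast
  have J_bound: "\<bar>J n y\<bar> \<le> ?\<kappa> * B" for n y
  proof -
    have "\<bar>J n y\<bar> \<le> (LINT u|?\<mu>. \<bar>W n u * h (- node y m + u)\<bar>)"
      unfolding J_def by (rule integral_abs_bound)
    also have "\<dots> \<le> (LINT u|?\<mu>. W n u * B)"
    proof (rule integral_mono)
      have "integrable ?\<mu> (\<lambda>u. W n u * h (- node y m + u))"
        by (rule Bochner_Integration.integrable_bound[OF integrable_mult_left[OF W(2)[of n], of B]])
           (use B B0 W in \<open>auto simp: abs_mult intro!: mult_left_mono\<close>)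
      then show "integrable ?\<mu> (\<lambda>u. \<bar>W n u * h (- node y m + u)\<bar>)" by (rule integrable_abs)
      show "\<bar>W n u * h (- node y m + u)\<bar> \<le> W n u * B" for u
        using B W by (auto simp: abs_mult intro!: mult_left_mono)
    qed (use W in auto)
    also have "\<dots> = ?\<kappa> * B" by (simp only: integral_mult_left_zero W)
    finally show ?thesis .
  qed
  have J_meas [measurable]: "J n \<in> borel_measurable P" for n
    unfolding J_def by (rule freq.borel_measurable_lebesgue_integral) measurable
  have lim1: "(\<lambda>n. LINT y|P. ch y * J n y) \<longlonglongrightarrow> (LINT y|P. ch y * (?\<kappa> * h (- node y m)))"
  proof (rule integral_dominated_convergence[where w="\<lambda>y. \<bar>ch y\<bar> * (?\<kappa> * B)"])
    show "integrable P (\<lambda>y. \<bar>ch y\<bar> * (?\<kappa> * B))" using ch_int by (intro integrable_mult_left integrable_abs)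
    show "AE y in P. (\<lambda>n. ch y * J n y) \<longlonglongrightarrow> ch y * (?\<kappa> * h (- node y m))"
      by (intro AE_I2 tendsto_mult tendsto_const J_lim)
    show "AE y in P. norm (ch y * J n y) \<le> \<bar>ch y\<bar> * (?\<kappa> * B)" for n
      using J_bound by (auto simp: abs_mult intro!: mult_left_mono)
  qed measurable
  have lim2: "(\<lambda>n. LINT t|?\<nu>. of_real (w n t) * ?G t) \<longlonglongrightarrow> (LINT t|?\<nu>. ?G t)"
  proof (rule integral_dominated_convergence[where w="\<lambda>t. cmod (?G t)"])
    show "integrable ?\<nu> (\<lambda>t. cmod (?G t))" using int by (simp add: h_def[abs_def])
    show "AE t in ?\<nu>. (\<lambda>n. of_real (w n t) * ?G t) \<longlonglongrightarrow> ?G t"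
      using AE_time_measure[of c]
    proof eventually_elim
      case (elim t)
      have "(\<lambda>n. complex_of_real (w n t) * ?G t) \<longlonglongrightarrow> of_real 1 * ?G t"
        using K elim by (intro tendsto_intros) (auto simp: summability_kernel_def)
      then show ?case by simp
    qed
    show "AE t in ?\<nu>. norm (of_real (w n t) * ?G t) \<le> cmod (?G t)" for n
    proof (rule AE_I2)
      fix t
      have "w n t * cmod (?G t) \<le> 1 * cmod (?G t)" by (intro mult_right_mono w) simp
      then show "norm (of_real (w n t) * ?G t) \<le> cmod (?G t)"
        using w(1)[of n t] by (simp add: norm_mult)
    qed
  qed measurable
  have "(\<lambda>n. LINT t|?\<nu>. of_real (w n t) * ?G t) \<longlonglongrightarrow> of_real (LINT y|P. ch y * (?\<kappa> * h (- node y m)))"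
    unfolding key by (rule tendsto_of_real[OF lim1])
  with lim2 have "(LINT t|?\<nu>. ?G t) = of_real (LINT y|P. ch y * (?\<kappa> * h (- node y m)))"
    by (rule LIMSEQ_unique)
  also have "(LINT y|P. ch y * (?\<kappa> * h (- node y m))) = ?\<kappa> * (LINT y|P. ch y * h (- node y m))"
    by (subst integral_mult_right_zero[symmetric]) (simp only: mult_ac)
  finally show ?thesis by (simp add: h_def[abs_def] ch_def P_def)
qed

text \<open>A weighted Young inequality with crude constants, from comparing x with d a. The small
  weight falls on the fixed power of \<open>a\<close>, and the approximation error x pays with
  d^(-m).\<close>

lemma young_pair: "a ^ m * x \<le> d * a ^ Suc m + x ^ Suc m / d ^ m" if "0 \<le> a" "0 \<le> x" "0 < d" for a x d :: real
proof (cases "x \<le> d * a")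
  case True
  then have "a ^ m * x \<le> a ^ m * (d * a)" using that by (intro mult_left_mono) auto
  also have "\<dots> = d * a ^ Suc m" by simp
  finally show ?thesis using that by (smt (verit) divide_nonneg_pos zero_le_power zero_less_power)
next
  case False
  then have "a \<le> x / d" using that by (simp add: field_simps)
  then have "a ^ m * x \<le> (x / d) ^ m * x" using that by (intro mult_right_mono power_mono) auto
  also have "\<dots> = x ^ Suc m / d ^ m" by (simp add: power_divide)
  finally show ?thesis using that by (smt (verit) mult_nonneg_nonneg zero_le_power)
qed

text \<open>Both sides of the inversion formula are continuous in the last factor for the
  \<open>L\<^sub>q\<close> norm, so it is enough to know it when that factor is a test function.\<close>

theorem fourier_inversion_power:
  fixes f :: "real ^ 'd::finite \<Rightarrow> real"
  assumes f_meas [measurable]: "f \<in> borel_measurable borel" and f: "integrable (freq_measure c) f" and m: "1 \<le> m"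
    and A: "(\<integral>\<^sup>+ x. ennreal (\<bar>f x\<bar> powr (real (Suc m) / real m)) \<partial>freq_measure c) \<le> ennreal A" "0 < A"
    and approx: "\<And>e. 0 < e \<Longrightarrow> \<exists>g. continuous_on UNIV (\<lambda>x. g (wrap c x)) \<and> bounded (range (\<lambda>x. g (wrap c x))) \<and>
      integrable (freq_measure c) (\<lambda>x. g (wrap c x)) \<and>
      (\<integral>\<^sup>+ x. ennreal (\<bar>f x - g (wrap c x)\<bar> powr (real (Suc m) / real m)) \<partial>freq_measure c) \<le> ennreal e"
  shows "integrable (freq_power c m) (\<lambda>y. (\<Prod>i\<in>{1..m}. f (edge c y i)) * f (wrap c (- node y m)))"
    and "integrable (time_measure c) (\<lambda>t. cmod (fourier c f t) ^ Suc m)"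
    and "(LINT t|time_measure c. fourier c f t ^ Suc m) =
      of_real (dual_factor c CARD('d) * (LINT y|freq_power c m. (\<Prod>i\<in>{1..m}. f (edge c y i)) * f (wrap c (- node y m))))"
proof -
  let ?\<mu> = "freq_measure c :: (real ^ 'd) measure" and ?\<nu> = "time_measure c :: (real ^ 'd) measure"
  define P where "P = (freq_power c m :: (nat \<Rightarrow> real ^ 'd) measure)"
  let ?\<kappa> = "dual_factor c CARD('d)"
  let ?q = "real (Suc m) / real m"
  have q: "1 < ?q" "?q \<le> 2" using m by (auto simp: field_simps)
  have kap: "0 \<le> ?\<kappa>" by (cases c) auto
  let ?F = "fourier c f"
  have m2: "2 \<le> Suc m" using m by simp
  have q_eq: "real (Suc m) / (real (Suc m) - 1) = ?q" by simp
  obtain C where C: "0 \<le> C"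
    "\<And>h :: real ^ 'd \<Rightarrow> real. \<And>N. h \<in> borel_measurable borel \<Longrightarrow> integrable ?\<mu> h \<Longrightarrow> 0 < N \<Longrightarrow>
      (\<integral>\<^sup>+ x. ennreal (\<bar>h x\<bar> powr ?q) \<partial>?\<mu>) \<le> ennreal N \<Longrightarrow>
      (\<integral>\<^sup>+ t. ennreal (cmod (fourier c h t) ^ Suc m) \<partial>?\<nu>) \<le> ennreal (C * N ^ m)"
    by (rule hausdorff_young[OF m2, of c, unfolded q_eq diff_Suc_1]) (rule that)
  define ch where "ch y = (\<Prod>i\<in>{1..m}. f (edge c y i))" for y
  have ch_meas [measurable]: "ch \<in> borel_measurable P"
    using integrable_chain[OF f_meas f, of m] by (simp add: P_def ch_def[abs_def])
  have node_m [measurable]: "(\<lambda>y. node y m) \<in> P \<rightarrow>\<^sub>M (borel :: (real ^ 'd) measure)" unfolding P_def by measurable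
  have chain_bound: "(\<integral>\<^sup>+ y. ennreal (norm (ch y * h (wrap c (- node y m)))) \<partial>P) \<le> ennreal (real m * A ^ (m - 1) * B + A ^ m)"
    if [measurable]: "h \<in> borel_measurable borel" and "(\<integral>\<^sup>+ x. ennreal (\<bar>h x\<bar> powr ?q) \<partial>?\<mu>) \<le> ennreal B" "0 \<le> B" for h B
    using young_chain[OF f_meas that(1) m A(1) _ that(2,3), of 0, folded P_def] A(2) by (simp add: ch_def abs_mult abs_prod)
  have chain_int: "integrable P (\<lambda>y. ch y * h (wrap c (- node y m)))"
    if [measurable]: "h \<in> borel_measurable borel" and "(\<integral>\<^sup>+ x. ennreal (\<bar>h x\<bar> powr ?q) \<partial>?\<mu>) \<le> ennreal B" "0 \<le> B" for h B
    by (rule integrableI_bounded) (use chain_bound[OF that] in \<open>auto intro: order_le_less_trans\<close>)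
  have HY_int: "integrable ?\<nu> (\<lambda>t. cmod (fourier c h t) ^ Suc m)" and HY: "(LINT t|?\<nu>. cmod (fourier c h t) ^ Suc m) \<le> C * N ^ m"
    if [measurable]: "h \<in> borel_measurable borel" and "integrable ?\<mu> h" "0 < N" "(\<integral>\<^sup>+ x. ennreal (\<bar>h x\<bar> powr ?q) \<partial>?\<mu>) \<le> ennreal N" for h N
  proof -
    note * = C(2)[OF that]
    show i: "integrable ?\<nu> (\<lambda>t. cmod (fourier c h t) ^ Suc m)"
      by (rule integrableI_bounded) (use * in \<open>auto intro: order_le_less_trans\<close>)
    have "ennreal (LINT t|?\<nu>. cmod (fourier c h t) ^ Suc m) \<le> ennreal (C * N ^ m)"
      using * by (subst nn_integral_eq_integral[symmetric, OF i]) auto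
    then show "(LINT t|?\<nu>. cmod (fourier c h t) ^ Suc m) \<le> C * N ^ m"
      using C(1) that(3) by (subst (asm) ennreal_le_iff) auto
  qed
  show Fint: "integrable ?\<nu> (\<lambda>t. cmod (?F t) ^ Suc m)" by (rule HY_int[OF f_meas f A(2,1)])
  have fchain: "integrable P (\<lambda>y. ch y * f (wrap c (- node y m)))"
    by (rule chain_int[OF f_meas A(1)]) (use A in simp)
  then show "integrable (freq_power c m) (\<lambda>y. (\<Prod>i\<in>{1..m}. f (edge c y i)) * f (wrap c (- node y m)))"
    by (simp only: P_def ch_def)
  define R where "R = ?\<kappa> * (LINT y|P. ch y * f (wrap c (- node y m)))"
  define K where "K = C * A ^ m + C + ?\<kappa> * (real m * A ^ (m - 1) + A ^ m)"
  have bound: "cmod ((LINT t|?\<nu>. ?F t ^ Suc m) - of_real R) \<le> K * d" if d: "0 < d" "d \<le> 1" for d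
  proof -
    \<comment> \<open>The square serves both error terms. In the time integral it gives e^m / d^m =
      d^m, which is at most d; in the chain integral it gives e = d^2, at most d^q, because q \<le>
      2 and d \<le> 1.\<close>
    define e where "e = d\<^sup>2"
    have e: "0 < e" using d by (simp add: e_def)
    obtain g where g: "continuous_on UNIV (\<lambda>x. g (wrap c x))" "bounded (range (\<lambda>x. g (wrap c x)))"
      "integrable ?\<mu> (\<lambda>x. g (wrap c x))" "(\<integral>\<^sup>+ x. ennreal (\<bar>f x - g (wrap c x)\<bar> powr ?q) \<partial>?\<mu>) \<le> ennreal e"
      using approx[OF e] by blast
    define h where "h x = g (wrap c x)" for x
    have [measurable]: "h \<in> borel_measurable borel"
      using g(1) unfolding h_def[abs_def] by (rule borel_measurable_continuous_onI)
    have h: "integrable ?\<mu> h" "(\<integral>\<^sup>+ x. ennreal (\<bar>f x - h x\<bar> powr ?q) \<partial>?\<mu>) \<le> ennreal e"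
      using g(3,4) by (auto simp: h_def[abs_def])
    let ?H = "fourier c h"
    have diff: "fourier c (\<lambda>x. f x - h x) t = ?F t - ?H t" for t
      by (rule fourier_diff[OF f h(1)])
    have fh: "integrable ?\<mu> (\<lambda>x. f x - h x)" using f h by simp
    have Dint: "integrable ?\<nu> (\<lambda>t. cmod (?F t - ?H t) ^ Suc m)" and D: "(LINT t|?\<nu>. cmod (?F t - ?H t) ^ Suc m) \<le> C * e ^ m"
      using HY_int[OF _ fh e h(2)] HY[OF _ fh e h(2)] by (simp_all add: diff)
    have FD: "cmod (?F t ^ m * (?F t - ?H t)) \<le> d * cmod (?F t) ^ Suc m + cmod (?F t - ?H t) ^ Suc m / d ^ m" for t
      unfolding norm_mult norm_power by (rule young_pair) (use d in auto)
    have FDint: "integrable ?\<nu> (\<lambda>t. ?F t ^ m * (?F t - ?H t))"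
      by (rule Bochner_Integration.integrable_bound[of _ "\<lambda>t. d * cmod (?F t) ^ Suc m + cmod (?F t - ?H t) ^ Suc m / d ^ m"])
         (use FD Fint Dint d in \<open>auto intro!: order_trans[OF FD] simp del: power_Suc\<close>)
    have FSint: "integrable ?\<nu> (\<lambda>t. ?F t ^ Suc m)"
      by (rule Bochner_Integration.integrable_bound[OF Fint]) (auto simp: norm_power norm_mult)
    have FHint: "integrable ?\<nu> (\<lambda>t. ?F t ^ m * ?H t)"
      using Bochner_Integration.integrable_diff[OF FSint FDint] by (simp add: algebra_simps)
    have eq: "(LINT t|?\<nu>. ?F t ^ m * ?H t) = of_real (?\<kappa> * (LINT y|P. ch y * h (wrap c (- node y m))))"
    proof -
      have "(LINT t|?\<nu>. ?F t ^ m * fourier c (\<lambda>x. g (wrap c x)) t) = of_real (?\<kappa> * (LINT y|P. ch y * g (wrap c (- node y m))))"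
        unfolding P_def ch_def by (rule fourier_inversion_test[OF f_meas f g(1,2,3)]) (use FHint in \<open>auto simp: h_def[abs_def] intro: integrable_norm\<close>)
      then show ?thesis by (simp add: h_def[abs_def])
    qed
    have part1: "cmod ((LINT t|?\<nu>. ?F t ^ Suc m) - (LINT t|?\<nu>. ?F t ^ m * ?H t)) \<le> (C * A ^ m + C) * d"
    proof -
      have "(LINT t|?\<nu>. ?F t ^ Suc m) - (LINT t|?\<nu>. ?F t ^ m * ?H t) = (LINT t|?\<nu>. ?F t ^ m * (?F t - ?H t))"
        using FSint FHint by (subst Bochner_Integration.integral_diff[symmetric]) (auto simp: algebra_simps)
      also have "cmod \<dots> \<le> (LINT t|?\<nu>. cmod (?F t ^ m * (?F t - ?H t)))" by (rule integral_norm_bound)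
      also have "\<dots> \<le> (LINT t|?\<nu>. d * cmod (?F t) ^ Suc m + cmod (?F t - ?H t) ^ Suc m / d ^ m)"
        using FDint Fint Dint by (intro integral_mono FD) (auto simp del: power_Suc)
      also have "\<dots> = d * (LINT t|?\<nu>. cmod (?F t) ^ Suc m) + (LINT t|?\<nu>. cmod (?F t - ?H t) ^ Suc m) / d ^ m"
        using Fint Dint by (simp del: power_Suc)
      also have "\<dots> \<le> d * (C * A ^ m) + (C * e ^ m) / d ^ m"
        using d HY[OF f_meas f A(2,1)] D by (intro add_mono mult_left_mono divide_right_mono) auto
      also have "(C * e ^ m) / d ^ m = C * d ^ m"
        using d by (simp add: e_def power2_eq_square power_mult_distrib)
      also have "d * (C * A ^ m) + C * d ^ m \<le> d * (C * A ^ m) + C * d"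
        using d m C(1) power_decreasing[of 1 m d] by (intro add_mono mult_left_mono) auto
      finally show ?thesis by (simp add: algebra_simps)
    qed
    have part2: "\<bar>(LINT y|P. ch y * h (wrap c (- node y m))) - (LINT y|P. ch y * f (wrap c (- node y m)))\<bar>
       \<le> d * (real m * A ^ (m - 1) + A ^ m)"
    proof -
      \<comment> \<open>The chain bound has a term that does not shrink with its last factor.
        Dividing the difference by d normalizes its q-th moment to at most 1, so the bound becomes a
        constant, and linearity returns the factor d.\<close>
      define k where "k x = (f x - h x) / d" for x
      have [measurable]: "k \<in> borel_measurable borel" unfolding k_def by measurable
      have "(\<integral>\<^sup>+ x. ennreal (\<bar>k x\<bar> powr ?q) \<partial>?\<mu>) = (\<integral>\<^sup>+ x. ennreal (1 / d powr ?q) * ennreal (\<bar>f x - h x\<bar> powr ?q) \<partial>?\<mu>)"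
        using d by (intro nn_integral_cong) (simp add: k_def powr_divide abs_div_pos[symmetric] flip: ennreal_mult)
      also have "\<dots> = ennreal (1 / d powr ?q) * (\<integral>\<^sup>+ x. ennreal (\<bar>f x - h x\<bar> powr ?q) \<partial>?\<mu>)"
        by (rule nn_integral_cmult) measurable
      also have "\<dots> \<le> ennreal (1 / d powr ?q) * ennreal e" by (intro mult_left_mono h) simp
      also have "\<dots> = ennreal (e / d powr ?q)" using d e by (simp flip: ennreal_mult)
      also have "\<dots> \<le> ennreal 1"
      proof (rule ennreal_leI)
        have "e = d powr 2" using d by (simp add: e_def powr_numeral)
        also have "\<dots> \<le> d powr ?q" using d q by (intro powr_mono') auto
        finally show "e / d powr ?q \<le> 1" using d by (simp add: divide_le_eq)
      qed
      finally have k: "(\<integral>\<^sup>+ x. ennreal (\<bar>k x\<bar> powr ?q) \<partial>?\<mu>) \<le> ennreal 1" .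
      have kint: "integrable P (\<lambda>y. ch y * k (wrap c (- node y m)))"
        by (rule chain_int[OF _ k]) auto
      have hk: "h x = f x - d * k x" for x using d by (simp add: k_def)
      have "(LINT y|P. ch y * h (wrap c (- node y m))) =
        (LINT y|P. ch y * f (wrap c (- node y m)) - d * (ch y * k (wrap c (- node y m))))"
        unfolding hk by (intro Bochner_Integration.integral_cong refl) (simp add: algebra_simps)
      also have "\<dots> = (LINT y|P. ch y * f (wrap c (- node y m))) - d * (LINT y|P. ch y * k (wrap c (- node y m)))"
        using fchain kint by (subst Bochner_Integration.integral_diff) auto
      finally have "\<bar>(LINT y|P. ch y * h (wrap c (- node y m))) - (LINT y|P. ch y * f (wrap c (- node y m)))\<bar>
         = d * \<bar>LINT y|P. ch y * k (wrap c (- node y m))\<bar>"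
        using d by (simp add: abs_mult)
      also have "\<bar>LINT y|P. ch y * k (wrap c (- node y m))\<bar> \<le> (LINT y|P. norm (ch y * k (wrap c (- node y m))))"
        using integral_abs_bound by simp
      also have "\<dots> \<le> real m * A ^ (m - 1) * 1 + A ^ m"
      proof -
        have "ennreal (LINT y|P. norm (ch y * k (wrap c (- node y m)))) \<le> ennreal (real m * A ^ (m - 1) * 1 + A ^ m)"
          using chain_bound[OF _ k] kint by (subst nn_integral_eq_integral[symmetric]) auto
        then show ?thesis using A(2) by (subst (asm) ennreal_le_iff) auto
      qed
      finally show ?thesis using d by simp
    qed
    have "cmod ((LINT t|?\<nu>. ?F t ^ Suc m) - of_real R) \<le> cmod ((LINT t|?\<nu>. ?F t ^ Suc m) - (LINT t|?\<nu>. ?F t ^ m * ?H t)) + cmod ((LINT t|?\<nu>. ?F t ^ m * ?H t) - of_real R)"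
      by (rule norm_triangle_ineq[THEN order_trans[rotated], of _ _ "_ - _"]) simp
    also have "cmod ((LINT t|?\<nu>. ?F t ^ m * ?H t) - of_real R) = ?\<kappa> * \<bar>(LINT y|P. ch y * h (wrap c (- node y m))) - (LINT y|P. ch y * f (wrap c (- node y m)))\<bar>"
      unfolding eq R_def of_real_diff[symmetric] norm_of_real using kap
      by (simp only: right_diff_distrib[symmetric] abs_mult abs_of_nonneg)
    also have "\<dots> \<le> ?\<kappa> * (d * (real m * A ^ (m - 1) + A ^ m))" by (intro mult_left_mono part2 kap)
    finally show ?thesis using part1 unfolding K_def by (simp add: algebra_simps)
  qed
  have "(LINT t|?\<nu>. ?F t ^ Suc m) - of_real R = 0"
  proof (rule ccontr)
    assume ne: "(LINT t|?\<nu>. ?F t ^ Suc m) - of_real R \<noteq> 0"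
    let ?x = "cmod ((LINT t|?\<nu>. ?F t ^ Suc m) - of_real R)"
    have x: "0 < ?x" using ne by simp
    define d where "d = min 1 (?x / (2 * (\<bar>K\<bar> + 1)))"
    have d: "0 < d" "d \<le> 1" using x by (auto simp: d_def)
    have "?x \<le> K * d" by (rule bound[OF d])
    also have "\<dots> \<le> \<bar>K\<bar> * d" using d by (intro mult_right_mono) auto
    also have "\<dots> \<le> \<bar>K\<bar> * (?x / (2 * (\<bar>K\<bar> + 1)))" by (intro mult_left_mono) (auto simp: d_def)
    also have "\<dots> = ?x * (\<bar>K\<bar> / (2 * (\<bar>K\<bar> + 1)))" by simp
    also have "\<dots> \<le> ?x * (1 / 2)" using x by (intro mult_left_mono) (auto simp: field_simps)
    finally show False using x by simp
  qed
  then show "(LINT t|?\<nu>. ?F t ^ Suc m) = of_real (?\<kappa> * (LINT y|freq_power c m. (\<Prod>i\<in>{1..m}. f (edge c y i)) * f (wrap c (- node y m))))"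
    by (simp add: R_def P_def ch_def)
qed

section \<open>Approximation by test functions in the conjugate exponent\<close>

lemma wrap_in_freq_set: "wrap c x \<in> freq_set c"
proof (cases c)
  case Discrete
  then show ?thesis using wrap_Discrete_half_cube[of x] by (auto simp: half_cube_def freq_set_def less_imp_le)
qed (simp add: freq_set_def)

lemma powr_add_le:
  fixes a b q :: real
  assumes "0 \<le> q"
  shows "\<bar>a + b\<bar> powr q \<le> 2 powr q * (\<bar>a\<bar> powr q + \<bar>b\<bar> powr q)"
proof -
  have "\<bar>a + b\<bar> \<le> 2 * max \<bar>a\<bar> \<bar>b\<bar>" by linarith
  then have "\<bar>a + b\<bar> powr q \<le> (2 * max \<bar>a\<bar> \<bar>b\<bar>) powr q" using assms by (intro powr_mono2) auto
  also have "\<dots> = 2 powr q * (max \<bar>a\<bar> \<bar>b\<bar>) powr q" by (simp add: powr_mult)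
  also have "\<dots> \<le> 2 powr q * (\<bar>a\<bar> powr q + \<bar>b\<bar> powr q)" by (intro mult_left_mono) (auto simp: max_def)
  finally show ?thesis .
qed

text \<open>On a set of finite measure the q-th moment splits at height s: below it is at most s^q,
  above it at most s^(q-r) \<bar>h\<bar>^r for the real exponent r of the norm. The heights s and d
  are chosen so that s^q V and s^(q-r) d^r both equal e / 2; adding 1 to the measure keeps V
  positive. For an infinite exponent the bound by s alone suffices.\<close>

lemma Lp_norm_small:
  fixes q e :: real
  assumes [measurable]: "S \<in> sets M" and S: "emeasure M S < \<infinity>" and e: "0 < e" and q: "1 \<le> q" "p = \<infinity> \<or> q \<le> enn2real p"
  shows "\<exists>d>0. \<forall>h\<in>borel_measurable M. Lp_norm p M h < d \<longrightarrow>
    (\<integral>\<^sup>+ x. ennreal (\<bar>h x\<bar> powr q) * indicator S x \<partial>M) \<le> ennreal e"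
proof -
  define V where "V = measure M S + 1"
  have V: "0 < V" "emeasure M S \<le> ennreal V"
  proof -
    show "0 < V" unfolding V_def by (smt (verit) measure_nonneg)
    have "emeasure M S = ennreal (measure M S)" using S by (intro emeasure_eq_ennreal_measure) auto
    then show "emeasure M S \<le> ennreal V" unfolding V_def by (simp add: ennreal_leI)
  qed
  define s where "s = (e / (2 * V)) powr (1 / q)"
  have s: "0 < s" using e V by (simp add: s_def)
  have sq: "s powr q * V = e / 2" using e V q by (simp add: s_def powr_powr)
  show ?thesis
  proof (cases "p = \<infinity>")
    case True
    show ?thesis
    proof (intro exI conjI ballI impI)
      show "0 < ennreal s" using s by simp
      fix h assume [measurable]: "h \<in> borel_measurable M" and "Lp_norm p M h < ennreal s"
      then have "esssup M (\<lambda>x. ennreal \<bar>h x\<bar>) < ennreal s" using True by (simp add: Lp_norm_def)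
      then have "AE x in M. ennreal \<bar>h x\<bar> \<le> ennreal s"
        using esssup_AE[of "\<lambda>x. ennreal \<bar>h x\<bar>" M] by (auto elim!: eventually_mono)
      then have "AE x in M. \<bar>h x\<bar> \<le> s" using s by simp
      then have "(\<integral>\<^sup>+ x. ennreal (\<bar>h x\<bar> powr q) * indicator S x \<partial>M) \<le> (\<integral>\<^sup>+ x. ennreal (s powr q) * indicator S x \<partial>M)"
        using q by (intro nn_integral_mono_AE) (auto elim!: eventually_mono intro!: mult_right_mono ennreal_leI powr_mono2)
      also have "\<dots> = ennreal (s powr q) * emeasure M S" by (simp add: nn_integral_cmult)
      also have "\<dots> \<le> ennreal (s powr q) * ennreal V" by (intro mult_left_mono V) simp
      also have "\<dots> \<le> ennreal e" using sq V e by (simp flip: ennreal_mult)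
      finally show "(\<integral>\<^sup>+ x. ennreal (\<bar>h x\<bar> powr q) * indicator S x \<partial>M) \<le> ennreal e" .
    qed
  next
    case False
    define r where "r = enn2real p"
    have r: "q \<le> r" "1 \<le> r" using False q by (auto simp: r_def)
    define d where "d = (e / 2 * s powr (r - q)) powr (1 / r)"
    have d: "0 < d" using e s by (simp add: d_def)
    have dr: "s powr (q - r) * d powr r = e / 2"
    proof -
      have 1: "d powr r = e / 2 * s powr (r - q)" using e s r by (simp add: d_def powr_powr)
      have 2: "s powr (q - r) * s powr (r - q) = 1" using s by (simp flip: powr_add)
      have "s powr (q - r) * d powr r = (s powr (q - r) * s powr (r - q)) * (e / 2)" by (simp only: 1 mult_ac)
      then show ?thesis by (simp only: 2 mult_1)
    qed
    show ?thesis
    proof (intro exI conjI ballI impI)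
      show "0 < ennreal d" using d by simp
      fix h assume [measurable]: "h \<in> borel_measurable M" and h: "Lp_norm p M h < ennreal d"
      define N where "N = (\<integral>\<^sup>+ x. ennreal (\<bar>h x\<bar> powr r) \<partial>M)"
      have Nfin: "N \<noteq> \<infinity>" and "ennreal (enn2real N powr (1 / r)) < ennreal d"
        using h False by (auto simp: Lp_norm_def N_def r_def Let_def split: if_splits)
      then have "enn2real N powr (1 / r) < d" using d by (simp add: ennreal_less_iff)
      then have "(enn2real N powr (1 / r)) powr r \<le> d powr r" using r by (intro powr_mono2) auto
      then have "enn2real N \<le> d powr r" using r by (simp add: powr_powr)
      then have N: "N \<le> ennreal (d powr r)" using Nfin by (metis ennreal_enn2real_if ennreal_leI infinity_ennreal_def)
      have pt: "\<bar>h x\<bar> powr q \<le> s powr q + s powr (q - r) * \<bar>h x\<bar> powr r" for x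
      proof (cases "\<bar>h x\<bar> \<le> s")
        case True
        then have "\<bar>h x\<bar> powr q \<le> s powr q" using q by (intro powr_mono2) auto
        then show ?thesis by (smt (verit) mult_nonneg_nonneg powr_ge_zero)
      next
        case False
        then have "\<bar>h x\<bar> powr (q - r) \<le> s powr (q - r)" using s r by (intro powr_mono2') auto
        then have "\<bar>h x\<bar> powr (q - r) * \<bar>h x\<bar> powr r \<le> s powr (q - r) * \<bar>h x\<bar> powr r" by (intro mult_right_mono) auto
        then have "\<bar>h x\<bar> powr q \<le> s powr (q - r) * \<bar>h x\<bar> powr r" by (simp flip: powr_add)
        then show ?thesis by (smt (verit) powr_ge_zero)
      qed
      have "(\<integral>\<^sup>+ x. ennreal (\<bar>h x\<bar> powr q) * indicator S x \<partial>M) \<le> (\<integral>\<^sup>+ x. ennreal (s powr q) * indicator S x + ennreal (s powr (q - r)) * ennreal (\<bar>h x\<bar> powr r) \<partial>M)"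
      proof (rule nn_integral_mono)
        fix x
        have "ennreal (\<bar>h x\<bar> powr q) \<le> ennreal (s powr q) + ennreal (s powr (q - r)) * ennreal (\<bar>h x\<bar> powr r)"
          using pt[of x] by (simp add: ennreal_leI flip: ennreal_mult ennreal_plus)
        then show "ennreal (\<bar>h x\<bar> powr q) * indicator S x \<le> ennreal (s powr q) * indicator S x + ennreal (s powr (q - r)) * ennreal (\<bar>h x\<bar> powr r)"
          by (auto simp: indicator_def)
      qed
      also have "\<dots> = ennreal (s powr q) * emeasure M S + ennreal (s powr (q - r)) * N"
        unfolding N_def by (subst nn_integral_add) (auto simp: nn_integral_cmult)
      also have "\<dots> \<le> ennreal (s powr q) * ennreal V + ennreal (s powr (q - r)) * ennreal (d powr r)"
        by (intro add_mono mult_left_mono V N) auto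
      also have "\<dots> = ennreal (e / 2) + ennreal (e / 2)"
        using V by (simp add: sq dr flip: ennreal_mult)
      also have "\<dots> = ennreal e" using e by (simp flip: ennreal_plus)
      finally show "(\<integral>\<^sup>+ x. ennreal (\<bar>h x\<bar> powr q) * indicator S x \<partial>M) \<le> ennreal e" .
    qed
  qed
qed

lemma nn_integral_powr_add_le:
  fixes u v :: "'a \<Rightarrow> real"
  assumes [measurable]: "u \<in> borel_measurable M" "v \<in> borel_measurable M" and "0 \<le> q"
    and "(\<integral>\<^sup>+ x. ennreal (\<bar>u x\<bar> powr q) \<partial>M) \<le> A" "(\<integral>\<^sup>+ x. ennreal (\<bar>v x\<bar> powr q) \<partial>M) \<le> B"
  shows "(\<integral>\<^sup>+ x. ennreal (\<bar>u x + v x\<bar> powr q) \<partial>M) \<le> ennreal (2 powr q) * (A + B)"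
proof -
  have "(\<integral>\<^sup>+ x. ennreal (\<bar>u x + v x\<bar> powr q) \<partial>M) \<le> (\<integral>\<^sup>+ x. ennreal (2 powr q) * (ennreal (\<bar>u x\<bar> powr q) + ennreal (\<bar>v x\<bar> powr q)) \<partial>M)"
    using powr_add_le[OF assms(3)] by (intro nn_integral_mono) (simp add: ennreal_leI flip: ennreal_mult ennreal_plus)
  also have "\<dots> \<le> ennreal (2 powr q) * (A + B)"
    using assms by (subst nn_integral_cmult) (auto simp: nn_integral_add intro!: mult_left_mono add_mono)
  finally show ?thesis .
qed

text \<open>Closeness in L_p controls the q-th moment only on sets of finite measure, because q
  \<le> p. Integrability of \<open>f\<close> supplies the rest: small values satisfy \<bar>f\<bar>^q
  \<le> \<bar>f\<bar>, and large values occur on a set of finite measure.\<close>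

lemma Lp_closure_approx:
  fixes f :: "real ^ 'd::finite \<Rightarrow> real"
  assumes f: "f \<in> Lp_closure c p" "integrable (freq_measure c) f" and q: "1 \<le> q" "p = \<infinity> \<or> q \<le> enn2real p"
  shows "(\<integral>\<^sup>+ x. ennreal (\<bar>f x\<bar> powr q) \<partial>freq_measure c) < \<infinity>"
    and "0 < e \<Longrightarrow> \<exists>g. continuous_on UNIV (\<lambda>x. g (wrap c x)) \<and> bounded (range (\<lambda>x. g (wrap c x))) \<and>
      integrable (freq_measure c) (\<lambda>x. g (wrap c x)) \<and>
      (\<integral>\<^sup>+ x. ennreal (\<bar>f x - g (wrap c x)\<bar> powr q) \<partial>freq_measure c) \<le> ennreal e"
proof -
  let ?\<mu> = "freq_measure c :: (real ^ 'd) measure"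
  have f_meas [measurable]: "f \<in> borel_measurable borel" using f(2) by simp
  have local_approx: "\<exists>g\<in>test_functions c. (\<integral>\<^sup>+ x. ennreal (\<bar>f x - g (wrap c x)\<bar> powr q) * indicator S x \<partial>?\<mu>) \<le> ennreal e"
    if [measurable]: "S \<in> sets borel" and S: "emeasure ?\<mu> S < \<infinity>" and e: "0 < e" for S and e :: real
  proof -
    obtain d where d: "0 < d" "\<And>h. h \<in> borel_measurable ?\<mu> \<Longrightarrow> Lp_norm p ?\<mu> h < d \<Longrightarrow>
      (\<integral>\<^sup>+ x. ennreal (\<bar>h x\<bar> powr q) * indicator S x \<partial>?\<mu>) \<le> ennreal e"
      using Lp_norm_small[OF _ S e q] by auto
    obtain g where g: "g \<in> test_functions c" "Lp_norm p ?\<mu> (\<lambda>x. f x - g (wrap c x)) < d"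
      using f(1) d(1) by (auto simp: Lp_closure_def)
    have "(\<lambda>x. g (wrap c x)) \<in> borel_measurable borel"
      using g(1) by (intro borel_measurable_continuous_onI) (simp add: test_functions_def)
    then show ?thesis using g by (intro bexI[of _ g] d(2)) auto
  qed
  have test: "continuous_on UNIV (\<lambda>x. g (wrap c x))" "(\<lambda>x. g (wrap c x)) \<in> borel_measurable borel" "\<exists>G\<ge>0. \<forall>x. \<bar>g (wrap c x)\<bar> \<le> G"
    if "g \<in> test_functions c" for g :: "real ^ 'd \<Rightarrow> real"
  proof -
    show cont: "continuous_on UNIV (\<lambda>x. g (wrap c x))" using that by (simp add: test_functions_def)
    then show "(\<lambda>x. g (wrap c x)) \<in> borel_measurable borel" by (rule borel_measurable_continuous_onI)
    have "bounded (g ` freq_set c)" using that by (simp add: test_functions_def)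
    then obtain G where "\<And>x. x \<in> freq_set c \<Longrightarrow> \<bar>g x\<bar> \<le> G" by (auto simp: bounded_iff)
    then have "\<forall>x. \<bar>g (wrap c x)\<bar> \<le> \<bar>G\<bar>" using wrap_in_freq_set[of c] by (meson abs_ge_self order_trans)
    then show "\<exists>G\<ge>0. \<forall>x. \<bar>g (wrap c x)\<bar> \<le> G" by (meson abs_ge_zero)
  qed
  show fin: "(\<integral>\<^sup>+ x. ennreal (\<bar>f x\<bar> powr q) \<partial>?\<mu>) < \<infinity>"
  proof -
    \<comment> \<open>Markov's inequality makes this set of finite measure. On it \<open>f\<close>
      is a bounded function plus an error with small q-th moment; off it \<bar>f\<bar>^q \<le>
      \<bar>f\<bar>.\<close>
    define S where "S = {x. 1 \<le> \<bar>f x\<bar>}"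
    have [measurable]: "S \<in> sets borel" unfolding S_def by measurable
    have fi: "(\<integral>\<^sup>+ x. ennreal \<bar>f x\<bar> \<partial>?\<mu>) < \<infinity>" using f(2) by (simp add: integrable_iff_bounded)
    have "emeasure ?\<mu> S = (\<integral>\<^sup>+ x. indicator S x \<partial>?\<mu>)" by simp
    also have "\<dots> \<le> (\<integral>\<^sup>+ x. ennreal \<bar>f x\<bar> \<partial>?\<mu>)"
      by (intro nn_integral_mono) (auto simp: indicator_def S_def)
    finally have S: "emeasure ?\<mu> S < \<infinity>" using fi by (rule order_le_less_trans)
    obtain g where g: "g \<in> test_functions c" "(\<integral>\<^sup>+ x. ennreal (\<bar>f x - g (wrap c x)\<bar> powr q) * indicator S x \<partial>?\<mu>) \<le> ennreal 1"
      using local_approx[OF _ S, of 1] by auto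
    obtain G where G: "0 \<le> G" "\<And>x. \<bar>g (wrap c x)\<bar> \<le> G" using test(3)[OF g(1)] by auto
    note test(2)[OF g(1), measurable]
    have "(\<integral>\<^sup>+ x. ennreal (\<bar>f x\<bar> powr q) \<partial>?\<mu>) \<le> (\<integral>\<^sup>+ x. ennreal \<bar>f x\<bar> + (ennreal (2 powr q) * (ennreal (\<bar>f x - g (wrap c x)\<bar> powr q) * indicator S x) + ennreal (2 powr q * G powr q) * indicator S x) \<partial>?\<mu>)"
    proof (rule nn_integral_mono)
      fix x
      show "ennreal (\<bar>f x\<bar> powr q) \<le> ennreal \<bar>f x\<bar> + (ennreal (2 powr q) * (ennreal (\<bar>f x - g (wrap c x)\<bar> powr q) * indicator S x) + ennreal (2 powr q * G powr q) * indicator S x)"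
      proof (cases "x \<in> S")
        case True
        have "\<bar>f x\<bar> powr q \<le> 2 powr q * (\<bar>f x - g (wrap c x)\<bar> powr q + \<bar>g (wrap c x)\<bar> powr q)"
          using powr_add_le[of q "f x - g (wrap c x)" "g (wrap c x)"] q by simp
        also have "\<dots> \<le> 2 powr q * (\<bar>f x - g (wrap c x)\<bar> powr q + G powr q)"
          using G q by (intro mult_left_mono add_mono powr_mono2) auto
        finally have "ennreal (\<bar>f x\<bar> powr q) \<le> ennreal (2 powr q) * ennreal (\<bar>f x - g (wrap c x)\<bar> powr q) + ennreal (2 powr q * G powr q)"
          by (simp add: algebra_simps ennreal_leI flip: ennreal_mult ennreal_plus)
        then show ?thesis using True by (auto intro: add_increasing)
      next
        case False
        then have "\<bar>f x\<bar> \<le> 1" by (simp add: S_def)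
        then have "\<bar>f x\<bar> powr q \<le> \<bar>f x\<bar> powr 1" using q by (intro powr_mono') auto
        then show ?thesis using False by (simp add: ennreal_leI)
      qed
    qed
    also have "\<dots> = (\<integral>\<^sup>+ x. ennreal \<bar>f x\<bar> \<partial>?\<mu>) + (ennreal (2 powr q) * (\<integral>\<^sup>+ x. ennreal (\<bar>f x - g (wrap c x)\<bar> powr q) * indicator S x \<partial>?\<mu>) + ennreal (2 powr q * G powr q) * emeasure ?\<mu> S)"
      by (simp add: nn_integral_add nn_integral_cmult)
    also have "\<dots> < \<infinity>"
      using fi S g(2) by (auto simp: ennreal_mult_less_top less_top[symmetric] ennreal_add_eq_top ennreal_mult_eq_top_iff top_unique)
    finally show ?thesis .
  qed
  assume e: "0 < e"
  show "\<exists>g. continuous_on UNIV (\<lambda>x. g (wrap c x)) \<and> bounded (range (\<lambda>x. g (wrap c x))) \<and>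
      integrable ?\<mu> (\<lambda>x. g (wrap c x)) \<and> (\<integral>\<^sup>+ x. ennreal (\<bar>f x - g (wrap c x)\<bar> powr q) \<partial>?\<mu>) \<le> ennreal e"
  proof (cases c)
    case Discrete
    interpret prob_space ?\<mu> unfolding Discrete by (rule prob_space_freq_Discrete)
    obtain g where g: "g \<in> test_functions c" "(\<integral>\<^sup>+ x. ennreal (\<bar>f x - g (wrap c x)\<bar> powr q) * indicator UNIV x \<partial>?\<mu>) \<le> ennreal e"
      using local_approx[OF _ _ e, of UNIV] emeasure_space_1 by auto
    obtain G where G: "\<And>x. \<bar>g (wrap c x)\<bar> \<le> G" using test(3)[OF g(1)] by auto
    show ?thesis
    proof (intro exI conjI)
      show "continuous_on UNIV (\<lambda>x. g (wrap c x))" by (rule test(1)[OF g(1)])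
      show "bounded (range (\<lambda>x. g (wrap c x)))" using G by (auto simp: bounded_iff)
      show "integrable ?\<mu> (\<lambda>x. g (wrap c x))"
        using G test(2)[OF g(1)] by (intro integrable_const_bound[where B=G]) auto
      show "(\<integral>\<^sup>+ x. ennreal (\<bar>f x - g (wrap c x)\<bar> powr q) \<partial>?\<mu>) \<le> ennreal e" using g(2) by simp
    qed
  next
    case Continuous
    have w: "wrap c x = x" for x :: "real ^ 'd" by (simp add: Continuous wrap_def)
    have mu: "?\<mu> = lborel" by (simp add: Continuous freq_measure_def)
    define k where "k = 2 powr q"
    have k: "0 < k" by (simp add: k_def)
    \<comment> \<open>The error is a sum of two pieces, one on the ball and one in the tail, each
      with q-th moment at most \<open>e1\<close>; the quasi-triangle inequality costs the factor k =
      2^q.\<close>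
    define e1 where "e1 = e / (2 * k)"
    have e1: "0 < e1" using e k by (simp add: e1_def)
    have "(\<lambda>n. \<integral>\<^sup>+ x. ennreal (\<bar>f x\<bar> powr q) * indicator {x. real n < norm x} x \<partial>?\<mu>) \<longlonglongrightarrow> (\<integral>\<^sup>+ x. 0 \<partial>?\<mu>)"
    proof (rule nn_integral_dominated_convergence[where w="\<lambda>x. ennreal (\<bar>f x\<bar> powr q)"])
      show "AE x in ?\<mu>. (\<lambda>n. ennreal (\<bar>f x\<bar> powr q) * indicator {x. real n < norm x} x) \<longlonglongrightarrow> 0"
      proof (rule AE_I2)
        fix x
        have "eventually (\<lambda>n. ennreal (\<bar>f x\<bar> powr q) * indicator {x. real n < norm x} x = 0) sequentially"
          using eventually_ge_at_top[of "nat \<lceil>norm x\<rceil>"] by eventually_elim (auto simp: indicator_def)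
        then show "(\<lambda>n. ennreal (\<bar>f x\<bar> powr q) * indicator {x. real n < norm x} x) \<longlonglongrightarrow> 0"
          by (rule tendsto_eventually)
      qed
    qed (use fin in \<open>auto simp: indicator_def\<close>)
    then have "(\<lambda>n. \<integral>\<^sup>+ x. ennreal (\<bar>f x\<bar> powr q) * indicator {x. real n < norm x} x \<partial>?\<mu>) \<longlonglongrightarrow> 0" by simp
    then have "eventually (\<lambda>n. (\<integral>\<^sup>+ x. ennreal (\<bar>f x\<bar> powr q) * indicator {x. real n < norm x} x \<partial>?\<mu>) < ennreal e1) sequentially"
      by (rule order_tendstoD) (use e1 in simp)
    then obtain R :: nat where R: "(\<integral>\<^sup>+ x. ennreal (\<bar>f x\<bar> powr q) * indicator {x. real R < norm x} x \<partial>?\<mu>) < ennreal e1"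
      by (auto simp: eventually_sequentially)
    define S where "S = (cball 0 (real R + 1) :: (real ^ 'd) set)"
    have [measurable]: "S \<in> sets borel" by (simp add: S_def)
    have Sfin: "emeasure ?\<mu> S < \<infinity>" unfolding S_def mu using emeasure_lborel_cball_finite by (auto simp: less_top)
    obtain g where g: "g \<in> test_functions c" "(\<integral>\<^sup>+ x. ennreal (\<bar>f x - g (wrap c x)\<bar> powr q) * indicator S x \<partial>?\<mu>) \<le> ennreal e1"
      using local_approx[OF _ Sfin e1] by auto
    obtain G where G: "0 \<le> G" "\<And>x. \<bar>g x\<bar> \<le> G" using test(3)[OF g(1)] by (auto simp: w)
    have g_cont: "continuous_on UNIV g" and [measurable]: "g \<in> borel_measurable borel"
      using test(1,2)[OF g(1)] by (simp_all add: w)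
    \<comment> \<open>An approximant that is good in L_p may still be far from \<open>f\<close> in
      L_q near infinity. The continuous cutoff, equal to 1 up to radius R and 0 beyond R + 1,
      replaces it there by 0, and the loss is the tail of \<open>f\<close> itself, which R was
      chosen to make small.\<close>
    define cut where "cut x = max 0 (min 1 (real R + 1 - norm x))" for x :: "real ^ 'd"
    have chi: "0 \<le> cut x" "cut x \<le> 1" "norm x \<le> real R \<Longrightarrow> cut x = 1" "x \<notin> S \<Longrightarrow> cut x = 0" for x
      by (auto simp: cut_def S_def)
    have chi_cont: "continuous_on UNIV cut" unfolding cut_def[abs_def] by (intro continuous_intros)
    have [measurable]: "cut \<in> borel_measurable borel" by (rule borel_measurable_continuous_onI[OF chi_cont])
    define g' where "g' x = g x * cut x" for x
    have gB: "\<bar>g' x\<bar> \<le> G * indicator S x" for x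
      using G chi(1,2)[of x] chi(4)[of x] mult_mono[of "\<bar>g x\<bar>" G "cut x" 1] by (auto simp: g'_def abs_mult indicator_def)
    show ?thesis
    proof (intro exI conjI)
      show "continuous_on UNIV (\<lambda>x. g' (wrap c x))" unfolding w g'_def by (intro continuous_intros g_cont chi_cont)
      have "\<bar>g' x\<bar> \<le> G" for x using gB[of x] G(1) by (cases "x \<in> S") auto
      then show "bounded (range (\<lambda>x. g' (wrap c x)))" by (auto simp: bounded_iff)
      have "integrable ?\<mu> (\<lambda>x. G * indicator S x)" using Sfin by (intro integrable_mult_right) auto
      then show "integrable ?\<mu> (\<lambda>x. g' (wrap c x))"
      proof (rule Bochner_Integration.integrable_bound)
        show "AE x in ?\<mu>. norm (g' (wrap c x)) \<le> norm (G * indicator S x)"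
          by (rule AE_I2) (use gB abs_ge_self in \<open>auto simp: w intro: order_trans\<close>)
      qed (simp add: w g'_def[abs_def])
      have split: "f x - g' (wrap c x) = (f x - g x) * cut x + f x * (1 - cut x)" for x by (simp add: w g'_def algebra_simps)
      have "(\<integral>\<^sup>+ x. ennreal (\<bar>f x - g' (wrap c x)\<bar> powr q) \<partial>?\<mu>) \<le> ennreal (2 powr q) * (ennreal e1 + ennreal e1)"
        unfolding split
      proof (rule nn_integral_powr_add_le)
        have "(\<integral>\<^sup>+ x. ennreal (\<bar>(f x - g x) * cut x\<bar> powr q) \<partial>?\<mu>) \<le> (\<integral>\<^sup>+ x. ennreal (\<bar>f x - g (wrap c x)\<bar> powr q) * indicator S x \<partial>?\<mu>)"
        proof (rule nn_integral_mono)
          fix x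
          show "ennreal (\<bar>(f x - g x) * cut x\<bar> powr q) \<le> ennreal (\<bar>f x - g (wrap c x)\<bar> powr q) * indicator S x"
          proof (cases "x \<in> S")
            case True
            have "\<bar>(f x - g x) * cut x\<bar> \<le> \<bar>f x - g x\<bar>"
              using chi(1,2)[of x] mult_left_le[of "cut x" "\<bar>f x - g x\<bar>"] by (simp add: abs_mult)
            then show ?thesis using True q by (auto simp: w intro!: ennreal_leI powr_mono2)
          qed (simp add: chi)
        qed
        then show "(\<integral>\<^sup>+ x. ennreal (\<bar>(f x - g x) * cut x\<bar> powr q) \<partial>?\<mu>) \<le> ennreal e1" using g(2) by (rule order_trans)
        have "(\<integral>\<^sup>+ x. ennreal (\<bar>f x * (1 - cut x)\<bar> powr q) \<partial>?\<mu>) \<le> (\<integral>\<^sup>+ x. ennreal (\<bar>f x\<bar> powr q) * indicator {x. real R < norm x} x \<partial>?\<mu>)"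
        proof (rule nn_integral_mono)
          fix x
          show "ennreal (\<bar>f x * (1 - cut x)\<bar> powr q) \<le> ennreal (\<bar>f x\<bar> powr q) * indicator {x. real R < norm x} x"
          proof (cases "real R < norm x")
            case True
            have "\<bar>f x * (1 - cut x)\<bar> \<le> \<bar>f x\<bar>"
              using chi(1,2)[of x] mult_left_le[of "1 - cut x" "\<bar>f x\<bar>"] by (simp add: abs_mult)
            then show ?thesis using True q by (auto intro!: ennreal_leI powr_mono2)
          qed (simp add: chi)
        qed
        then show "(\<integral>\<^sup>+ x. ennreal (\<bar>f x * (1 - cut x)\<bar> powr q) \<partial>?\<mu>) \<le> ennreal e1" using R by simp
      qed (use q in auto)
      also have "\<dots> = ennreal e" using k e1 e by (simp add: k_def[symmetric] e1_def flip: ennreal_mult ennreal_plus)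
      finally show "(\<integral>\<^sup>+ x. ennreal (\<bar>f x - g' (wrap c x)\<bar> powr q) \<partial>?\<mu>) \<le> ennreal e" .
    qed
  qed
qed

lemma conv_integrand_chain:
  assumes "1 \<le> m"
  shows "conv_integrand c (Suc m) f y = (\<Prod>i\<in>{1..m}. f (edge c y i)) * f (wrap c (- node y m))"
proof -
  have "{1..m} = insert 1 {2..m}" using assms by auto
  then have "(\<Prod>i\<in>{1..m}. f (edge c y i)) = f (wrap c (y 1)) * (\<Prod>i\<in>{2..m}. f (edge c y i))"
    by (simp add: edge_def node_def)
  also have "(\<Prod>i\<in>{2..m}. f (edge c y i)) = (\<Prod>i\<in>{2..m}. f (wrap c (y i - y (i - 1))))"
    by (intro prod.cong) (auto simp: edge_def node_def)
  finally show ?thesis using assms by (simp add: conv_integrand_def node_def)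
qed

text \<open>The condition on \<open>inverse p\<close> says that p is at least q = l / (l - 1). Hence
  \<open>f\<close> has a finite q-th moment and is approximable in it, and inversion applies with m
  = l - 1 edges in the chain and one more edge that closes the cycle.\<close>

theorem conv_at_0_fourier:
  fixes f :: "real ^ 'd::finite \<Rightarrow> real"
  assumes f: "integrable (freq_measure c) f" "f \<in> Lp_closure c p" and "1 \<le> p" and l: "2 \<le> l"
    and p: "inverse p \<le> ennreal (1 - 1 / real l)"
  shows "integrable (conv_measure c l) (conv_integrand c l f)"
    and "integrable (time_measure c) (\<lambda>t. cmod (fourier c f t) ^ l)"
    and "(LINT t|time_measure c. fourier c f t ^ l) = of_real (dual_factor c CARD('d) * conv_at_0 c l f)"
proof -
  define m where "m = l - 1"
  have m: "1 \<le> m" "l = Suc m" using l by (auto simp: m_def)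
  let ?q = "real (Suc m) / real m"
  have q: "1 \<le> ?q" using m by (auto simp: field_simps)
  have pq: "p = \<infinity> \<or> ?q \<le> enn2real p"
  proof (cases "p = \<infinity>")
    case False
    then obtain r where r: "p = ennreal r" "0 \<le> r" by (cases p) auto
    then have "1 \<le> r" using \<open>1 \<le> p\<close> by simp
    then have "ennreal (1 / r) \<le> ennreal (1 - 1 / real l)"
      using p r by (simp add: inverse_ennreal inverse_eq_divide)
    moreover have "0 \<le> 1 - 1 / real l" using l by simp
    ultimately have "1 / r \<le> 1 - 1 / real l" by simp
    then have "?q \<le> r" using \<open>1 \<le> r\<close> m by (simp add: field_simps)
    then show ?thesis using r by simp
  qed simp
  have fin: "(\<integral>\<^sup>+ x. ennreal (\<bar>f x\<bar> powr ?q) \<partial>freq_measure c) < \<infinity>" by (rule Lp_closure_approx(1)[OF f(2,1) q pq])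
  define A where "A = enn2real (\<integral>\<^sup>+ x. ennreal (\<bar>f x\<bar> powr ?q) \<partial>freq_measure c) + 1"
  have A: "0 < A" "(\<integral>\<^sup>+ x. ennreal (\<bar>f x\<bar> powr ?q) \<partial>freq_measure c) \<le> ennreal A"
  proof -
    show "0 < A" unfolding A_def by (smt (verit) enn2real_nonneg)
    have "(\<integral>\<^sup>+ x. ennreal (\<bar>f x\<bar> powr ?q) \<partial>freq_measure c) = ennreal (enn2real (\<integral>\<^sup>+ x. ennreal (\<bar>f x\<bar> powr ?q) \<partial>freq_measure c))"
      using fin by simp
    also have "\<dots> \<le> ennreal A" unfolding A_def by (intro ennreal_leI) simp
    finally show "(\<integral>\<^sup>+ x. ennreal (\<bar>f x\<bar> powr ?q) \<partial>freq_measure c) \<le> ennreal A" .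
  qed
  have f_meas: "f \<in> borel_measurable borel" using f(1) by simp
  note * = fourier_inversion_power[OF f_meas f(1) m(1) A(2,1) Lp_closure_approx(2)[OF f(2,1) q pq]]
  have eq: "conv_integrand c l f = (\<lambda>y. (\<Prod>i\<in>{1..m}. f (edge c y i)) * f (wrap c (- node y m)))"
    unfolding m(2) using conv_integrand_chain[OF m(1)] by blast
  have eq2: "conv_measure c l = freq_power c m" by (simp add: conv_measure_def m)
  show "integrable (conv_measure c l) (conv_integrand c l f)"
    unfolding eq eq2 by (rule *(1))
  show "integrable (time_measure c) (\<lambda>t. cmod (fourier c f t) ^ l)" unfolding m(2) by (rule *(2))
  show "(LINT t|time_measure c. fourier c f t ^ l) = of_real (dual_factor c CARD('d) * conv_at_0 c l f)"
    unfolding conv_at_0_def eq eq2 unfolding m(2) by (rule *(3))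
qed

text \<open>The increment of the transform is bounded by the integral of \<bar>f\<bar> against the
  modulus of cis ((t - s) . x) - 1, which depends on t - s alone. A sequence violating uniformity
  has t - s tending to 0, contradicting dominated convergence. Replacing points of a time domain by
  nearby ones relies on this.\<close>

lemma fourier_uniformly_continuous:
  fixes f :: "real ^ 'd::finite \<Rightarrow> real"
  assumes f: "integrable (freq_measure c) f" and e: "0 < e"
  shows "\<exists>d>0. \<forall>s t. norm (t - s) \<le> d \<longrightarrow> cmod (fourier c f t - fourier c f s) < e"
proof (rule ccontr)
  let ?\<mu> = "freq_measure c :: (real ^ 'd) measure"
  assume "\<not> ?thesis"
  then have "\<forall>n. \<exists>s t. norm (t - s) \<le> inverse (real (Suc n)) \<and> e \<le> cmod (fourier c f t - fourier c f s)"
    by (metis inverse_positive_iff_positive not_le of_nat_0_less_iff zero_less_Suc)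
  then obtain s t where st: "\<And>n. norm (t n - s n) \<le> inverse (real (Suc n))" "\<And>n. e \<le> cmod (fourier c f (t n) - fourier c f (s n))"
    by metis
  have [measurable]: "f \<in> borel_measurable borel" using f by simp
  have u: "(\<lambda>n. t n - s n) \<longlonglongrightarrow> 0"
    by (rule Lim_null_comparison[OF _ LIMSEQ_inverse_real_of_nat]) (use st in simp)
  have "(\<lambda>n. LINT x|?\<mu>. cmod (cis ((t n - s n) \<bullet> x) - 1) * \<bar>f x\<bar>) \<longlonglongrightarrow> (LINT x|?\<mu>. 0)"
  proof (rule integral_dominated_convergence[where w="\<lambda>x. 2 * \<bar>f x\<bar>"])
    show "AE x in ?\<mu>. (\<lambda>n. cmod (cis ((t n - s n) \<bullet> x) - 1) * \<bar>f x\<bar>) \<longlonglongrightarrow> 0"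
    proof (rule AE_I2)
      fix x :: "real ^ 'd"
      have "(\<lambda>n. cmod (cis ((t n - s n) \<bullet> x) - 1) * \<bar>f x\<bar>) \<longlonglongrightarrow> cmod (cis (0 \<bullet> x) - 1) * \<bar>f x\<bar>"
        unfolding cis_conv_exp by (intro tendsto_intros u)
      then show "(\<lambda>n. cmod (cis ((t n - s n) \<bullet> x) - 1) * \<bar>f x\<bar>) \<longlonglongrightarrow> 0" by simp
    qed
    show "AE x in ?\<mu>. norm (cmod (cis ((t n - s n) \<bullet> x) - 1) * \<bar>f x\<bar>) \<le> 2 * \<bar>f x\<bar>" for n
    proof (rule AE_I2)
      fix x
      have "cmod (cis ((t n - s n) \<bullet> x) - 1) \<le> cmod (cis ((t n - s n) \<bullet> x)) + cmod 1" by (rule norm_triangle_ineq4)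
      then show "norm (cmod (cis ((t n - s n) \<bullet> x) - 1) * \<bar>f x\<bar>) \<le> 2 * \<bar>f x\<bar>"
        by (simp add: mult_right_mono)
    qed
  qed (use f in auto)
  then have lim: "(\<lambda>n. LINT x|?\<mu>. cmod (cis ((t n - s n) \<bullet> x) - 1) * \<bar>f x\<bar>) \<longlonglongrightarrow> 0" by simp
  have le: "cmod (fourier c f (t n) - fourier c f (s n)) \<le> (LINT x|?\<mu>. cmod (cis ((t n - s n) \<bullet> x) - 1) * \<bar>f x\<bar>)" for n
  proof -
    have "fourier c f (t n) - fourier c f (s n) = (LINT x|?\<mu>. cis (t n \<bullet> x) * of_real (f x) - cis (s n \<bullet> x) * of_real (f x))"
      unfolding fourier_def using f by (subst Bochner_Integration.integral_diff) auto
    also have "\<dots> = (LINT x|?\<mu>. cis (s n \<bullet> x) * (cis ((t n - s n) \<bullet> x) - 1) * of_real (f x))"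
      by (intro Bochner_Integration.integral_cong refl) (simp add: algebra_simps cis_mult)
    also have "cmod \<dots> \<le> (LINT x|?\<mu>. cmod (cis (s n \<bullet> x) * (cis ((t n - s n) \<bullet> x) - 1) * of_real (f x)))"
      by (rule integral_norm_bound)
    also have "\<dots> = (LINT x|?\<mu>. cmod (cis ((t n - s n) \<bullet> x) - 1) * \<bar>f x\<bar>)"
      by (simp add: norm_mult)
    finally show ?thesis .
  qed
  have "e \<le> 0" by (rule LIMSEQ_le_const[OF lim]) (use st(2) le in \<open>auto intro: order_trans\<close>)
  then show False using e by simp
qed

section \<open>Gaussian integration by parts\<close>

lemma sets_normal_law [simp, measurable_cong]: "sets (normal_law m v) = sets borel"
  by (simp add: normal_law_def)

lemma prob_space_normal_law: "0 \<le> v \<Longrightarrow> prob_space (normal_law m v)"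
  unfolding normal_law_def by (auto intro!: prob_space_return prob_space_normal_density)

lemma real_distribution_normal_law: "0 \<le> v \<Longrightarrow> real_distribution (normal_law m v)"
  unfolding real_distribution_def real_distribution_axioms_def
  by (simp add: prob_space_normal_law)

lemma char_normal_law:
  assumes "0 \<le> v"
  shows "char (normal_law 0 v) t = of_real (exp (- v * t\<^sup>2 / 2))"
proof (cases "v = 0")
  case True
  then show ?thesis by (simp add: normal_law_def char_def integral_return)
next
  case False
  then have v: "0 < v" using assms by simp
  let ?s = "sqrt v"
  have s: "0 < ?s" using v by simp
  have d: "?s * normal_density 0 ?s (?s * y) = std_normal_density y" for y
    using v by (simp add: normal_density_def real_sqrt_mult power_mult_distrib field_simps)
  have "char (normal_law 0 v) t = (LINT x|lborel. normal_density 0 ?s x *\<^sub>R iexp (t * x))"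
    using False by (simp add: char_def normal_law_def integral_density)
  also have "\<dots> = ?s *\<^sub>R (LINT y|lborel. normal_density 0 ?s (?s * y) *\<^sub>R iexp (t * (?s * y)))"
    using lborel_integral_real_affine[of ?s "\<lambda>x. normal_density 0 ?s x *\<^sub>R iexp (t * x)" 0] s by simp
  also have "\<dots> = (LINT y|lborel. ?s *\<^sub>R (normal_density 0 ?s (?s * y) *\<^sub>R iexp (t * (?s * y))))"
    by (rule integral_scaleR_right[symmetric])
  also have "\<dots> = (LINT y|lborel. std_normal_density y *\<^sub>R iexp ((t * ?s) * y))"
    by (intro Bochner_Integration.integral_cong refl) (simp add: mult_ac flip: d)
  also have "\<dots> = char std_normal_distribution (t * ?s)"
    by (simp add: char_def integral_density)
  finally show ?thesis using v by (simp add: char_std_normal_distribution power_mult_distrib mult_ac)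
qed

lemma integrable_normal_law_moment:
  assumes "0 \<le> v"
  shows "integrable (normal_law 0 v) (\<lambda>x. \<bar>x\<bar> ^ k)"
proof (cases "v = 0")
  case True
  interpret prob_space "return borel (0::real)" by (rule prob_space_return) simp
  have "integrable (return borel 0) (\<lambda>x. \<bar>x::real\<bar> ^ k)"
    by (rule integrable_const_bound[where B="0 ^ k"]) (auto simp: AE_return)
  then show ?thesis using True by (simp add: normal_law_def)
next
  case False
  then show ?thesis
    using integrable_normal_moment_abs[of "sqrt v" 0 k] assms
    by (simp add: normal_law_def integrable_density)
qed

text \<open>A class closed under sums and products, hence under polynomials. It turns the
  integrability of every Hermite expression below into a matter of its shape.\<close>

definition all_moments :: "'w measure \<Rightarrow> ('w \<Rightarrow> real) \<Rightarrow> bool" where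
  "all_moments M Z \<longleftrightarrow> Z \<in> borel_measurable M \<and> (\<forall>n. integrable M (\<lambda>\<omega>. \<bar>Z \<omega>\<bar> ^ n))"

lemma all_moments_measurable [measurable_dest]: "all_moments M Z \<Longrightarrow> Z \<in> borel_measurable M"
  by (simp add: all_moments_def)

lemma all_moments_integrable: "all_moments M Z \<Longrightarrow> integrable M Z"
proof -
  assume Z: "all_moments M Z"
  then have "integrable M (\<lambda>\<omega>. \<bar>Z \<omega>\<bar> ^ 1)" unfolding all_moments_def by blast
  then show "integrable M Z" using integrable_abs_iff[OF all_moments_measurable[OF Z]] by simp
qed

lemma (in prob_space) all_moments_const: "all_moments M (\<lambda>\<omega>. k)"
  by (simp add: all_moments_def)

lemma all_moments_add:
  assumes "all_moments M Y" "all_moments M Z"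
  shows "all_moments M (\<lambda>\<omega>. Y \<omega> + Z \<omega>)"
  unfolding all_moments_def
proof (intro conjI allI)
  note [measurable] = assms[THEN all_moments_measurable]
  show "(\<lambda>\<omega>. Y \<omega> + Z \<omega>) \<in> borel_measurable M" by measurable
  fix n
  have "integrable M (\<lambda>\<omega>. 2 ^ n * (\<bar>Y \<omega>\<bar> ^ n + \<bar>Z \<omega>\<bar> ^ n))"
    using assms by (intro integrable_mult_right Bochner_Integration.integrable_add) (auto simp: all_moments_def)
  then show "integrable M (\<lambda>\<omega>. \<bar>Y \<omega> + Z \<omega>\<bar> ^ n)"
  proof (rule Bochner_Integration.integrable_bound)
    show "AE \<omega> in M. norm (\<bar>Y \<omega> + Z \<omega>\<bar> ^ n) \<le> norm (2 ^ n * (\<bar>Y \<omega>\<bar> ^ n + \<bar>Z \<omega>\<bar> ^ n))"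
    proof (rule AE_I2)
      fix \<omega>
      have "\<bar>Y \<omega> + Z \<omega>\<bar> ^ n \<le> (2 * max \<bar>Y \<omega>\<bar> \<bar>Z \<omega>\<bar>) ^ n" by (intro power_mono) auto
      also have "\<dots> \<le> 2 ^ n * (\<bar>Y \<omega>\<bar> ^ n + \<bar>Z \<omega>\<bar> ^ n)"
        by (auto simp: power_mult_distrib max_def)
      finally show "norm (\<bar>Y \<omega> + Z \<omega>\<bar> ^ n) \<le> norm (2 ^ n * (\<bar>Y \<omega>\<bar> ^ n + \<bar>Z \<omega>\<bar> ^ n))" by simp
    qed
  qed measurable
qed

lemma all_moments_mult:
  assumes "all_moments M Y" "all_moments M Z"
  shows "all_moments M (\<lambda>\<omega>. Y \<omega> * Z \<omega>)"
  unfolding all_moments_def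
proof (intro conjI allI)
  note [measurable] = assms[THEN all_moments_measurable]
  show "(\<lambda>\<omega>. Y \<omega> * Z \<omega>) \<in> borel_measurable M" by measurable
  fix n
  have "integrable M (\<lambda>\<omega>. \<bar>Y \<omega>\<bar> ^ (2 * n) + \<bar>Z \<omega>\<bar> ^ (2 * n))"
    using assms by (intro Bochner_Integration.integrable_add) (auto simp: all_moments_def)
  then show "integrable M (\<lambda>\<omega>. \<bar>Y \<omega> * Z \<omega>\<bar> ^ n)"
  proof (rule Bochner_Integration.integrable_bound)
    show "AE \<omega> in M. norm (\<bar>Y \<omega> * Z \<omega>\<bar> ^ n) \<le> norm (\<bar>Y \<omega>\<bar> ^ (2 * n) + \<bar>Z \<omega>\<bar> ^ (2 * n))"
    proof (rule AE_I2)
      fix \<omega>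
      have "2 * (\<bar>Y \<omega>\<bar> ^ n * \<bar>Z \<omega>\<bar> ^ n) \<le> (\<bar>Y \<omega>\<bar> ^ n)\<^sup>2 + (\<bar>Z \<omega>\<bar> ^ n)\<^sup>2"
        using sum_squares_bound[of "\<bar>Y \<omega>\<bar> ^ n" "\<bar>Z \<omega>\<bar> ^ n"] by simp
      moreover have "0 \<le> \<bar>Y \<omega>\<bar> ^ n * \<bar>Z \<omega>\<bar> ^ n" by simp
      ultimately have "\<bar>Y \<omega>\<bar> ^ n * \<bar>Z \<omega>\<bar> ^ n \<le> \<bar>Y \<omega>\<bar> ^ (2 * n) + \<bar>Z \<omega>\<bar> ^ (2 * n)"
        by (simp only: power_mult[symmetric] mult.commute[of n 2])
      then show "norm (\<bar>Y \<omega> * Z \<omega>\<bar> ^ n) \<le> norm (\<bar>Y \<omega>\<bar> ^ (2 * n) + \<bar>Z \<omega>\<bar> ^ (2 * n))"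
        by (simp add: abs_mult power_mult_distrib)
    qed
  qed measurable
qed

lemma (in prob_space) all_moments_sum:
  "(\<And>i. i \<in> I \<Longrightarrow> all_moments M (Z i)) \<Longrightarrow> all_moments M (\<lambda>\<omega>. \<Sum>i\<in>I. Z i \<omega>)"
  by (induction I rule: infinite_finite_induct) (auto intro: all_moments_const all_moments_add)

lemma (in prob_space) all_moments_prod:
  "(\<And>i. i \<in> I \<Longrightarrow> all_moments M (Z i)) \<Longrightarrow> all_moments M (\<lambda>\<omega>. \<Prod>i\<in>I. Z i \<omega>)"
  by (induction I rule: infinite_finite_induct) (auto intro: all_moments_const all_moments_mult)

lemma (in prob_space) all_moments_poly:
  "all_moments M Z \<Longrightarrow> all_moments M (\<lambda>\<omega>. poly p (Z \<omega>))"
  by (induction p) (auto intro: all_moments_const all_moments_mult all_moments_add)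

text \<open>These limits are the vanishing boundary terms of a partial integration. The bound of a
  power of y by 1 + y^(2k) reduces all powers to powers of y^2 / (2 v), which the exponential
  dominates at both ends.\<close>

lemma poly_gauss_tendsto:
  fixes v :: real
  assumes v: "0 < v"
  shows "((\<lambda>y. poly Q y * exp (- y\<^sup>2 / (2 * v))) \<longlongrightarrow> 0) at_top"
    and "((\<lambda>y. poly Q y * exp (- y\<^sup>2 / (2 * v))) \<longlongrightarrow> 0) at_bot"
proof -
  have gen: "((\<lambda>y. y ^ k * poly Q y * exp (- y\<^sup>2 / (2 * v))) \<longlongrightarrow> 0) F"
    if F: "filterlim (\<lambda>y. y\<^sup>2 / (2 * v)) at_top F" for F and k :: nat
  proof -
    have mono: "((\<lambda>y. y ^ k * exp (- y\<^sup>2 / (2 * v))) \<longlongrightarrow> 0) F" for k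
    proof -
      let ?z = "\<lambda>y. y\<^sup>2 / (2 * v)"
      have "((\<lambda>y. ?z y ^ 0 / exp (?z y) + (2 * v) ^ k * (?z y ^ k / exp (?z y))) \<longlongrightarrow> 0 + (2 * v) ^ k * 0) F"
        by (intro tendsto_intros filterlim_compose[OF tendsto_power_div_exp_0 F])
      then have lim: "((\<lambda>y. ?z y ^ 0 / exp (?z y) + (2 * v) ^ k * (?z y ^ k / exp (?z y))) \<longlongrightarrow> 0) F" by simp
      show ?thesis
      proof (rule Lim_null_comparison[OF always_eventually lim], rule allI)
        fix y :: real
        have "\<bar>y ^ k\<bar> \<le> 1 + y ^ (2 * k)"
        proof -
          have "2 * \<bar>y ^ k\<bar> \<le> 1 + (\<bar>y ^ k\<bar>)\<^sup>2" using sum_squares_bound[of 1 "\<bar>y ^ k\<bar>"] by simp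
          moreover have "(\<bar>y ^ k\<bar>)\<^sup>2 = y ^ (2 * k)" by (simp add: mult.commute[of 2] power_mult)
          moreover have "0 \<le> y ^ (2 * k)" by simp
          ultimately show ?thesis by linarith
        qed
        also have "y ^ (2 * k) = (2 * v) ^ k * ?z y ^ k" using v by (simp add: power_divide power_mult)
        finally have "\<bar>y ^ k\<bar> * exp (- ?z y) \<le> (1 + (2 * v) ^ k * ?z y ^ k) * exp (- ?z y)"
          by (intro mult_right_mono) auto
        moreover have "norm (y ^ k * exp (- y\<^sup>2 / (2 * v))) = \<bar>y ^ k\<bar> * exp (- ?z y)"
          by (simp add: abs_mult)
        moreover have "(1 + (2 * v) ^ k * ?z y ^ k) * exp (- ?z y) = ?z y ^ 0 / exp (?z y) + (2 * v) ^ k * (?z y ^ k / exp (?z y))"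
          unfolding exp_minus divide_inverse[of _ "exp _"] power_0 by (simp only: distrib_right mult.assoc)
        ultimately show "norm (y ^ k * exp (- y\<^sup>2 / (2 * v))) \<le> ?z y ^ 0 / exp (?z y) + (2 * v) ^ k * (?z y ^ k / exp (?z y))"
          by (simp only:)
      qed
    qed
    show ?thesis
    proof (induction Q arbitrary: k)
      case (pCons a Q)
      have "((\<lambda>y. a * (y ^ k * exp (- y\<^sup>2 / (2 * v))) + y ^ Suc k * poly Q y * exp (- y\<^sup>2 / (2 * v))) \<longlongrightarrow> a * 0 + 0) F"
        by (intro tendsto_intros mono pCons.IH)
      then show ?case by (simp add: algebra_simps)
    qed simp
  qed
  have half: "filterlim (\<lambda>y::real. y\<^sup>2 / (2 * v)) at_top F" if "filterlim (\<lambda>y::real. y\<^sup>2) at_top F" for F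
    unfolding divide_inverse
    by (rule filterlim_at_top_mult_tendsto_pos[OF tendsto_const _ that]) (use v in simp)
  have "filterlim (\<lambda>y::real. y\<^sup>2) at_top at_top"
    by (rule filterlim_pow_at_top) (auto intro: filterlim_ident)
  note top = half[OF this]
  have "filterlim (\<lambda>y::real. y\<^sup>2) at_top at_bot"
    by (rule filterlim_pow_at_bot_even) (auto intro: filterlim_ident)
  note bot = half[OF this]
  from gen[OF top, of 0] gen[OF bot, of 0]
  show "((\<lambda>y. poly Q y * exp (- y\<^sup>2 / (2 * v))) \<longlongrightarrow> 0) at_top"
    and "((\<lambda>y. poly Q y * exp (- y\<^sup>2 / (2 * v))) \<longlongrightarrow> 0) at_bot" by simp_all
qed

text \<open>Stein's identity for a function of the form Q cis R. The centred normal density has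
  derivative - y / v times itself, so the total derivative of Q times density times cis R has
  integral 0, and its three terms are the three terms of the claim.\<close>

lemma stein_poly:
  fixes Q R :: "real poly"
  assumes v: "0 < v"
  shows "(LINT y|normal_law 0 v. of_real (y * poly Q y) * cis (poly R y)) =
    of_real v * (LINT y|normal_law 0 v. (of_real (poly (pderiv Q) y) + \<i> * of_real (poly (pderiv R) y * poly Q y)) * cis (poly R y))"
proof -
  let ?N = "normal_law 0 v"
  let ?d = "normal_density 0 (sqrt v)"
  interpret N: prob_space ?N using v by (intro prob_space_normal_law) simp
  have moments: "all_moments ?N (\<lambda>y. y)"
    using v by (simp add: all_moments_def integrable_normal_law_moment)
  have poly_int: "integrable ?N (\<lambda>y. poly p y)" for p
    by (intro all_moments_integrable N.all_moments_poly moments)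
  have d_eq: "?d y = (1 / sqrt (2 * pi * v)) * exp (- y\<^sup>2 / (2 * v))" for y
    using v by (simp add: normal_density_def)
  have [measurable]: "(\<lambda>y. poly p y) \<in> borel_measurable borel" for p :: "real poly"
    by (intro borel_measurable_continuous_onI continuous_intros)
  have d_deriv: "(?d has_real_derivative (- y / v * ?d y)) (at y)" for y
    unfolding d_eq[abs_def] using v by (auto intro!: derivative_eq_intros simp: field_simps power2_eq_square)
  define F where "F y = of_real (poly Q y * ?d y) * cis (poly R y)" for y
  define f1 where "f1 y = (of_real (poly (pderiv Q) y) + \<i> * of_real (poly (pderiv R) y * poly Q y)) * cis (poly R y)" for y
  define f2 where "f2 y = of_real (y * poly Q y) * cis (poly R y)" for y
  define f where "f y = of_real (?d y) * (f1 y - f2 y / of_real v)" for y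
  have cis_der: "((\<lambda>y. cis (poly R y)) has_vector_derivative (\<i> * of_real (poly (pderiv R) y) * cis (poly R y))) (at y)" for y
  proof -
    have "((\<lambda>y. \<i> * of_real (poly R y)) has_vector_derivative (\<i> * of_real (poly (pderiv R) y))) (at y)"
      using poly_DERIV[of R y] by (auto intro!: derivative_eq_intros has_vector_derivative_of_real simp: has_real_derivative_iff_has_vector_derivative)
    from field_vector_diff_chain_at[OF this DERIV_exp] show ?thesis
      by (simp add: cis_conv_exp o_def mult_ac)
  qed
  have F_der: "(F has_vector_derivative f y) (at y)" for y
  proof -
    have "((\<lambda>y. poly Q y * ?d y) has_real_derivative (poly (pderiv Q) y * ?d y + (- y / v * ?d y) * poly Q y)) (at y)"
      by (rule DERIV_mult[OF poly_DERIV d_deriv])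
    then have "((\<lambda>y. complex_of_real (poly Q y * ?d y)) has_vector_derivative of_real (poly (pderiv Q) y * ?d y + (- y / v * ?d y) * poly Q y)) (at y)"
      by (intro has_vector_derivative_of_real) (simp add: has_real_derivative_iff_has_vector_derivative)
    from has_vector_derivative_mult[OF this cis_der] show ?thesis
      unfolding F_def[abs_def] f_def f1_def f2_def using v by (simp add: field_simps)
  qed
  have cont: "isCont f y" for y
  proof -
    have "isCont (\<lambda>y. complex_of_real (?d y)) y"
      by (intro continuous_of_real DERIV_isCont[OF d_deriv])
    moreover have "isCont f1 y" "isCont f2 y" unfolding f1_def[abs_def] f2_def[abs_def] cis_conv_exp
      by (intro continuous_intros)+
    ultimately show ?thesis unfolding f_def[abs_def] using v
      by (intro isCont_mult isCont_diff isCont_divide continuous_const) auto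
  qed
  have f1_int: "integrable ?N f1" and f2_int: "integrable ?N f2"
  proof -
    have p: "integrable ?N (\<lambda>y. of_real (poly p y) * cis (poly R y))" for p
      by (intro integrable_cis poly_int) measurable
    have e1: "f1 = (\<lambda>y. of_real (poly (pderiv Q) y) * cis (poly R y) + \<i> * (of_real (poly (pderiv R * Q) y) * cis (poly R y)))"
      by (auto simp: f1_def algebra_simps)
    show "integrable ?N f1"
      unfolding e1 by (intro Bochner_Integration.integrable_add integrable_mult_right p)
    have e2: "f2 = (\<lambda>y. of_real (poly ([:0, 1:] * Q) y) * cis (poly R y))" by (auto simp: f2_def)
    show "integrable ?N f2" unfolding e2 by (rule p)
  qed
  have N_int: "integrable ?N g \<longleftrightarrow> integrable lborel (\<lambda>y. of_real (?d y) * g y)" and N_lint: "(LINT y|?N. g y) = (LINT y|lborel. of_real (?d y) * g y)"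
    if "g \<in> borel_measurable borel" for g :: "real \<Rightarrow> complex"
    using that v by (simp_all add: normal_law_def integrable_density integral_density scaleR_conv_of_real)
  have [measurable]: "f1 \<in> borel_measurable borel" "f2 \<in> borel_measurable borel"
    using f1_int f2_int by (auto dest: borel_measurable_integrable)
  have f_int: "integrable lborel f"
    unfolding f_def[abs_def] using N_int[of "\<lambda>y. f1 y - f2 y / of_real v"] f1_int f2_int by simp
  have lim: "(F \<longlongrightarrow> 0) G" if "((\<lambda>y. poly Q y * exp (- y\<^sup>2 / (2 * v))) \<longlongrightarrow> 0) G" for G
  proof (rule tendsto_norm_zero_cancel)
    have "((\<lambda>y. \<bar>1 / sqrt (2 * pi * v) * (poly Q y * exp (- y\<^sup>2 / (2 * v)))\<bar>) \<longlongrightarrow> \<bar>1 / sqrt (2 * pi * v) * 0\<bar>) G"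
      by (intro tendsto_intros that)
    then show "((\<lambda>y. norm (F y)) \<longlongrightarrow> 0) G"
      unfolding F_def norm_mult norm_cis norm_of_real d_eq by (simp add: mult_ac)
  qed
  have "(LBINT y=-\<infinity>..\<infinity>. f y) = 0 - 0"
    by (rule interval_integral_FTC_integrable[where F=F])
       (use F_der cont f_int lim[OF poly_gauss_tendsto(1)[OF v]] lim[OF poly_gauss_tendsto(2)[OF v]] in
         \<open>auto simp: ereal_tendsto_simps set_integrable_def\<close>)
  then have "(LINT y|lborel. f y) = 0"
    by (simp add: interval_lebesgue_integral_def set_lebesgue_integral_def)
  then have "(LINT y|?N. f1 y - f2 y / of_real v) = 0"
    by (subst N_lint) (simp_all add: f_def[abs_def])
  then have "(LINT y|?N. f1 y) - (LINT y|?N. f2 y) / of_real v = 0"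
    using f1_int f2_int by (simp add: Bochner_Integration.integral_diff)
  then have "(LINT y|?N. f2 y) = of_real v * (LINT y|?N. f1 y)"
    using v by (simp add: field_simps)
  then show ?thesis by (simp only: f1_def[abs_def] f2_def[abs_def])
qed

section \<open>Uniqueness arguments with characteristic functions\<close>

context prob_space begin

text \<open>A signed density \<open>g\<close> with vanishing Fourier transform along \<open>Z\<close> does not change the law
  of \<open>Z\<close> when added to \<open>1\<close>.\<close>

lemma fourier_zero_real:
  fixes Z g :: "'a \<Rightarrow> real"
  assumes [measurable]: "random_variable borel Z" "random_variable borel g" and g: "\<And>\<omega>. \<bar>g \<omega>\<bar> \<le> 1"
    and zero: "\<And>s. (LINT \<omega>|M. cis (s * Z \<omega>) * of_real (g \<omega>)) = 0" and [measurable]: "B \<in> sets borel"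
  shows "(LINT \<omega>|M. indicator B (Z \<omega>) * g \<omega>) = 0"
proof -
  have g_int: "integrable M g" by (rule integrable_const_bound[where B=1]) (use g in auto)
  have g_nn: "0 \<le> 1 + g \<omega>" for \<omega> using g[of \<omega>] by linarith
  define D where "D = density M (\<lambda>\<omega>. ennreal (1 + g \<omega>))"
  have [measurable_cong, simp]: "sets D = sets M" by (simp add: D_def)
  have [simp]: "space D = space M" by (simp add: D_def)
  have g0: "(LINT \<omega>|M. g \<omega>) = 0"
    using zero[of 0] by simp
  have "prob_space D"
  proof
    have "emeasure D (space D) = (\<integral>\<^sup>+ \<omega>. ennreal (1 + g \<omega>) \<partial>M)"
      unfolding D_def by (simp add: emeasure_density cong: nn_integral_cong)
    also have "\<dots> = ennreal (LINT \<omega>|M. 1 + g \<omega>)"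
      using g_int g_nn by (intro nn_integral_eq_integral) auto
    also have "\<dots> = 1" using g_int g0 prob_space by (simp add: Bochner_Integration.integral_add)
    finally show "emeasure D (space D) = 1" .
  qed
  then interpret D: prob_space D .
  have "char (distr D borel Z) s = char (distr M borel Z) s" for s
  proof -
    have c: "integrable M (\<lambda>\<omega>. cis (s * Z \<omega>))" by (rule integrable_const_bound[where B=1]) auto
    have "char (distr D borel Z) s = (LINT \<omega>|D. cis (s * Z \<omega>))"
      by (simp add: char_def integral_distr cis_conv_exp)
    also have "\<dots> = (LINT \<omega>|M. (1 + g \<omega>) *\<^sub>R cis (s * Z \<omega>))"
      unfolding D_def using g_nn by (subst integral_density) auto
    also have "\<dots> = (LINT \<omega>|M. cis (s * Z \<omega>) + cis (s * Z \<omega>) * of_real (g \<omega>))"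
      by (intro Bochner_Integration.integral_cong refl) (simp add: scaleR_conv_of_real algebra_simps)
    also have "\<dots> = (LINT \<omega>|M. cis (s * Z \<omega>))"
      using c g_int by (subst Bochner_Integration.integral_add) (auto simp: zero)
    also have "\<dots> = char (distr M borel Z) s"
      by (simp add: char_def integral_distr cis_conv_exp)
    finally show ?thesis .
  qed
  then have "distr D borel Z = distr M borel Z"
    by (intro Levy_uniqueness D.real_distribution_distr real_distribution_distr) auto
  then have "(LINT x|distr D borel Z. indicat_real B x) = (LINT x|distr M borel Z. indicat_real B x)" by simp
  then have "(LINT \<omega>|D. indicat_real B (Z \<omega>)) = (LINT \<omega>|M. indicat_real B (Z \<omega>))"
    by (subst (asm) (1 2) integral_distr) simp_all
  moreover have "(LINT \<omega>|D. indicat_real B (Z \<omega>)) = (LINT \<omega>|M. (1 + g \<omega>) *\<^sub>R indicat_real B (Z \<omega>))"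
    unfolding D_def using g_nn by (subst integral_density) auto
  moreover have "(LINT \<omega>|M. (1 + g \<omega>) *\<^sub>R indicat_real B (Z \<omega>)) = (LINT \<omega>|M. indicat_real B (Z \<omega>)) + (LINT \<omega>|M. indicat_real B (Z \<omega>) * g \<omega>)"
  proof -
    have "integrable M (\<lambda>\<omega>. indicat_real B (Z \<omega>))" by (rule integrable_const_bound[where B=1]) auto
    moreover have "integrable M (\<lambda>\<omega>. indicat_real B (Z \<omega>) * g \<omega>)"
      by (rule integrable_const_bound[where B=1]) (use g in \<open>auto simp: indicator_def\<close>)
    ultimately show ?thesis
      by (subst Bochner_Integration.integral_add[symmetric]) (auto simp: algebra_simps)
  qed
  ultimately show ?thesis by simp
qed

text \<open>The real case is applied to the real and imaginary parts, divided by K to fit the unit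
  bound. The transform of the conjugate also vanishes, by replacing s with - s, so the transforms of
  both parts vanish.\<close>

lemma fourier_zero:
  fixes Z :: "'a \<Rightarrow> real" and g :: "'a \<Rightarrow> complex"
  assumes [measurable]: "random_variable borel Z" "g \<in> borel_measurable M" and g: "\<And>\<omega>. cmod (g \<omega>) \<le> C"
    and zero: "\<And>s. (LINT \<omega>|M. cis (s * Z \<omega>) * g \<omega>) = 0" and B: "B \<in> sets borel"
  shows "(LINT \<omega>|M. indicator B (Z \<omega>) * g \<omega>) = 0"
proof -
  define K where "K = \<bar>C\<bar> + 1"
  have K: "0 < K" "cmod (g \<omega>) \<le> K" for \<omega>
    using g[of \<omega>] by (auto simp: K_def)
  have int: "integrable M (\<lambda>\<omega>. cis (s * Z \<omega>) * g \<omega>)" for s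
    by (rule integrable_const_bound[where B=K]) (auto simp: norm_mult K)
  have zero': "(LINT \<omega>|M. cis (s * Z \<omega>) * cnj (g \<omega>)) = 0" for s
  proof -
    have "(LINT \<omega>|M. cis (s * Z \<omega>) * cnj (g \<omega>)) = (LINT \<omega>|M. cnj (cis (- s * Z \<omega>) * g \<omega>))"
      by (intro Bochner_Integration.integral_cong refl) (simp add: cis_cnj)
    also have "\<dots> = cnj (LINT \<omega>|M. cis (- s * Z \<omega>) * g \<omega>)" by (rule Bochner_Integration.integral_cnj)
    also have "\<dots> = 0" unfolding zero by simp
    finally show ?thesis .
  qed
  have int': "integrable M (\<lambda>\<omega>. cis (s * Z \<omega>) * cnj (g \<omega>))" for s
    using integrable_cnj[OF int[of "- s"]] by (simp add: cis_cnj)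
  have re: "(LINT \<omega>|M. indicator B (Z \<omega>) * (Re (g \<omega>) / K)) = 0"
  proof (rule fourier_zero_real[OF assms(1) _ _ _ B])
    show "\<bar>Re (g \<omega>) / K\<bar> \<le> 1" for \<omega>
      using order_trans[OF abs_Re_le_cmod K(2)[of \<omega>]] K(1) by (simp add: divide_le_eq)
    show "(LINT \<omega>|M. cis (s * Z \<omega>) * of_real (Re (g \<omega>) / K)) = 0" for s
    proof -
      have "cis (s * Z \<omega>) * of_real (Re (g \<omega>) / K) = (1 / (2 * of_real K)) * (cis (s * Z \<omega>) * g \<omega> + cis (s * Z \<omega>) * cnj (g \<omega>))" for \<omega>
        unfolding distrib_left[symmetric] complex_add_cnj using K(1) by (simp add: field_simps)
      then have "(LINT \<omega>|M. cis (s * Z \<omega>) * of_real (Re (g \<omega>) / K)) = (1 / (2 * of_real K)) * (LINT \<omega>|M. cis (s * Z \<omega>) * g \<omega> + cis (s * Z \<omega>) * cnj (g \<omega>))"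
        by (simp only: integral_mult_right_zero)
      also have "\<dots> = 0" using int int' by (subst Bochner_Integration.integral_add) (auto simp: zero zero')
      finally show ?thesis .
    qed
  qed measurable
  have im: "(LINT \<omega>|M. indicator B (Z \<omega>) * (Im (g \<omega>) / K)) = 0"
  proof (rule fourier_zero_real[OF assms(1) _ _ _ B])
    show "\<bar>Im (g \<omega>) / K\<bar> \<le> 1" for \<omega>
      using order_trans[OF abs_Im_le_cmod K(2)[of \<omega>]] K(1) by (simp add: divide_le_eq)
    show "(LINT \<omega>|M. cis (s * Z \<omega>) * of_real (Im (g \<omega>) / K)) = 0" for s
    proof -
      have "cis (s * Z \<omega>) * of_real (Im (g \<omega>) / K) = (1 / (2 * \<i> * of_real K)) * (cis (s * Z \<omega>) * g \<omega> - cis (s * Z \<omega>) * cnj (g \<omega>))" for \<omega>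
        unfolding right_diff_distrib[symmetric] complex_diff_cnj using K(1) by (simp add: field_simps)
      then have "(LINT \<omega>|M. cis (s * Z \<omega>) * of_real (Im (g \<omega>) / K)) = (1 / (2 * \<i> * of_real K)) * (LINT \<omega>|M. cis (s * Z \<omega>) * g \<omega> - cis (s * Z \<omega>) * cnj (g \<omega>))"
        by (simp only: integral_mult_right_zero)
      also have "\<dots> = 0" using int int' by (subst Bochner_Integration.integral_diff) (auto simp: zero zero')
      finally show ?thesis .
    qed
  qed measurable
  have gint: "integrable M (\<lambda>\<omega>. indicator B (Z \<omega>) * g \<omega>)"
    using B by (intro integrable_const_bound[where B=K]) (auto simp: indicator_def K intro: less_imp_le)
  have "Re (LINT \<omega>|M. indicator B (Z \<omega>) * g \<omega>) = (LINT \<omega>|M. Re (indicator B (Z \<omega>) * g \<omega>))"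
    by (rule integral_Re[OF gint, symmetric])
  also have "\<dots> = (LINT \<omega>|M. K * (indicator B (Z \<omega>) * (Re (g \<omega>) / K)))"
    using K(1) by (intro Bochner_Integration.integral_cong refl) (auto simp: indicator_def)
  also have "\<dots> = 0" by (simp only: integral_mult_right_zero re)
  finally have 1: "Re (LINT \<omega>|M. indicator B (Z \<omega>) * g \<omega>) = 0" .
  have "Im (LINT \<omega>|M. indicator B (Z \<omega>) * g \<omega>) = (LINT \<omega>|M. Im (indicator B (Z \<omega>) * g \<omega>))"
    by (rule integral_Im[OF gint, symmetric])
  also have "\<dots> = (LINT \<omega>|M. K * (indicator B (Z \<omega>) * (Im (g \<omega>) / K)))"
    using K(1) by (intro Bochner_Integration.integral_cong refl) (auto simp: indicator_def)
  also have "\<dots> = 0" by (simp only: integral_mult_right_zero im)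
  finally have 2: "Im (LINT \<omega>|M. indicator B (Z \<omega>) * g \<omega>) = 0" .
  show ?thesis using 1 2 by (simp add: complex_eq_iff)
qed

text \<open>Coordinates are treated one at a time: the indicator for the coordinate just treated is
  absorbed into the signed density, which stays bounded by C, and the remaining coordinates keep a
  vanishing transform for all coefficients.\<close>

lemma fourier_zero_vector:
  fixes U :: "'i \<Rightarrow> 'a \<Rightarrow> real" and g :: "'a \<Rightarrow> complex"
  assumes "finite J" "\<And>j. j \<in> J \<Longrightarrow> random_variable borel (U j)" "g \<in> borel_measurable M" "\<And>\<omega>. cmod (g \<omega>) \<le> C"
    and "\<And>a. (LINT \<omega>|M. cis (\<Sum>j\<in>J. a j * U j \<omega>) * g \<omega>) = 0" and "\<And>j. j \<in> J \<Longrightarrow> B j \<in> sets borel"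
  shows "(LINT \<omega>|M. (\<Prod>j\<in>J. indicator (B j) (U j \<omega>)) * g \<omega>) = 0"
  using assms
proof (induction J arbitrary: g rule: finite_induct)
  case empty
  then show ?case by simp
next
  case (insert j J)
  have Um [measurable]: "random_variable borel (U i)" if "i \<in> insert j J" for i using insert.prems that by auto
  note [measurable] = insert.prems(2)
  have C: "0 \<le> C" using insert.prems(3) norm_ge_zero order_trans by blast
  define g' where "g' \<omega> = indicator (B j) (U j \<omega>) * g \<omega>" for \<omega>
  have Uj [measurable]: "random_variable borel (U j)" and Bj [measurable]: "B j \<in> sets borel" using insert.prems by auto
  have g'_meas: "g' \<in> borel_measurable M" unfolding g'_def by measurable
  have UJ [measurable]: "random_variable borel (\<lambda>\<omega>. \<Sum>i\<in>J. a i * U i \<omega>)" for a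
    by (intro borel_measurable_sum borel_measurable_times Um) auto
  have "(LINT \<omega>|M. (\<Prod>i\<in>J. indicator (B i) (U i \<omega>)) * g' \<omega>) = 0"
  proof (rule insert.IH)
    show "cmod (g' \<omega>) \<le> C" for \<omega> using insert.prems(3)[of \<omega>] C by (auto simp: g'_def indicator_def)
    fix a :: "'i \<Rightarrow> real"
    define h where "h \<omega> = cis (\<Sum>i\<in>J. a i * U i \<omega>) * g \<omega>" for \<omega>
    have "(LINT \<omega>|M. indicator (B j) (U j \<omega>) * h \<omega>) = 0"
    proof (rule fourier_zero)
      show "h \<in> borel_measurable M" unfolding h_def by measurable
      show "cmod (h \<omega>) \<le> C" for \<omega> using insert.prems(3) by (simp add: h_def norm_mult)
      fix s
      have "cis (s * U j \<omega>) * h \<omega> = cis (\<Sum>i\<in>insert j J. (a(j := s)) i * U i \<omega>) * g \<omega>" for \<omega>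
      proof -
        have "(\<Sum>i\<in>J. (a(j := s)) i * U i \<omega>) = (\<Sum>i\<in>J. a i * U i \<omega>)"
          using insert.hyps by (intro sum.cong) auto
        then show ?thesis using insert.hyps by (simp add: h_def mult.assoc flip: cis_mult)
      qed
      then show "(LINT \<omega>|M. cis (s * U j \<omega>) * h \<omega>) = 0" using insert.prems(4)[of "a(j := s)"] by simp
    qed (use Uj Bj in auto)
    then show "(LINT \<omega>|M. cis (\<Sum>j\<in>J. a j * U j \<omega>) * g' \<omega>) = 0" by (simp add: h_def g'_def mult_ac)
  qed (use insert.prems g'_meas in auto)
  then show ?case using insert.hyps by (simp add: g'_def mult_ac)
qed

end

section \<open>Finite Gaussian families and regression on one member\<close>

definition quad_form :: "'i set \<Rightarrow> ('i \<Rightarrow> 'i \<Rightarrow> real) \<Rightarrow> ('i \<Rightarrow> real) \<Rightarrow> real" where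
  "quad_form I r a = (\<Sum>i\<in>I. \<Sum>j\<in>I. a i * a j * r i j)"

text \<open>The family is described by the laws of its linear combinations, with \<open>r\<close> as
  covariance matrix. Singular matrices are included, so a family may repeat a variable.
  Nonnegativity of the quadratic form is part of the definition because it appears as a variance in
  \<open>normal_law\<close>.\<close>

definition centred_gaussian :: "'w measure \<Rightarrow> 'i set \<Rightarrow> ('i \<Rightarrow> 'w \<Rightarrow> real) \<Rightarrow> ('i \<Rightarrow> 'i \<Rightarrow> real) \<Rightarrow> bool" where
  "centred_gaussian M I Y r \<longleftrightarrow> finite I \<and> (\<forall>i\<in>I. Y i \<in> borel_measurable M) \<and> (\<forall>i\<in>I. \<forall>j\<in>I. r i j = r j i) \<and>
     (\<forall>a. 0 \<le> quad_form I r a \<and> distr M borel (\<lambda>\<omega>. \<Sum>i\<in>I. a i * Y i \<omega>) = normal_law 0 (quad_form I r a))"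

lemma quad_form_shift:
  assumes "finite I" "k \<in> I" "\<And>i j. i \<in> I \<Longrightarrow> j \<in> I \<Longrightarrow> r i j = r j i"
  shows "quad_form I r (\<lambda>i. a i + (if i = k then s else 0)) = quad_form I r a + 2 * s * (\<Sum>j\<in>I. a j * r k j) + s\<^sup>2 * r k k"
proof -
  let ?d = "\<lambda>i. if i = k then s else (0::real)"
  have "quad_form I r (\<lambda>i. a i + ?d i) = (\<Sum>i\<in>I. \<Sum>j\<in>I. a i * a j * r i j + ?d i * (a j * r i j) + ?d j * (a i * r i j) + ?d i * ?d j * r i j)"
    unfolding quad_form_def by (intro sum.cong refl) (simp add: algebra_simps)
  also have "\<dots> = quad_form I r a + (\<Sum>i\<in>I. ?d i * (\<Sum>j\<in>I. a j * r i j)) + (\<Sum>i\<in>I. \<Sum>j\<in>I. ?d j * (a i * r i j)) + (\<Sum>i\<in>I. ?d i * (\<Sum>j\<in>I. ?d j * r i j))"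
    unfolding quad_form_def sum.distrib sum_distrib_left by (simp add: mult.assoc)
  also have "(\<Sum>i\<in>I. ?d i * (\<Sum>j\<in>I. a j * r i j)) = s * (\<Sum>j\<in>I. a j * r k j)"
    using assms by (simp add: if_distrib[of "\<lambda>x. x * _"] cong: if_cong)
  also have "(\<Sum>i\<in>I. \<Sum>j\<in>I. ?d j * (a i * r i j)) = (\<Sum>i\<in>I. s * (a i * r i k))"
    using assms by (simp add: if_distrib[of "\<lambda>x. x * _"] cong: if_cong)
  also have "\<dots> = s * (\<Sum>j\<in>I. a j * r k j)"
    using assms by (simp add: sum_distrib_left)
  also have "(\<Sum>i\<in>I. ?d i * (\<Sum>j\<in>I. ?d j * r i j)) = s\<^sup>2 * r k k"
    using assms by (simp add: if_distrib[of "\<lambda>x. x * _"] power2_eq_square cong: if_cong)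
  finally show ?thesis by simp
qed

context prob_space begin

lemma centred_gaussian_char:
  assumes "centred_gaussian M I Y r"
  shows "(LINT \<omega>|M. cis (\<Sum>i\<in>I. a i * Y i \<omega>)) = of_real (exp (- quad_form I r a / 2))"
proof -
  have [measurable]: "(\<lambda>\<omega>. \<Sum>i\<in>I. a i * Y i \<omega>) \<in> borel_measurable M"
    using assms by (intro borel_measurable_sum borel_measurable_times) (auto simp: centred_gaussian_def)
  have "(LINT \<omega>|M. cis (\<Sum>i\<in>I. a i * Y i \<omega>)) = char (distr M borel (\<lambda>\<omega>. \<Sum>i\<in>I. a i * Y i \<omega>)) 1"
    by (simp add: char_def integral_distr cis_conv_exp)
  also have "\<dots> = of_real (exp (- quad_form I r a / 2))"
    using assms by (simp add: centred_gaussian_def char_normal_law)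
  finally show ?thesis .
qed

lemma centred_gaussian_distr:
  assumes "centred_gaussian M I Y r" "i \<in> I"
  shows "distr M borel (Y i) = normal_law 0 (r i i)" "0 \<le> r i i"
proof -
  have I: "finite I" using assms by (simp add: centred_gaussian_def)
  let ?a = "\<lambda>j. if j = i then 1 else (0::real)"
  have "(\<lambda>\<omega>. \<Sum>j\<in>I. ?a j * Y j \<omega>) = Y i"
    using I assms by (simp add: if_distrib[of "\<lambda>x. x * _"] cong: if_cong)
  moreover have "quad_form I r ?a = r i i"
    using quad_form_shift[OF I assms(2), where a="\<lambda>_. 0" and s=1 and r=r] assms(1)
    by (simp add: quad_form_def centred_gaussian_def)
  ultimately show "distr M borel (Y i) = normal_law 0 (r i i)" "0 \<le> r i i"
    using assms(1) unfolding centred_gaussian_def by metis+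
qed

lemma centred_gaussian_moments:
  assumes "centred_gaussian M I Y r" "i \<in> I"
  shows "all_moments M (Y i)"
  unfolding all_moments_def
proof (intro conjI allI)
  show m [measurable]: "Y i \<in> borel_measurable M" using assms by (simp add: centred_gaussian_def)
  fix n
  have "integrable (distr M borel (Y i)) (\<lambda>x. \<bar>x\<bar> ^ n)"
    unfolding centred_gaussian_distr(1)[OF assms] by (intro integrable_normal_law_moment centred_gaussian_distr(2)[OF assms])
  then show "integrable M (\<lambda>\<omega>. \<bar>Y i \<omega>\<bar> ^ n)" by (subst (asm) integrable_distr_eq) auto
qed

text \<open>The residuals \<open>U\<close> are uncorrelated with \<open>Y k\<close>, so the joint
  characteristic function factorizes. Independence is then deduced in two stages, first as a
  statement about events of \<open>Y k\<close>, then about boxes of residuals, and finally extended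
  to the product sigma-algebra.\<close>

lemma gaussian_regression:
  assumes G: "centred_gaussian M I Y r" and k: "k \<in> I" and rk: "0 < r k k"
  defines "U \<equiv> \<lambda>j \<omega>. Y j \<omega> - r k j / r k k * Y k \<omega>"
  shows "distr M (borel \<Otimes>\<^sub>M (\<Pi>\<^sub>M j\<in>I. borel)) (\<lambda>\<omega>. (Y k \<omega>, \<lambda>j\<in>I. U j \<omega>)) =
    normal_law 0 (r k k) \<Otimes>\<^sub>M distr M (\<Pi>\<^sub>M j\<in>I. borel) (\<lambda>\<omega>. \<lambda>j\<in>I. U j \<omega>)"
proof -
  have I: "finite I" and Ym: "\<And>i. i \<in> I \<Longrightarrow> Y i \<in> borel_measurable M" and sym: "\<And>i j. i \<in> I \<Longrightarrow> j \<in> I \<Longrightarrow> r i j = r j i"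
    using G by (auto simp: centred_gaussian_def)
  have Yk [measurable]: "Y k \<in> borel_measurable M" using Ym k by blast
  have Um: "U j \<in> borel_measurable M" if "j \<in> I" for j
    unfolding U_def using Ym[OF that] by measurable
  have UI [measurable]: "(\<lambda>\<omega>. \<lambda>j\<in>I. U j \<omega>) \<in> M \<rightarrow>\<^sub>M (\<Pi>\<^sub>M j\<in>I. borel)"
    by (intro measurable_restrict Um)
  have joint: "(LINT \<omega>|M. cis (s * Y k \<omega> + (\<Sum>j\<in>I. a j * U j \<omega>))) = (LINT \<omega>|M. cis (s * Y k \<omega>)) * (LINT \<omega>|M. cis (\<Sum>j\<in>I. a j * U j \<omega>))" for s a
  proof -
    \<comment> \<open>\<open>c\<close> is the regression coefficient of the combination on
      \<open>Y k\<close>, and \<open>?b\<close> are the coefficients of the combination of residuals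
      in terms of the original variables. Their covariance with \<open>Y k\<close> is 0, so the
      quadratic form has no cross term.\<close>
    define c where "c = (\<Sum>j\<in>I. a j * (r k j / r k k))"
    let ?b = "\<lambda>i. a i + (if i = k then - c else 0)"
    have U_eq: "s * Y k \<omega> + (\<Sum>j\<in>I. a j * U j \<omega>) = (\<Sum>i\<in>I. (?b i + (if i = k then s else 0)) * Y i \<omega>)" for s \<omega>
    proof -
      have "(\<Sum>j\<in>I. a j * U j \<omega>) = (\<Sum>j\<in>I. a j * Y j \<omega>) - c * Y k \<omega>"
        by (simp add: U_def c_def right_diff_distrib sum_subtractf sum_distrib_right mult.assoc)
      moreover have "(\<Sum>i\<in>I. (?b i + (if i = k then s else 0)) * Y i \<omega>) = (\<Sum>i\<in>I. a i * Y i \<omega>) + (s - c) * Y k \<omega>"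
        using I k by (simp add: distrib_right sum.distrib if_distrib[of "\<lambda>x. x * _"] left_diff_distrib cong: if_cong)
      ultimately show ?thesis by (simp add: algebra_simps)
    qed
    have orth: "(\<Sum>j\<in>I. ?b j * r k j) = 0"
    proof -
      have "(\<Sum>j\<in>I. ?b j * r k j) = (\<Sum>j\<in>I. a j * r k j) - c * r k k"
        using I k by (simp add: distrib_right sum.distrib if_distrib[of "\<lambda>x. x * _"] cong: if_cong)
      also have "c * r k k = (\<Sum>j\<in>I. a j * r k j)"
        using rk by (simp add: c_def sum_distrib_right)
      finally show ?thesis by simp
    qed
    have q: "quad_form I r (\<lambda>i. ?b i + (if i = k then s else 0)) = quad_form I r ?b + s\<^sup>2 * r k k" for s
      by (subst quad_form_shift[OF I k sym]) (simp_all add: orth)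
    have q0: "quad_form I r (\<lambda>i. if i = k then s else 0) = s\<^sup>2 * r k k"
      using quad_form_shift[OF I k sym, where a="\<lambda>_. 0" and s=s] by (simp add: quad_form_def)
    have Yk_char: "(LINT \<omega>|M. cis (s * Y k \<omega>)) = of_real (exp (- (s\<^sup>2 * r k k) / 2))"
      using centred_gaussian_char[OF G, of "\<lambda>i. if i = k then s else 0"] I k
      by (simp add: q0 if_distrib[of "\<lambda>x. x * _"] cong: if_cong)
    have U_char: "(LINT \<omega>|M. cis (\<Sum>j\<in>I. a j * U j \<omega>)) = of_real (exp (- quad_form I r ?b / 2))"
    proof -
      have "(\<Sum>j\<in>I. a j * U j \<omega>) = (\<Sum>i\<in>I. ?b i * Y i \<omega>)" for \<omega>
        using U_eq[of 0 \<omega>] by simp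
      then show ?thesis by (simp only: centred_gaussian_char[OF G])
    qed
    have "(LINT \<omega>|M. cis (s * Y k \<omega> + (\<Sum>j\<in>I. a j * U j \<omega>))) = of_real (exp (- (quad_form I r ?b + s\<^sup>2 * r k k) / 2))"
      unfolding U_eq by (subst centred_gaussian_char[OF G]) (simp only: q)
    also have "\<dots> = of_real (exp (- (s\<^sup>2 * r k k) / 2)) * of_real (exp (- quad_form I r ?b / 2))"
      by (simp flip: of_real_mult exp_add add: field_simps)
    finally show ?thesis by (simp only: Yk_char U_char)
  qed
  have cis_int: "integrable M (\<lambda>\<omega>. cis (h \<omega>))" if "h \<in> borel_measurable M" for h
    using that by (intro integrable_const_bound[where B=1]) auto
  have sumU [measurable]: "(\<lambda>\<omega>. \<Sum>j\<in>I. a j * U j \<omega>) \<in> borel_measurable M" for a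
    by (intro borel_measurable_sum borel_measurable_times Um) auto
  \<comment> \<open>Uniqueness in the variable \<open>Y k\<close>: the centred character of the
    residuals is used as the complex signed density.\<close>
  have step1: "(LINT \<omega>|M. indicator A (Y k \<omega>) * (cis (\<Sum>j\<in>I. a j * U j \<omega>) - (LINT \<omega>|M. cis (\<Sum>j\<in>I. a j * U j \<omega>)))) = 0"
    if A: "A \<in> sets borel" for A a
  proof (rule fourier_zero[where C=2])
    let ?e = "LINT \<omega>|M. cis (\<Sum>j\<in>I. a j * U j \<omega>)"
    have e1: "cmod ?e \<le> 1"
      using integral_norm_bound[of M "\<lambda>\<omega>. cis (\<Sum>j\<in>I. a j * U j \<omega>)"] prob_space by simp
    show "cmod (cis (\<Sum>j\<in>I. a j * U j \<omega>) - ?e) \<le> 2" for \<omega>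
      using norm_triangle_ineq4[of "cis (\<Sum>j\<in>I. a j * U j \<omega>)" ?e] e1 by simp
    fix s
    have "(LINT \<omega>|M. cis (s * Y k \<omega>) * (cis (\<Sum>j\<in>I. a j * U j \<omega>) - ?e)) = (LINT \<omega>|M. cis (s * Y k \<omega> + (\<Sum>j\<in>I. a j * U j \<omega>)) - cis (s * Y k \<omega>) * ?e)"
      by (simp add: right_diff_distrib cis_mult)
    also have "\<dots> = (LINT \<omega>|M. cis (s * Y k \<omega> + (\<Sum>j\<in>I. a j * U j \<omega>))) - (LINT \<omega>|M. cis (s * Y k \<omega>)) * ?e"
      by (subst Bochner_Integration.integral_diff) (auto intro!: cis_int)
    finally show "(LINT \<omega>|M. cis (s * Y k \<omega>) * (cis (\<Sum>j\<in>I. a j * U j \<omega>) - ?e)) = 0" by (simp add: joint)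
  qed (use A in auto)
  \<comment> \<open>The roles are exchanged: now the centred indicator of an event of
    \<open>Y k\<close> is the signed density, and its transform along every combination of residuals
    vanishes.\<close>
  have step2: "(LINT \<omega>|M. cis (\<Sum>j\<in>I. a j * U j \<omega>) * of_real (indicator A (Y k \<omega>) - prob (Y k -` A \<inter> space M))) = 0"
    if A [measurable]: "A \<in> sets borel" for A a
  proof -
    let ?e = "LINT \<omega>|M. cis (\<Sum>j\<in>I. a j * U j \<omega>)" and ?p = "prob (Y k -` A \<inter> space M)"
    have i1: "integrable M (\<lambda>\<omega>. indicator A (Y k \<omega>) * cis (\<Sum>j\<in>I. a j * U j \<omega>))"
      by (intro integrable_const_bound[where B=1]) (auto simp: indicator_def)
    have i2: "integrable M (\<lambda>\<omega>. indicator A (Y k \<omega>) :: complex)"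
      by (intro integrable_const_bound[where B=1]) (auto simp: indicator_def)
    have ind: "(LINT \<omega>|M. indicator A (Y k \<omega>) :: complex) = of_real ?p"
    proof -
      have "(LINT \<omega>|M. indicator A (Y k \<omega>) :: complex) = (LINT \<omega>|M. of_real (indicat_real (Y k -` A \<inter> space M) \<omega>))"
        by (intro Bochner_Integration.integral_cong refl) (auto simp: indicator_def)
      then show ?thesis by simp
    qed
    have "0 = (LINT \<omega>|M. indicator A (Y k \<omega>) * cis (\<Sum>j\<in>I. a j * U j \<omega>) - indicator A (Y k \<omega>) * ?e)"
      using step1[OF A, of a] by (simp add: right_diff_distrib)
    also have "\<dots> = (LINT \<omega>|M. indicator A (Y k \<omega>) * cis (\<Sum>j\<in>I. a j * U j \<omega>)) - of_real ?p * ?e"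
      using i1 i2 by (subst Bochner_Integration.integral_diff) (auto simp: ind)
    also have "\<dots> = (LINT \<omega>|M. indicator A (Y k \<omega>) * cis (\<Sum>j\<in>I. a j * U j \<omega>) - of_real ?p * cis (\<Sum>j\<in>I. a j * U j \<omega>))"
      using i1 by (subst Bochner_Integration.integral_diff) (auto intro!: cis_int)
    also have "\<dots> = (LINT \<omega>|M. cis (\<Sum>j\<in>I. a j * U j \<omega>) * of_real (indicator A (Y k \<omega>) - ?p))"
      by (intro Bochner_Integration.integral_cong refl) (auto simp: indicator_def algebra_simps)
    finally show ?thesis by simp
  qed
  have rect: "prob ((Y k -` A \<inter> space M) \<inter> {\<omega>\<in>space M. \<forall>j\<in>I. U j \<omega> \<in> B j}) = prob (Y k -` A \<inter> space M) * prob {\<omega>\<in>space M. \<forall>j\<in>I. U j \<omega> \<in> B j}"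
    if A [measurable]: "A \<in> sets borel" and B: "\<And>j. j \<in> I \<Longrightarrow> B j \<in> sets borel" for A and B :: "_ \<Rightarrow> real set"
  proof -
    let ?p = "prob (Y k -` A \<inter> space M)"
    let ?S = "{\<omega>\<in>space M. \<forall>j\<in>I. U j \<omega> \<in> B j}"
    have S_eq: "?S = (\<Inter>j\<in>I. U j -` B j \<inter> space M) \<inter> space M" using k by auto
    have [measurable]: "?S \<in> sets M" unfolding S_eq
      by (rule sets.Int[OF sets.finite_INT[OF I _ measurable_sets[OF Um B]] sets.top]) (use k in auto)
    have pb: "\<bar>indicator A (Y k \<omega>) - ?p\<bar> \<le> 1" for \<omega>
      using prob_le_1[of "Y k -` A \<inter> space M"] measure_nonneg[of M "Y k -` A \<inter> space M"] by (auto simp: indicator_def)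
    have "(LINT \<omega>|M. (\<Prod>j\<in>I. indicator (B j) (U j \<omega>)) * complex_of_real (indicator A (Y k \<omega>) - ?p)) = 0"
      by (rule fourier_zero_vector[where C=1]) (use I Um B step2[OF A] pb in \<open>auto simp flip: of_real_diff simp del: of_real_diff\<close>)
    moreover have "(\<Prod>j\<in>I. indicator (B j) (U j \<omega>)) * complex_of_real (indicator A (Y k \<omega>) - ?p) = of_real (indicat_real ((Y k -` A \<inter> space M) \<inter> ?S) \<omega> - ?p * indicat_real ?S \<omega>)"
      if "\<omega> \<in> space M" for \<omega>
    proof -
      have "(\<Prod>j\<in>I. indicator (B j) (U j \<omega>)) = (indicator ?S \<omega> :: complex)"
        using that I by (auto simp: indicator_def prod_eq_1_iff intro!: prod.neutral prod_zero)
      then show ?thesis using that by (auto simp: indicator_def)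
    qed
    ultimately have "(LINT \<omega>|M. of_real (indicat_real ((Y k -` A \<inter> space M) \<inter> ?S) \<omega> - ?p * indicat_real ?S \<omega>)) = (0::complex)"
      by (simp cong: Bochner_Integration.integral_cong)
    then have "(LINT \<omega>|M. indicat_real ((Y k -` A \<inter> space M) \<inter> ?S) \<omega> - ?p * indicat_real ?S \<omega>) = 0"
      by (simp only: integral_complex_of_real of_real_eq_0_iff)
    moreover have "(LINT \<omega>|M. indicat_real ((Y k -` A \<inter> space M) \<inter> ?S) \<omega> - ?p * indicat_real ?S \<omega>) = prob ((Y k -` A \<inter> space M) \<inter> ?S) - ?p * prob ?S"
    proof -
      have i: "integrable M (indicat_real X)" if "X \<in> sets M" for X
        using that by (intro integrable_real_indicator) (auto simp: emeasure_eq_measure)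
      have [simp]: "X \<inter> space M = X" if "X \<in> sets M" for X
        using sets.sets_into_space[OF that] by auto
      show ?thesis by (subst Bochner_Integration.integral_diff) (auto intro!: i integrable_mult_right)
    qed
    ultimately show ?thesis by simp
  qed
  let ?V = "\<lambda>\<omega>. \<lambda>j\<in>I. U j \<omega>"
  let ?P = "\<Pi>\<^sub>M j\<in>I. (borel :: real measure)"
  have V_PiE: "?V -` PiE I B \<inter> space M = {\<omega>\<in>space M. \<forall>j\<in>I. U j \<omega> \<in> B j}" for B
    by (auto simp: PiE_iff)
  interpret D1: prob_space "distr M borel (Y k)" by (rule prob_space_distr) simp
  interpret D2: prob_space "distr M ?P ?V" by (rule prob_space_distr) simp
  have "distr M borel (Y k) \<Otimes>\<^sub>M distr M ?P ?V = distr M (borel \<Otimes>\<^sub>M ?P) (\<lambda>\<omega>. (Y k \<omega>, ?V \<omega>))"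
  proof (rule pair_measure_eqI)
    show "sigma_finite_measure (distr M borel (Y k))" "sigma_finite_measure (distr M ?P ?V)" ..
    show "sets (distr M borel (Y k) \<Otimes>\<^sub>M distr M ?P ?V) = sets (distr M (borel \<Otimes>\<^sub>M ?P) (\<lambda>\<omega>. (Y k \<omega>, ?V \<omega>)))"
      by (simp cong: sets_pair_measure_cong)
    fix A B assume "A \<in> sets (distr M borel (Y k))" "B \<in> sets (distr M ?P ?V)"
    then have A [measurable]: "A \<in> sets borel" and B [measurable]: "B \<in> sets ?P" by auto
    let ?EA = "Y k -` A \<inter> space M"
    have [measurable]: "?EA \<in> sets M" by measurable
    \<comment> \<open>For a fixed event of \<open>Y k\<close> both sides of the product formula are
      finite measures in the residual event. They agree on boxes by \<open>rect\<close>, hence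
      everywhere.\<close>
    define \<mu>1 where "\<mu>1 = distr (density M (indicator ?EA)) ?P ?V"
    define \<mu>2 where "\<mu>2 = density (distr M ?P ?V) (\<lambda>_. ennreal (prob ?EA))"
    have e1: "emeasure \<mu>1 C = emeasure M (?EA \<inter> (?V -` C \<inter> space M))" if [measurable]: "C \<in> sets ?P" for C
    proof -
      have "emeasure \<mu>1 C = emeasure (density M (indicator ?EA)) (?V -` C \<inter> space M)"
        unfolding \<mu>1_def by (subst emeasure_distr) auto
      also have "\<dots> = (\<integral>\<^sup>+ \<omega>. indicator ?EA \<omega> * indicator (?V -` C \<inter> space M) \<omega> \<partial>M)"
        by (subst emeasure_density) auto
      also have "\<dots> = (\<integral>\<^sup>+ \<omega>. indicator (?EA \<inter> (?V -` C \<inter> space M)) \<omega> \<partial>M)"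
        by (intro nn_integral_cong) (auto simp: indicator_def)
      also have "\<dots> = emeasure M (?EA \<inter> (?V -` C \<inter> space M))"
        by (rule nn_integral_indicator) measurable
      finally show ?thesis .
    qed
    have e2: "emeasure \<mu>2 C = ennreal (prob ?EA) * emeasure M (?V -` C \<inter> space M)" if [measurable]: "C \<in> sets ?P" for C
      unfolding \<mu>2_def by (subst emeasure_density) (auto simp: nn_integral_cmult emeasure_distr)
    have "\<mu>1 = \<mu>2"
    proof (rule measure_eqI_PiM_finite[where A="\<lambda>_. space ?P" and I=I and M="\<lambda>_. borel"])
      fix C :: "_ \<Rightarrow> real set" assume C: "\<And>i. i \<in> I \<Longrightarrow> C i \<in> sets borel"
      have [measurable]: "PiE I C \<in> sets ?P" using I C by (intro sets_PiM_I_finite) auto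
      show "emeasure \<mu>1 (PiE I C) = emeasure \<mu>2 (PiE I C)"
        unfolding e1[OF \<open>PiE I C \<in> sets ?P\<close>] e2[OF \<open>PiE I C \<in> sets ?P\<close>] V_PiE
        using rect[OF A C] by (simp add: emeasure_eq_measure ennreal_mult)
    next
      show "range (\<lambda>_::nat. space ?P) \<subseteq> prod_algebra I (\<lambda>_. borel)"
        using prod_algebraI_finite[OF I, of "\<lambda>_. UNIV" "\<lambda>_. borel"] by (auto simp: space_PiM)
      show "emeasure \<mu>1 (space ?P) \<noteq> \<infinity>" by (subst e1) (auto simp: emeasure_eq_measure)
    qed (auto simp: I \<mu>1_def \<mu>2_def)
    then have "emeasure \<mu>1 B = emeasure \<mu>2 B" by simp
    moreover have "emeasure (distr M (borel \<Otimes>\<^sub>M ?P) (\<lambda>\<omega>. (Y k \<omega>, ?V \<omega>))) (A \<times> B) = emeasure M (?EA \<inter> (?V -` B \<inter> space M))"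
      by (subst emeasure_distr) (auto intro!: arg_cong[where f="emeasure M"])
    ultimately show "emeasure (distr M borel (Y k)) A * emeasure (distr M ?P ?V) B = emeasure (distr M (borel \<Otimes>\<^sub>M ?P) (\<lambda>\<omega>. (Y k \<omega>, ?V \<omega>))) (A \<times> B)"
      unfolding e1[OF B] e2[OF B] by (simp add: emeasure_distr emeasure_eq_measure)
  qed
  then show ?thesis by (simp only: centred_gaussian_distr(1)[OF G k])
qed

end

lemma borel_measurable_poly [measurable]:
  "h \<in> borel_measurable N \<Longrightarrow> (\<lambda>x. poly p (h x :: real)) \<in> borel_measurable N"
  by (rule measurable_compose[of h N borel]) (auto intro!: borel_measurable_continuous_onI continuous_intros)

lemma pderiv_sum: "pderiv (\<Sum>i\<in>A. f i) = (\<Sum>i\<in>A. pderiv (f i))"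
  by (induction A rule: infinite_finite_induct) (auto simp: pderiv_add)

lemma stein_algebra:
  fixes c A B :: "'i \<Rightarrow> complex"
  shows "v * (((\<Sum>j\<in>I. c j * A j) + \<i> * ((\<Sum>j\<in>I. c j * B j) * P)) * e) = (\<Sum>j\<in>I. v * c j * ((A j + \<i> * (B j * P)) * e))"
  by (induction I rule: infinite_finite_induct) (simp_all add: algebra_simps)

context prob_space begin

lemma integrable_moments_cis:
  assumes "all_moments M Z" "R \<in> borel_measurable M"
  shows "integrable M (\<lambda>\<omega>. of_real (Z \<omega>) * cis (R \<omega>))"
  by (intro integrable_cis all_moments_integrable assms)

text \<open>Each variable is a residual plus c_j times \<open>Y k\<close>, with residuals
  independent of \<open>Y k\<close>. For fixed residuals all factors are polynomials in one normal
  variable, so the one-dimensional identity applies; the chain rule yields the factor c_j, and v c_j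
  = r k j.\<close>

lemma gaussian_ibp:
  fixes Y :: "'i \<Rightarrow> 'a \<Rightarrow> real" and q s :: "'i \<Rightarrow> real poly"
  assumes G: "centred_gaussian M I Y r" and k: "k \<in> I" and rk: "0 < r k k"
  shows "(LINT \<omega>|M. of_real (Y k \<omega> * (\<Prod>i\<in>I. poly (q i) (Y i \<omega>))) * cis (\<Sum>i\<in>I. poly (s i) (Y i \<omega>))) =
    (\<Sum>j\<in>I. of_real (r k j) * (LINT \<omega>|M. (of_real (poly (pderiv (q j)) (Y j \<omega>) * (\<Prod>i\<in>I - {j}. poly (q i) (Y i \<omega>)))
       + \<i> * of_real (poly (pderiv (s j)) (Y j \<omega>) * (\<Prod>i\<in>I. poly (q i) (Y i \<omega>)))) * cis (\<Sum>i\<in>I. poly (s i) (Y i \<omega>))))"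
proof -
  define v where "v = r k k"
  have v_pos: "0 < v" using rk by (simp add: v_def)
  define c where "c j = r k j / v" for j
  define V where "V \<omega> = (\<lambda>j\<in>I. Y j \<omega> - c j * Y k \<omega>)" for \<omega>
  let ?P = "\<Pi>\<^sub>M j\<in>I. (borel :: real measure)"
  have I: "finite I" and Ym: "\<And>i. i \<in> I \<Longrightarrow> Y i \<in> borel_measurable M" using G by (auto simp: centred_gaussian_def)
  have mom: "\<And>i. i \<in> I \<Longrightarrow> all_moments M (Y i)" by (rule centred_gaussian_moments[OF G])
  have Yk [measurable]: "Y k \<in> borel_measurable M" by (rule Ym[OF k])
  have Vm [measurable]: "V \<in> M \<rightarrow>\<^sub>M ?P"
    unfolding V_def by (intro measurable_restrict borel_measurable_diff borel_measurable_times Ym Yk borel_measurable_const)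
  have V_comp: "V \<omega> i + Y k \<omega> * c i = Y i \<omega>" if "i \<in> I" for i \<omega>
    using that by (simp add: V_def)
  define N where "N = normal_law 0 v"
  define D where "D = distr M ?P V"
  have sets_N [measurable_cong]: "sets N = sets borel" and sets_D [measurable_cong]: "sets D = sets ?P"
    by (simp_all add: N_def D_def)
  interpret N: prob_space N unfolding N_def by (rule prob_space_normal_law) (use v_pos in simp)
  interpret D: prob_space D unfolding D_def by (rule prob_space_distr) measurable
  interpret ND: pair_sigma_finite N D ..
  have law: "distr M (borel \<Otimes>\<^sub>M ?P) (\<lambda>\<omega>. (Y k \<omega>, V \<omega>)) = N \<Otimes>\<^sub>M D"
    using gaussian_regression[OF G k rk] by (simp add: N_def D_def V_def[abs_def] c_def v_def)
  have transfer: "(LINT \<omega>|M. h (Y k \<omega>) (V \<omega>)) = (LINT u|D. (LINT y|N. h y u))"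
    if m: "(\<lambda>(y, u). h y u) \<in> borel_measurable (borel \<Otimes>\<^sub>M ?P)" and i: "integrable M (\<lambda>\<omega>. h (Y k \<omega>) (V \<omega>))"
    for h :: "real \<Rightarrow> ('i \<Rightarrow> real) \<Rightarrow> complex"
  proof -
    have pm: "(\<lambda>\<omega>. (Y k \<omega>, V \<omega>)) \<in> M \<rightarrow>\<^sub>M borel \<Otimes>\<^sub>M ?P" by measurable
    have "integrable (N \<Otimes>\<^sub>M D) (\<lambda>(y, u). h y u)"
      unfolding law[symmetric] using i by (subst integrable_distr_eq[OF pm m]) simp
    then have "(LINT u|D. (LINT y|N. h y u)) = integral\<^sup>L (N \<Otimes>\<^sub>M D) (\<lambda>(y, u). h y u)"
      by (rule ND.integral_snd)
    also have "\<dots> = (LINT \<omega>|M. h (Y k \<omega>) (V \<omega>))"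
      unfolding law[symmetric] by (subst integral_distr[OF pm m]) simp
    finally show ?thesis by simp
  qed
  \<comment> \<open>The linear polynomial that recovers variable i from its residual u i and the
    value of \<open>Y k\<close>; composing with it makes products and phases honest polynomials in
    that value.\<close>
  let ?L = "\<lambda>u i. [:u i, c i:]"
  define Q where "Q u = (\<Prod>i\<in>I. pcompose (q i) (?L u i))" for u
  define R where "R u = (\<Sum>i\<in>I. pcompose (s i) (?L u i))" for u
  have poly_Q: "poly (Q u) y = (\<Prod>i\<in>I. poly (q i) (u i + y * c i))" for u y
    by (simp add: Q_def poly_prod poly_pcompose)
  have poly_R: "poly (R u) y = (\<Sum>i\<in>I. poly (s i) (u i + y * c i))" for u y
    by (simp add: R_def poly_sum poly_pcompose)
  define T where "T j y u = (of_real (poly (pderiv (q j)) (u j + y * c j) * (\<Prod>i\<in>I - {j}. poly (q i) (u i + y * c i)))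
       + \<i> * of_real (poly (pderiv (s j)) (u j + y * c j) * (\<Prod>i\<in>I. poly (q i) (u i + y * c i)))) * cis (poly (R u) y)" for j y u
  define h1 where "h1 y u = of_real (y * poly (Q u) y) * cis (poly (R u) y)" for y u
  define h2 where "h2 y u = (\<Sum>j\<in>I. of_real (r k j) * T j y u)" for y u
  have pdQ: "poly (pderiv (Q u)) y = (\<Sum>j\<in>I. c j * (poly (pderiv (q j)) (u j + y * c j) * (\<Prod>i\<in>I - {j}. poly (q i) (u i + y * c i))))" for u y
    unfolding Q_def pderiv_prod poly_sum
  proof (rule sum.cong[OF refl])
    fix j
    have "poly (pderiv (pcompose (q j) (?L u j))) y = c j * poly (pderiv (q j)) (u j + y * c j)"
      unfolding pderiv_pcompose poly_mult poly_pcompose by (simp add: pderiv_pCons)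
    then show "poly ((\<Prod>i\<in>I - {j}. pcompose (q i) (?L u i)) * pderiv (pcompose (q j) (?L u j))) y =
        c j * (poly (pderiv (q j)) (u j + y * c j) * (\<Prod>i\<in>I - {j}. poly (q i) (u i + y * c i)))"
      by (simp add: poly_prod poly_pcompose)
  qed
  have pdR: "poly (pderiv (R u)) y = (\<Sum>j\<in>I. c j * poly (pderiv (s j)) (u j + y * c j))" for u y
  proof -
    have "poly (pderiv (pcompose (s j) (?L u j))) y = c j * poly (pderiv (s j)) (u j + y * c j)" for j
      unfolding pderiv_pcompose poly_mult poly_pcompose by (simp add: pderiv_pCons)
    then show ?thesis unfolding R_def by (simp add: pderiv_sum poly_sum)
  qed
  have stein: "(LINT y|N. h1 y u) = (LINT y|N. h2 y u)" for u
  proof -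
    have "(LINT y|N. h1 y u) = of_real v * (LINT y|N. (of_real (poly (pderiv (Q u)) y) + \<i> * of_real (poly (pderiv (R u)) y * poly (Q u) y)) * cis (poly (R u) y))"
      unfolding h1_def N_def by (rule stein_poly[OF v_pos])
    also have "\<dots> = (LINT y|N. of_real v * ((of_real (poly (pderiv (Q u)) y) + \<i> * of_real (poly (pderiv (R u)) y * poly (Q u) y)) * cis (poly (R u) y)))"
      by (rule integral_mult_right_zero[symmetric])
    also have "\<dots> = (LINT y|N. h2 y u)"
    proof (intro Bochner_Integration.integral_cong refl)
      fix y
      have rc: "complex_of_real (r k j) = of_real v * of_real (c j)" for j
        using v_pos by (simp add: c_def)
      show "of_real v * ((of_real (poly (pderiv (Q u)) y) + \<i> * of_real (poly (pderiv (R u)) y * poly (Q u) y)) * cis (poly (R u) y)) = h2 y u"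
        unfolding h2_def T_def pdQ pdR poly_Q rc of_real_mult of_real_sum by (rule stein_algebra)
    qed
    finally show ?thesis .
  qed
  have comp: "(\<lambda>p. snd p i + fst p * c i) \<in> borel_measurable (borel \<Otimes>\<^sub>M ?P)" if "i \<in> I" for i
    using that by measurable
  have R_meas: "(\<lambda>p. poly (R (snd p)) (fst p)) \<in> borel_measurable (borel \<Otimes>\<^sub>M ?P)"
    unfolding poly_R by (intro borel_measurable_sum borel_measurable_poly comp) auto
  have Q_meas: "(\<lambda>p. \<Prod>i\<in>K. poly (q i) (snd p i + fst p * c i)) \<in> borel_measurable (borel \<Otimes>\<^sub>M ?P)" if "K \<subseteq> I" for K
    using that by (intro borel_measurable_prod borel_measurable_poly comp) auto
  have h1_meas: "(\<lambda>(y, u). h1 y u) \<in> borel_measurable (borel \<Otimes>\<^sub>M ?P)"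
    unfolding h1_def split_beta poly_Q
    by (intro borel_measurable_times measurable_compose[OF _ borel_measurable_of_real] borel_measurable_cis R_meas Q_meas order_refl measurable_fst)
  have T_meas: "(\<lambda>p. T j (fst p) (snd p)) \<in> borel_measurable (borel \<Otimes>\<^sub>M ?P)" if j: "j \<in> I" for j
    unfolding T_def
    by (intro borel_measurable_times borel_measurable_add measurable_compose[OF _ borel_measurable_of_real] borel_measurable_cis R_meas Q_meas
          order_refl Diff_subset borel_measurable_poly comp[OF j] borel_measurable_const)
  have h2_meas: "(\<lambda>(y, u). h2 y u) \<in> borel_measurable (borel \<Otimes>\<^sub>M ?P)"
    unfolding h2_def split_beta by (intro borel_measurable_sum borel_measurable_times borel_measurable_const T_meas)
  have R_V: "poly (R (V \<omega>)) (Y k \<omega>) = (\<Sum>i\<in>I. poly (s i) (Y i \<omega>))" for \<omega>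
    unfolding poly_R by (intro sum.cong refl) (simp add: V_comp)
  have Q_V: "(\<Prod>i\<in>K. poly (q i) (V \<omega> i + Y k \<omega> * c i)) = (\<Prod>i\<in>K. poly (q i) (Y i \<omega>))" if "K \<subseteq> I" for K \<omega>
    using that by (intro prod.cong refl) (auto simp: V_comp)
  have Rm: "(\<lambda>\<omega>. \<Sum>i\<in>I. poly (s i) (Y i \<omega>)) \<in> borel_measurable M"
    by (intro borel_measurable_sum borel_measurable_poly Ym)
  have Qmom: "all_moments M (\<lambda>\<omega>. \<Prod>i\<in>K. poly (q i) (Y i \<omega>))" if "K \<subseteq> I" for K
    using that by (intro all_moments_prod all_moments_poly mom) auto
  have h1_V: "h1 (Y k \<omega>) (V \<omega>) = of_real (Y k \<omega> * (\<Prod>i\<in>I. poly (q i) (Y i \<omega>))) * cis (\<Sum>i\<in>I. poly (s i) (Y i \<omega>))" for \<omega>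
    unfolding h1_def poly_Q R_V Q_V[OF order_refl] ..
  have T_V: "T j (Y k \<omega>) (V \<omega>) = (of_real (poly (pderiv (q j)) (Y j \<omega>) * (\<Prod>i\<in>I - {j}. poly (q i) (Y i \<omega>)))
       + \<i> * of_real (poly (pderiv (s j)) (Y j \<omega>) * (\<Prod>i\<in>I. poly (q i) (Y i \<omega>)))) * cis (\<Sum>i\<in>I. poly (s i) (Y i \<omega>))"
    if "j \<in> I" for j \<omega>
    unfolding T_def R_V Q_V[OF order_refl] Q_V[of "I - {j}", OF Diff_subset] V_comp[OF that] ..
  have h1_int: "integrable M (\<lambda>\<omega>. h1 (Y k \<omega>) (V \<omega>))"
    unfolding h1_V by (intro integrable_moments_cis all_moments_mult mom[OF k] Qmom order_refl Rm)
  have T_int: "integrable M (\<lambda>\<omega>. T j (Y k \<omega>) (V \<omega>))" if j: "j \<in> I" for j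
    unfolding T_V[OF j] distrib_right mult.assoc
    unfolding mult.assoc[symmetric, of _ "of_real _"]
  proof -
    have "integrable M (\<lambda>\<omega>. of_real (poly (pderiv (q j)) (Y j \<omega>) * (\<Prod>i\<in>I - {j}. poly (q i) (Y i \<omega>))) * cis (\<Sum>i\<in>I. poly (s i) (Y i \<omega>)) +
      \<i> * (of_real (poly (pderiv (s j)) (Y j \<omega>) * (\<Prod>i\<in>I. poly (q i) (Y i \<omega>))) * cis (\<Sum>i\<in>I. poly (s i) (Y i \<omega>))))"
      by (intro Bochner_Integration.integrable_add integrable_mult_right integrable_moments_cis all_moments_mult all_moments_poly mom[OF j] Qmom Rm) auto
    then show "integrable M (\<lambda>\<omega>. of_real (poly (pderiv (q j)) (Y j \<omega>) * (\<Prod>i\<in>I - {j}. poly (q i) (Y i \<omega>))) * cis (\<Sum>i\<in>I. poly (s i) (Y i \<omega>)) +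
      \<i> * of_real (poly (pderiv (s j)) (Y j \<omega>) * (\<Prod>i\<in>I. poly (q i) (Y i \<omega>))) * cis (\<Sum>i\<in>I. poly (s i) (Y i \<omega>)))"
      by (simp only: mult.assoc)
  qed
  have h2_int: "integrable M (\<lambda>\<omega>. h2 (Y k \<omega>) (V \<omega>))"
    unfolding h2_def by (intro Bochner_Integration.integrable_sum integrable_mult_right T_int)
  have "(LINT \<omega>|M. h1 (Y k \<omega>) (V \<omega>)) = (LINT u|D. (LINT y|N. h1 y u))" by (rule transfer[OF h1_meas h1_int])
  also have "\<dots> = (LINT u|D. (LINT y|N. h2 y u))" by (simp only: stein)
  also have "\<dots> = (LINT \<omega>|M. h2 (Y k \<omega>) (V \<omega>))" by (rule transfer[OF h2_meas h2_int, symmetric])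
  also have "\<dots> = (\<Sum>j\<in>I. of_real (r k j) * (LINT \<omega>|M. T j (Y k \<omega>) (V \<omega>)))"
    unfolding h2_def using T_int by (subst Bochner_Integration.integral_sum) auto
  finally show ?thesis unfolding h1_V by (simp add: T_V cong: sum.cong)
qed

end

section \<open>Hermite polynomials\<close>

text \<open>The monic Hermite polynomials for variance v; for v > 0 these are v^(n/2) He_n(x / sqrt
  v) with the probabilists' He_n.\<close>

fun hermite :: "real \<Rightarrow> nat \<Rightarrow> real poly" where
  "hermite v 0 = 1"
| "hermite v (Suc 0) = [:0, 1:]"
| "hermite v (Suc (Suc n)) = [:0, 1:] * hermite v (Suc n) - smult (real (Suc n) * v) (hermite v n)"

text \<open>The recursion in a form uniform in n: at n = 0 the truncated index is harmless because
  its coefficient is 0. The same convention makes \<open>n j - 1\<close> harmless in the moment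
  formulas.\<close>

lemma hermite_Suc: "hermite v (Suc n) = [:0, 1:] * hermite v n - smult (real n * v) (hermite v (n - 1))"
  by (cases n) simp_all

lemma pderiv_hermite: "pderiv (hermite v n) = smult (real n) (hermite v (n - 1))"
proof (induction n rule: less_induct)
  case (less n)
  show ?case
  proof (cases n)
    case (Suc m)
    have IH: "pderiv (hermite v m) = smult (real m) (hermite v (m - 1))" using less Suc by simp
    have IH': "pderiv (hermite v (m - 1)) = smult (real (m - 1)) (hermite v (m - 1 - 1))" using less Suc by simp
    have "pderiv (hermite v (Suc m)) = hermite v m + [:0, 1:] * pderiv (hermite v m) - smult (real m * v) (pderiv (hermite v (m - 1)))"
      unfolding hermite_Suc by (simp add: pderiv_diff pderiv_mult pderiv_smult pderiv_pCons)
    also have "\<dots> = hermite v m + smult (real m) ([:0, 1:] * hermite v (m - 1) - smult (real (m - 1) * v) (hermite v (m - 1 - 1)))"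
      unfolding IH IH' by (simp add: smult_diff_right mult_ac)
    also have "\<dots> = smult (real (Suc m)) (hermite v m)"
    proof (cases m)
      case (Suc p)
      then have "[:0, 1:] * hermite v (m - 1) - smult (real (m - 1) * v) (hermite v (m - 1 - 1)) = hermite v m"
        by (simp only: hermite_Suc[of v p] diff_Suc_1)
      then have "hermite v m + smult (real m) ([:0, 1:] * hermite v (m - 1) - smult (real (m - 1) * v) (hermite v (m - 1 - 1))) =
        smult 1 (hermite v m) + smult (real m) (hermite v m)"
        by (simp only: smult_1_left)
      also have "\<dots> = smult (real (Suc m)) (hermite v m)"
        by (simp only: smult_add_left[symmetric] of_nat_Suc)
      finally show ?thesis .
    qed simp
    finally show ?thesis using Suc by simp
  qed (simp add: pderiv_1)
qed

context prob_space begin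

definition hprod :: "'i set \<Rightarrow> ('i \<Rightarrow> 'a \<Rightarrow> real) \<Rightarrow> real \<Rightarrow> ('i \<Rightarrow> nat) \<Rightarrow> 'a \<Rightarrow> real" where
  "hprod I Y v n \<omega> = (\<Prod>i\<in>I. poly (hermite v (n i)) (Y i \<omega>))"

lemma hprod_upd:
  assumes "finite I" "k \<in> I"
  shows "hprod I Y v (n(k := m)) \<omega> = poly (hermite v m) (Y k \<omega>) * (\<Prod>i\<in>I - {k}. poly (hermite v (n i)) (Y i \<omega>))"
proof -
  have "hprod I Y v (n(k := m)) \<omega> = poly (hermite v ((n(k := m)) k)) (Y k \<omega>) * (\<Prod>i\<in>I - {k}. poly (hermite v ((n(k := m)) i)) (Y i \<omega>))"
    unfolding hprod_def using assms by (rule prod.remove)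
  also have "(\<Prod>i\<in>I - {k}. poly (hermite v ((n(k := m)) i)) (Y i \<omega>)) = (\<Prod>i\<in>I - {k}. poly (hermite v (n i)) (Y i \<omega>))"
    by (intro prod.cong) auto
  finally show ?thesis by (simp only: fun_upd_same)
qed

lemma all_moments_hprod:
  "centred_gaussian M I Y r \<Longrightarrow> all_moments M (hprod I Y v n)"
  unfolding hprod_def[abs_def] by (intro all_moments_prod all_moments_poly centred_gaussian_moments)

text \<open>The contraction of the \<open>k\<close>-th factor with itself cancels against the recursion term of the
  Hermite polynomial.\<close>

lemma wick:
  assumes G: "centred_gaussian M I Y r" and k: "k \<in> I" and rk: "r k k = v" "0 < v"
  shows "(LINT \<omega>|M. of_real (hprod I Y v (n(k := Suc (n k))) \<omega>) * cis (\<Sum>i\<in>I. poly (s i) (Y i \<omega>))) =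
    (\<Sum>j\<in>I - {k}. of_real (r k j * real (n j)) * (LINT \<omega>|M. of_real (hprod I Y v (n(j := n j - 1)) \<omega>) * cis (\<Sum>i\<in>I. poly (s i) (Y i \<omega>))))
    + \<i> * (\<Sum>j\<in>I. of_real (r k j) * (LINT \<omega>|M. of_real (poly (pderiv (s j)) (Y j \<omega>) * hprod I Y v n \<omega>) * cis (\<Sum>i\<in>I. poly (s i) (Y i \<omega>))))"
proof -
  have I: "finite I" and Ym: "\<And>i. i \<in> I \<Longrightarrow> Y i \<in> borel_measurable M" using G by (auto simp: centred_gaussian_def)
  let ?S = "\<lambda>\<omega>. \<Sum>i\<in>I. poly (s i) (Y i \<omega>)"
  have Sm: "?S \<in> borel_measurable M" by (intro borel_measurable_sum borel_measurable_poly Ym)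
  define E where "E Z = (LINT \<omega>|M. of_real (Z \<omega>) * cis (?S \<omega>))" for Z
  have E_add: "E (\<lambda>\<omega>. a * Z \<omega> + b * W \<omega>) = of_real a * E Z + of_real b * E W"
    if "all_moments M Z" "all_moments M W" for a b Z W
  proof -
    have "E (\<lambda>\<omega>. a * Z \<omega> + b * W \<omega>) = (LINT \<omega>|M. of_real a * (of_real (Z \<omega>) * cis (?S \<omega>)) + of_real b * (of_real (W \<omega>) * cis (?S \<omega>)))"
      unfolding E_def by (intro Bochner_Integration.integral_cong refl) (simp add: algebra_simps)
    also have "\<dots> = of_real a * E Z + of_real b * E W"
      using integrable_moments_cis[OF that(1) Sm] integrable_moments_cis[OF that(2) Sm]
      by (subst Bochner_Integration.integral_add) (auto simp: E_def)
    finally show ?thesis .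
  qed
  have hm: "all_moments M (hprod I Y v n)" for n by (rule all_moments_hprod[OF G])
  have Yk: "all_moments M (Y k)" by (rule centred_gaussian_moments[OF G k])
  have rec: "hprod I Y v (n(k := Suc (n k))) = (\<lambda>\<omega>. 1 * (Y k \<omega> * hprod I Y v n \<omega>) + (- (real (n k) * v)) * hprod I Y v (n(k := n k - 1)) \<omega>)"
  proof
    fix \<omega>
    have "hprod I Y v n \<omega> = poly (hermite v (n k)) (Y k \<omega>) * (\<Prod>i\<in>I - {k}. poly (hermite v (n i)) (Y i \<omega>))"
      using hprod_upd[OF I k, of Y v n "n k" \<omega>] by simp
    then show "hprod I Y v (n(k := Suc (n k))) \<omega> = 1 * (Y k \<omega> * hprod I Y v n \<omega>) + (- (real (n k) * v)) * hprod I Y v (n(k := n k - 1)) \<omega>"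
      unfolding hprod_upd[OF I k] hermite_Suc by (simp add: algebra_simps)
  qed
  have ibp: "E (\<lambda>\<omega>. Y k \<omega> * hprod I Y v n \<omega>) = (\<Sum>j\<in>I. of_real (r k j * real (n j)) * E (hprod I Y v (n(j := n j - 1)))
     + \<i> * (of_real (r k j) * E (\<lambda>\<omega>. poly (pderiv (s j)) (Y j \<omega>) * hprod I Y v n \<omega>)))"
  proof -
    have "E (\<lambda>\<omega>. Y k \<omega> * hprod I Y v n \<omega>) = (\<Sum>j\<in>I. of_real (r k j) * (LINT \<omega>|M. (of_real (poly (pderiv (hermite v (n j))) (Y j \<omega>) * (\<Prod>i\<in>I - {j}. poly (hermite v (n i)) (Y i \<omega>)))
       + \<i> * of_real (poly (pderiv (s j)) (Y j \<omega>) * (\<Prod>i\<in>I. poly (hermite v (n i)) (Y i \<omega>)))) * cis (?S \<omega>)))"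
      unfolding E_def hprod_def by (rule gaussian_ibp[OF G k]) (use rk in simp)
    also have "\<dots> = (\<Sum>j\<in>I. of_real (r k j * real (n j)) * E (hprod I Y v (n(j := n j - 1)))
     + \<i> * (of_real (r k j) * E (\<lambda>\<omega>. poly (pderiv (s j)) (Y j \<omega>) * hprod I Y v n \<omega>)))"
    proof (rule sum.cong[OF refl])
      fix j assume j: "j \<in> I"
      have mj: "all_moments M (\<lambda>\<omega>. poly (pderiv (s j)) (Y j \<omega>) * hprod I Y v n \<omega>)"
        by (intro all_moments_mult all_moments_poly hm centred_gaussian_moments[OF G j])
      have "(LINT \<omega>|M. (of_real (poly (pderiv (hermite v (n j))) (Y j \<omega>) * (\<Prod>i\<in>I - {j}. poly (hermite v (n i)) (Y i \<omega>)))
         + \<i> * of_real (poly (pderiv (s j)) (Y j \<omega>) * (\<Prod>i\<in>I. poly (hermite v (n i)) (Y i \<omega>)))) * cis (?S \<omega>))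
       = (LINT \<omega>|M. of_real (real (n j)) * (of_real (hprod I Y v (n(j := n j - 1)) \<omega>) * cis (?S \<omega>)) + \<i> * (of_real (poly (pderiv (s j)) (Y j \<omega>) * hprod I Y v n \<omega>) * cis (?S \<omega>)))"
        by (intro Bochner_Integration.integral_cong refl)
           (simp add: pderiv_hermite hprod_upd[OF I j] hprod_def[of _ _ _ n] algebra_simps)
      also have "\<dots> = of_real (real (n j)) * E (hprod I Y v (n(j := n j - 1))) + \<i> * E (\<lambda>\<omega>. poly (pderiv (s j)) (Y j \<omega>) * hprod I Y v n \<omega>)"
        using integrable_moments_cis[OF hm Sm] integrable_moments_cis[OF mj Sm]
        by (subst Bochner_Integration.integral_add) (auto simp: E_def)
      finally show "of_real (r k j) * (LINT \<omega>|M. (of_real (poly (pderiv (hermite v (n j))) (Y j \<omega>) * (\<Prod>i\<in>I - {j}. poly (hermite v (n i)) (Y i \<omega>)))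
         + \<i> * of_real (poly (pderiv (s j)) (Y j \<omega>) * (\<Prod>i\<in>I. poly (hermite v (n i)) (Y i \<omega>)))) * cis (?S \<omega>)) =
        of_real (r k j * real (n j)) * E (hprod I Y v (n(j := n j - 1))) + \<i> * (of_real (r k j) * E (\<lambda>\<omega>. poly (pderiv (s j)) (Y j \<omega>) * hprod I Y v n \<omega>))"
        by (simp only: distrib_left of_real_mult mult_ac)
    qed
    finally show ?thesis .
  qed
  have "E (hprod I Y v (n(k := Suc (n k)))) = of_real 1 * E (\<lambda>\<omega>. Y k \<omega> * hprod I Y v n \<omega>) + of_real (- (real (n k) * v)) * E (hprod I Y v (n(k := n k - 1)))"
    unfolding rec by (rule E_add) (intro all_moments_mult Yk hm)+
  also have "\<dots> = (\<Sum>j\<in>I - {k}. of_real (r k j * real (n j)) * E (hprod I Y v (n(j := n j - 1))))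
    + \<i> * (\<Sum>j\<in>I. of_real (r k j) * E (\<lambda>\<omega>. poly (pderiv (s j)) (Y j \<omega>) * hprod I Y v n \<omega>))"
    unfolding ibp sum.distrib sum_distrib_left[symmetric]
    using I k by (subst sum.remove[OF I k]) (simp add: rk algebra_simps)
  finally show ?thesis unfolding E_def .
qed

lemma wick_moments:
  assumes G: "centred_gaussian M I Y r" and k: "k \<in> I" and rk: "r k k = v" "0 < v"
  shows "expectation (hprod I Y v (n(k := Suc (n k)))) = (\<Sum>j\<in>I - {k}. r k j * real (n j) * expectation (hprod I Y v (n(j := n j - 1))))"
proof -
  have "complex_of_real (expectation (hprod I Y v (n(k := Suc (n k))))) = of_real (\<Sum>j\<in>I - {k}. r k j * real (n j) * expectation (hprod I Y v (n(j := n j - 1))))"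
    using wick[OF G k rk, of n "\<lambda>_. 0"] by simp
  then show ?thesis by (simp only: of_real_eq_iff)
qed

end

lemma sum_fibres:
  fixes a f :: "_ \<Rightarrow> real"
  assumes "finite K" "finite I" "\<kappa> ` K \<subseteq> I"
  shows "(\<Sum>k\<in>K. a k * f (\<kappa> k)) = (\<Sum>i\<in>I. (\<Sum>k\<in>{k\<in>K. \<kappa> k = i}. a k) * f i)"
proof -
  have "(\<Sum>i\<in>I. (\<Sum>k\<in>{k\<in>K. \<kappa> k = i}. a k) * f i) = (\<Sum>i\<in>I. \<Sum>k\<in>{k\<in>K. \<kappa> k = i}. a k * f (\<kappa> k))"
    by (simp add: sum_distrib_right)
  also have "\<dots> = (\<Sum>k\<in>K. a k * f (\<kappa> k))" by (rule sum.group[OF assms])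
  finally show ?thesis by simp
qed

lemma quad_form_alt: "quad_form I r b = (\<Sum>i\<in>I. b i * (\<Sum>j\<in>I. b j * r i j))"
  by (simp add: quad_form_def sum_distrib_left mult.assoc)

lemma quad_form_reindex:
  assumes "finite K" "finite I" "\<kappa> ` K \<subseteq> I"
  shows "quad_form K (\<lambda>i j. r (\<kappa> i) (\<kappa> j)) a = quad_form I r (\<lambda>i. \<Sum>k\<in>{k\<in>K. \<kappa> k = i}. a k)"
proof -
  let ?b = "\<lambda>i. \<Sum>k\<in>{k\<in>K. \<kappa> k = i}. a k"
  have "quad_form K (\<lambda>i j. r (\<kappa> i) (\<kappa> j)) a = (\<Sum>i\<in>K. a i * (\<Sum>j\<in>K. a j * r (\<kappa> i) (\<kappa> j)))"
    by (rule quad_form_alt)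
  also have "\<dots> = (\<Sum>i\<in>K. a i * (\<Sum>j\<in>I. ?b j * r (\<kappa> i) j))"
    by (intro sum.cong refl) (simp only: sum_fibres[OF assms])
  also have "\<dots> = (\<Sum>i\<in>I. ?b i * (\<Sum>j\<in>I. ?b j * r i j))"
    by (rule sum_fibres[OF assms, of a "\<lambda>i. \<Sum>j\<in>I. ?b j * r i j"])
  finally show ?thesis by (simp only: quad_form_alt)
qed

text \<open>The map \<kappa> need not be injective. This lets two or four points that may coincide
  be treated as a family with distinct indices, so moment recursions need no case distinction on
  coincidences.\<close>

lemma centred_gaussian_reindex:
  assumes G: "centred_gaussian M I Y r" and K: "finite K" "\<kappa> ` K \<subseteq> I"
  shows "centred_gaussian M K (\<lambda>k. Y (\<kappa> k)) (\<lambda>i j. r (\<kappa> i) (\<kappa> j))"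
proof -
  have I: "finite I" using G by (simp add: centred_gaussian_def)
  have "(\<lambda>\<omega>. \<Sum>k\<in>K. a k * Y (\<kappa> k) \<omega>) = (\<lambda>\<omega>. \<Sum>i\<in>I. (\<Sum>k\<in>{k\<in>K. \<kappa> k = i}. a k) * Y i \<omega>)" for a
    by (rule ext) (rule sum_fibres[OF K(1) I K(2)])
  with G K show ?thesis
    unfolding centred_gaussian_def quad_form_reindex[OF K(1) I K(2)]
    by (auto simp: image_subset_iff)
qed

section \<open>Fourth moments\<close>

text \<open>The joint moment of four Hermite polynomials of degrees a, b, c, d, where p, q, s, t, u,
  w are the covariances 12, 13, 14, 23, 24, 34. Each clause removes one point from the first group
  that is not empty and contracts it with a point of a later group.\<close>

fun wick4 :: "real \<Rightarrow> real \<Rightarrow> real \<Rightarrow> real \<Rightarrow> real \<Rightarrow> real \<Rightarrow> nat \<Rightarrow> nat \<Rightarrow> nat \<Rightarrow> nat \<Rightarrow> real" where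
  "wick4 p q s t u w (Suc a) b c d = p * real b * wick4 p q s t u w a (b - 1) c d
     + q * real c * wick4 p q s t u w a b (c - 1) d + s * real d * wick4 p q s t u w a b c (d - 1)"
| "wick4 p q s t u w 0 (Suc b) c d = t * real c * wick4 p q s t u w 0 b (c - 1) d + u * real d * wick4 p q s t u w 0 b c (d - 1)"
| "wick4 p q s t u w 0 0 (Suc c) d = w * real d * wick4 p q s t u w 0 0 c (d - 1)"
| "wick4 p q s t u w 0 0 0 (Suc d) = 0"
| "wick4 p q s t u w 0 0 0 0 = 1"

text \<open>The pairings of four groups of points, as exponents of the edges 12, 13, 14, 23, 24, 34.\<close>

type_synonym pairing = "nat \<times> nat \<times> nat \<times> nat \<times> nat \<times> nat"

definition inc12 :: "pairing \<Rightarrow> pairing" where "inc12 = (\<lambda>(p, q, s, t, u, w). (Suc p, q, s, t, u, w))"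
definition inc13 :: "pairing \<Rightarrow> pairing" where "inc13 = (\<lambda>(p, q, s, t, u, w). (p, Suc q, s, t, u, w))"
definition inc14 :: "pairing \<Rightarrow> pairing" where "inc14 = (\<lambda>(p, q, s, t, u, w). (p, q, Suc s, t, u, w))"
definition inc23 :: "pairing \<Rightarrow> pairing" where "inc23 = (\<lambda>(p, q, s, t, u, w). (p, q, s, Suc t, u, w))"
definition inc24 :: "pairing \<Rightarrow> pairing" where "inc24 = (\<lambda>(p, q, s, t, u, w). (p, q, s, t, Suc u, w))"
definition inc34 :: "pairing \<Rightarrow> pairing" where "inc34 = (\<lambda>(p, q, s, t, u, w). (p, q, s, t, u, Suc w))"

lemmas inc_defs = inc12_def inc13_def inc14_def inc23_def inc24_def inc34_def

text \<open>Repetitions in the list carry the multiplicities: a point of one group may be matched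
  with any of the remaining points of a later group. No edge joins a group to itself, which reflects
  the cancellation of self-contractions of Hermite polynomials.\<close>

fun pairings :: "nat \<Rightarrow> nat \<Rightarrow> nat \<Rightarrow> nat \<Rightarrow> pairing list" where
  "pairings (Suc a) b c d = concat (replicate b (map inc12 (pairings a (b - 1) c d)))
     @ concat (replicate c (map inc13 (pairings a b (c - 1) d))) @ concat (replicate d (map inc14 (pairings a b c (d - 1))))"
| "pairings 0 (Suc b) c d = concat (replicate c (map inc23 (pairings 0 b (c - 1) d)))
     @ concat (replicate d (map inc24 (pairings 0 b c (d - 1))))"
| "pairings 0 0 (Suc c) d = concat (replicate d (map inc34 (pairings 0 0 c (d - 1))))"
| "pairings 0 0 0 (Suc d) = []"
| "pairings 0 0 0 0 = [(0, 0, 0, 0, 0, 0)]"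

definition monomial6 :: "real \<Rightarrow> real \<Rightarrow> real \<Rightarrow> real \<Rightarrow> real \<Rightarrow> real \<Rightarrow> pairing \<Rightarrow> real" where
  "monomial6 p q s t u w = (\<lambda>(a, b, c, d, e, f). p ^ a * q ^ b * s ^ c * t ^ d * u ^ e * w ^ f)"

lemma monomial6_inc [simp]:
  "monomial6 p q s t u w (inc12 e) = p * monomial6 p q s t u w e"
  "monomial6 p q s t u w (inc13 e) = q * monomial6 p q s t u w e"
  "monomial6 p q s t u w (inc14 e) = s * monomial6 p q s t u w e"
  "monomial6 p q s t u w (inc23 e) = t * monomial6 p q s t u w e"
  "monomial6 p q s t u w (inc24 e) = u * monomial6 p q s t u w e"
  "monomial6 p q s t u w (inc34 e) = w * monomial6 p q s t u w e"
  by (cases e; simp add: monomial6_def inc_defs)+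

lemma sum_list_concat_replicate:
  assumes "\<And>e. f (h e) = p * (f e :: real)"
  shows "(\<Sum>e\<leftarrow>concat (replicate n (map h xs)). f e) = p * real n * (\<Sum>e\<leftarrow>xs. f e)"
proof (induction n)
  case (Suc n)
  have "(\<Sum>e\<leftarrow>map h xs. f e) = p * (\<Sum>e\<leftarrow>xs. f e)"
    by (simp add: o_def assms sum_list_const_mult)
  then show ?case using Suc by (simp add: algebra_simps)
qed simp

lemma wick4_pairings: "wick4 p q s t u w a b c d = (\<Sum>e\<leftarrow>pairings a b c d. monomial6 p q s t u w e)"
proof -
  note red = pairings.simps wick4.simps map_append sum_list_append add.assoc
    sum_list_concat_replicate[of "monomial6 p q s t u w" inc12, OF monomial6_inc(1)]
    sum_list_concat_replicate[of "monomial6 p q s t u w" inc13, OF monomial6_inc(2)]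
    sum_list_concat_replicate[of "monomial6 p q s t u w" inc14, OF monomial6_inc(3)]
    sum_list_concat_replicate[of "monomial6 p q s t u w" inc23, OF monomial6_inc(4)]
    sum_list_concat_replicate[of "monomial6 p q s t u w" inc24, OF monomial6_inc(5)]
    sum_list_concat_replicate[of "monomial6 p q s t u w" inc34, OF monomial6_inc(6)]
  show ?thesis
  proof (induction a b c d rule: pairings.induct)
    case (1 a b c d)
    show ?case by (simp only: red "1.IH")
  next
    case (2 b c d)
    show ?case by (simp only: red "2.IH")
  next
    case (3 c d)
    show ?case by (simp only: red "3.IH")
  qed (simp_all add: monomial6_def)
qed

lemma pairings_degree:
  "e \<in> set (pairings a b c d) \<Longrightarrow>
    (case e of (p, q, s, t, u, w) \<Rightarrow> p + q + s = a \<and> p + t + u = b \<and> q + t + w = c \<and> s + u + w = d)"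
proof (induction a b c d arbitrary: e rule: pairings.induct)
  case (1 a b c d)
  from "1.prems" consider
      x where "x \<in> set (pairings a (b - 1) c d)" "0 < b" "e = inc12 x"
    | x where "x \<in> set (pairings a b (c - 1) d)" "0 < c" "e = inc13 x"
    | x where "x \<in> set (pairings a b c (d - 1))" "0 < d" "e = inc14 x"
    by (auto simp: set_replicate_conv_if split: if_splits)
  then show ?case
  proof cases
    case (1 x)
    show ?thesis using "1.IH"(1)[OF 1(1)] 1(2,3) by (cases x) (auto simp: inc_defs)
  next
    case (2 x)
    show ?thesis using "1.IH"(2)[OF 2(1)] 2(2,3) by (cases x) (auto simp: inc_defs)
  next
    case (3 x)
    show ?thesis using "1.IH"(3)[OF 3(1)] 3(2,3) by (cases x) (auto simp: inc_defs)
  qed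
next
  case (2 b c d)
  from "2.prems" consider
      x where "x \<in> set (pairings 0 b (c - 1) d)" "0 < c" "e = inc23 x"
    | x where "x \<in> set (pairings 0 b c (d - 1))" "0 < d" "e = inc24 x"
    by (auto simp: set_replicate_conv_if split: if_splits)
  then show ?case
  proof cases
    case (1 x)
    show ?thesis using "2.IH"(1)[OF 1(1)] 1(2,3) by (cases x) (auto simp: inc_defs)
  next
    case (2 x)
    show ?thesis using "2.IH"(2)[OF 2(1)] 2(2,3) by (cases x) (auto simp: inc_defs)
  qed
next
  case (3 c d)
  from "3.prems" obtain x where "x \<in> set (pairings 0 0 c (d - 1))" "0 < d" "e = inc34 x"
    by (auto simp: set_replicate_conv_if split: if_splits)
  then show ?case using "3.IH"[of x] by (cases x) (auto simp: inc_defs)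
qed auto

text \<open>Setting the four cross covariances to 0 keeps only the pairings that do not join groups
  1, 2 to groups 3, 4, and those factor. On the right the cross covariances may be arbitrary, since
  with two empty groups they are multiplied by 0. The product of two expectations is thereby the sum
  over disconnected pairings.\<close>

lemma wick4_factor: "wick4 p 0 0 0 0 w a b c d = wick4 p q s t u w a b 0 0 * wick4 p q s t u w 0 0 c d"
  by (induction a b c d rule: pairings.induct) simp_all

text \<open>A monomial of degree m + 1 that contains \<open>A\<close> and at least one of
  \<open>B\<close>, \<open>C\<close> lies below the extreme monomials: first the mixed part in
  \<open>B\<close> and \<open>C\<close> is bounded by pure powers, then \<open>A\<close> is compared
  with each. Only products with exponents m and 1 remain, which is the form of a four-cycle
  sum.\<close>

lemma pairing_product_bound:
  fixes A B C :: real
  assumes "0 \<le> A" "0 \<le> B" "0 \<le> C" and m: "m = a + b + c" "1 \<le> b + c"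
  shows "A ^ Suc a * B ^ b * C ^ c \<le> A ^ m * B + A * B ^ m + (A ^ m * C + A * C ^ m)"
proof -
  have two: "A ^ Suc a * B ^ Suc n \<le> A ^ (a + Suc n) * B + A * B ^ (a + Suc n)" if "0 \<le> B" for n B
  proof (cases "B \<le> A")
    case True
    have "A ^ Suc a * B ^ Suc n = (A ^ Suc a * B) * B ^ n" by simp
    also have "\<dots> \<le> (A ^ Suc a * B) * A ^ n" using assms that True by (intro mult_left_mono power_mono) auto
    also have "\<dots> = A ^ (a + Suc n) * B" by (simp add: power_add mult_ac)
    finally show ?thesis using assms that by (simp add: add_increasing2)
  next
    case False
    have "A ^ Suc a * B ^ Suc n = (A * B ^ Suc n) * A ^ a" by simp
    also have "\<dots> \<le> (A * B ^ Suc n) * B ^ a" using assms that False by (intro mult_left_mono power_mono) auto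
    also have "\<dots> = A * B ^ (a + Suc n)" by (simp add: power_add mult_ac)
    finally show ?thesis using assms that by (simp add: add_increasing)
  qed
  obtain n where n: "b + c = Suc n" using m by (cases "b + c") auto
  have "B ^ b * C ^ c \<le> B ^ Suc n + C ^ Suc n"
  proof (cases "B \<le> C")
    case True
    then have "B ^ b * C ^ c \<le> C ^ b * C ^ c" using assms by (intro mult_right_mono power_mono) auto
    also have "\<dots> = C ^ Suc n" by (simp add: n flip: power_add)
    finally show ?thesis using assms by (simp add: add_increasing)
  next
    case False
    then have "B ^ b * C ^ c \<le> B ^ b * B ^ c" using assms by (intro mult_left_mono power_mono) auto
    also have "\<dots> = B ^ Suc n" by (simp add: n flip: power_add)
    finally show ?thesis using assms by (simp add: add_increasing2)
  qed
  then have "A ^ Suc a * (B ^ b * C ^ c) \<le> A ^ Suc a * (B ^ Suc n + C ^ Suc n)"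
    using assms by (intro mult_left_mono) auto
  also have "\<dots> \<le> (A ^ (a + Suc n) * B + A * B ^ (a + Suc n)) + (A ^ (a + Suc n) * C + A * C ^ (a + Suc n))"
    unfolding distrib_left using assms by (intro add_mono two) auto
  finally show ?thesis using m n by (simp add: mult.assoc add.assoc)
qed

text \<open>With all four groups of size m, the degree equations force opposite edges to have equal
  exponents, so every pairing contributes a monomial in the products \<open>A\<close>,
  \<open>B\<close>, \<open>C\<close> of opposite covariances. The disconnected pairings cancel
  against the product of expectations, and each remaining one has a positive exponent on
  \<open>B\<close> or \<open>C\<close>.\<close>

lemma wick4_covariance_bound:
  fixes p q s t u w :: real and m :: nat
  defines "A \<equiv> \<bar>p\<bar> * \<bar>w\<bar>" and "B \<equiv> \<bar>q\<bar> * \<bar>u\<bar>" and "C \<equiv> \<bar>s\<bar> * \<bar>t\<bar>"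
  shows "\<bar>p * w * (wick4 p q s t u w m m m m - wick4 p q s t u w m m 0 0 * wick4 p q s t u w 0 0 m m)\<bar>
    \<le> real (length (pairings m m m m)) * (A ^ m * B + A * B ^ m + (A ^ m * C + A * C ^ m))"
proof -
  let ?P = "pairings m m m m"
  let ?\<Phi> = "A ^ m * B + A * B ^ m + (A ^ m * C + A * C ^ m)"
  have nn: "0 \<le> A" "0 \<le> B" "0 \<le> C" by (auto simp: A_def B_def C_def)
  have eq0: "p * w * (wick4 p q s t u w m m m m - wick4 p q s t u w m m 0 0 * wick4 p q s t u w 0 0 m m)
    = (\<Sum>e\<leftarrow>?P. p * w * (monomial6 p q s t u w e - monomial6 p 0 0 0 0 w e))"
  proof -
    have F: "wick4 p q s t u w m m 0 0 * wick4 p q s t u w 0 0 m m = wick4 p 0 0 0 0 w m m m m"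
      by (rule wick4_factor[symmetric])
    show ?thesis unfolding F unfolding wick4_pairings by (simp add: sum_list_subtractf sum_list_const_mult)
  qed
  have eq: "\<bar>p * w * (wick4 p q s t u w m m m m - wick4 p q s t u w m m 0 0 * wick4 p q s t u w 0 0 m m)\<bar>
    = \<bar>\<Sum>e\<leftarrow>?P. p * w * (monomial6 p q s t u w e - monomial6 p 0 0 0 0 w e)\<bar>"
    by (rule arg_cong[OF eq0])
  have "\<bar>\<Sum>e\<leftarrow>xs. f e\<bar> \<le> (\<Sum>e\<leftarrow>xs. \<bar>f e\<bar>)" for f :: "pairing \<Rightarrow> real" and xs
    by (induction xs) (auto intro: order_trans[OF abs_triangle_ineq])
  then have "\<bar>\<Sum>e\<leftarrow>?P. p * w * (monomial6 p q s t u w e - monomial6 p 0 0 0 0 w e)\<bar> \<le> (\<Sum>e\<leftarrow>?P. \<bar>p * w * (monomial6 p q s t u w e - monomial6 p 0 0 0 0 w e)\<bar>)"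
    .
  also have "\<dots> \<le> (\<Sum>e\<leftarrow>?P. ?\<Phi>)"
  proof (rule sum_list_mono)
    fix e assume "e \<in> set ?P"
    note deg = pairings_degree[OF this]
    obtain e1 e2 e3 e4 e5 e6 where e0: "e = (e1, e2, e3, e4, e5, e6)" by (cases e)
    from deg have e: "e = (e1, e2, e3, e4, e5, e6)"
      "e1 + e2 + e3 = m" "e1 + e4 + e5 = m" "e2 + e4 + e6 = m" "e3 + e5 + e6 = m"
      by (simp_all only: e0 prod.case)
    then have eq: "e6 = e1" "e5 = e2" "e4 = e3" by linarith+
    show "\<bar>p * w * (monomial6 p q s t u w e - monomial6 p 0 0 0 0 w e)\<bar> \<le> ?\<Phi>"
    proof (cases "e2 + e3 = 0")
      case True
      then have "e2 = 0" "e3 = 0" by auto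
      then have "monomial6 p q s t u w e = monomial6 p 0 0 0 0 w e"
        unfolding e(1) eq monomial6_def by simp
      then show ?thesis using nn by simp
    next
      case False
      then have z: "monomial6 p 0 0 0 0 w e = 0" unfolding e(1) eq monomial6_def by (auto simp: power_0_left)
      have "\<bar>p * w * (monomial6 p q s t u w e - monomial6 p 0 0 0 0 w e)\<bar> = A ^ Suc e1 * B ^ e2 * C ^ e3"
        unfolding z diff_zero unfolding e(1) eq monomial6_def A_def B_def C_def
        by (simp add: abs_mult power_abs power_mult_distrib)
      also have "\<dots> \<le> ?\<Phi>" by (rule pairing_product_bound) (use nn False e(2) in linarith)+
      finally show ?thesis .
    qed
  qed
  also have "\<dots> = real (length ?P) * ?\<Phi>" by (simp add: sum_list_triv)
  finally show ?thesis unfolding eq .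
qed

context prob_space begin

lemma hermite_mean:
  assumes G: "centred_gaussian M I Y r" and k: "k \<in> I" "r k k = v" "0 < v" and m: "1 \<le> m"
  shows "expectation (\<lambda>\<omega>. poly (hermite v m) (Y k \<omega>)) = 0"
proof -
  have I: "finite I" using G by (simp add: centred_gaussian_def)
  obtain p where p: "m = Suc p" using m by (cases m) auto
  let ?n = "(\<lambda>_. 0)(k := p)"
  have "hprod I Y v (?n(k := Suc (?n k))) = (\<lambda>\<omega>. poly (hermite v m) (Y k \<omega>))"
    by (rule ext) (simp add: hprod_upd[OF I k(1)] p prod.neutral)
  moreover have "expectation (hprod I Y v (?n(k := Suc (?n k)))) = 0"
    unfolding wick_moments[OF G k, of ?n] by (intro sum.neutral) auto
  ultimately show ?thesis by simp
qed

text \<open>Contracting one point of the first factor with one of the m + 1 points of the second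
  lowers both degrees by one; iterating gives m! pairings. The points are relabelled by 0 and 1 so
  that \<open>k = j\<close> is covered as well.\<close>

lemma hermite_cov:
  assumes G: "centred_gaussian M I Y r" and k: "k \<in> I" "j \<in> I" and v: "r k k = v" "r j j = v" "0 < v"
  shows "expectation (\<lambda>\<omega>. poly (hermite v m) (Y k \<omega>) * poly (hermite v m) (Y j \<omega>)) = fact m * r k j ^ m"
proof -
  define \<kappa> where "\<kappa> i = (if i = 0 then k else j)" for i :: nat
  let ?I = "{0, 1} :: nat set"
  let ?Y = "\<lambda>i. Y (\<kappa> i)" and ?r = "\<lambda>i i'. r (\<kappa> i) (\<kappa> i')"
  have G2: "centred_gaussian M ?I ?Y ?r"
    by (rule centred_gaussian_reindex[OF G]) (auto simp: \<kappa>_def k)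
  have v0: "?r 0 0 = v" using v by (simp add: \<kappa>_def)
  have step: "expectation (hprod ?I ?Y v ((\<lambda>_. 0)(0 := m, 1 := m))) = fact m * r k j ^ m"
  proof (induction m)
    case 0
    then show ?case by (simp add: hprod_def[abs_def] prob_space)
  next
    case (Suc m)
    let ?n = "(\<lambda>_. 0)(0 := m, 1 := Suc m) :: nat \<Rightarrow> nat"
    have single: "(\<Sum>i\<in>{1::nat}. f i) = f 1" for f :: "nat \<Rightarrow> real" by simp
    have e: "(\<lambda>_. 0)(0 := Suc m, 1 := Suc m) = ?n(0 := Suc (?n 0))" by auto
    have e2: "?n(1 := ?n 1 - 1) = (\<lambda>_. 0)(0 := m, 1 := m)" by auto
    have "expectation (hprod ?I ?Y v ((\<lambda>_. 0)(0 := Suc m, 1 := Suc m))) = (\<Sum>i\<in>?I - {0}. ?r 0 i * real (?n i) * expectation (hprod ?I ?Y v (?n(i := ?n i - 1))))"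
      unfolding e by (rule wick_moments[OF G2]) (use v0 v(3) in auto)
    also have "?I - {0} = {1}" by auto
    also have "(\<Sum>i\<in>{1}. ?r 0 i * real (?n i) * expectation (hprod ?I ?Y v (?n(i := ?n i - 1)))) = r k j * real (Suc m) * (fact m * r k j ^ m)"
      unfolding single e2 Suc.IH by (simp add: \<kappa>_def)
    finally show ?case by (simp add: mult_ac)
  qed
  have "hprod ?I ?Y v ((\<lambda>_. 0)(0 := m, 1 := m)) = (\<lambda>\<omega>. poly (hermite v m) (Y k \<omega>) * poly (hermite v m) (Y j \<omega>))"
    by (auto simp: hprod_def \<kappa>_def)
  with step show ?thesis by simp
qed

text \<open>Removing a point from the first nonempty group is the moment recursion at that index.
  Already emptied groups contribute 0 because their degree is a factor.\<close>

lemma hermite_four: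
  fixes Y :: "nat \<Rightarrow> 'a \<Rightarrow> real"
  assumes G: "centred_gaussian M {0, 1, 2, 3} Y r" and v: "\<And>i. i \<in> {0, 1, 2, 3} \<Longrightarrow> r i i = v" "0 < v"
  shows "expectation (hprod {0, 1, 2, 3} Y v ((\<lambda>_. 0)(0 := a, 1 := b, 2 := c, 3 := d)))
    = wick4 (r 0 1) (r 0 2) (r 0 3) (r 1 2) (r 1 3) (r 2 3) a b c d"
proof (induction a b c d rule: pairings.induct)
  case (1 a b c d)
  let ?n = "(\<lambda>_. 0)(0 := a, 1 := b, 2 := c, 3 := d) :: nat \<Rightarrow> nat"
  have e: "(\<lambda>_. 0)(0 := Suc a, 1 := b, 2 := c, 3 := d) = ?n(0 := Suc (?n 0))"
    "?n(1 := ?n 1 - 1) = (\<lambda>_. 0)(0 := a, 1 := b - 1, 2 := c, 3 := d)"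
    "?n(2 := ?n 2 - 1) = (\<lambda>_. 0)(0 := a, 1 := b, 2 := c - 1, 3 := d)"
    "?n(3 := ?n 3 - 1) = (\<lambda>_. 0)(0 := a, 1 := b, 2 := c, 3 := d - 1)" by auto
  have s: "{0, 1, 2, 3} - {0} = {1, 2, 3 :: nat}" by auto
  have "expectation (hprod {0, 1, 2, 3} Y v (?n(0 := Suc (?n 0)))) = (\<Sum>j\<in>{0, 1, 2, 3} - {0}. r 0 j * real (?n j) * expectation (hprod {0, 1, 2, 3} Y v (?n(j := ?n j - 1))))"
    by (rule wick_moments[OF G]) (use v in auto)
  also have "\<dots> = r 0 1 * real b * expectation (hprod {0, 1, 2, 3} Y v (?n(1 := ?n 1 - 1)))
     + r 0 2 * real c * expectation (hprod {0, 1, 2, 3} Y v (?n(2 := ?n 2 - 1))) + r 0 3 * real d * expectation (hprod {0, 1, 2, 3} Y v (?n(3 := ?n 3 - 1)))"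
    unfolding s by simp
  finally show ?case unfolding e(1) unfolding e(2-) "1.IH" by (simp only: wick4.simps)
next
  case (2 b c d)
  let ?n = "(\<lambda>_. 0)(0 := 0, 1 := b, 2 := c, 3 := d) :: nat \<Rightarrow> nat"
  have e: "(\<lambda>_. 0)(0 := 0, 1 := Suc b, 2 := c, 3 := d) = ?n(1 := Suc (?n 1))"
    "?n(2 := ?n 2 - 1) = (\<lambda>_. 0)(0 := 0, 1 := b, 2 := c - 1, 3 := d)"
    "?n(3 := ?n 3 - 1) = (\<lambda>_. 0)(0 := 0, 1 := b, 2 := c, 3 := d - 1)" by auto
  have s: "{0, 1, 2, 3} - {1} = {0, 2, 3 :: nat}" by auto
  have "expectation (hprod {0, 1, 2, 3} Y v (?n(1 := Suc (?n 1)))) = (\<Sum>j\<in>{0, 1, 2, 3} - {1}. r 1 j * real (?n j) * expectation (hprod {0, 1, 2, 3} Y v (?n(j := ?n j - 1))))"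
    by (rule wick_moments[OF G]) (use v in auto)
  also have "\<dots> = r 1 2 * real c * expectation (hprod {0, 1, 2, 3} Y v (?n(2 := ?n 2 - 1))) + r 1 3 * real d * expectation (hprod {0, 1, 2, 3} Y v (?n(3 := ?n 3 - 1)))"
    unfolding s by simp
  finally show ?case unfolding e(1) unfolding e(2-) "2.IH" by (simp only: wick4.simps)
next
  case (3 c d)
  let ?n = "(\<lambda>_. 0)(0 := 0, 1 := 0, 2 := c, 3 := d) :: nat \<Rightarrow> nat"
  have e: "(\<lambda>_. 0)(0 := 0, 1 := 0, 2 := Suc c, 3 := d) = ?n(2 := Suc (?n 2))"
    "?n(3 := ?n 3 - 1) = (\<lambda>_. 0)(0 := 0, 1 := 0, 2 := c, 3 := d - 1)" by auto
  have s: "{0, 1, 2, 3} - {2} = {0, 1, 3 :: nat}" by auto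
  have "expectation (hprod {0, 1, 2, 3} Y v (?n(2 := Suc (?n 2)))) = (\<Sum>j\<in>{0, 1, 2, 3} - {2}. r 2 j * real (?n j) * expectation (hprod {0, 1, 2, 3} Y v (?n(j := ?n j - 1))))"
    by (rule wick_moments[OF G]) (use v in auto)
  also have "\<dots> = r 2 3 * real d * expectation (hprod {0, 1, 2, 3} Y v (?n(3 := ?n 3 - 1)))"
    unfolding s by simp
  finally show ?case unfolding e(1) unfolding e(2-) "3.IH" by (simp only: wick4.simps)
next
  case (4 d)
  let ?n = "(\<lambda>_. 0)(0 := 0, 1 := 0, 2 := 0, 3 := d) :: nat \<Rightarrow> nat"
  have e: "(\<lambda>_. 0)(0 := 0, 1 := 0, 2 := 0, 3 := Suc d) = ?n(3 := Suc (?n 3))" by auto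
  have "expectation (hprod {0, 1, 2, 3} Y v (?n(3 := Suc (?n 3)))) = (\<Sum>j\<in>{0, 1, 2, 3} - {3}. r 3 j * real (?n j) * expectation (hprod {0, 1, 2, 3} Y v (?n(j := ?n j - 1))))"
    by (rule wick_moments[OF G]) (use v in auto)
  also have "\<dots> = 0" by (intro sum.neutral) auto
  finally show ?case unfolding e by (simp only: wick4.simps)
next
  case 5
  then show ?case by (simp add: hprod_def[abs_def] prob_space)
qed

end

section \<open>Characteristic functions of Hermite sums\<close>

definition weighted_sum4 :: "'i set \<Rightarrow> ('i \<Rightarrow> real) \<Rightarrow> ('i \<Rightarrow> 'i \<Rightarrow> 'i \<Rightarrow> 'i \<Rightarrow> real) \<Rightarrow> real" where
  "weighted_sum4 J w g = (\<Sum>i\<in>J. \<Sum>j\<in>J. \<Sum>k\<in>J. \<Sum>p\<in>J. w i * w j * w k * w p * g i j k p)"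

lemma weighted_sum4_swap12: "weighted_sum4 J w (\<lambda>i j k p. g j i k p) = weighted_sum4 J w g"
  unfolding weighted_sum4_def by (subst sum.swap) (simp only: mult.commute[of "w _" "w _"])

lemma weighted_sum4_swap23: "weighted_sum4 J w (\<lambda>i j k p. g i k j p) = weighted_sum4 J w g"
proof -
  have "(\<Sum>j\<in>J. \<Sum>k\<in>J. \<Sum>p\<in>J. w i * w j * w k * w p * g i k j p) = (\<Sum>k\<in>J. \<Sum>j\<in>J. \<Sum>p\<in>J. w i * w k * w j * w p * g i k j p)" for i
    by (subst sum.swap, intro sum.cong refl) (simp only: mult_ac)
  then show ?thesis unfolding weighted_sum4_def by (simp only:)
qed

lemma weighted_sum4_swap34: "weighted_sum4 J w (\<lambda>i j k p. g i j p k) = weighted_sum4 J w g"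
proof -
  have "(\<Sum>k\<in>J. \<Sum>p\<in>J. w i * w j * w k * w p * g i j p k) = (\<Sum>p\<in>J. \<Sum>k\<in>J. w i * w j * w p * w k * g i j p k)" for i j
    by (subst sum.swap, intro sum.cong refl) (simp only: mult_ac)
  then show ?thesis unfolding weighted_sum4_def by (simp only:)
qed

lemma weighted_sum4_mono:
  assumes "\<And>i. i \<in> J \<Longrightarrow> 0 \<le> w i"
    "\<And>i j k p. i \<in> J \<Longrightarrow> j \<in> J \<Longrightarrow> k \<in> J \<Longrightarrow> p \<in> J \<Longrightarrow> g i j k p \<le> h i j k p"
  shows "weighted_sum4 J w g \<le> weighted_sum4 J w h"
  unfolding weighted_sum4_def using assms by (intro sum_mono mult_left_mono) auto

lemma weighted_sum4_add: "weighted_sum4 J w (\<lambda>i j k p. g i j k p + h i j k p) = weighted_sum4 J w g + weighted_sum4 J w h"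
  by (simp add: weighted_sum4_def distrib_left sum.distrib)

lemma weighted_sum4_cmult: "weighted_sum4 J w (\<lambda>i j k p. c * g i j k p) = c * weighted_sum4 J w g"
  by (simp add: weighted_sum4_def sum_distrib_left mult.left_commute)

text \<open>The edges ij, jp, pk, ki form a cycle, two opposite edges with exponent m and two with
  exponent 1. The inequality between geometric and arithmetic mean replaces the two simple edges by
  the square of one of them. Then j and p are leaves, each summing to at most R1, the squared edge
  sums to at most R2, and the last point gives the total weight.\<close>

lemma four_cycle_bound:
  fixes \<rho> :: "'i \<Rightarrow> 'i \<Rightarrow> real"
  assumes w: "\<And>i. i \<in> J \<Longrightarrow> 0 \<le> w i" and \<rho>: "\<And>i j. 0 \<le> \<rho> i j" and sym: "\<And>i j. i \<in> J \<Longrightarrow> j \<in> J \<Longrightarrow> \<rho> i j = \<rho> j i"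
    and R1: "\<And>i. i \<in> J \<Longrightarrow> (\<Sum>k\<in>J. w k * \<rho> i k ^ m) \<le> R1" and R2: "\<And>i. i \<in> J \<Longrightarrow> (\<Sum>k\<in>J. w k * (\<rho> i k)\<^sup>2) \<le> R2"
  shows "weighted_sum4 J w (\<lambda>i j k p. (\<rho> i j * \<rho> k p) ^ m * (\<rho> i k * \<rho> j p)) \<le> (\<Sum>i\<in>J. w i) * R2 * R1\<^sup>2"
proof -
  define h where "h i j k p = (\<rho> i j * \<rho> k p) ^ m * (\<rho> i k)\<^sup>2" for i j k p
  have h_bound: "weighted_sum4 J w h \<le> (\<Sum>i\<in>J. w i) * R2 * R1\<^sup>2"
  proof -
    have "weighted_sum4 J w h = (\<Sum>i\<in>J. \<Sum>k\<in>J. \<Sum>j\<in>J. \<Sum>p\<in>J. w i * w j * w k * w p * h i j k p)"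
      unfolding weighted_sum4_def by (intro sum.cong refl sum.swap)
    also have "\<dots> = (\<Sum>i\<in>J. \<Sum>k\<in>J. w i * (w k * (\<rho> i k)\<^sup>2) * ((\<Sum>j\<in>J. w j * \<rho> i j ^ m) * (\<Sum>p\<in>J. w p * \<rho> k p ^ m)))"
    proof (intro sum.cong refl)
      fix i k
      have "(\<Sum>j\<in>J. \<Sum>p\<in>J. w i * w j * w k * w p * h i j k p) = (\<Sum>j\<in>J. \<Sum>p\<in>J. w i * (w k * (\<rho> i k)\<^sup>2) * ((w j * \<rho> i j ^ m) * (w p * \<rho> k p ^ m)))"
        by (intro sum.cong refl) (simp only: h_def power_mult_distrib mult_ac)
      also have "\<dots> = w i * (w k * (\<rho> i k)\<^sup>2) * ((\<Sum>j\<in>J. w j * \<rho> i j ^ m) * (\<Sum>p\<in>J. w p * \<rho> k p ^ m))"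
        unfolding sum_product by (simp only: sum_distrib_left)
      finally show "(\<Sum>j\<in>J. \<Sum>p\<in>J. w i * w j * w k * w p * h i j k p) = w i * (w k * (\<rho> i k)\<^sup>2) * ((\<Sum>j\<in>J. w j * \<rho> i j ^ m) * (\<Sum>p\<in>J. w p * \<rho> k p ^ m))" .
    qed
    also have "\<dots> \<le> (\<Sum>i\<in>J. \<Sum>k\<in>J. w i * (w k * (\<rho> i k)\<^sup>2) * R1\<^sup>2)"
    proof (intro sum_mono mult_left_mono)
      fix i k assume ik: "i \<in> J" "k \<in> J"
      have nn: "0 \<le> (\<Sum>j\<in>J. w j * \<rho> i j ^ m)" for i using w \<rho> by (intro sum_nonneg) auto
      show "(\<Sum>j\<in>J. w j * \<rho> i j ^ m) * (\<Sum>p\<in>J. w p * \<rho> k p ^ m) \<le> R1\<^sup>2"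
        unfolding power2_eq_square using R1 ik nn order_trans[OF nn R1] by (intro mult_mono) auto
      show "0 \<le> w i * (w k * (\<rho> i k)\<^sup>2)" using w ik by auto
    qed
    also have "\<dots> = (\<Sum>i\<in>J. w i * (\<Sum>k\<in>J. w k * (\<rho> i k)\<^sup>2)) * R1\<^sup>2"
      by (simp only: sum_distrib_left sum_distrib_right mult.assoc)
    also have "\<dots> \<le> (\<Sum>i\<in>J. w i * R2) * R1\<^sup>2"
      using w R2 by (intro mult_right_mono sum_mono mult_left_mono) auto
    finally show ?thesis by (simp add: sum_distrib_right)
  qed
  have "weighted_sum4 J w (\<lambda>i j k p. (\<rho> i j * \<rho> k p) ^ m * (\<rho> i k * \<rho> j p)) \<le>
    weighted_sum4 J w (\<lambda>i j k p. (1 / 2) * h i j k p + (1 / 2) * h j i p k)"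
  proof (rule weighted_sum4_mono[OF w])
    fix i j k p assume J: "i \<in> J" "j \<in> J" "k \<in> J" "p \<in> J"
    have "\<rho> i k * \<rho> j p \<le> (1 / 2) * (\<rho> i k)\<^sup>2 + (1 / 2) * (\<rho> j p)\<^sup>2"
      using sum_squares_bound[of "\<rho> i k" "\<rho> j p"] by simp
    then have "(\<rho> i j * \<rho> k p) ^ m * (\<rho> i k * \<rho> j p) \<le> (\<rho> i j * \<rho> k p) ^ m * ((1 / 2) * (\<rho> i k)\<^sup>2 + (1 / 2) * (\<rho> j p)\<^sup>2)"
      using \<rho> by (intro mult_left_mono) auto
    also have "\<dots> = (1 / 2) * h i j k p + (1 / 2) * h j i p k"
      using sym[of j i] sym[of p k] J by (simp add: h_def algebra_simps)
    finally show "(\<rho> i j * \<rho> k p) ^ m * (\<rho> i k * \<rho> j p) \<le> (1 / 2) * h i j k p + (1 / 2) * h j i p k" .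
  qed
  also have "\<dots> = (1 / 2) * weighted_sum4 J w h + (1 / 2) * weighted_sum4 J w (\<lambda>i j k p. h j i p k)"
    by (simp only: weighted_sum4_add weighted_sum4_cmult)
  also have "weighted_sum4 J w (\<lambda>i j k p. h j i p k) = weighted_sum4 J w h"
    by (rule trans[OF weighted_sum4_swap12[of J w "\<lambda>i j k p. h i j p k"] weighted_sum4_swap34[of J w h]])
  finally show ?thesis using h_bound by simp
qed

context prob_space begin

text \<open>The remainder of second order in the expansion of the exponential, integrated, gives an
  error of at most \<bar>y - u\<bar> E(S^2) / 2 in the difference quotient.\<close>

lemma has_vector_derivative_char:
  assumes S: "all_moments M S"
  shows "((\<lambda>u. LINT \<omega>|M. cis (u * S \<omega>)) has_vector_derivative (\<i> * (LINT \<omega>|M. of_real (S \<omega>) * cis (u * S \<omega>)))) (at u)"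
proof -
  note [measurable] = all_moments_measurable[OF S]
  define D where "D = \<i> * (LINT \<omega>|M. of_real (S \<omega>) * cis (u * S \<omega>))"
  have S2: "integrable M (\<lambda>\<omega>. (S \<omega>)\<^sup>2)"
    using all_moments_integrable[OF all_moments_mult[OF S S]] by (simp add: power2_eq_square)
  have ci: "integrable M (\<lambda>\<omega>. cis (h * S \<omega>))" for h by (rule integrable_const_bound[where B=1]) auto
  have Sci: "integrable M (\<lambda>\<omega>. of_real (S \<omega>) * cis (u * S \<omega>))"
    by (intro integrable_moments_cis S) measurable
  have "((\<lambda>u. LINT \<omega>|M. cis (u * S \<omega>)) has_derivative (\<lambda>h. h *\<^sub>R D)) (at u)"
  proof (rule has_derivativeI_sandwich[where e=1 and H="\<lambda>y. \<bar>y - u\<bar> * (LINT \<omega>|M. (S \<omega>)\<^sup>2) / 2"])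
    show "bounded_linear (\<lambda>h. h *\<^sub>R D)" by (rule bounded_linear_scaleR_left)
    show "((\<lambda>y. \<bar>y - u\<bar> * (LINT \<omega>|M. (S \<omega>)\<^sup>2) / 2) \<longlongrightarrow> 0) (at u)"
      by (auto intro!: tendsto_eq_intros)
    fix y assume y: "y \<noteq> u"
    have pt: "cmod (cis (y * S \<omega>) - cis (u * S \<omega>) - of_real (y - u) * (\<i> * (of_real (S \<omega>) * cis (u * S \<omega>)))) \<le> (y - u)\<^sup>2 * (S \<omega>)\<^sup>2 / 2" for \<omega>
    proof -
      let ?x = "(y - u) * S \<omega>"
      have "cis (y * S \<omega>) - cis (u * S \<omega>) - of_real (y - u) * (\<i> * (of_real (S \<omega>) * cis (u * S \<omega>)))
        = cis (u * S \<omega>) * (cis ?x - (1 + \<i> * of_real ?x))"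
        by (simp add: algebra_simps cis_mult)
      moreover have "cmod (cis ?x - (1 + \<i> * of_real ?x)) \<le> ?x\<^sup>2 / 2"
        using iexp_approx1[of ?x 1] by (simp add: cis_conv_exp power2_eq_square)
      ultimately show ?thesis by (simp add: norm_mult power_mult_distrib)
    qed
    have "(LINT \<omega>|M. cis (y * S \<omega>)) - (LINT \<omega>|M. cis (u * S \<omega>)) - (y - u) *\<^sub>R D
      = (LINT \<omega>|M. cis (y * S \<omega>) - cis (u * S \<omega>) - of_real (y - u) * (\<i> * (of_real (S \<omega>) * cis (u * S \<omega>))))"
      using ci Sci by (simp add: D_def scaleR_conv_of_real)
    also have "cmod \<dots> \<le> (LINT \<omega>|M. cmod (cis (y * S \<omega>) - cis (u * S \<omega>) - of_real (y - u) * (\<i> * (of_real (S \<omega>) * cis (u * S \<omega>)))))"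
      by (rule integral_norm_bound)
    also have "\<dots> \<le> (LINT \<omega>|M. (y - u)\<^sup>2 * (S \<omega>)\<^sup>2 / 2)"
      using ci Sci S2 by (intro integral_mono pt integrable_norm Bochner_Integration.integrable_diff integrable_mult_right integrable_divide)
    also have "\<dots> = (\<bar>y - u\<bar> * (LINT \<omega>|M. (S \<omega>)\<^sup>2) / 2) * norm (y - u)"
      unfolding power2_abs[of "y - u", symmetric] by (simp add: power2_eq_square)
    finally show "cmod ((LINT \<omega>|M. cis (y * S \<omega>)) - (LINT \<omega>|M. cis (u * S \<omega>)) - (y - u) *\<^sub>R D) / norm (y - u) \<le> \<bar>y - u\<bar> * (LINT \<omega>|M. (S \<omega>)\<^sup>2) / 2"
      using y by (intro mult_imp_div_pos_le) simp_all
  qed simp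
  then show ?thesis by (simp add: has_vector_derivative_def D_def)
qed

text \<open>The characteristic function solves \<open>\<phi>' = - u V \<phi>\<close> up to the error \<open>\<bar>u\<bar> \<delta>\<close>, so
  \<open>\<phi> exp (V u^2 / 2)\<close> has a small derivative.\<close>

lemma char_ode_bound:
  assumes S: "all_moments M S" and \<Gamma>: "all_moments M \<Gamma>" and V: "0 \<le> V"
    and eq: "\<And>u. (LINT \<omega>|M. of_real (S \<omega>) * cis (u * S \<omega>)) = \<i> * of_real u * (LINT \<omega>|M. of_real (\<Gamma> \<omega>) * cis (u * S \<omega>))"
    and \<delta>: "expectation (\<lambda>\<omega>. \<bar>\<Gamma> \<omega> - V\<bar>) \<le> \<delta>"
  shows "cmod ((LINT \<omega>|M. cis (u * S \<omega>)) - of_real (exp (- (V * u\<^sup>2 / 2)))) \<le> u\<^sup>2 * \<delta>"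
proof -
  note [measurable] = all_moments_measurable[OF S] all_moments_measurable[OF \<Gamma>]
  define \<phi> where "\<phi> u = (LINT \<omega>|M. cis (u * S \<omega>))" for u
  define e where "e u = exp (V * u\<^sup>2 / 2)" for u
  define \<psi>' where "\<psi>' u = of_real (e u) * (\<i> * (LINT \<omega>|M. of_real (S \<omega>) * cis (u * S \<omega>))) + of_real (V * u * e u) * \<phi> u" for u
  have \<delta>0: "0 \<le> \<delta>"
    using \<delta> by (rule order_trans[rotated]) (simp add: Bochner_Integration.integral_nonneg)
  have der: "((\<lambda>u. of_real (e u) * \<phi> u) has_vector_derivative \<psi>' x) (at x within T)" for x T
  proof -
    have "(e has_real_derivative V * x * e x) (at x)"
      unfolding e_def[abs_def] by (auto intro!: derivative_eq_intros)
    then have "((\<lambda>u. complex_of_real (e u)) has_vector_derivative of_real (V * x * e x)) (at x)"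
      by (intro has_vector_derivative_of_real) (simp add: has_real_derivative_iff_has_vector_derivative)
    from has_vector_derivative_mult[OF this has_vector_derivative_char[OF S]]
    have "((\<lambda>u. of_real (e u) * \<phi> u) has_vector_derivative \<psi>' x) (at x)"
      by (simp add: \<phi>_def \<psi>'_def)
    then show ?thesis by (rule has_vector_derivative_at_within)
  qed
  \<comment> \<open>On the symmetric interval up to \<bar>u\<bar> the weight \<open>e\<close> is at
    most \<open>e u\<close>. This factor is divided out at the end, so the final estimate contains
    no exponential growth.\<close>
  have \<psi>'_bound: "cmod (\<psi>' x) \<le> e u * (\<bar>u\<bar> * \<delta>)" if x: "\<bar>x\<bar> \<le> \<bar>u\<bar>" for x
  proof -
    have i1: "integrable M (\<lambda>\<omega>. of_real (\<Gamma> \<omega>) * cis (x * S \<omega>))" by (intro integrable_moments_cis \<Gamma>) measurable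
    have i2: "integrable M (\<lambda>\<omega>. cis (x * S \<omega>))" by (rule integrable_const_bound[where B=1]) auto
    have "\<psi>' x = - of_real (e x * x) * ((LINT \<omega>|M. of_real (\<Gamma> \<omega>) * cis (x * S \<omega>)) - of_real V * \<phi> x)"
      unfolding \<psi>'_def eq by (simp add: algebra_simps)
    also have "(LINT \<omega>|M. of_real (\<Gamma> \<omega>) * cis (x * S \<omega>)) - of_real V * \<phi> x = (LINT \<omega>|M. of_real (\<Gamma> \<omega>) * cis (x * S \<omega>) - of_real V * cis (x * S \<omega>))"
      using i1 i2 by (simp add: \<phi>_def)
    also have "\<dots> = (LINT \<omega>|M. of_real (\<Gamma> \<omega> - V) * cis (x * S \<omega>))"
      by (intro Bochner_Integration.integral_cong refl) (simp add: algebra_simps)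
    finally have "cmod (\<psi>' x) = e x * \<bar>x\<bar> * cmod (LINT \<omega>|M. of_real (\<Gamma> \<omega> - V) * cis (x * S \<omega>))"
      by (simp add: norm_mult e_def abs_mult)
    also have "\<dots> \<le> e x * \<bar>x\<bar> * \<delta>"
    proof (rule mult_left_mono)
      have "cmod (LINT \<omega>|M. of_real (\<Gamma> \<omega> - V) * cis (x * S \<omega>)) \<le> (LINT \<omega>|M. cmod (of_real (\<Gamma> \<omega> - V) * cis (x * S \<omega>)))"
        by (rule integral_norm_bound)
      also have "\<dots> = expectation (\<lambda>\<omega>. \<bar>\<Gamma> \<omega> - V\<bar>)" by (simp only: norm_mult norm_cis norm_of_real mult_1_right)
      finally show "cmod (LINT \<omega>|M. of_real (\<Gamma> \<omega> - V) * cis (x * S \<omega>)) \<le> \<delta>" using \<delta> by linarith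
    qed (simp add: e_def)
    also have "\<dots> \<le> e u * (\<bar>u\<bar> * \<delta>)"
    proof -
      have "x\<^sup>2 \<le> u\<^sup>2" using x by (simp add: abs_le_square_iff)
      then have "e x \<le> e u" using V by (simp add: e_def mult_left_mono)
      then have "e x * (\<bar>x\<bar> * \<delta>) \<le> e u * (\<bar>u\<bar> * \<delta>)" using x \<delta>0 by (intro mult_mono) (auto simp: e_def)
      then show ?thesis by (simp add: mult.assoc)
    qed
    finally show ?thesis .
  qed
  have "cmod (of_real (e u) * \<phi> u - of_real (e 0) * \<phi> 0) \<le> (e u * (\<bar>u\<bar> * \<delta>)) * norm (u - 0)"
  proof (rule differentiable_bound[where S="{- \<bar>u\<bar>..\<bar>u\<bar>}" and f="\<lambda>u. of_real (e u) * \<phi> u" and f'="\<lambda>x h. h *\<^sub>R \<psi>' x"])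
    fix x assume x: "x \<in> {- \<bar>u\<bar>..\<bar>u\<bar>}"
    show "((\<lambda>u. of_real (e u) * \<phi> u) has_derivative (\<lambda>h. h *\<^sub>R \<psi>' x)) (at x within {- \<bar>u\<bar>..\<bar>u\<bar>})"
      using der[of x "{- \<bar>u\<bar>..\<bar>u\<bar>}"] by (simp add: has_vector_derivative_def)
    have "\<bar>x\<bar> \<le> \<bar>u\<bar>" using x by (simp add: abs_le_iff)
    then show "onorm (\<lambda>h. h *\<^sub>R \<psi>' x) \<le> e u * (\<bar>u\<bar> * \<delta>)"
      using \<psi>'_bound by (intro onorm_le) (auto simp: mult.commute intro!: mult_left_mono)
  qed auto
  moreover have "(e u * (\<bar>u\<bar> * \<delta>)) * norm (u - 0) = e u * (u\<^sup>2 * \<delta>)"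
    unfolding power2_abs[of u, symmetric] by (simp only: real_norm_def diff_zero power2_eq_square mult_ac)
  moreover have "of_real (e 0) * \<phi> 0 = 1" by (simp add: e_def \<phi>_def prob_space)
  ultimately have "cmod (of_real (e u) * \<phi> u - 1) \<le> e u * (u\<^sup>2 * \<delta>)" by (simp only:)
  then have "inverse (e u) * cmod (of_real (e u) * \<phi> u - 1) \<le> u\<^sup>2 * \<delta>"
    by (simp add: e_def inverse_eq_divide divide_le_eq mult.commute)
  also have "inverse (e u) * cmod (of_real (e u) * \<phi> u - 1) = cmod (of_real (inverse (e u)) * (of_real (e u) * \<phi> u - 1))"
    by (simp add: norm_mult norm_inverse e_def)
  also have "of_real (inverse (e u)) * (of_real (e u) * \<phi> u - 1) = \<phi> u - of_real (exp (- (V * u\<^sup>2 / 2)))"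
    by (simp add: e_def right_diff_distrib exp_minus flip: mult.assoc of_real_mult)
  finally show ?thesis by (simp add: \<phi>_def)
qed

text \<open>By the covariance formula the expression is the second moment of the weighted Hermite
  sum.\<close>

lemma hermite_sum_variance_nonneg:
  fixes Y :: "'i \<Rightarrow> 'a \<Rightarrow> real" and w :: "'i \<Rightarrow> real"
  assumes G: "centred_gaussian M J Y r" and v: "\<And>i. i \<in> J \<Longrightarrow> r i i = v" "0 < v"
  shows "0 \<le> fact m * (\<Sum>i\<in>J. \<Sum>j\<in>J. w i * w j * r i j ^ m)"
proof -
  define H where "H i \<omega> = poly (hermite v m) (Y i \<omega>)" for i \<omega>
  have Hm: "all_moments M (H i)" if "i \<in> J" for i
    unfolding H_def[abs_def] by (intro all_moments_poly centred_gaussian_moments[OF G] that)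
  have "fact m * (\<Sum>i\<in>J. \<Sum>j\<in>J. w i * w j * r i j ^ m) = (\<Sum>i\<in>J. \<Sum>j\<in>J. w i * w j * expectation (\<lambda>\<omega>. H i \<omega> * H j \<omega>))"
    unfolding sum_distrib_left H_def
    by (intro sum.cong refl) (subst hermite_cov[OF G _ _ v(1) v(1) v(2)], auto)
  also have "\<dots> = expectation (\<lambda>\<omega>. \<Sum>i\<in>J. \<Sum>j\<in>J. w i * w j * (H i \<omega> * H j \<omega>))"
  proof -
    have i2: "integrable M (\<lambda>\<omega>. w i * w j * (H i \<omega> * H j \<omega>))" if "i \<in> J" "j \<in> J" for i j
      using that by (intro integrable_mult_right all_moments_integrable all_moments_mult Hm)
    have i1: "integrable M (\<lambda>\<omega>. \<Sum>j\<in>J. w i * w j * (H i \<omega> * H j \<omega>))" if "i \<in> J" for i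
      by (intro Bochner_Integration.integrable_sum i2 that)
    show ?thesis
      by (simp only: Bochner_Integration.integral_sum i1 i2 integral_mult_right_zero cong: sum.cong)
  qed
  also have "\<dots> = expectation (\<lambda>\<omega>. (\<Sum>i\<in>J. w i * H i \<omega>) * (\<Sum>i\<in>J. w i * H i \<omega>))"
    unfolding sum_product by (intro Bochner_Integration.integral_cong sum.cong refl) (simp only: mult_ac)
  also have "\<dots> \<ge> 0" by (intro Bochner_Integration.integral_nonneg) simp
  finally show ?thesis .
qed

text \<open>The quantitative limit theorem for finite sums. The right-hand side sees the points only
  through R1, R2 and the total weight, so it is stable when a sum approximates an integral. The
  factor 4 counts the four arrangements of the four-cycle that arise from one pairing, and the
  length of \<open>pairings\<close> bounds their number.\<close>

theorem hermite_sum_char: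
  fixes Y :: "'i \<Rightarrow> 'a \<Rightarrow> real" and w :: "'i \<Rightarrow> real"
  assumes G: "centred_gaussian M J Y r" and v: "\<And>i. i \<in> J \<Longrightarrow> r i i = v" "0 < v"
    and w: "\<And>i. i \<in> J \<Longrightarrow> 0 \<le> w i"
    and R1: "\<And>i. i \<in> J \<Longrightarrow> (\<Sum>k\<in>J. w k * \<bar>r i k\<bar> ^ m) \<le> R1" and R2: "\<And>i. i \<in> J \<Longrightarrow> (\<Sum>k\<in>J. w k * \<bar>r i k\<bar>\<^sup>2) \<le> R2"
  defines "V \<equiv> fact (Suc m) * (\<Sum>i\<in>J. \<Sum>j\<in>J. w i * w j * r i j ^ Suc m)"
  shows "cmod ((LINT \<omega>|M. cis (u * (\<Sum>i\<in>J. w i * poly (hermite v (Suc m)) (Y i \<omega>)))) - of_real (exp (- (V * u\<^sup>2 / 2))))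
    \<le> u\<^sup>2 * sqrt ((real (Suc m))\<^sup>2 * (4 * real (length (pairings m m m m))) * ((\<Sum>i\<in>J. w i) * R2 * R1\<^sup>2))"
proof -
  have J: "finite J" and sym: "\<And>i j. i \<in> J \<Longrightarrow> j \<in> J \<Longrightarrow> r i j = r j i" using G by (auto simp: centred_gaussian_def)
  have mom: "\<And>i. i \<in> J \<Longrightarrow> all_moments M (Y i)" by (rule centred_gaussian_moments[OF G])
  define H where "H n i \<omega> = poly (hermite v n) (Y i \<omega>)" for n i \<omega>
  have Hm: "all_moments M (H n i)" if "i \<in> J" for n i
    unfolding H_def[abs_def] by (intro all_moments_poly mom that)
  define S where "S \<omega> = (\<Sum>i\<in>J. w i * H (Suc m) i \<omega>)" for \<omega>
  have Smom: "all_moments M S" unfolding S_def[abs_def]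
    by (intro all_moments_sum all_moments_mult all_moments_const Hm)
  note [measurable] = all_moments_measurable[OF Smom]
  define Z where "Z i j \<omega> = H m i \<omega> * H m j \<omega>" for i j \<omega>
  have Zmom: "all_moments M (Z i j)" if "i \<in> J" "j \<in> J" for i j
    unfolding Z_def[abs_def] by (intro all_moments_mult Hm that)
  define a where "a i j = w i * w j * r i j" for i j
  \<comment> \<open>The contraction of S with itself along one edge: the derivative of a Hermite
    polynomial of degree m + 1 is m + 1 times the one of degree m, and the contracted edge
    contributes the covariance inside \<open>a i j\<close>. Its mean is V.\<close>
  define \<Gamma> where "\<Gamma> \<omega> = real (Suc m) * (\<Sum>i\<in>J. \<Sum>j\<in>J. a i j * Z i j \<omega>)" for \<omega>
  have \<Gamma>mom: "all_moments M \<Gamma>" unfolding \<Gamma>_def[abs_def]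
    by (intro all_moments_mult all_moments_const all_moments_sum Zmom)
  have EZ: "expectation (Z i j) = fact m * r i j ^ m" if "i \<in> J" "j \<in> J" for i j
    unfolding Z_def[abs_def] H_def by (rule hermite_cov[OF G that v(1)[OF that(1)] v(1)[OF that(2)] v(2)])
  have V_eq: "V = real (Suc m) * (\<Sum>i\<in>J. \<Sum>j\<in>J. a i j * expectation (Z i j))"
  proof -
    have "(\<Sum>i\<in>J. \<Sum>j\<in>J. a i j * expectation (Z i j)) = (\<Sum>i\<in>J. \<Sum>j\<in>J. fact m * (w i * w j * r i j ^ Suc m))"
      by (intro sum.cong refl) (simp add: EZ a_def)
    also have "\<dots> = fact m * (\<Sum>i\<in>J. \<Sum>j\<in>J. w i * w j * r i j ^ Suc m)" by (simp only: sum_distrib_left)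
    finally show ?thesis by (simp add: V_def)
  qed
  have V: "0 \<le> V" unfolding V_def by (rule hermite_sum_variance_nonneg[OF G v])
  have eq: "(LINT \<omega>|M. of_real (S \<omega>) * cis (u * S \<omega>)) = \<i> * of_real u * (LINT \<omega>|M. of_real (\<Gamma> \<omega>) * cis (u * S \<omega>))" for u
  proof -
    define E where "E X = (LINT \<omega>|M. of_real (X \<omega>) * cis (u * S \<omega>))" for X
    have Eint: "integrable M (\<lambda>\<omega>. of_real (X \<omega>) * cis (u * S \<omega>))" if "all_moments M X" for X
      by (intro integrable_moments_cis that) measurable
    have Ec: "E (\<lambda>\<omega>. b * X \<omega>) = of_real b * E X" for b X
      unfolding E_def of_real_mult mult.assoc by (rule integral_mult_right_zero)
    have Es: "E (\<lambda>\<omega>. \<Sum>i\<in>J. X i \<omega>) = (\<Sum>i\<in>J. E (X i))" if "\<And>i. i \<in> J \<Longrightarrow> all_moments M (X i)" for X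
      unfolding E_def of_real_sum sum_distrib_right using that
      by (subst Bochner_Integration.integral_sum) (auto intro!: Eint)
    have one: "E (H (Suc m) i) = \<i> * (\<Sum>j\<in>J. of_real (u * real (Suc m) * w j * r i j) * E (Z i j))" if i: "i \<in> J" for i
    proof -
      \<comment> \<open>Only the factor at i is present, with degree m, and the phase is u S. All
        other degrees are 0, so the contractions between polynomial factors vanish and just the
        contractions with the phase survive.\<close>
      let ?n = "(\<lambda>_. 0)(i := m)"
      let ?s = "\<lambda>j. smult (u * w j) (hermite v (Suc m))"
      have s: "(\<Sum>j\<in>J. poly (?s j) (Y j \<omega>)) = u * S \<omega>" for \<omega>
        by (simp only: S_def H_def sum_distrib_left poly_smult mult.assoc)
      have h1: "hprod J Y v (?n(i := Suc (?n i))) \<omega> = H (Suc m) i \<omega>" for \<omega>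
        unfolding hprod_upd[OF J i] by (simp add: H_def prod.neutral)
      have h2: "hprod J Y v ?n \<omega> = H m i \<omega>" for \<omega>
        unfolding hprod_upd[OF J i] by (simp add: H_def prod.neutral)
      have pd: "poly (pderiv (?s j)) (Y j \<omega>) * hprod J Y v ?n \<omega> = (u * w j * real (Suc m)) * Z i j \<omega>" for j \<omega>
        unfolding h2 pderiv_smult pderiv_hermite diff_Suc_1 poly_smult Z_def H_def by (simp only: mult_ac)
      have "E (H (Suc m) i) = (\<Sum>j\<in>J - {i}. of_real (r i j * real (?n j)) * (LINT \<omega>|M. of_real (hprod J Y v (?n(j := ?n j - 1)) \<omega>) * cis (u * S \<omega>)))
        + \<i> * (\<Sum>j\<in>J. of_real (r i j) * E (\<lambda>\<omega>. (u * w j * real (Suc m)) * Z i j \<omega>))"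
        using wick[OF G i v(1)[OF i] v(2), of ?n ?s] unfolding s h1 pd E_def by simp
      also have "(\<Sum>j\<in>J - {i}. of_real (r i j * real (?n j)) * (LINT \<omega>|M. of_real (hprod J Y v (?n(j := ?n j - 1)) \<omega>) * cis (u * S \<omega>))) = 0"
        by (intro sum.neutral) auto
      also have "(\<Sum>j\<in>J. of_real (r i j) * E (\<lambda>\<omega>. (u * w j * real (Suc m)) * Z i j \<omega>)) = (\<Sum>j\<in>J. of_real (u * real (Suc m) * w j * r i j) * E (Z i j))"
        unfolding Ec by (intro sum.cong refl) (simp only: of_real_mult mult_ac)
      finally show ?thesis by simp
    qed
    have "E S = (\<Sum>i\<in>J. of_real (w i) * E (H (Suc m) i))"
      unfolding S_def[abs_def] by (subst Es) (auto simp: Ec intro!: all_moments_mult all_moments_const Hm)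
    also have "\<dots> = (\<Sum>i\<in>J. \<Sum>j\<in>J. \<i> * of_real u * (of_real (real (Suc m) * a i j) * E (Z i j)))"
      by (intro sum.cong refl) (simp only: one sum_distrib_left a_def of_real_mult mult_ac)
    also have "\<dots> = \<i> * of_real u * (\<Sum>i\<in>J. \<Sum>j\<in>J. of_real (real (Suc m) * a i j) * E (Z i j))"
      by (simp only: sum_distrib_left)
    also have "(\<Sum>i\<in>J. \<Sum>j\<in>J. of_real (real (Suc m) * a i j) * E (Z i j)) = E \<Gamma>"
    proof -
      have "\<Gamma> = (\<lambda>\<omega>. \<Sum>i\<in>J. \<Sum>j\<in>J. (real (Suc m) * a i j) * Z i j \<omega>)"
        by (rule ext) (simp only: \<Gamma>_def sum_distrib_left mult.assoc)
      then have "E \<Gamma> = (\<Sum>i\<in>J. E (\<lambda>\<omega>. \<Sum>j\<in>J. (real (Suc m) * a i j) * Z i j \<omega>))"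
        by (simp only:) (rule Es, intro all_moments_sum all_moments_mult all_moments_const Zmom)
      also have "\<dots> = (\<Sum>i\<in>J. \<Sum>j\<in>J. of_real (real (Suc m) * a i j) * E (Z i j))"
      proof (intro sum.cong refl)
        fix i assume i: "i \<in> J"
        show "E (\<lambda>\<omega>. \<Sum>j\<in>J. (real (Suc m) * a i j) * Z i j \<omega>) = (\<Sum>j\<in>J. of_real (real (Suc m) * a i j) * E (Z i j))"
          by (subst Es) (simp_all only: Ec all_moments_mult[OF all_moments_const Zmom[OF i]])
      qed
      finally show ?thesis by simp
    qed
    finally show ?thesis by (simp only: E_def)
  qed
  define L where "L = real (length (pairings m m m m))"
  define \<rho> where "\<rho> i j = \<bar>r i j\<bar>" for i j
  define F where "F i j k p = (\<rho> i j * \<rho> k p) ^ m * (\<rho> i k * \<rho> j p)" for i j k p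
  let ?W = "(\<Sum>i\<in>J. w i) * R2 * R1\<^sup>2"
  have F_sum: "weighted_sum4 J w F \<le> ?W"
    unfolding F_def[abs_def] by (rule four_cycle_bound) (use w R1 R2 sym in \<open>auto simp: \<rho>_def\<close>)
  \<comment> \<open>The covariance of two products of degree-m Hermite factors, weighted by the two
    contracted edges ij and kp. Those edges provide the extra factor p w in
    \<open>wick4_covariance_bound\<close>, and the four terms are the four-cycles with
    \<open>F\<close> in different labellings.\<close>
  have cov: "a i j * a k p * (expectation (\<lambda>\<omega>. Z i j \<omega> * Z k p \<omega>) - expectation (Z i j) * expectation (Z k p))
      \<le> w i * w j * w k * w p * (L * (F i j k p + F i k j p + (F i j p k + F i p j k)))"
    if ijkp: "i \<in> J" "j \<in> J" "k \<in> J" "p \<in> J" for i j k p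
  proof -
    define \<kappa> where "\<kappa> n = (if n = 0 then i else if n = 1 then j else if n = 2 then k else p)" for n :: nat
    let ?Y = "\<lambda>n. Y (\<kappa> n)" and ?r = "\<lambda>n n'. r (\<kappa> n) (\<kappa> n')"
    have G4: "centred_gaussian M {0, 1, 2, 3} ?Y ?r"
      by (rule centred_gaussian_reindex[OF G]) (auto simp: \<kappa>_def ijkp)
    have v4: "?r n n = v" if "n \<in> {0, 1, 2, 3}" for n using v(1) ijkp by (simp add: \<kappa>_def)
    note four = hermite_four[OF G4 v4 v(2)]
    have k: "\<kappa> 0 = i" "\<kappa> 1 = j" "\<kappa> 2 = k" "\<kappa> 3 = p" by (simp_all add: \<kappa>_def)
    have hp: "hprod {0, 1, 2, 3} ?Y v ((\<lambda>_. 0)(0 := a', 1 := b', 2 := c', 3 := d')) = (\<lambda>\<omega>. H a' i \<omega> * (H b' j \<omega> * (H c' k \<omega> * H d' p \<omega>)))" for a' b' c' d'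
      by (rule ext) (simp add: hprod_def H_def \<kappa>_def)
    have H0: "H 0 i = (\<lambda>_. 1)" for i by (simp add: H_def[abs_def])
    let ?wk = "wick4 (r i j) (r i k) (r i p) (r j k) (r j p) (r k p)"
    have e1: "expectation (\<lambda>\<omega>. Z i j \<omega> * Z k p \<omega>) = ?wk m m m m"
      using four[of m m m m] unfolding hp k by (simp only: Z_def mult.assoc)
    have e2: "expectation (Z i j) = ?wk m m 0 0"
      using four[of m m 0 0] unfolding hp k H0 by (simp only: Z_def[abs_def] mult_1_right)
    have e3: "expectation (Z k p) = ?wk 0 0 m m"
      using four[of 0 0 m m] unfolding hp k H0 by (simp only: Z_def[abs_def] mult_1)
    have "a i j * a k p * (expectation (\<lambda>\<omega>. Z i j \<omega> * Z k p \<omega>) - expectation (Z i j) * expectation (Z k p))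
      = w i * w j * w k * w p * (r i j * r k p * (?wk m m m m - ?wk m m 0 0 * ?wk 0 0 m m))"
      unfolding e1 e2 e3 a_def by (simp only: mult_ac)
    also have "\<dots> \<le> w i * w j * w k * w p * (L * (F i j k p + F i k j p + (F i j p k + F i p j k)))"
    proof (rule mult_left_mono)
      have s: "\<rho> p k = \<rho> k p" "\<rho> k j = \<rho> j k" using sym ijkp by (auto simp: \<rho>_def)
      have "r i j * r k p * (?wk m m m m - ?wk m m 0 0 * ?wk 0 0 m m) \<le> L * ((\<rho> i j * \<rho> k p) ^ m * (\<rho> i k * \<rho> j p) + \<rho> i j * \<rho> k p * (\<rho> i k * \<rho> j p) ^ m
         + ((\<rho> i j * \<rho> k p) ^ m * (\<rho> i p * \<rho> j k) + \<rho> i j * \<rho> k p * (\<rho> i p * \<rho> j k) ^ m))"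
        unfolding L_def \<rho>_def by (rule order_trans[OF abs_ge_self wick4_covariance_bound])
      then show "r i j * r k p * (?wk m m m m - ?wk m m 0 0 * ?wk 0 0 m m) \<le> L * (F i j k p + F i k j p + (F i j p k + F i p j k))"
        unfolding F_def by (simp only: s mult.commute[of "(\<rho> i k * \<rho> j p) ^ m"] mult.commute[of "(\<rho> i p * \<rho> j k) ^ m"])
      show "0 \<le> w i * w j * w k * w p" using w ijkp by simp
    qed
    finally show ?thesis .
  qed
  define X where "X i j \<omega> = Z i j \<omega> - expectation (Z i j)" for i j \<omega>
  have Xmom: "all_moments M (X i j)" if "i \<in> J" "j \<in> J" for i j
    using all_moments_add[OF Zmom[OF that] all_moments_const[of "- expectation (Z i j)"]] by (simp add: X_def[abs_def])
  have EXX: "expectation (\<lambda>\<omega>. X i j \<omega> * X k p \<omega>) = expectation (\<lambda>\<omega>. Z i j \<omega> * Z k p \<omega>) - expectation (Z i j) * expectation (Z k p)"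
    if "i \<in> J" "j \<in> J" "k \<in> J" "p \<in> J" for i j k p
  proof -
    have i: "integrable M (Z i j)" "integrable M (Z k p)" "integrable M (\<lambda>\<omega>. Z i j \<omega> * Z k p \<omega>)"
      using that by (auto intro!: all_moments_integrable all_moments_mult Zmom)
    have "expectation (\<lambda>\<omega>. X i j \<omega> * X k p \<omega>) = expectation (\<lambda>\<omega>. Z i j \<omega> * Z k p \<omega> - expectation (Z k p) * Z i j \<omega> - expectation (Z i j) * Z k p \<omega> + expectation (Z i j) * expectation (Z k p))"
      by (intro Bochner_Integration.integral_cong refl) (simp add: X_def algebra_simps)
    then show ?thesis using i by (simp add: prob_space)
  qed
  have \<Gamma>X: "(\<Gamma> \<omega> - V)\<^sup>2 = (real (Suc m))\<^sup>2 * (\<Sum>i\<in>J. \<Sum>k\<in>J. \<Sum>j\<in>J. \<Sum>p\<in>J. (a i j * a k p) * (X i j \<omega> * X k p \<omega>))" for \<omega>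
  proof -
    have "\<Gamma> \<omega> - V = real (Suc m) * (\<Sum>i\<in>J. \<Sum>j\<in>J. a i j * X i j \<omega>)"
      unfolding \<Gamma>_def V_eq X_def by (simp only: right_diff_distrib sum_subtractf)
    moreover have "(\<Sum>i\<in>J. \<Sum>j\<in>J. a i j * X i j \<omega>)\<^sup>2 = (\<Sum>i\<in>J. \<Sum>k\<in>J. \<Sum>j\<in>J. \<Sum>p\<in>J. (a i j * a k p) * (X i j \<omega> * X k p \<omega>))"
      unfolding power2_eq_square sum_product by (simp only: mult_ac)
    ultimately show ?thesis by (simp only: power_mult_distrib)
  qed
  have "expectation (\<lambda>\<omega>. (\<Gamma> \<omega> - V)\<^sup>2) = (real (Suc m))\<^sup>2 * (\<Sum>i\<in>J. \<Sum>k\<in>J. \<Sum>j\<in>J. \<Sum>p\<in>J. (a i j * a k p) * expectation (\<lambda>\<omega>. X i j \<omega> * X k p \<omega>))"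
  proof -
    have XX: "integrable M (\<lambda>\<omega>. X i j \<omega> * X k p \<omega>)" if "i \<in> J" "j \<in> J" "k \<in> J" "p \<in> J" for i j k p
      using that by (intro all_moments_integrable all_moments_mult Xmom)
    have "expectation (\<lambda>\<omega>. (\<Gamma> \<omega> - V)\<^sup>2) = (real (Suc m))\<^sup>2 * expectation (\<lambda>\<omega>. \<Sum>i\<in>J. \<Sum>k\<in>J. \<Sum>j\<in>J. \<Sum>p\<in>J. (a i j * a k p) * (X i j \<omega> * X k p \<omega>))"
      unfolding \<Gamma>X by (rule integral_mult_right_zero)
    also have "expectation (\<lambda>\<omega>. \<Sum>i\<in>J. \<Sum>k\<in>J. \<Sum>j\<in>J. \<Sum>p\<in>J. (a i j * a k p) * (X i j \<omega> * X k p \<omega>)) =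
      (\<Sum>i\<in>J. \<Sum>k\<in>J. \<Sum>j\<in>J. \<Sum>p\<in>J. expectation (\<lambda>\<omega>. (a i j * a k p) * (X i j \<omega> * X k p \<omega>)))"
    proof -
      have i4: "integrable M (\<lambda>\<omega>. (a i j * a k p) * (X i j \<omega> * X k p \<omega>))" if "i \<in> J" "j \<in> J" "k \<in> J" "p \<in> J" for i j k p
        using XX[OF that] by (rule integrable_mult_right)
      have i3: "integrable M (\<lambda>\<omega>. \<Sum>p\<in>J. (a i j * a k p) * (X i j \<omega> * X k p \<omega>))" if "i \<in> J" "j \<in> J" "k \<in> J" for i j k
        by (intro Bochner_Integration.integrable_sum i4 that)
      have i2: "integrable M (\<lambda>\<omega>. \<Sum>j\<in>J. \<Sum>p\<in>J. (a i j * a k p) * (X i j \<omega> * X k p \<omega>))" if "i \<in> J" "k \<in> J" for i k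
        by (intro Bochner_Integration.integrable_sum i3 that)
      have i1: "integrable M (\<lambda>\<omega>. \<Sum>k\<in>J. \<Sum>j\<in>J. \<Sum>p\<in>J. (a i j * a k p) * (X i j \<omega> * X k p \<omega>))" if "i \<in> J" for i
        by (intro Bochner_Integration.integrable_sum i2 that)
      show ?thesis
        by (simp only: Bochner_Integration.integral_sum i1 i2 i3 i4 cong: sum.cong)
    qed
    finally show ?thesis by (simp only: integral_mult_right_zero)
  qed
  also have "\<dots> \<le> (real (Suc m))\<^sup>2 * (\<Sum>i\<in>J. \<Sum>k\<in>J. \<Sum>j\<in>J. \<Sum>p\<in>J. w i * w j * w k * w p * (L * (F i j k p + F i k j p + (F i j p k + F i p j k))))"
    by (intro mult_left_mono sum_mono) (simp_all only: EXX cov zero_le_power2)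
  also have "(\<Sum>i\<in>J. \<Sum>k\<in>J. \<Sum>j\<in>J. \<Sum>p\<in>J. w i * w j * w k * w p * (L * (F i j k p + F i k j p + (F i j p k + F i p j k))))
    = weighted_sum4 J w (\<lambda>i j k p. L * (F i j k p + F i k j p + (F i j p k + F i p j k)))"
    unfolding weighted_sum4_def by (intro sum.cong refl sum.swap)
  also have "\<dots> = L * (weighted_sum4 J w F + weighted_sum4 J w (\<lambda>i j k p. F i k j p) + (weighted_sum4 J w (\<lambda>i j k p. F i j p k) + weighted_sum4 J w (\<lambda>i j k p. F i p j k)))"
    by (simp only: weighted_sum4_cmult weighted_sum4_add)
  \<comment> \<open>The four labellings differ by permutations of the summation variables and have
    the same sum.\<close>
  also have "\<dots> = L * (4 * weighted_sum4 J w F)"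
    unfolding weighted_sum4_swap34[of J w F] weighted_sum4_swap23[of J w F]
      trans[OF weighted_sum4_swap34[of J w "\<lambda>i j k p. F i k j p"] weighted_sum4_swap23[of J w F]] by simp
  also have "(real (Suc m))\<^sup>2 * (L * (4 * weighted_sum4 J w F)) \<le> (real (Suc m))\<^sup>2 * (L * (4 * ?W))"
    using F_sum by (intro mult_left_mono) (auto simp: L_def)
  finally have var: "expectation (\<lambda>\<omega>. (\<Gamma> \<omega> - V)\<^sup>2) \<le> (real (Suc m))\<^sup>2 * (4 * L) * ?W"
    by (simp only: mult_ac)
  have \<delta>: "expectation (\<lambda>\<omega>. \<bar>\<Gamma> \<omega> - V\<bar>) \<le> sqrt ((real (Suc m))\<^sup>2 * (4 * L) * ?W)"
  proof (rule real_le_rsqrt)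
    have m1: "all_moments M (\<lambda>\<omega>. \<Gamma> \<omega> - V)"
      using all_moments_add[OF \<Gamma>mom all_moments_const[of "- V"]] by simp
    have i1: "integrable M (\<lambda>\<omega>. \<bar>\<Gamma> \<omega> - V\<bar>)" by (intro integrable_abs all_moments_integrable m1)
    have i2: "integrable M (\<lambda>\<omega>. \<bar>\<Gamma> \<omega> - V\<bar>\<^sup>2)"
      using all_moments_integrable[OF all_moments_mult[OF m1 m1]] by (simp add: power2_eq_square)
    have "(expectation (\<lambda>\<omega>. \<bar>\<Gamma> \<omega> - V\<bar>))\<^sup>2 \<le> expectation (\<lambda>\<omega>. \<bar>\<Gamma> \<omega> - V\<bar>\<^sup>2)"
      using variance_eq[OF i1 i2] variance_positive[of "\<lambda>\<omega>. \<bar>\<Gamma> \<omega> - V\<bar>"] by linarith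
    also have "\<dots> \<le> (real (Suc m))\<^sup>2 * (4 * L) * ?W" using var by simp
    finally show "(expectation (\<lambda>\<omega>. \<bar>\<Gamma> \<omega> - V\<bar>))\<^sup>2 \<le> (real (Suc m))\<^sup>2 * (4 * L) * ?W" .
  qed
  have "cmod ((LINT \<omega>|M. cis (u * S \<omega>)) - of_real (exp (- (V * u\<^sup>2 / 2)))) \<le> u\<^sup>2 * sqrt ((real (Suc m))\<^sup>2 * (4 * L) * ?W)"
    by (rule char_ode_bound[OF Smom \<Gamma>mom V eq \<delta>])
  then show ?thesis by (simp only: S_def H_def L_def)
qed

end

section \<open>Characteristic functions of Hermite integrals\<close>

text \<open>A finite net of the compact set together with a measurable rule: each point goes to the
  first net point that is close to it.\<close>

lemma compact_quantisation:
  fixes D :: "'a::euclidean_space set"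
  assumes "compact D" "D \<noteq> {}" "0 < \<eta>"
  obtains \<pi> where "\<pi> \<in> borel_measurable borel" "finite (range \<pi>)" "range \<pi> \<subseteq> D" "\<And>t. t \<in> D \<Longrightarrow> norm (\<pi> t - t) \<le> \<eta>"
proof -
  obtain K where K: "finite K" "K \<subseteq> D" "D \<subseteq> (\<Union>x\<in>K. ball x \<eta>)"
    using compactE_image[OF assms(1), of D "\<lambda>x. ball x \<eta>"] assms(3) by (force simp: dist_commute)
  have "K \<noteq> {}" using K assms(2) by auto
  obtain xs where xs: "set xs = K" using finite_list[OF K(1)] by blast
  define n where "n = length xs - 1"
  have len: "0 < length xs" using \<open>K \<noteq> {}\<close> xs by auto
  \<comment> \<open>The alternative \<open>i = n\<close>, the last position, makes the least index
    exist for every \<open>t\<close>, in particular for \<open>t\<close> outside the set. For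
    \<open>t\<close> in the set the least index belongs to a close net point.\<close>
  define j where "j t = (LEAST i. (i = n \<or> dist (xs ! i) t < \<eta>))" for t
  have j_le: "j t \<le> n" for t unfolding j_def by (rule Least_le) simp
  have j_len: "j t < length xs" for t using j_le[of t] len unfolding n_def by linarith
  have jm [measurable]: "j \<in> borel \<rightarrow>\<^sub>M count_space UNIV" unfolding j_def[abs_def] by measurable
  show thesis
  proof
    have "(\<lambda>i. xs ! i) \<in> count_space UNIV \<rightarrow>\<^sub>M borel" by simp
    from measurable_compose[OF jm this] show "(\<lambda>t. xs ! j t) \<in> borel_measurable borel" .
    have "xs ! j t \<in> D" for t using nth_mem[OF j_len[of t]] xs K(2) by auto
    then show "range (\<lambda>t. xs ! j t) \<subseteq> D" by auto
    show "finite (range (\<lambda>t. xs ! j t))"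
      by (rule finite_subset[OF _ K(1)]) (use nth_mem[OF j_len] xs in auto)
    fix t assume "t \<in> D"
    then obtain x where x: "x \<in> K" "dist x t < \<eta>" using K(3) by (auto simp: dist_commute)
    then obtain i where i: "i < length xs" "xs ! i = x" using xs by (metis in_set_conv_nth)
    have ij: "j t = n \<or> dist (xs ! j t) t < \<eta>" unfolding j_def
      by (rule LeastI[of "\<lambda>i. i = n \<or> dist (xs ! i) t < \<eta>" n]) simp
    have "j t \<le> i" unfolding j_def using i x by (intro Least_le) simp
    moreover have "i \<le> n" using i by (simp add: n_def)
    ultimately have "dist (xs ! j t) t < \<eta>" using ij i x by (metis le_antisym)
    then show "norm (xs ! j t - t) \<le> \<eta>" by (simp add: dist_norm)
  qed
qed

lemma uniform_compose:
  fixes r :: "'a::real_normed_vector \<Rightarrow> real" and \<phi> :: "real \<Rightarrow> real"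
  assumes r: "\<And>e. 0 < e \<Longrightarrow> \<exists>d>0. \<forall>s t. norm (s - t) \<le> d \<longrightarrow> \<bar>r s - r t\<bar> < e" and b: "\<And>t. \<bar>r t\<bar> \<le> B"
    and \<phi>: "continuous_on {-B..B} \<phi>" and e: "0 < e"
  shows "\<exists>d>0. \<forall>s t. norm (s - t) \<le> d \<longrightarrow> \<bar>\<phi> (r s) - \<phi> (r t)\<bar> \<le> e"
proof -
  have "uniformly_continuous_on {-B..B} \<phi>" by (rule compact_uniformly_continuous[OF \<phi>]) simp
  then obtain d where d: "d > 0" "\<And>x y. x \<in> {-B..B} \<Longrightarrow> y \<in> {-B..B} \<Longrightarrow> dist y x < d \<Longrightarrow> dist (\<phi> y) (\<phi> x) < e"
    unfolding uniformly_continuous_on_def using e by meson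
  obtain d' where d': "d' > 0" "\<And>s t. norm (s - t) \<le> d' \<Longrightarrow> \<bar>r s - r t\<bar> < d" using r[OF d(1)] by blast
  have "r t \<in> {-B..B}" for t using b[of t] by (auto simp: abs_le_iff)
  then have "\<bar>\<phi> (r s) - \<phi> (r t)\<bar> \<le> e" if "norm (s - t) \<le> d'" for s t
    using d(2)[of "r t" "r s"] d'(2)[OF that] by (auto simp: dist_real_def)
  then show ?thesis using d'(1) by blast
qed

lemma integral_finite_range:
  fixes g :: "'b::t2_space \<Rightarrow> real"
  assumes N: "finite_measure N" and \<pi>: "\<pi> \<in> N \<rightarrow>\<^sub>M borel" and K: "finite (range \<pi>)"
  shows "(LINT t|N. g (\<pi> t)) = (\<Sum>k\<in>range \<pi>. measure N {t\<in>space N. \<pi> t = k} * g k)"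
    and "integrable N (\<lambda>t. g (\<pi> t))"
proof -
  interpret finite_measure N by fact
  have eq: "g (\<pi> t) = (\<Sum>k\<in>range \<pi>. indicator {t\<in>space N. \<pi> t = k} t * g k)" if "t \<in> space N" for t
    using K that by (subst sum.remove[of _ "\<pi> t"]) (auto intro!: sum.neutral simp: indicator_def)
  have s: "{t\<in>space N. \<pi> t = k} \<in> sets N" for k
  proof -
    have "\<pi> -` {k} \<inter> space N \<in> sets N" by (rule measurable_sets[OF \<pi>]) simp
    moreover have "\<pi> -` {k} \<inter> space N = {t\<in>space N. \<pi> t = k}" by auto
    ultimately show ?thesis by simp
  qed
  have i: "integrable N (\<lambda>t. indicator {t\<in>space N. \<pi> t = k} t * g k)" for k
    by (intro integrable_mult_left integrable_real_indicator s) (simp add: emeasure_eq_measure)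
  have "(LINT t|N. g (\<pi> t)) = (LINT t|N. (\<Sum>k\<in>range \<pi>. indicator {t\<in>space N. \<pi> t = k} t * g k))"
    by (rule Bochner_Integration.integral_cong[OF refl eq])
  also have "\<dots> = (\<Sum>k\<in>range \<pi>. measure N {t\<in>space N. \<pi> t = k} * g k)"
    by (subst Bochner_Integration.integral_sum[OF i]) (auto intro!: sum.cong arg_cong[where f="measure N"])
  finally show "(LINT t|N. g (\<pi> t)) = (\<Sum>k\<in>range \<pi>. measure N {t\<in>space N. \<pi> t = k} * g k)" .
  show "integrable N (\<lambda>t. g (\<pi> t))"
    by (subst Bochner_Integration.integrable_cong[OF refl eq]) (auto intro!: i)
qed

lemma (in finite_measure) integral_close:
  fixes g h :: "'a \<Rightarrow> real"
  assumes g: "integrable M g" and h: "integrable M h" and gh: "AE t in M. \<bar>g t - h t\<bar> \<le> e"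
  shows "\<bar>(LINT t|M. g t) - (LINT t|M. h t)\<bar> \<le> measure M (space M) * e"
proof -
  have "\<bar>(LINT t|M. g t) - (LINT t|M. h t)\<bar> = \<bar>LINT t|M. g t - h t\<bar>" using g h by simp
  also have "\<dots> \<le> (LINT t|M. \<bar>g t - h t\<bar>)" by (rule integral_abs_bound)
  also have "\<dots> \<le> (LINT t|M. e)" using gh by (intro integral_mono_AE integrable_abs Bochner_Integration.integrable_diff g h integrable_const)
  finally show ?thesis by simp
qed

lemma exp_minus_diff_le:
  fixes a b :: real
  assumes "0 \<le> a" "0 \<le> b"
  shows "\<bar>exp (- a) - exp (- b)\<bar> \<le> \<bar>a - b\<bar>"
proof -
  have *: "exp (- a) - exp (- b) \<le> b - a" if "0 \<le> a" "a \<le> b" for a b :: real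
  proof -
    have "exp (- a) - exp (- b) = exp (- a) * (1 - exp (- (b - a)))"
      by (simp add: right_diff_distrib flip: exp_add)
    also have "\<dots> \<le> 1 * (b - a)"
    proof (rule mult_mono)
      show "1 - exp (- (b - a)) \<le> b - a" using exp_ge_add_one_self[of "- (b - a)"] by linarith
    qed (use that in auto)
    finally show ?thesis by simp
  qed
  show ?thesis using *[of a b] *[of b a] assms by (cases "a \<le> b") auto
qed

lemma norm_cis_diff_le: "cmod (cis x - cis y) \<le> \<bar>x - y\<bar>"
proof -
  have "cis x - cis y = cis y * (cis (x - y) - 1)" by (simp add: algebra_simps cis_mult)
  then have "cmod (cis x - cis y) = cmod (cis (x - y) - 1)" by (simp add: norm_mult)
  also have "\<dots> \<le> \<bar>x - y\<bar>" using iexp_approx1[of "x - y" 0] by (simp add: cis_conv_exp)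
  finally show ?thesis .
qed

text \<open>Replacing \<open>Y t\<close> by its value at the quantised time turns the integral into
  a weighted sum whose weights are the masses of the cells. Because the bound for sums involves only
  the total mass, R1 and R2, it passes to the limit. The replacement is controlled in mean through
  the covariance, so uniform continuity of \<open>r\<close> suffices and no regularity of paths is
  used.\<close>

lemma (in prob_space) hermite_integral_char:
  fixes Y :: "'b::euclidean_space \<Rightarrow> 'a \<Rightarrow> real" and r :: "'b \<Rightarrow> real"
  assumes N: "finite_measure N" and sN [measurable_cong]: "sets N = sets borel"
    and D: "compact D" "D \<noteq> {}" "AE t in N. t \<in> D"
    and G: "\<And>K. finite K \<Longrightarrow> K \<subseteq> D \<Longrightarrow> centred_gaussian M K Y (\<lambda>s t. r (s - t))"
    and Ym [measurable]: "(\<lambda>(t, \<omega>). Y t \<omega>) \<in> borel_measurable (N \<Otimes>\<^sub>M M)"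
    and rm [measurable]: "r \<in> borel_measurable borel"
    and rB: "\<And>t. \<bar>r t\<bar> \<le> B" and v: "0 < r 0"
    and unif: "\<And>e. 0 < e \<Longrightarrow> \<exists>d>0. \<forall>s t. norm (s - t) \<le> d \<longrightarrow> \<bar>r s - r t\<bar> < e"
    and R1: "\<And>s. s \<in> D \<Longrightarrow> (LINT t|N. \<bar>r (s - t)\<bar> ^ m) \<le> R1"
    and R2: "\<And>s. s \<in> D \<Longrightarrow> (LINT t|N. \<bar>r (s - t)\<bar>\<^sup>2) \<le> R2"
  defines "V \<equiv> fact (Suc m) * (LINT t|N. LINT s|N. r (t - s) ^ Suc m)"
    and "C \<equiv> (real (Suc m))\<^sup>2 * (4 * real (length (pairings m m m m)))"
  shows "cmod ((LINT \<omega>|M. cis (u * (LINT t|N. poly (hermite (r 0) (Suc m)) (Y t \<omega>)))) - of_real (exp (- (V * u\<^sup>2 / 2))))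
    \<le> u\<^sup>2 * sqrt (C * (measure N (space N) * R2 * R1\<^sup>2))"
proof -
  interpret N: finite_measure N by fact
  interpret NM: pair_sigma_finite N M ..
  define n where "n = measure N (space N)"
  have n0: "0 \<le> n" by (simp add: n_def)
  define h where "h t \<omega> = poly (hermite (r 0) (Suc m)) (Y t \<omega>)" for t \<omega>
  have hm [measurable]: "(\<lambda>(t, \<omega>). h t \<omega>) \<in> borel_measurable (N \<Otimes>\<^sub>M M)"
    unfolding h_def by measurable
  have spN [simp]: "space N = UNIV" using sets_eq_imp_space_eq[OF sN] by simp
  have Gst: "centred_gaussian M {s, t} Y (\<lambda>s t. r (s - t))" if "s \<in> D" "t \<in> D" for s t
    using that by (intro G) auto
  have hmom: "all_moments M (h t)" if "t \<in> D" for t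
    unfolding h_def[abs_def] by (intro all_moments_poly centred_gaussian_moments[OF Gst[OF that that]]) simp
  have hdiff: "all_moments M (\<lambda>\<omega>. h s \<omega> - h t \<omega>)" if "s \<in> D" "t \<in> D" for s t
    using all_moments_add[OF hmom[OF that(1)] all_moments_mult[OF all_moments_const[of "-1"] hmom[OF that(2)]]] by simp
  have cov: "expectation (\<lambda>\<omega>. h s \<omega> * h t \<omega>) = fact (Suc m) * r (s - t) ^ Suc m" if "s \<in> D" "t \<in> D" for s t
    unfolding h_def by (rule hermite_cov[OF Gst[OF that]]) (use v in auto)
  \<comment> \<open>The second moment of an increment is computed from the covariance formula alone;
    nonnegativity of the variance of its modulus passes from the second moment to the first.\<close>
  have diff_bound: "expectation (\<lambda>\<omega>. \<bar>h s \<omega> - h t \<omega>\<bar>) \<le> sqrt (2 * fact (Suc m) * (r 0 ^ Suc m - r (s - t) ^ Suc m))"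
    if st: "s \<in> D" "t \<in> D" for s t
  proof (rule real_le_rsqrt)
    let ?d = "\<lambda>\<omega>. h s \<omega> - h t \<omega>"
    note d = hdiff[OF st]
    have i1: "integrable M (\<lambda>\<omega>. \<bar>?d \<omega>\<bar>)" by (intro integrable_abs all_moments_integrable d)
    have i2: "integrable M (\<lambda>\<omega>. \<bar>?d \<omega>\<bar>\<^sup>2)"
      using all_moments_integrable[OF all_moments_mult[OF d d]] by (simp add: power2_eq_square)
    have "(expectation (\<lambda>\<omega>. \<bar>?d \<omega>\<bar>))\<^sup>2 \<le> expectation (\<lambda>\<omega>. \<bar>?d \<omega>\<bar>\<^sup>2)"
      using variance_eq[OF i1 i2] variance_positive[of "\<lambda>\<omega>. \<bar>?d \<omega>\<bar>"] by linarith
    also have "\<dots> = expectation (\<lambda>\<omega>. h s \<omega> * h s \<omega> + h t \<omega> * h t \<omega> - 2 * (h s \<omega> * h t \<omega>))"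
      by (simp add: power2_eq_square algebra_simps)
    also have "\<dots> = expectation (\<lambda>\<omega>. h s \<omega> * h s \<omega>) + expectation (\<lambda>\<omega>. h t \<omega> * h t \<omega>) - 2 * expectation (\<lambda>\<omega>. h s \<omega> * h t \<omega>)"
      using st by (simp add: all_moments_integrable all_moments_mult hmom)
    also have "\<dots> = 2 * fact (Suc m) * (r 0 ^ Suc m - r (s - t) ^ Suc m)"
      unfolding cov[OF st] cov[OF st(1) st(1)] cov[OF st(2) st(2)] by (simp add: right_diff_distrib)
    finally show "(expectation (\<lambda>\<omega>. \<bar>?d \<omega>\<bar>))\<^sup>2 \<le> 2 * fact (Suc m) * (r 0 ^ Suc m - r (s - t) ^ Suc m)" .
  qed
  have pow_int: "integrable N (\<lambda>t. r (a - t) ^ k)" "integrable N (\<lambda>t. \<bar>r (a - t)\<bar> ^ k)" for a k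
    using rB by (auto intro!: N.integrable_const_bound[where B="B ^ k"] AE_I2 power_mono simp: power_abs)
  define S where "S \<omega> = (LINT t|N. h t \<omega>)" for \<omega>
  have Sm [measurable]: "S \<in> borel_measurable M" unfolding S_def by measurable
  \<comment> \<open>The first term is the cost of quantising the field, the second the error bound
    for the finite sum, with R1 and R2 enlarged by the quantisation error n \<epsilon>.\<close>
  define E1 where "E1 \<epsilon> = \<bar>u\<bar> * (n * sqrt (2 * fact (Suc m) * \<epsilon>)) + u\<^sup>2 * sqrt (C * (n * (R2 + n * \<epsilon>) * (R1 + n * \<epsilon>)\<^sup>2))" for \<epsilon>
  define c where "c = fact (Suc m) * (n * n)"
  have approx: "\<exists>V'. 0 \<le> V' \<and> \<bar>V' - V\<bar> \<le> c * \<epsilon> \<and> cmod ((LINT \<omega>|M. cis (u * S \<omega>)) - of_real (exp (- (V' * u\<^sup>2 / 2)))) \<le> E1 \<epsilon>"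
    if \<epsilon>: "0 < \<epsilon>" for \<epsilon>
  proof -
    obtain d1 where d1: "d1 > 0" "\<And>s t. norm (s - t) \<le> d1 \<Longrightarrow> \<bar>r s ^ Suc m - r t ^ Suc m\<bar> \<le> \<epsilon>"
      using uniform_compose[OF unif rB _ \<epsilon>, where \<phi>="\<lambda>x. x ^ Suc m"] by (force intro!: continuous_intros)
    obtain d2 where d2: "d2 > 0" "\<And>s t. norm (s - t) \<le> d2 \<Longrightarrow> \<bar>\<bar>r s\<bar> ^ m - \<bar>r t\<bar> ^ m\<bar> \<le> \<epsilon>"
      using uniform_compose[OF unif rB _ \<epsilon>, where \<phi>="\<lambda>x. \<bar>x\<bar> ^ m"] by (force intro!: continuous_intros)
    obtain d3 where d3: "d3 > 0" "\<And>s t. norm (s - t) \<le> d3 \<Longrightarrow> \<bar>\<bar>r s\<bar>\<^sup>2 - \<bar>r t\<bar>\<^sup>2\<bar> \<le> \<epsilon>"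
      using uniform_compose[OF unif rB _ \<epsilon>, where \<phi>="\<lambda>x. \<bar>x\<bar>\<^sup>2"] by (force intro!: continuous_intros)
    \<comment> \<open>In the variance both arguments of \<open>r\<close> are quantised, so their
      difference moves by up to 2 \<eta>; in the sums for R1 and R2 only one argument moves.\<close>
    define \<eta> where "\<eta> = min (d1 / 2) (min d2 d3)"
    have \<eta>: "0 < \<eta>" "2 * \<eta> \<le> d1" "\<eta> \<le> d1" "\<eta> \<le> d2" "\<eta> \<le> d3" using d1(1) d2(1) d3(1) by (auto simp: \<eta>_def)
    obtain \<pi> where pm: "\<pi> \<in> borel_measurable borel" and pf: "finite (range \<pi>)" and pD: "range \<pi> \<subseteq> D" and p\<eta>: "\<And>t. t \<in> D \<Longrightarrow> norm (\<pi> t - t) \<le> \<eta>"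
      using compact_quantisation[OF D(1,2) \<eta>(1)] by blast
    have pm' [measurable]: "\<pi> \<in> N \<rightarrow>\<^sub>M borel" using pm by measurable
    define K where "K = range \<pi>"
    have K: "finite K" "K \<subseteq> D" using pf pD by (simp_all add: K_def)
    have pK: "\<pi> t \<in> D" for t using pD by auto
    define w where "w k = measure N {t\<in>space N. \<pi> t = k}" for k
    note disc = integral_finite_range[OF N pm' pf, folded K_def w_def]
    define S' where "S' \<omega> = (LINT t|N. h (\<pi> t) \<omega>)" for \<omega>
    have S'_eq: "S' \<omega> = (\<Sum>k\<in>K. w k * h k \<omega>)" for \<omega> unfolding S'_def by (rule disc)
    have hkm: "h k \<in> borel_measurable M" if "k \<in> D" for k using hmom[OF that] by (rule all_moments_measurable)
    have S'm [measurable]: "S' \<in> borel_measurable M" unfolding S'_eq[abs_def]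
      using K hkm by (intro borel_measurable_sum borel_measurable_times) auto
    define V' where "V' = fact (Suc m) * (\<Sum>i\<in>K. \<Sum>j\<in>K. w i * w j * r (i - j) ^ Suc m)"
    have close1: "\<bar>(LINT t|N. \<bar>r (i - \<pi> t)\<bar> ^ m) - (LINT t|N. \<bar>r (i - t)\<bar> ^ m)\<bar> \<le> n * \<epsilon>" for i
      unfolding n_def
    proof (rule N.integral_close)
      show "AE t in N. \<bar>\<bar>r (i - \<pi> t)\<bar> ^ m - \<bar>r (i - t)\<bar> ^ m\<bar> \<le> \<epsilon>"
        using D(3) by eventually_elim (use p\<eta> \<eta> in \<open>force intro!: d2(2) simp: norm_minus_commute\<close>)
    qed (rule disc pow_int)+
    have close2: "\<bar>(LINT t|N. \<bar>r (i - \<pi> t)\<bar>\<^sup>2) - (LINT t|N. \<bar>r (i - t)\<bar>\<^sup>2)\<bar> \<le> n * \<epsilon>" for i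
      unfolding n_def
    proof (rule N.integral_close)
      show "AE t in N. \<bar>\<bar>r (i - \<pi> t)\<bar>\<^sup>2 - \<bar>r (i - t)\<bar>\<^sup>2\<bar> \<le> \<epsilon>"
        using D(3) by eventually_elim (use p\<eta> \<eta> in \<open>force intro!: d3(2) simp: norm_minus_commute\<close>)
    qed (rule disc pow_int)+
    have discrete: "cmod ((LINT \<omega>|M. cis (u * S' \<omega>)) - of_real (exp (- (V' * u\<^sup>2 / 2)))) \<le> u\<^sup>2 * sqrt (C * (n * (R2 + n * \<epsilon>) * (R1 + n * \<epsilon>)\<^sup>2))"
    proof -
      have sw: "(\<Sum>k\<in>K. w k) = n" using disc(1)[of "\<lambda>_. 1"] by (simp add: n_def)
      have r1: "(\<Sum>k\<in>K. w k * \<bar>r (i - k)\<bar> ^ m) \<le> R1 + n * \<epsilon>" if "i \<in> K" for i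
        using disc(1)[of "\<lambda>k. \<bar>r (i - k)\<bar> ^ m"] close1[of i] R1[of i] that K by auto
      have r2: "(\<Sum>k\<in>K. w k * \<bar>r (i - k)\<bar>\<^sup>2) \<le> R2 + n * \<epsilon>" if "i \<in> K" for i
        using disc(1)[of "\<lambda>k. \<bar>r (i - k)\<bar>\<^sup>2"] close2[of i] R2[of i] that K by auto
      have w0: "0 \<le> w i" for i by (simp add: w_def)
      have vv: "r (i - i) = r 0" for i by simp
      show ?thesis
        using hermite_sum_char[OF G[OF K] vv v w0 r1 r2, where u=u]
        unfolding S'_eq V'_def C_def h_def sw by simp
    qed
    have step1: "cmod ((LINT \<omega>|M. cis (u * S \<omega>)) - (LINT \<omega>|M. cis (u * S' \<omega>))) \<le> \<bar>u\<bar> * (n * sqrt (2 * fact (Suc m) * \<epsilon>))"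
    proof -
      define q where "q = sqrt (2 * fact (Suc m) * \<epsilon>)"
      define g where "g = (\<lambda>(t, \<omega>). h (\<pi> t) \<omega>)"
      have gm: "g \<in> borel_measurable (N \<Otimes>\<^sub>M M)"
      proof -
        have eq: "g x = (\<Sum>k\<in>K. indicator {t\<in>space N. \<pi> t = k} (fst x) * h k (snd x))" for x
          unfolding g_def using K(1) by (subst sum.remove[of _ "\<pi> (fst x)"]) (auto intro!: sum.neutral simp: indicator_def K_def split: prod.split)
        have "(\<lambda>x. indicator {t\<in>space N. \<pi> t = k} (fst x) * h k (snd x)) \<in> borel_measurable (N \<Otimes>\<^sub>M M)" if "k \<in> K" for k
        proof -
          have [measurable]: "h k \<in> borel_measurable M" using hkm that K by auto
          show ?thesis by measurable
        qed
        then show ?thesis unfolding eq[abs_def] by (intro borel_measurable_sum) auto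
      qed
      have gm' [measurable]: "(\<lambda>(t, \<omega>). h (\<pi> t) \<omega>) \<in> borel_measurable (N \<Otimes>\<^sub>M M)" using gm by (simp add: g_def)
      have hb: "expectation (\<lambda>\<omega>. \<bar>h t \<omega> - h (\<pi> t) \<omega>\<bar>) \<le> q" if "t \<in> D" for t
      proof -
        have "\<bar>r (t - \<pi> t) ^ Suc m - r 0 ^ Suc m\<bar> \<le> \<epsilon>"
          using p\<eta>[OF that] \<eta> by (intro d1(2)) (simp add: norm_minus_commute)
        then have "r 0 ^ Suc m - r (t - \<pi> t) ^ Suc m \<le> \<epsilon>" by linarith
        then show ?thesis unfolding q_def
          by (intro order_trans[OF diff_bound[OF that pK]] real_sqrt_le_mono mult_left_mono) auto
      qed
      have dm: "(\<lambda>(t, \<omega>). h t \<omega> - h (\<pi> t) \<omega>) \<in> borel_measurable (N \<Otimes>\<^sub>M M)" by measurable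
      have dint: "integrable (N \<Otimes>\<^sub>M M) (\<lambda>(t, \<omega>). h t \<omega> - h (\<pi> t) \<omega>)"
      proof (rule NM.Fubini_integrable[OF dm])
        show "integrable N (\<lambda>t. LINT \<omega>|M. norm (case (t, \<omega>) of (t, \<omega>) \<Rightarrow> h t \<omega> - h (\<pi> t) \<omega>))"
        proof (rule N.integrable_const_bound[where B=q])
          show "AE t in N. norm (LINT \<omega>|M. norm (case (t, \<omega>) of (t, \<omega>) \<Rightarrow> h t \<omega> - h (\<pi> t) \<omega>)) \<le> q"
            using D(3) by eventually_elim (use hb in simp)
        qed measurable
        show "AE t in N. integrable M (\<lambda>\<omega>. case (t, \<omega>) of (t, \<omega>) \<Rightarrow> h t \<omega> - h (\<pi> t) \<omega>)"
          using D(3) by eventually_elim (auto intro!: all_moments_integrable hdiff pK)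
      qed
      \<comment> \<open>An integral whose integrand is not integrable is 0 by convention, so
        linearity needs integrable sections. The quantised section has finite range and is always
        integrable; the difference is integrable for almost every outcome, and hence so is the
        original section.\<close>
      have sect: "AE \<omega> in M. S \<omega> - S' \<omega> = (LINT t|N. h t \<omega> - h (\<pi> t) \<omega>)"
        using NM.AE_integrable_snd[OF dint]
      proof eventually_elim
        case (elim \<omega>)
        have i2: "integrable N (\<lambda>t. h (\<pi> t) \<omega>)" by (rule disc(2))
        have "integrable N (\<lambda>t. (h t \<omega> - h (\<pi> t) \<omega>) + h (\<pi> t) \<omega>)"
          using elim i2 by (intro Bochner_Integration.integrable_add) auto
        then show ?case unfolding S_def S'_def using i2 by simp
      qed
      have dabs: "integrable (N \<Otimes>\<^sub>M M) (\<lambda>(t, \<omega>). \<bar>h t \<omega> - h (\<pi> t) \<omega>\<bar>)"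
        using integrable_abs[OF dint] by (simp add: split_beta')
      have di: "integrable M (\<lambda>\<omega>. LINT t|N. \<bar>h t \<omega> - h (\<pi> t) \<omega>\<bar>)"
        by (rule NM.integrable_snd[OF dabs])
      have "cmod ((LINT \<omega>|M. cis (u * S \<omega>)) - (LINT \<omega>|M. cis (u * S' \<omega>))) = cmod (LINT \<omega>|M. cis (u * S \<omega>) - cis (u * S' \<omega>))"
        by (subst Bochner_Integration.integral_diff) (auto intro!: integrable_const_bound[where B=1])
      also have "\<dots> \<le> (LINT \<omega>|M. cmod (cis (u * S \<omega>) - cis (u * S' \<omega>)))" by (rule integral_norm_bound)
      also have "\<dots> \<le> (LINT \<omega>|M. \<bar>u\<bar> * (LINT t|N. \<bar>h t \<omega> - h (\<pi> t) \<omega>\<bar>))"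
      proof (rule integral_mono_AE)
        show "integrable M (\<lambda>\<omega>. cmod (cis (u * S \<omega>) - cis (u * S' \<omega>)))"
          by (rule integrable_const_bound[where B=2]) (auto intro!: order_trans[OF norm_triangle_ineq4])
        show "integrable M (\<lambda>\<omega>. \<bar>u\<bar> * (LINT t|N. \<bar>h t \<omega> - h (\<pi> t) \<omega>\<bar>))" by (intro integrable_mult_right di)
        show "AE \<omega> in M. cmod (cis (u * S \<omega>) - cis (u * S' \<omega>)) \<le> \<bar>u\<bar> * (LINT t|N. \<bar>h t \<omega> - h (\<pi> t) \<omega>\<bar>)"
          using sect
        proof eventually_elim
          case (elim \<omega>)
          have "cmod (cis (u * S \<omega>) - cis (u * S' \<omega>)) \<le> \<bar>u * S \<omega> - u * S' \<omega>\<bar>" by (rule norm_cis_diff_le)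
          also have "\<dots> = \<bar>u\<bar> * \<bar>LINT t|N. h t \<omega> - h (\<pi> t) \<omega>\<bar>" by (simp add: abs_mult flip: elim right_diff_distrib)
          also have "\<dots> \<le> \<bar>u\<bar> * (LINT t|N. \<bar>h t \<omega> - h (\<pi> t) \<omega>\<bar>)" by (intro mult_left_mono integral_abs_bound) simp
          finally show ?case .
        qed
      qed
      also have "\<dots> = \<bar>u\<bar> * (LINT \<omega>|M. LINT t|N. \<bar>h t \<omega> - h (\<pi> t) \<omega>\<bar>)" by (rule integral_mult_right_zero)
      also have "(LINT \<omega>|M. LINT t|N. \<bar>h t \<omega> - h (\<pi> t) \<omega>\<bar>) = (LINT t|N. LINT \<omega>|M. \<bar>h t \<omega> - h (\<pi> t) \<omega>\<bar>)"
        by (rule NM.Fubini_integral[OF dabs])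
      also have "\<dots> \<le> (LINT t|N. q)"
      proof (rule integral_mono_AE)
        show "integrable N (\<lambda>t. LINT \<omega>|M. \<bar>h t \<omega> - h (\<pi> t) \<omega>\<bar>)"
          by (rule NM.integrable_fst[OF dabs])
        show "AE t in N. (LINT \<omega>|M. \<bar>h t \<omega> - h (\<pi> t) \<omega>\<bar>) \<le> q" using D(3) by eventually_elim (rule hb)
      qed simp
      also have "(LINT t|N. q) = n * q" by (simp add: n_def)
      finally show ?thesis by (simp add: q_def mult_left_mono)
    qed
    have V_close: "\<bar>V' - V\<bar> \<le> fact (Suc m) * (n * (n * \<epsilon>))"
    proof -
      have "(\<Sum>i\<in>K. \<Sum>j\<in>K. w i * w j * r (i - j) ^ Suc m) = (\<Sum>i\<in>K. w i * (\<Sum>j\<in>K. w j * r (i - j) ^ Suc m))"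
        by (simp only: sum_distrib_left mult.assoc)
      also have "\<dots> = (LINT t|N. LINT s|N. r (\<pi> t - \<pi> s) ^ Suc m)" unfolding disc(1)[symmetric] ..
      finally have V': "V' = fact (Suc m) * (LINT t|N. LINT s|N. r (\<pi> t - \<pi> s) ^ Suc m)" by (simp only: V'_def)
      have "\<bar>(LINT t|N. LINT s|N. r (\<pi> t - \<pi> s) ^ Suc m) - (LINT t|N. LINT s|N. r (t - s) ^ Suc m)\<bar> \<le> measure N (space N) * (n * \<epsilon>)"
      proof (rule N.integral_close)
        have nb: "\<bar>LINT s|N. r (t - s) ^ Suc m\<bar> \<le> n * B ^ Suc m" for t
        proof -
          have "\<bar>LINT s|N. r (t - s) ^ Suc m\<bar> \<le> (LINT s|N. \<bar>r (t - s) ^ Suc m\<bar>)" by (rule integral_abs_bound)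
          also have "\<dots> \<le> (LINT s|N. B ^ Suc m)"
            by (intro integral_mono integrable_abs pow_int) (auto simp: power_abs simp del: power_Suc intro!: power_mono rB)
          finally show ?thesis by (simp add: n_def)
        qed
        show "integrable N (\<lambda>t. LINT s|N. r (t - s) ^ Suc m)"
        proof (rule N.integrable_const_bound[where B="n * B ^ Suc m"])
          show "AE t in N. norm (LINT s|N. r (t - s) ^ Suc m) \<le> n * B ^ Suc m" using nb by simp
        qed measurable
        show "integrable N (\<lambda>t. LINT s|N. r (\<pi> t - \<pi> s) ^ Suc m)" by (rule disc)
        show "AE t in N. \<bar>(LINT s|N. r (\<pi> t - \<pi> s) ^ Suc m) - (LINT s|N. r (t - s) ^ Suc m)\<bar> \<le> n * \<epsilon>"
          using D(3)
        proof eventually_elim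
          case (elim t)
          show ?case unfolding n_def
          proof (rule N.integral_close)
            show "AE s in N. \<bar>r (\<pi> t - \<pi> s) ^ Suc m - r (t - s) ^ Suc m\<bar> \<le> \<epsilon>"
              using D(3)
            proof eventually_elim
              case (elim s)
              have "norm ((\<pi> t - \<pi> s) - (t - s)) \<le> norm (\<pi> t - t) + norm (\<pi> s - s)"
                using norm_triangle_ineq4[of "\<pi> t - t" "\<pi> s - s"] by (simp add: algebra_simps)
              then show ?case using p\<eta>[OF elim] p\<eta>[OF \<open>t \<in> D\<close>] \<eta>(2) by (intro d1(2)) linarith
            qed
          qed (rule disc pow_int)+
        qed
      qed
      then show ?thesis unfolding V' V_def right_diff_distrib[symmetric] abs_mult n_def
        by (intro mult_mono) auto
    qed
    have vv: "r (i - i) = r 0" for i by simp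
    have V0: "0 \<le> V'" unfolding V'_def by (rule hermite_sum_variance_nonneg[OF G[OF K] vv v])
    have "cmod ((LINT \<omega>|M. cis (u * S \<omega>)) - of_real (exp (- (V' * u\<^sup>2 / 2)))) \<le>
      cmod ((LINT \<omega>|M. cis (u * S \<omega>)) - (LINT \<omega>|M. cis (u * S' \<omega>))) + cmod ((LINT \<omega>|M. cis (u * S' \<omega>)) - of_real (exp (- (V' * u\<^sup>2 / 2))))"
      by norm
    then have "cmod ((LINT \<omega>|M. cis (u * S \<omega>)) - of_real (exp (- (V' * u\<^sup>2 / 2)))) \<le> E1 \<epsilon>"
      unfolding E1_def using step1 discrete by linarith
    then show ?thesis using V0 V_close by (auto simp: c_def mult.assoc)
  qed
  \<comment> \<open>Nonnegativity is known for the variances of finite sums and passes to the limit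
    as \<epsilon> tends to 0.\<close>
  have V0: "0 \<le> V"
  proof -
    have "((\<lambda>\<epsilon>. V + c * \<epsilon>) \<longlongrightarrow> V + c * 0) (at_right 0)" by (intro tendsto_intros)
    moreover have "eventually (\<lambda>\<epsilon>. 0 \<le> V + c * \<epsilon>) (at_right 0)"
      using approx by (intro eventually_at_rightI[of 0 1]) force+
    ultimately show ?thesis using tendsto_lowerbound by fastforce
  qed
  define E where "E \<epsilon> = u\<^sup>2 / 2 * (c * \<epsilon>) + E1 \<epsilon>" for \<epsilon>
  have main: "cmod ((LINT \<omega>|M. cis (u * S \<omega>)) - of_real (exp (- (V * u\<^sup>2 / 2)))) \<le> E \<epsilon>" if \<epsilon>: "0 < \<epsilon>" for \<epsilon>
  proof -
    obtain V' where V': "0 \<le> V'" "\<bar>V' - V\<bar> \<le> c * \<epsilon>" "cmod ((LINT \<omega>|M. cis (u * S \<omega>)) - of_real (exp (- (V' * u\<^sup>2 / 2)))) \<le> E1 \<epsilon>"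
      using approx[OF \<epsilon>] by blast
    have step2: "cmod (of_real (exp (- (V' * u\<^sup>2 / 2))) - complex_of_real (exp (- (V * u\<^sup>2 / 2)))) \<le> u\<^sup>2 / 2 * (c * \<epsilon>)"
    proof -
      have "\<bar>exp (- (V' * u\<^sup>2 / 2)) - exp (- (V * u\<^sup>2 / 2))\<bar> \<le> \<bar>V' * u\<^sup>2 / 2 - V * u\<^sup>2 / 2\<bar>"
        using V0 V'(1) by (intro exp_minus_diff_le) auto
      also have "V' * u\<^sup>2 / 2 - V * u\<^sup>2 / 2 = u\<^sup>2 / 2 * (V' - V)" by (simp add: field_simps)
      also have "\<bar>u\<^sup>2 / 2 * (V' - V)\<bar> = u\<^sup>2 / 2 * \<bar>V' - V\<bar>" by (simp add: abs_mult)
      also have "\<dots> \<le> u\<^sup>2 / 2 * (c * \<epsilon>)" using V'(2) by (intro mult_left_mono) auto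
      finally show ?thesis by (simp flip: of_real_diff)
    qed
    have "cmod ((LINT \<omega>|M. cis (u * S \<omega>)) - of_real (exp (- (V * u\<^sup>2 / 2)))) \<le>
      cmod (of_real (exp (- (V' * u\<^sup>2 / 2))) - complex_of_real (exp (- (V * u\<^sup>2 / 2)))) + cmod ((LINT \<omega>|M. cis (u * S \<omega>)) - of_real (exp (- (V' * u\<^sup>2 / 2))))"
      by norm
    then show ?thesis unfolding E_def using step2 V'(3) by linarith
  qed
  have "(E \<longlongrightarrow> E 0) (at_right 0)"
    unfolding E_def[abs_def] E1_def[abs_def] by (intro tendsto_intros)
  then have "cmod ((LINT \<omega>|M. cis (u * S \<omega>)) - of_real (exp (- (V * u\<^sup>2 / 2)))) \<le> E 0"
    by (rule tendsto_lowerbound) (use main in \<open>auto intro!: eventually_at_rightI[of 0 1]\<close>)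
  then show ?thesis by (simp add: E_def E1_def S_def h_def n_def)
qed

section \<open>Growth of boxes\<close>

text \<open>The one-dimensional measure of an interval: the number of integers in it, or its length.
  Both forms yield 0 for an empty interval with reversed endpoints, so intersections of boxes need
  no separate treatment.\<close>

definition side :: "time_case \<Rightarrow> real \<Rightarrow> real \<Rightarrow> real" where
  "side c a b = (case c of Discrete \<Rightarrow> real (nat (\<lfloor>b\<rfloor> - \<lceil>a\<rceil> + 1)) | Continuous \<Rightarrow> max 0 (b - a))"

lemma side_approx: "\<bar>side c a b - max 0 (b - a)\<bar> \<le> 1"
proof (cases c)
  case Discrete
  have e: "real_of_int (\<lfloor>b\<rfloor> - \<lceil>a\<rceil> + 1) \<le> b - a + 1" "b - a - 1 < real_of_int (\<lfloor>b\<rfloor> - \<lceil>a\<rceil> + 1)"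
    by linarith+
  show ?thesis
  proof (cases "0 \<le> \<lfloor>b\<rfloor> - \<lceil>a\<rceil> + 1")
    case True
    then have "side c a b = real_of_int (\<lfloor>b\<rfloor> - \<lceil>a\<rceil> + 1)" "0 \<le> real_of_int (\<lfloor>b\<rfloor> - \<lceil>a\<rceil> + 1)" using Discrete by (simp_all add: side_def)
    then show ?thesis using e by linarith
  next
    case False
    then have "side c a b = 0" "real_of_int (\<lfloor>b\<rfloor> - \<lceil>a\<rceil> + 1) < 0" using Discrete by (simp_all only: side_def) auto
    then show ?thesis using e by linarith
  qed
qed (simp add: side_def)

lemma side_nonneg: "0 \<le> side c a b"
  by (cases c) (auto simp: side_def)

definition time_box :: "time_case \<Rightarrow> real ^ 'd::finite \<Rightarrow> real ^ 'd \<Rightarrow> (real ^ 'd) set" where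
  "time_box c a b = {t \<in> index_set c. \<forall>i. a $ i \<le> t $ i \<and> t $ i \<le> b $ i}"

lemma time_box_eq: "time_box c a b = index_set c \<inter> cbox a b"
  by (auto simp: time_box_def mem_box_cart)

lemma time_box_borel [measurable]: "time_box c a b \<in> sets borel"
  unfolding time_box_eq by measurable

lemma integrable_time_borel: "integrable (time_measure c) g \<Longrightarrow> g \<in> borel_measurable borel"
  using borel_measurable_integrable[of "time_measure c" g] unfolding measurable_cong_sets[OF sets_time_measure refl] by blast

lemma
  fixes a b :: "real ^ 'd::finite"
  shows finite_time_box_Discrete: "finite (time_box Discrete a b)"
  and emeasure_time_box: "emeasure (time_measure c) (time_box c a b) = ennreal (\<Prod>i\<in>UNIV. side c (a $ i) (b $ i))"
proof -
  have int: "a $ i \<le> t $ i \<longleftrightarrow> of_int \<lceil>a $ i\<rceil> \<le> t $ i" "t $ i \<le> b $ i \<longleftrightarrow> t $ i \<le> of_int \<lfloor>b $ i\<rfloor>"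
    if "t \<in> index_set Discrete" for t :: "real ^ 'd" and i
  proof -
    have "t $ i \<in> \<int>" using that by (simp add: index_set_def)
    then obtain k where "t $ i = of_int k" by (elim Ints_cases)
    then show "a $ i \<le> t $ i \<longleftrightarrow> of_int \<lceil>a $ i\<rceil> \<le> t $ i" "t $ i \<le> b $ i \<longleftrightarrow> t $ i \<le> of_int \<lfloor>b $ i\<rfloor>"
      by (simp_all add: ceiling_le_iff le_floor_iff)
  qed
  have eq: "time_box Discrete a b = {t \<in> index_set Discrete. \<forall>i. of_int \<lceil>a $ i\<rceil> \<le> t $ i \<and> t $ i \<le> of_int \<lfloor>b $ i\<rfloor>}"
    unfolding time_box_def using int by blast
  show fin: "finite (time_box Discrete a b)" unfolding eq by (rule finite_integer_box)
  show "emeasure (time_measure c) (time_box c a b) = ennreal (\<Prod>i\<in>UNIV. side c (a $ i) (b $ i))"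
  proof (cases c)
    case Discrete
    have "emeasure (time_measure Discrete) (time_box Discrete a b) = emeasure (count_space (index_set Discrete)) (time_box Discrete a b)"
      by (subst emeasure_time_Discrete) (auto simp: time_box_def intro!: arg_cong2[where f=emeasure])
    also have "\<dots> = of_nat (card (time_box Discrete a b))"
      by (rule emeasure_count_space_finite) (auto simp: time_box_def fin[unfolded time_box_def])
    also have "card (time_box Discrete a b) = (\<Prod>i\<in>UNIV. nat (\<lfloor>b $ i\<rfloor> - \<lceil>a $ i\<rceil> + 1))" unfolding eq by (rule card_integer_box)
    finally show ?thesis using Discrete by (simp add: side_def ennreal_of_nat_eq_real_of_nat)
  next
    case Continuous
    have "measure lborel (cbox a b) = (\<Prod>i\<in>UNIV. max 0 (b $ i - a $ i))"
    proof (cases "cbox a b = {}")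
      case True
      then obtain i where "b $ i < a $ i" by (auto simp: interval_eq_empty_cart)
      then have "max 0 (b $ i - a $ i) = 0" by simp
      then have "(\<Prod>i\<in>UNIV. max 0 (b $ i - a $ i)) = 0" by (intro prod_zero) auto
      then show ?thesis using True by simp
    next
      case False
      then have "a $ i \<le> b $ i" for i by (auto simp: interval_ne_empty_cart)
      then show ?thesis using content_cbox_cart[OF False] by (auto intro!: prod.cong simp: max_def)
    qed
    moreover have "emeasure lborel (cbox a b) = ennreal (measure lborel (cbox a b))"
      by (rule emeasure_eq_ennreal_measure) (use emeasure_lborel_cbox_finite[of a b] in auto)
    ultimately show ?thesis
      using Continuous by (simp add: time_box_eq time_measure_Continuous side_def index_set_def)
  qed
qed

lemma measure_time_box: "measure (time_measure c) (time_box c a b) = (\<Prod>i\<in>UNIV. side c (a $ i) (b $ i))"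
  by (rule measure_eq_emeasure_eq_ennreal) (auto intro: prod_nonneg simp: side_nonneg emeasure_time_box)

lemma compact_time_box: "compact (time_box c a b)"
proof (cases c)
  case Discrete
  then show ?thesis by (simp add: finite_time_box_Discrete finite_imp_compact)
qed (simp add: time_box_eq index_set_def)

lemma integral_time_reflect:
  fixes h :: "real ^ 'd::finite \<Rightarrow> real"
  assumes h: "h \<in> borel_measurable borel" and a: "a \<in> index_set c"
  shows "(LINT t|time_measure c. h (a - t)) = (LINT t|time_measure c. h t)"
proof -
  have "distr (time_measure c) borel (\<lambda>t. a - t) = time_measure c"
  proof (rule measure_eqI)
    fix A assume "A \<in> sets (distr (time_measure c) borel (\<lambda>t. a - t))"
    then have [measurable]: "A \<in> sets borel" by simp
    have "emeasure (distr (time_measure c) borel (\<lambda>t. a - t)) A = (\<integral>\<^sup>+ t. indicator A t \<partial>distr (time_measure c) borel (\<lambda>t. a - t))"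
      by simp
    also have "\<dots> = (\<integral>\<^sup>+ t. indicator A (a - t) \<partial>time_measure c)"
      by (rule nn_integral_distr) measurable
    also have "\<dots> = (\<integral>\<^sup>+ t. indicator A t \<partial>time_measure c)" by (rule nn_integral_time_reflect[OF _ a]) measurable
    finally show "emeasure (distr (time_measure c) borel (\<lambda>t. a - t)) A = emeasure (time_measure c) A" by simp
  qed simp
  then have "(LINT t|time_measure c. h t) = (LINT t|distr (time_measure c) borel (\<lambda>t. a - t). h t)" by simp
  also have "\<dots> = (LINT t|time_measure c. h (a - t))"
    by (rule integral_distr[OF _ h]) measurable
  finally show ?thesis by simp
qed

interpretation time2: pair_sigma_finite "time_measure c" "time_measure c'" ..

text \<open>In the variables t and the difference s, the inner integral over t is the measure of the
  intersection of the box with its translate by s. That intersection is again a box, whence the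
  product of sides.\<close>

lemma double_integral_time_box:
  fixes g :: "real ^ 'd::finite \<Rightarrow> real"
  assumes g: "integrable (time_measure c) g"
  shows "(LINT t|time_measure c. indicator (time_box c a b) t * (LINT s|time_measure c. indicator (time_box c a b) s * g (t - s)))
    = (LINT s|time_measure c. (\<Prod>i\<in>UNIV. side c (max (a $ i) (a $ i + s $ i)) (min (b $ i) (b $ i + s $ i))) * g s)"
proof -
  let ?\<nu> = "time_measure c" and ?D = "time_box c a b"
  have [measurable]: "g \<in> borel_measurable borel" by (rule integrable_time_borel[OF g])
  have i1: "integrable ?\<nu> (\<lambda>t. indicator ?D t :: real)"
    by (rule integrable_real_indicator) (simp_all add: emeasure_time_box)
  have i2: "integrable (?\<nu> \<Otimes>\<^sub>M ?\<nu>) (\<lambda>(t, s). indicator ?D t * (indicator ?D (t - s) * g s))"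
  proof (rule Bochner_Integration.integrable_bound[OF time2.integrable_pair_mult[OF i1 g]])
    show "AE x in ?\<nu> \<Otimes>\<^sub>M ?\<nu>. norm (case x of (t, s) \<Rightarrow> indicator ?D t * (indicator ?D (t - s) * g s)) \<le> norm (indicator ?D (fst x) * g (snd x))"
      by (intro AE_I2) (auto simp: indicator_def)
  qed measurable
  have "(LINT t|?\<nu>. indicator ?D t * (LINT s|?\<nu>. indicator ?D s * g (t - s))) = (LINT t|?\<nu>. LINT s|?\<nu>. indicator ?D t * (indicator ?D (t - s) * g s))"
  proof (rule Bochner_Integration.integral_cong_AE)
    show "AE t in ?\<nu>. indicator ?D t * (LINT s|?\<nu>. indicator ?D s * g (t - s)) = (LINT s|?\<nu>. indicator ?D t * (indicator ?D (t - s) * g s))"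
      using AE_time_measure
    proof eventually_elim
      case (elim t)
      have "(LINT s|?\<nu>. indicator ?D s * g (t - s)) = (LINT s|?\<nu>. indicator ?D (t - s) * g (t - (t - s)))"
        by (rule integral_time_reflect[OF _ elim, symmetric]) measurable
      then show ?case by simp
    qed
  qed measurable
  also have "\<dots> = (LINT s|?\<nu>. LINT t|?\<nu>. indicator ?D t * (indicator ?D (t - s) * g s))"
    by (rule time2.Fubini_integral[OF i2, symmetric])
  also have "\<dots> = (LINT s|?\<nu>. (\<Prod>i\<in>UNIV. side c (max (a $ i) (a $ i + s $ i)) (min (b $ i) (b $ i + s $ i))) * g s)"
  proof (rule Bochner_Integration.integral_cong_AE)
    show "AE s in ?\<nu>. (LINT t|?\<nu>. indicator ?D t * (indicator ?D (t - s) * g s)) = (\<Prod>i\<in>UNIV. side c (max (a $ i) (a $ i + s $ i)) (min (b $ i) (b $ i + s $ i))) * g s"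
      using AE_time_measure
    proof eventually_elim
      case (elim s)
      let ?E = "time_box c (\<chi> i. max (a $ i) (a $ i + s $ i)) (\<chi> i. min (b $ i) (b $ i + s $ i))"
      have "t - s \<in> index_set c" if "t \<in> index_set c" for t using that elim by (rule index_set_diff)
      then have eq: "indicator ?D t * (indicator ?D (t - s) * g s) = indicator ?E t * g s" for t
        by (auto simp: time_box_def indicator_def algebra_simps)
      show ?case unfolding eq by (simp add: measure_time_box)
    qed
    show "(\<lambda>s. (\<Prod>i\<in>UNIV. side c (max (a $ i) (a $ i + s $ i)) (min (b $ i) (b $ i + s $ i))) * g s) \<in> borel_measurable ?\<nu>"
      unfolding side_def by (cases c) (simp_all, measurable)
  qed measurable
  finally show ?thesis .
qed

text \<open>For each fixed s the overlap fraction of the box with its translate tends to 1, and it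
  is bounded uniformly, so dominated convergence with the integrable \<open>g\<close> gives the
  limit. Both kinds of domain are covered by letting the sides deviate from T by at most 1.\<close>

lemma double_integral_limit:
  fixes g :: "real ^ 'd::finite \<Rightarrow> real" and a b :: "real \<Rightarrow> real ^ 'd"
  assumes g: "integrable (time_measure c) g" and ab: "\<And>T i. \<bar>b T $ i - a T $ i - T\<bar> \<le> 1"
  shows "((\<lambda>T. (LINT t|time_measure c. indicator (time_box c (a T) (b T)) t * (LINT s|time_measure c. indicator (time_box c (a T) (b T)) s * g (t - s))) / T ^ CARD('d))
     \<longlongrightarrow> (LINT s|time_measure c. g s)) at_top"
proof -
  let ?\<nu> = "time_measure c"
  have [measurable]: "g \<in> borel_measurable borel" by (rule integrable_time_borel[OF g])
  define \<sigma> where "\<sigma> T i s = side c (max (a T $ i) (a T $ i + s)) (min (b T $ i) (b T $ i + s))" for T i s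
  have \<sigma>0: "0 \<le> \<sigma> T i s" for T i s by (simp add: \<sigma>_def side_nonneg)
  have diff: "min (b T $ i) (b T $ i + s) - max (a T $ i) (a T $ i + s) = b T $ i - a T $ i - \<bar>s\<bar>" for T i s
    by (auto simp: min_def max_def)
  have \<sigma>_approx: "\<bar>\<sigma> T i s - max 0 (b T $ i - a T $ i - \<bar>s\<bar>)\<bar> \<le> 1" for T i s
    using side_approx[of c "max (a T $ i) (a T $ i + s)" "min (b T $ i) (b T $ i + s)"] unfolding diff by (simp only: \<sigma>_def)
  have arith: "\<bar>x - T\<bar> \<le> 2 + z" "x \<le> T + 2" if "\<bar>x - max 0 (y - z)\<bar> \<le> 1" "\<bar>y - T\<bar> \<le> 1" "0 \<le> T" "0 \<le> z" for x y z T :: real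
    using that by (cases "0 \<le> y - z"; simp add: max_def abs_le_iff split: if_splits)+
  note \<sigma>_close = arith(1)[OF \<sigma>_approx ab _ abs_ge_zero] and \<sigma>_le = arith(2)[OF \<sigma>_approx ab _ abs_ge_zero]
  have lim1: "((\<lambda>T. \<sigma> T i s / T) \<longlongrightarrow> 1) at_top" for i s
  proof (rule Lim_null[THEN iffD2], rule Lim_null_comparison)
    show "eventually (\<lambda>T. norm (\<sigma> T i s / T - 1) \<le> (2 + \<bar>s\<bar>) / T) at_top"
      using eventually_gt_at_top[of 0]
    proof eventually_elim
      case (elim T)
      then have "\<sigma> T i s / T - 1 = (\<sigma> T i s - T) / T" by (simp add: field_simps)
      then show ?case using \<sigma>_close[of T i s] elim by (simp add: divide_right_mono)
    qed
    show "((\<lambda>T. (2 + \<bar>s\<bar>) / T) \<longlongrightarrow> 0) at_top" by (rule tendsto_divide_0[OF tendsto_const]) (simp add: filterlim_at_top_imp_at_infinity filterlim_ident)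
  qed
  have "((\<lambda>T. LINT s|?\<nu>. (\<Prod>i\<in>UNIV. \<sigma> T i (s $ i) / T) * g s) \<longlongrightarrow> (LINT s|?\<nu>. g s)) at_top"
  proof (rule integral_dominated_convergence_at_top[where w="\<lambda>s. 3 ^ CARD('d) * \<bar>g s\<bar>"])
    show "integrable ?\<nu> (\<lambda>s. 3 ^ CARD('d) * \<bar>g s\<bar>)" using g by auto
    have "((\<lambda>T. (\<Prod>i\<in>UNIV. \<sigma> T i (s $ i) / T) * g s) \<longlongrightarrow> (\<Prod>i\<in>(UNIV :: 'd set). 1) * g s) at_top" for s
      by (intro tendsto_intros lim1)
    then show "AE s in ?\<nu>. ((\<lambda>T. (\<Prod>i\<in>UNIV. \<sigma> T i (s $ i) / T) * g s) \<longlongrightarrow> g s) at_top" by (intro AE_I2) simp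
    show "eventually (\<lambda>T. AE s in ?\<nu>. norm ((\<Prod>i\<in>UNIV. \<sigma> T i (s $ i) / T) * g s) \<le> 3 ^ CARD('d) * \<bar>g s\<bar>) at_top"
      using eventually_ge_at_top[of 1]
    proof eventually_elim
      case (elim T)
      \<comment> \<open>An overlap side is at most T + 2: one unit for the deviation of the box side
        and one for counting lattice points. For T at least 1 this is at most 3 T.\<close>
      have s1: "0 \<le> \<sigma> T i x / T \<and> \<sigma> T i x / T \<le> 3" for i x
        using \<sigma>_le[of T i x] \<sigma>0[of T i x] elim by (simp add: divide_le_eq)
      have "(\<Prod>i\<in>(UNIV :: 'd set). \<sigma> T i (s $ i) / T) \<le> (\<Prod>i\<in>(UNIV :: 'd set). 3)" for s :: "real ^ 'd"
        by (intro prod_mono s1)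
      moreover have "0 \<le> (\<Prod>i\<in>(UNIV :: 'd set). \<sigma> T i (s $ i) / T)" for s :: "real ^ 'd"
        using s1 by (intro prod_nonneg) auto
      ultimately show ?case by (intro AE_I2) (simp add: abs_mult mult_right_mono)
    qed
    show "(\<lambda>s. (\<Prod>i\<in>UNIV. \<sigma> T i (s $ i) / T) * g s) \<in> borel_measurable ?\<nu>" for T
      unfolding side_def \<sigma>_def by (cases c) (simp_all, measurable)
  qed measurable
  moreover have "(LINT s|?\<nu>. (\<Prod>i\<in>UNIV. \<sigma> T i (s $ i) / T) * g s) = (LINT t|?\<nu>. indicator (time_box c (a T) (b T)) t * (LINT s|?\<nu>. indicator (time_box c (a T) (b T)) s * g (t - s))) / T ^ CARD('d)" for T
    unfolding double_integral_time_box[OF g] by (simp add: prod_dividef \<sigma>_def flip: integral_divide_zero)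
  ultimately show ?thesis by simp
qed

text \<open>Split at height 1 / x. Above it, g^2 is at most g^(m+1) x^(m-1); below it, g^2 is at
  most 1 / x^2, integrated over a set of measure at most C x^(m+1). Both parts have order
  x^(m-1).\<close>

lemma second_moment_le:
  fixes g :: "'a \<Rightarrow> real"
  assumes g: "integrable M (\<lambda>t. g t ^ Suc m)" and g0: "\<And>t. 0 \<le> g t" and [measurable]: "g \<in> borel_measurable M" and m: "1 \<le> m"
    and B: "B \<in> sets M" "emeasure M B < \<infinity>" "measure M B \<le> C * x ^ Suc m" and x: "0 < x"
  shows "(LINT t|M. indicator B t * (g t)\<^sup>2) \<le> ((LINT t|M. g t ^ Suc m) + C) * x ^ (m - 1)"
proof -
  have iB: "integrable M (\<lambda>t. indicator B t :: real)" by (rule integrable_real_indicator) (use B in auto)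
  have "(LINT t|M. indicator B t * (g t)\<^sup>2) \<le> (LINT t|M. g t ^ Suc m * x ^ (m - 1) + indicator B t * (1 / x)\<^sup>2)"
  proof (rule integral_mono')
    show "integrable M (\<lambda>t. g t ^ Suc m * x ^ (m - 1) + indicator B t * (1 / x)\<^sup>2)" using g iB by simp
    fix t
    show "indicator B t * (g t)\<^sup>2 \<le> g t ^ Suc m * x ^ (m - 1) + indicator B t * (1 / x)\<^sup>2"
    proof (cases "1 / x \<le> g t")
      case True
      have e: "Suc m = 2 + (m - 1)" using m by simp
      have "(g t)\<^sup>2 * 1 \<le> (g t)\<^sup>2 * (g t * x) ^ (m - 1)"
        using True x by (intro mult_left_mono one_le_power) (auto simp: field_simps)
      also have "\<dots> = g t ^ Suc m * x ^ (m - 1)" unfolding e power_add by (simp add: power_mult_distrib)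
      finally show ?thesis using g0[of t] x by (auto simp: indicator_def intro: add_increasing2)
    next
      case False
      then have "(g t)\<^sup>2 \<le> (1 / x)\<^sup>2" using g0[of t] by (intro power_mono) auto
      moreover have "0 \<le> g t ^ Suc m * x ^ (m - 1)" using g0[of t] x by simp
      ultimately show ?thesis by (auto simp: indicator_def)
    qed
    show "0 \<le> g t ^ Suc m * x ^ (m - 1) + indicator B t * (1 / x)\<^sup>2" using g0[of t] x by simp
  qed
  also have "\<dots> = (LINT t|M. g t ^ Suc m) * x ^ (m - 1) + measure M B * (1 / x)\<^sup>2" using g iB B by (simp add: sets.sets_into_space Int_absorb2)
  also have "\<dots> \<le> (LINT t|M. g t ^ Suc m) * x ^ (m - 1) + (C * x ^ Suc m) * (1 / x)\<^sup>2"
    using B by (intro add_left_mono mult_right_mono) auto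
  also have "(C * x ^ Suc m) * (1 / x)\<^sup>2 = C * x ^ (m - 1)"
    using m x by (cases m) (simp_all add: field_simps power2_eq_square)
  finally show ?thesis by (simp add: distrib_right)
qed

text \<open>The gain over Hoelder's O(x). Large values of \<open>g\<close> contribute a constant,
  which x in the denominator kills. Values below \<theta> / x contribute at most C \<theta>^m after
  division. Values in between are charged to \<tau> n, the part of the integral of g^(m+1) carried
  by small values, and this tends to 0.\<close>

lemma lower_moment_ratio_tendsto_0:
  fixes g :: "'a \<Rightarrow> real" and x :: "real \<Rightarrow> real"
  assumes g: "integrable M (\<lambda>t. g t ^ Suc m)" and g0: "\<And>t. 0 \<le> g t" and [measurable]: "g \<in> borel_measurable M" and m: "1 \<le> m"
    and B: "\<And>T. B T \<in> sets M" "\<And>T. emeasure M (B T) < \<infinity>" "eventually (\<lambda>T. measure M (B T) \<le> C * x T ^ Suc m) at_top"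
    and C: "0 \<le> C" and x: "filterlim x at_top at_top"
  shows "((\<lambda>T. (LINT t|M. indicator (B T) t * g t ^ m) / x T) \<longlongrightarrow> 0) at_top"
proof -
  let ?G = "LINT t|M. g t ^ Suc m"
  define \<tau> where "\<tau> n = (LINT t|M. g t ^ Suc m * (if g t < 1 / Suc n then 1 else 0))" for n :: nat
  have \<tau>_int: "integrable M (\<lambda>t. g t ^ Suc m * (if g t < 1 / Suc n then 1 else 0))" for n
    by (rule Bochner_Integration.integrable_bound[OF g]) auto
  have \<tau>0: "\<tau> \<longlonglongrightarrow> 0"
  proof -
    have "(\<lambda>n. LINT t|M. g t ^ Suc m * (if g t < 1 / Suc n then 1 else 0)) \<longlonglongrightarrow> (LINT t|M. 0)"
    proof (rule integral_dominated_convergence[where w="\<lambda>t. g t ^ Suc m"])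
      have "(\<lambda>n. g t ^ Suc m * (if g t < 1 / Suc n then 1 else 0)) \<longlonglongrightarrow> 0" for t
      proof (cases "g t = 0")
        case False
        then have "0 < g t" using g0[of t] by linarith
        then have "eventually (\<lambda>n. 1 / real (Suc n) < g t) sequentially"
          using order_tendstoD(2)[OF LIMSEQ_Suc[OF lim_1_over_n]] by simp
        then have "eventually (\<lambda>n. g t ^ Suc m * (if g t < 1 / Suc n then 1 else 0) = 0) sequentially"
          by eventually_elim auto
        then show ?thesis by (rule tendsto_eventually)
      qed simp
      then show "AE t in M. (\<lambda>n. g t ^ Suc m * (if g t < 1 / Suc n then 1 else 0)) \<longlonglongrightarrow> 0" by simp
      show "AE t in M. norm (g t ^ Suc m * (if g t < 1 / Suc n then 1 else 0)) \<le> g t ^ Suc m" for n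
        using g0 by (intro AE_I2) auto
    qed (use g in measurable)
    then show ?thesis by (simp add: \<tau>_def[abs_def])
  qed
  have bound: "(LINT t|M. indicator (B T) t * g t ^ m) / x T \<le> ?G * real (Suc n) / x T + \<tau> n / \<theta> + C * \<theta> ^ m"
    if T: "0 < x T" "measure M (B T) \<le> C * x T ^ Suc m" and \<theta>: "0 < \<theta>" for T \<theta> n
  proof -
    let ?i = "\<lambda>t. if g t < 1 / Suc n then 1 else (0::real)"
    have iB: "integrable M (\<lambda>t. indicator (B T) t :: real)" by (rule integrable_real_indicator) (use B in auto)
    have "(LINT t|M. indicator (B T) t * g t ^ m) \<le> (LINT t|M. g t ^ Suc m * real (Suc n) + g t ^ Suc m * ?i t * (x T / \<theta>) + indicator (B T) t * (\<theta> / x T) ^ m)"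
    proof (rule integral_mono')
      show "integrable M (\<lambda>t. g t ^ Suc m * real (Suc n) + g t ^ Suc m * ?i t * (x T / \<theta>) + indicator (B T) t * (\<theta> / x T) ^ m)"
        by (intro Bochner_Integration.integrable_add integrable_mult_left g \<tau>_int iB)
      fix t
      have nn: "0 \<le> g t ^ Suc m * real (Suc n)" "0 \<le> g t ^ Suc m * ?i t * (x T / \<theta>)" "0 \<le> indicator (B T) t * (\<theta> / x T) ^ m"
        using g0[of t] T \<theta> by auto
      then show "0 \<le> g t ^ Suc m * real (Suc n) + g t ^ Suc m * ?i t * (x T / \<theta>) + indicator (B T) t * (\<theta> / x T) ^ m" by linarith
      have gm: "0 \<le> g t ^ m" using g0[of t] by simp
      show "indicator (B T) t * g t ^ m \<le> g t ^ Suc m * real (Suc n) + g t ^ Suc m * ?i t * (x T / \<theta>) + indicator (B T) t * (\<theta> / x T) ^ m"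
      proof (cases "t \<in> B T")
        case True
        consider "1 / Suc n \<le> g t" | "g t < 1 / Suc n" "\<theta> / x T \<le> g t" | "g t < \<theta> / x T" by linarith
        then show ?thesis
        proof cases
          case 1
          then have "g t ^ m * 1 \<le> g t ^ m * (g t * real (Suc n))" by (intro mult_left_mono gm) (simp add: divide_le_eq)
          then have "g t ^ m \<le> g t ^ Suc m * real (Suc n)" by (simp only: power_Suc mult_ac mult_1_right)
          then show ?thesis using True nn by simp
        next
          case 2
          then have "g t ^ m * 1 \<le> g t ^ m * (g t * (x T / \<theta>))" using T \<theta> by (intro mult_left_mono gm) (simp add: divide_le_eq le_divide_eq)
          then have "g t ^ m \<le> g t ^ Suc m * ?i t * (x T / \<theta>)" using 2(1) by (simp only: power_Suc mult_ac mult_1_right if_True)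
          then show ?thesis using True nn by simp
        next
          case 3
          then have "g t ^ m \<le> (\<theta> / x T) ^ m" using g0[of t] by (intro power_mono) auto
          then show ?thesis using True nn by simp
        qed
      next
        case False
        then show ?thesis using nn by simp
      qed
    qed
    also have "\<dots> = ?G * real (Suc n) + \<tau> n * (x T / \<theta>) + measure M (B T) * (\<theta> / x T) ^ m"
    proof -
      have "(LINT t|M. indicator (B T) t * (\<theta> / x T) ^ m) = measure M (B T) * (\<theta> / x T) ^ m"
        using B(1)[of T] by (simp add: sets.sets_into_space Int_absorb2)
      then show ?thesis unfolding \<tau>_def
        by (simp only: Bochner_Integration.integral_add Bochner_Integration.integrable_add integrable_mult_left g \<tau>_int iB integral_mult_left_zero)
    qed
    also have "\<dots> \<le> ?G * real (Suc n) + \<tau> n * (x T / \<theta>) + (C * x T ^ Suc m) * (\<theta> / x T) ^ m"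
      using T \<theta> by (intro add_left_mono mult_right_mono) auto
    also have "(C * x T ^ Suc m) * (\<theta> / x T) ^ m = C * \<theta> ^ m * x T" using T by (simp add: power_divide)
    finally have "(LINT t|M. indicator (B T) t * g t ^ m) / x T \<le> (?G * real (Suc n) + \<tau> n * (x T / \<theta>) + C * \<theta> ^ m * x T) / x T"
      using T by (intro divide_right_mono) auto
    also have "\<dots> = ?G * real (Suc n) / x T + \<tau> n / \<theta> + C * \<theta> ^ m" using T by (simp add: add_divide_distrib)
    finally show ?thesis .
  qed
  show ?thesis
  proof (rule tendstoI)
    fix e :: real assume e: "0 < e"
    \<comment> \<open>The order of choices matters: \<theta> depends on e alone, then n is taken so
      large that \<tau> n is small compared with \<theta>, and T comes last. The three ranges then
      each cost at most e / 4.\<close>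
    define \<theta> where "\<theta> = min 1 (e / (4 * (C + 1)))"
    have \<theta>: "0 < \<theta>" "\<theta> \<le> 1" using e C by (auto simp: \<theta>_def)
    have "C * \<theta> ^ m \<le> (C + 1) * \<theta>" using \<theta> C m power_decreasing[of 1 m \<theta>] by (intro mult_mono) auto
    also have "\<dots> \<le> (C + 1) * (e / (4 * (C + 1)))" using C by (intro mult_left_mono) (auto simp: \<theta>_def)
    also have "\<dots> = e / 4" using C by (simp add: field_simps)
    finally have 1: "C * \<theta> ^ m \<le> e / 4" .
    have "eventually (\<lambda>n. \<tau> n < e / 4 * \<theta>) sequentially" by (rule order_tendstoD(2)[OF \<tau>0]) (use e \<theta> in simp)
    then obtain n where "\<tau> n < e / 4 * \<theta>" by (auto simp: eventually_sequentially)
    then have 2: "\<tau> n / \<theta> < e / 4" using \<theta> by (simp add: divide_less_eq)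
    have "((\<lambda>T. ?G * real (Suc n) / x T) \<longlongrightarrow> 0) at_top"
      by (rule tendsto_divide_0[OF tendsto_const filterlim_at_top_imp_at_infinity[OF x]])
    from order_tendstoD(2)[OF this, of "e / 4"] have ev: "eventually (\<lambda>T. ?G * real (Suc n) / x T < e / 4) at_top" using e by simp
    have "eventually (\<lambda>T. 0 < x T) at_top" using x by (auto simp: filterlim_at_top_dense)
    then show "eventually (\<lambda>T. dist ((LINT t|M. indicator (B T) t * g t ^ m) / x T) 0 < e) at_top"
      using ev B(3)
    proof eventually_elim
      case (elim T)
      have "0 \<le> (LINT t|M. indicator (B T) t * g t ^ m)" using g0 by (intro Bochner_Integration.integral_nonneg) auto
      then have "0 \<le> (LINT t|M. indicator (B T) t * g t ^ m) / x T" using elim by simp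
      then show ?case using bound[OF elim(1,3) \<theta>(1), of n] elim(2) 1 2 e unfolding dist_real_def by linarith
    qed
  qed
qed

section \<open>Stationary Gaussian fields\<close>

lemma normal_law_mean_variance:
  assumes "0 \<le> v"
  shows "(LINT x|normal_law 0 v. x) = 0" and "(LINT x|normal_law 0 v. x\<^sup>2) = v"
proof -
  have "(LINT x|normal_law 0 v. x) = 0 \<and> (LINT x|normal_law 0 v. x\<^sup>2) = v"
  proof (cases "v = 0")
    case True
    then show ?thesis by (simp add: normal_law_def integral_return)
  next
    case False
    then have s: "0 < sqrt v" using assms by simp
    have "(LINT x|normal_law 0 v. x) = (LINT x|lborel. normal_density 0 (sqrt v) x * x)"
      unfolding normal_law_def using False by (simp add: integral_density)
    also have "\<dots> = 0" using integral_normal_moment_nz_1[OF s, of 0] by simp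
    finally have 1: "(LINT x|normal_law 0 v. x) = 0" .
    have "(LINT x|normal_law 0 v. x\<^sup>2) = (LINT x|lborel. normal_density 0 (sqrt v) x * x\<^sup>2)"
      unfolding normal_law_def using False by (simp add: integral_density)
    also have "\<dots> = v" using has_bochner_integral_integral_eq[OF normal_moment_even[OF s, of 0 1]] assms False
      by (simp add: fact_numeral)
    finally show ?thesis using 1 by simp
  qed
  then show "(LINT x|normal_law 0 v. x) = 0" and "(LINT x|normal_law 0 v. x\<^sup>2) = v" by simp_all
qed

lemma (in prob_space)
  assumes Y: "gaussian_rv M Y"
  shows gaussian_rv_moments: "all_moments M Y"
    and gaussian_rv_centred: "distr M borel (\<lambda>\<omega>. Y \<omega> - expectation Y) = normal_law 0 (expectation (\<lambda>\<omega>. (Y \<omega> - expectation Y)\<^sup>2))"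
proof -
  obtain m v where Ym [measurable]: "Y \<in> borel_measurable M" and v: "0 \<le> v" and d: "distr M borel Y = normal_law m v"
    using Y unfolding gaussian_rv_def by blast
  define W where "W \<omega> = Y \<omega> - m" for \<omega>
  have Wm [measurable]: "W \<in> borel_measurable M" unfolding W_def[abs_def] by measurable
  have W: "distr M borel W = normal_law 0 v"
  proof (cases "v = 0")
    case True
    have "distr M borel W = distr (distr M borel Y) borel (\<lambda>x. x - m)"
      unfolding W_def[abs_def] by (subst distr_distr) (auto simp: comp_def)
    also have "\<dots> = normal_law 0 v" unfolding d using True by (simp add: normal_law_def distr_return)
    finally show ?thesis .
  next
    case False
    have "distributed M lborel Y (normal_density m (sqrt v))"
      unfolding distributed_def using d False by (simp add: normal_law_def cong: distr_cong)
    from normal_density_affine[OF this _ , of 1 "- m"] False v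
    have "distributed M lborel W (normal_density 0 (sqrt v))" by (simp add: W_def[abs_def])
    then show ?thesis unfolding distributed_def using False by (simp add: normal_law_def cong: distr_cong)
  qed
  have Wmom: "all_moments M W" unfolding all_moments_def
  proof (intro conjI allI)
    fix n
    have "integrable (distr M borel W) (\<lambda>x. \<bar>x\<bar> ^ n)" unfolding W by (rule integrable_normal_law_moment[OF v])
    then show "integrable M (\<lambda>\<omega>. \<bar>W \<omega>\<bar> ^ n)" by (subst (asm) integrable_distr_eq) auto
  qed simp
  have YW: "Y = (\<lambda>\<omega>. W \<omega> + m)" by (simp add: W_def)
  show "all_moments M Y" unfolding YW by (intro all_moments_add Wmom all_moments_const)
  have "expectation W = (LINT x|distr M borel W. x)" by (subst integral_distr) auto
  then have EW: "expectation W = 0" unfolding W normal_law_mean_variance(1)[OF v] .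
  then have EY: "expectation Y = m" unfolding YW using all_moments_integrable[OF Wmom] by (simp add: prob_space)
  have "expectation (\<lambda>\<omega>. (W \<omega>)\<^sup>2) = (LINT x|distr M borel W. x\<^sup>2)" by (subst integral_distr) auto
  then have "expectation (\<lambda>\<omega>. (W \<omega>)\<^sup>2) = v" unfolding W normal_law_mean_variance(2)[OF v] .
  then show "distr M borel (\<lambda>\<omega>. Y \<omega> - expectation Y) = normal_law 0 (expectation (\<lambda>\<omega>. (Y \<omega> - expectation Y)\<^sup>2))"
    unfolding EY using W by (simp add: W_def[abs_def])
qed

lemma centred_gaussian_cong:
  assumes "centred_gaussian M K Y r" "\<And>k. k \<in> K \<Longrightarrow> Y' k = Y k"
  shows "centred_gaussian M K Y' r"
  using assms by (simp add: centred_gaussian_def cong: sum.cong)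

locale stationary_gaussian = prob_space M
  for M :: "'w measure" +
  fixes c :: time_case and X :: "real ^ 'd::finite \<Rightarrow> 'w \<Rightarrow> real" and f :: "real ^ 'd \<Rightarrow> real"
  assumes gaussian: "gaussian_field c M X" and stationary: "stationary_field c M X"
    and joint_measurable: "measurable_field c M X" and spectral: "has_spectral_density c M X f"
begin

definition \<mu> :: real where "\<mu> = expectation (X 0)"

text \<open>At index times this is the covariance function, since the transform is real there. The
  formula also gives values between lattice points, where it is not tied to the field; they make
  \<open>r\<close> one uniformly continuous function on the whole space in both cases.\<close>

definition r :: "real ^ 'd \<Rightarrow> real" where "r t = Re (fourier c f t)"

abbreviation Y :: "real ^ 'd \<Rightarrow> 'w \<Rightarrow> real" where "Y t \<omega> \<equiv> X t \<omega> - \<mu>"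

lemma X_measurable: "t \<in> index_set c \<Longrightarrow> X t \<in> borel_measurable M"
  using gaussian by (simp add: gaussian_field_def)

lemma X_gaussian: "t \<in> index_set c \<Longrightarrow> gaussian_rv M (X t)"
  using gaussian unfolding gaussian_field_def by (elim conjE allE[of _ "{t}"] allE[of _ "\<lambda>_. 1"]) simp

lemma X_moments: "t \<in> index_set c \<Longrightarrow> all_moments M (X t)"
  by (rule gaussian_rv_moments[OF X_gaussian])

lemma Y_moments: "t \<in> index_set c \<Longrightarrow> all_moments M (Y t)"
  using all_moments_add[OF X_moments all_moments_const[of "- \<mu>"]] by simp

lemma expectation_X:
  assumes t: "t \<in> index_set c"
  shows "expectation (X t) = \<mu>"
proof -
  let ?P = "\<Pi>\<^sub>M s\<in>{0 :: real ^ 'd}. borel :: real measure"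
  have [measurable]: "X t \<in> borel_measurable M" "X 0 \<in> borel_measurable M" using X_measurable t index_set_zero by auto
  have eq: "distr M ?P (\<lambda>\<omega>. \<lambda>s\<in>{0}. X (s + t) \<omega>) = distr M ?P (\<lambda>\<omega>. \<lambda>s\<in>{0}. X s \<omega>)"
    using stationary t index_set_zero unfolding stationary_field_def by blast
  have m1: "(\<lambda>\<omega>. \<lambda>s\<in>{0}. X (s + t) \<omega>) \<in> M \<rightarrow>\<^sub>M ?P" and m2: "(\<lambda>\<omega>. \<lambda>s\<in>{0}. X s \<omega>) \<in> M \<rightarrow>\<^sub>M ?P"
    by (rule measurable_restrict, simp)+
  have ev: "(\<lambda>g. g 0) \<in> borel_measurable ?P" by (rule measurable_component_singleton) simp
  have "expectation (X t) = (LINT g|distr M ?P (\<lambda>\<omega>. \<lambda>s\<in>{0}. X (s + t) \<omega>). g 0)" by (subst integral_distr[OF m1 ev]) simp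
  also have "\<dots> = expectation (X 0)" unfolding eq by (subst integral_distr[OF m2 ev]) simp
  finally show ?thesis by (simp add: \<mu>_def)
qed

lemma fourier_covariance:
  assumes "s \<in> index_set c" "t \<in> index_set c"
  shows "fourier c f (s - t) = of_real (expectation (\<lambda>\<omega>. Y s \<omega> * Y t \<omega>))"
proof -
  have "complex_of_real (covariance M (X s) (X t)) = (LINT x|freq_measure c. exp (\<i> * complex_of_real ((s - t) \<bullet> x)) * complex_of_real (f x))"
    using spectral assms unfolding has_spectral_density_def by blast
  then show ?thesis unfolding covariance_def expectation_X[OF assms(1)] expectation_X[OF assms(2)]
    by (simp add: fourier_def cis_conv_exp)
qed

lemma fourier_r: "t \<in> index_set c \<Longrightarrow> fourier c f t = of_real (r t)"
  using fourier_covariance[of t 0, OF _ index_set_zero] unfolding r_def diff_zero by simp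

lemma covariance_r:
  assumes "s \<in> index_set c" "t \<in> index_set c"
  shows "expectation (\<lambda>\<omega>. Y s \<omega> * Y t \<omega>) = r (s - t)"
  using fourier_covariance[OF assms] by (simp add: r_def)

lemma Y_centred_gaussian:
  assumes K: "finite K" "K \<subseteq> index_set c"
  shows "centred_gaussian M K Y (\<lambda>s t. r (s - t))"
  unfolding centred_gaussian_def
proof (intro conjI ballI allI)
  fix s assume s: "s \<in> K"
  have [measurable]: "X s \<in> borel_measurable M" using X_measurable s K by auto
  show "Y s \<in> borel_measurable M" by measurable
  fix t assume t: "t \<in> K"
  have "expectation (\<lambda>\<omega>. Y s \<omega> * Y t \<omega>) = expectation (\<lambda>\<omega>. Y t \<omega> * Y s \<omega>)" by (simp only: mult.commute)
  moreover have "s \<in> index_set c" "t \<in> index_set c" using s t K by auto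
  ultimately show "r (s - t) = r (t - s)" by (simp only: covariance_r)
next
  fix a
  let ?Z = "\<lambda>\<omega>. \<Sum>t\<in>K. a t * X t \<omega>"
  have Z: "gaussian_rv M ?Z" using gaussian K unfolding gaussian_field_def by blast
  have i: "integrable M (\<lambda>\<omega>. a t * X t \<omega>)" if "t \<in> K" for t
    using that K by (intro integrable_mult_right all_moments_integrable X_moments) auto
  have "expectation ?Z = (\<Sum>t\<in>K. a t * expectation (X t))" using i by simp
  also have "\<dots> = (\<Sum>t\<in>K. a t * \<mu>)" using K by (intro sum.cong refl) (auto simp: expectation_X)
  finally have ZY: "?Z \<omega> - expectation ?Z = (\<Sum>t\<in>K. a t * Y t \<omega>)" for \<omega>
    by (simp add: right_diff_distrib sum_subtractf)
  have "expectation (\<lambda>\<omega>. (\<Sum>t\<in>K. a t * Y t \<omega>)\<^sup>2) = expectation (\<lambda>\<omega>. \<Sum>s\<in>K. \<Sum>t\<in>K. (a s * a t) * (Y s \<omega> * Y t \<omega>))"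
    unfolding power2_eq_square sum_product by (intro Bochner_Integration.integral_cong sum.cong refl) (simp only: mult_ac)
  also have "\<dots> = (\<Sum>s\<in>K. \<Sum>t\<in>K. (a s * a t) * expectation (\<lambda>\<omega>. Y s \<omega> * Y t \<omega>))"
  proof -
    have i2: "integrable M (\<lambda>\<omega>. (a s * a t) * (Y s \<omega> * Y t \<omega>))" if "s \<in> K" "t \<in> K" for s t
      using that K by (intro integrable_mult_right all_moments_integrable all_moments_mult Y_moments) auto
    have i1: "integrable M (\<lambda>\<omega>. \<Sum>t\<in>K. (a s * a t) * (Y s \<omega> * Y t \<omega>))" if "s \<in> K" for s
      by (intro Bochner_Integration.integrable_sum i2 that)
    show ?thesis
      by (simp only: Bochner_Integration.integral_sum i1 i2 integral_mult_right_zero cong: sum.cong)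
  qed
  also have "\<dots> = quad_form K (\<lambda>s t. r (s - t)) a"
    unfolding quad_form_def by (intro sum.cong refl, subst covariance_r) (use K in auto)
  finally have var: "expectation (\<lambda>\<omega>. (\<Sum>t\<in>K. a t * Y t \<omega>)\<^sup>2) = quad_form K (\<lambda>s t. r (s - t)) a" .
  show "distr M borel (\<lambda>\<omega>. \<Sum>t\<in>K. a t * Y t \<omega>) = normal_law 0 (quad_form K (\<lambda>s t. r (s - t)) a)"
    using gaussian_rv_centred[OF Z] unfolding ZY var .
  show "0 \<le> quad_form K (\<lambda>s t. r (s - t)) a"
    unfolding var[symmetric] by (intro Bochner_Integration.integral_nonneg) simp
qed (rule K)

lemma r_0_nonneg: "0 \<le> r 0"
proof -
  have "0 \<le> expectation (\<lambda>\<omega>. Y 0 \<omega> * Y 0 \<omega>)" by (intro Bochner_Integration.integral_nonneg) simp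
  then show ?thesis using covariance_r[OF index_set_zero index_set_zero] by simp
qed

text \<open>A centred variable with variance 0 vanishes almost surely, and so does its covariance
  with any other value of the field.\<close>

lemma r_eq_0:
  assumes "r 0 = 0" "t \<in> index_set c"
  shows "r t = 0"
proof -
  have Y0: "all_moments M (Y 0)" by (rule Y_moments[OF index_set_zero])
  have "expectation (\<lambda>\<omega>. Y 0 \<omega> * Y 0 \<omega>) = 0" using covariance_r[OF index_set_zero index_set_zero] assms by simp
  then have "AE \<omega> in M. Y 0 \<omega> * Y 0 \<omega> = 0"
    by (subst (asm) integral_nonneg_eq_0_iff_AE) (auto intro!: all_moments_integrable all_moments_mult Y0)
  then have "AE \<omega> in M. Y t \<omega> * Y 0 \<omega> = 0" by eventually_elim simp
  then have "expectation (\<lambda>\<omega>. Y t \<omega> * Y 0 \<omega>) = 0" by (rule integral_eq_zero_AE)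
  then show ?thesis using covariance_r[OF assms(2) index_set_zero] by simp
qed

text \<open>Both sequences start at 1 and satisfy the same derivative rule, so in each induction
  step they differ by a constant, and the mean-zero condition makes it 0. The shift by \<mu> appears
  because the field may have nonzero mean.\<close>

lemma appell_hermite:
  assumes P: "appell (distr M borel (X 0)) P" and r0: "0 < r 0"
  shows "P n = pcompose (hermite (r 0) n) [:- \<mu>, 1:]"
proof (induction n)
  case 0
  then show ?case using P by (simp add: appell_def pcompose_1)
next
  case (Suc n)
  have [measurable]: "X 0 \<in> borel_measurable M" by (rule X_measurable[OF index_set_zero])
  define Q where "Q = pcompose (hermite (r 0) (Suc n)) [:- \<mu>, 1:]"
  have "pderiv (P (Suc n) - Q) = 0"
    using P Suc unfolding appell_def Q_def by (simp add: pderiv_diff pderiv_pcompose pderiv_hermite pcompose_smult pderiv_pCons)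
  then obtain k where "P (Suc n) - Q = [:k:]" by (auto simp: pderiv_eq_0_iff elim: degree_eq_zeroE)
  then have k: "P (Suc n) = Q + [:k:]" by (simp add: algebra_simps)
  have E: "integral\<^sup>L (distr M borel (X 0)) (poly (P (Suc n))) = 0"
    using P unfolding appell_def by (metis One_nat_def le_add1 plus_1_eq_Suc)
  have Em: "poly (P (Suc n)) \<in> borel_measurable borel" by (intro borel_measurable_continuous_onI continuous_intros)
  have "expectation (\<lambda>\<omega>. poly (P (Suc n)) (X 0 \<omega>)) = 0" using E by (subst (asm) integral_distr[OF _ Em]) auto
  moreover have G: "centred_gaussian M {0} Y (\<lambda>s t. r (s - t))" by (rule Y_centred_gaussian) (auto simp: index_set_zero)
  have "expectation (\<lambda>\<omega>. poly (hermite (r 0) (Suc n)) (Y 0 \<omega>)) = 0" by (rule hermite_mean[OF G _ _ r0]) auto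
  moreover have "poly (P (Suc n)) (X 0 \<omega>) = poly (hermite (r 0) (Suc n)) (Y 0 \<omega>) + k" for \<omega>
    unfolding k Q_def by (simp add: poly_pcompose)
  moreover have "integrable M (\<lambda>\<omega>. poly (hermite (r 0) (Suc n)) (Y 0 \<omega>))"
    by (intro all_moments_integrable all_moments_poly Y_moments index_set_zero)
  ultimately have "k = 0" by (simp add: prob_space)
  then show ?case using k by (simp add: Q_def)
qed

end

text \<open>All admissible domains are boxes whose sides differ from T by at most 1; the box from 1
  to T has side T - 1. Nonemptiness is recorded because the quantisation of the domain needs
  it.\<close>

lemma sampling_domain_time_box:
  assumes "D \<in> sampling_domains c"
  obtains a b where "\<And>T. D T = time_box c (a T) (b T)" "\<And>T i. \<bar>b T $ i - a T $ i - T\<bar> \<le> 1" "\<And>T. 2 \<le> T \<Longrightarrow> D T \<noteq> {}"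
proof -
  have cen: "centred_box c T = time_box c (\<chi> i. - T / 2) (\<chi> i. T / 2)" for T
    by (simp add: centred_box_def time_box_def)
  have cor: "corner_box c T = time_box c (\<chi> i. 1) (\<chi> i. T)" for T
    by (simp add: corner_box_def time_box_def)
  show thesis
  proof (cases "D = centred_box c")
    case True
    have "0 \<in> D T" if "2 \<le> T" for T using True that by (simp add: centred_box_def index_set_zero)
    then show ?thesis by (intro that[of "\<lambda>T. \<chi> i. - T / 2" "\<lambda>T. \<chi> i. T / 2"]) (use True cen in auto)
  next
    case False
    then have D: "D = corner_box c" "c = Discrete" using assms by (auto simp: sampling_domains_def split: time_case.splits)
    have "(\<chi> i. 1) \<in> D T" if "2 \<le> T" for T using D that by (simp add: corner_box_def index_set_def)
    then show ?thesis by (intro that[of "\<lambda>T. \<chi> i. 1" "\<lambda>T. \<chi> i. T"]) (use D cor in auto)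
  qed
qed

context stationary_gaussian begin

lemma f_integrable: "integrable (freq_measure c) f"
  using spectral by (simp add: has_spectral_density_def)

lemma r_measurable [measurable]: "r \<in> borel_measurable borel"
proof -
  have [measurable]: "f \<in> borel_measurable borel"
    using borel_measurable_integrable[OF f_integrable] unfolding measurable_cong_sets[OF sets_freq_measure refl] .
  show ?thesis unfolding r_def[abs_def] by measurable
qed

lemma r_bounded: "\<bar>r t\<bar> \<le> (LINT x|freq_measure c. \<bar>f x\<bar>)"
  unfolding r_def by (rule order_trans[OF abs_Re_le_cmod norm_fourier_le])

lemma r_uniformly_continuous:
  assumes "0 < e"
  shows "\<exists>d>0. \<forall>s t. norm (s - t) \<le> d \<longrightarrow> \<bar>r s - r t\<bar> < e"
proof -
  obtain d where d: "d > 0" "\<And>s t. norm (t - s) \<le> d \<Longrightarrow> cmod (fourier c f t - fourier c f s) < e"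
    using fourier_uniformly_continuous[OF f_integrable assms] by blast
  have "\<bar>r s - r t\<bar> \<le> cmod (fourier c f s - fourier c f t)" for s t
    using abs_Re_le_cmod[of "fourier c f s - fourier c f t"] by (simp add: r_def)
  then show ?thesis using d by (intro exI[of _ d]) (meson le_less_trans)
qed

lemma integral_r_power:
  assumes "f \<in> Lp_closure c p" "1 \<le> p" "2 \<le> l" "inverse p \<le> ennreal (1 - 1 / real l)"
  shows "integrable (time_measure c) (\<lambda>t. \<bar>r t\<bar> ^ l)"
    and "(LINT t|time_measure c. r t ^ l) = dual_factor c CARD('d) * conv_at_0 c l f"
proof -
  note F = conv_at_0_fourier[OF f_integrable assms]
  have ae: "AE t in time_measure c. fourier c f t = of_real (r t)"
    using AE_time_measure by eventually_elim (rule fourier_r)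
  show "integrable (time_measure c) (\<lambda>t. \<bar>r t\<bar> ^ l)"
    by (rule integrable_cong_AE_imp[OF F(2)]) (measurable, use ae in \<open>eventually_elim, simp\<close>)
  have [measurable]: "f \<in> borel_measurable borel"
    using borel_measurable_integrable[OF f_integrable] unfolding measurable_cong_sets[OF sets_freq_measure refl] .
  have "(LINT t|time_measure c. fourier c f t ^ l) = (LINT t|time_measure c. of_real (r t ^ l))"
    by (rule Bochner_Integration.integral_cong_AE) (measurable, use ae in \<open>eventually_elim, simp\<close>)
  also have "\<dots> = of_real (LINT t|time_measure c. r t ^ l)" by (rule integral_complex_of_real)
  finally show "(LINT t|time_measure c. r t ^ l) = dual_factor c CARD('d) * conv_at_0 c l f"
    unfolding F(3) of_real_eq_iff ..
qed

text \<open>The normalizing factor \<open>q\<close> is absorbed into the measure: the normalized sum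
  is an integral against the finite measure with density q on the domain. The box \<open>B\<close>
  contains every difference of two points of the domain, so the integrals over \<open>B\<close>
  bound those around each point s uniformly.\<close>

lemma field_sum_char_bound:
  fixes D :: "real \<Rightarrow> (real ^ 'd) set" and a b :: "real ^ 'd"
  assumes D: "D T = time_box c a b" "D T \<noteq> {}" and ab: "\<And>i. b $ i - a $ i \<le> 2 * T"
    and r0: "0 < r 0" and P: "\<And>x. poly Q x = poly (hermite (r 0) (Suc m)) (x - \<mu>)" and q: "0 \<le> q"
    and B: "B = time_box c (\<chi> i. - 2 * T) (\<chi> i. 2 * T)"
    and V: "V = fact (Suc m) * q\<^sup>2 * (LINT t|time_measure c. indicator (D T) t * (LINT s|time_measure c. indicator (D T) s * r (t - s) ^ Suc m))"
    and C: "C = (real (Suc m))\<^sup>2 * (4 * real (length (pairings m m m m)))"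
    and W: "W = q * measure (time_measure c) (D T) * (q * (LINT t|time_measure c. indicator B t * \<bar>r t\<bar>\<^sup>2)) * (q * (LINT t|time_measure c. indicator B t * \<bar>r t\<bar> ^ m))\<^sup>2"
  shows "cmod ((LINT \<omega>|M. cis (u * (q * field_sum c D Q X T \<omega>))) - of_real (exp (- (V * u\<^sup>2 / 2)))) \<le> u\<^sup>2 * sqrt (C * W)"
    and "field_sum c D Q X T \<in> borel_measurable M"
proof -
  let ?\<nu> = "time_measure c :: (real ^ 'd) measure" and ?D = "D T"
  have Db [measurable]: "?D \<in> sets borel" by (simp add: D)
  have DI: "?D \<subseteq> index_set c" by (auto simp: D time_box_def)
  have Dfin: "emeasure ?\<nu> ?D < \<infinity>" by (simp add: D emeasure_time_box)
  define w where "w t = q * indicator ?D t" for t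
  have wm [measurable]: "w \<in> borel_measurable borel" and w0: "\<And>t. 0 \<le> w t" using q by (simp_all add: w_def[abs_def])
  define N where "N = density ?\<nu> w"
  have sN [measurable_cong]: "sets N = sets borel" by (simp add: N_def)
  have spN: "space N = UNIV" by (simp add: N_def)
  have LN: "(LINT t|N. h t) = (LINT t|?\<nu>. w t * h t)" if "h \<in> borel_measurable borel" for h :: "real ^ 'd \<Rightarrow> real"
    unfolding N_def using that w0 by (subst integral_density) auto
  have eN: "emeasure N UNIV = ennreal q * emeasure ?\<nu> ?D"
  proof -
    have "emeasure N UNIV = (\<integral>\<^sup>+ t. ennreal q * indicator ?D t \<partial>?\<nu>)"
      unfolding N_def using q by (subst emeasure_density) (auto simp: w_def ennreal_mult indicator_def intro!: nn_integral_cong)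
    also have "\<dots> = ennreal q * emeasure ?\<nu> ?D" by (rule nn_integral_cmult_indicator) simp
    finally show ?thesis .
  qed
  have N: "finite_measure N"
    by (rule finite_measureI) (use Dfin in \<open>auto simp: spN eN ennreal_mult_eq_top_iff\<close>)
  have mN: "measure N (space N) = q * measure ?\<nu> ?D"
    unfolding spN measure_def eN using q by (simp add: enn2real_mult)
  have AEN: "AE t in N. t \<in> ?D"
    unfolding N_def by (subst AE_density) (auto simp: w_def indicator_def)
  \<comment> \<open>The hypotheses concern \<open>X\<close> only at index times, while the integral
    estimate asks for a jointly Borel measurable field. Setting it to 0 off the domain achieves
    this: in the discrete case \<open>Z\<close> is then a finite sum over lattice points.\<close>
  define Z where "Z t \<omega> = (if t \<in> ?D then Y t \<omega> else 0)" for t \<omega>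
  have Zm: "(\<lambda>(t, \<omega>). Z t \<omega>) \<in> borel_measurable (borel \<Otimes>\<^sub>M M)"
  proof (cases c)
    case Continuous
    then have [measurable]: "(\<lambda>(t, \<omega>). X t \<omega>) \<in> borel_measurable (borel \<Otimes>\<^sub>M M)"
      using joint_measurable by (simp add: measurable_field_def)
    show ?thesis unfolding Z_def by measurable
  next
    case Discrete
    have fin: "finite ?D" using D Discrete by (simp add: finite_time_box_Discrete)
    have "(\<lambda>(t, \<omega>). Z t \<omega>) = (\<lambda>x. \<Sum>k\<in>?D. indicator {k} (fst x) * Y k (snd x))"
      using fin by (auto simp: Z_def fun_eq_iff indicator_def sum.If_cases if_distrib[of "\<lambda>x. x * _"] cong: if_cong)
    moreover have "(\<lambda>x. indicator {k} (fst x) * Y k (snd x)) \<in> borel_measurable (borel \<Otimes>\<^sub>M M)" if "k \<in> ?D" for k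
    proof -
      have [measurable]: "X k \<in> borel_measurable M" using X_measurable that DI by auto
      show ?thesis by measurable
    qed
    ultimately show ?thesis by (simp add: borel_measurable_sum)
  qed
  have Zm' [measurable]: "(\<lambda>(t, \<omega>). Z t \<omega>) \<in> borel_measurable (N \<Otimes>\<^sub>M M)"
    using Zm unfolding measurable_cong_sets[OF sets_pair_measure_cong[OF sN refl] refl] .
  let ?H = "poly (hermite (r 0) (Suc m))"
  have FS: "q * field_sum c D Q X T \<omega> = (LINT t|N. ?H (Z t \<omega>))"
    and FS2: "field_sum c D Q X T \<omega> = (LINT t|?\<nu>. indicator ?D t * ?H (Z t \<omega>))" if \<omega>: "\<omega> \<in> space M" for \<omega>
  proof -
    have [measurable]: "(\<lambda>t. Z t \<omega>) \<in> borel_measurable borel"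
      using measurable_compose[OF measurable_Pair2'[OF \<omega>] Zm] by simp
    have "field_sum c D Q X T \<omega> = (LINT t|index_measure c. indicator ?D t * ?H (Z t \<omega>))"
      unfolding field_sum_def set_lebesgue_integral_def P by (intro Bochner_Integration.integral_cong refl) (auto simp: Z_def indicator_def)
    also have "\<dots> = (LINT t|?\<nu>. indicator ?D t * ?H (Z t \<omega>))"
      unfolding time_measure_def by (subst integral_distr) (auto simp: sets_index_borel)
    finally show 1: "field_sum c D Q X T \<omega> = (LINT t|?\<nu>. indicator ?D t * ?H (Z t \<omega>))" .
    show "q * field_sum c D Q X T \<omega> = (LINT t|N. ?H (Z t \<omega>))"
      unfolding 1 by (subst LN) (auto simp: w_def mult.assoc)
  qed
  have "(\<lambda>(t, \<omega>). Z t \<omega>) \<in> borel_measurable (?\<nu> \<Otimes>\<^sub>M M)"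
    using Zm unfolding measurable_cong_sets[OF sets_pair_measure_cong[OF sets_time_measure refl] refl] .
  then have [measurable]: "(\<lambda>\<omega>. LINT t|?\<nu>. indicator ?D t * ?H (Z t \<omega>)) \<in> borel_measurable M"
    by (intro time.borel_measurable_lebesgue_integral) measurable
  then show "field_sum c D Q X T \<in> borel_measurable M"
    by (subst measurable_cong[OF FS2]) auto
  have G: "centred_gaussian M K Z (\<lambda>s t. r (s - t))" if "finite K" "K \<subseteq> ?D" for K
    by (rule centred_gaussian_cong[OF Y_centred_gaussian]) (use that DI in \<open>auto simp: Z_def fun_eq_iff\<close>)
  let ?I = "\<lambda>k. LINT t|?\<nu>. indicator B t * \<bar>r t\<bar> ^ k"
  have Rk: "(LINT t|N. \<bar>r (s - t)\<bar> ^ k) \<le> q * ?I k" if s: "s \<in> ?D" for s k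
  proof -
    have sI: "s \<in> index_set c" using s DI by auto
    have "(LINT t|N. \<bar>r (s - t)\<bar> ^ k) = q * (LINT t|?\<nu>. indicator ?D t * \<bar>r (s - t)\<bar> ^ k)"
      by (subst LN) (auto simp: w_def mult.assoc)
    also have "(LINT t|?\<nu>. indicator ?D t * \<bar>r (s - t)\<bar> ^ k) = (LINT t|?\<nu>. indicator ?D (s - t) * \<bar>r (s - (s - t))\<bar> ^ k)"
      by (rule integral_time_reflect[OF _ sI, symmetric]) measurable
    also have "\<dots> \<le> ?I k"
    proof (rule integral_mono_AE')
      have Bm [measurable]: "B \<in> sets borel" by (simp add: B)
      have iB: "integrable ?\<nu> (\<lambda>t. (LINT x|freq_measure c. \<bar>f x\<bar>) ^ k * indicator B t)"
        by (intro integrable_mult_right integrable_real_indicator) (simp_all add: B emeasure_time_box)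
      show "integrable ?\<nu> (\<lambda>t. indicator B t * \<bar>r t\<bar> ^ k)"
      proof (rule Bochner_Integration.integrable_bound[OF iB])
        have "\<bar>r t\<bar> ^ k \<le> (LINT x|freq_measure c. \<bar>f x\<bar>) ^ k" for t by (intro power_mono r_bounded) simp
        then show "AE t in ?\<nu>. norm (indicator B t * \<bar>r t\<bar> ^ k) \<le> norm ((LINT x|freq_measure c. \<bar>f x\<bar>) ^ k * indicator B t)"
          by (intro AE_I2) (auto simp: indicator_def intro: order_trans[OF _ abs_ge_self])
      qed measurable
      show "AE t in ?\<nu>. indicator ?D (s - t) * \<bar>r (s - (s - t))\<bar> ^ k \<le> indicator B t * \<bar>r t\<bar> ^ k"
        using AE_time_measure
      proof eventually_elim
        case (elim t)
        \<comment> \<open>Both s and s - t lie in the domain, so each coordinate of t is at most b -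
          a in modulus, which is at most 2 T.\<close>
        have "t \<in> B" if "s - t \<in> ?D"
        proof -
          have "- 2 * T \<le> t $ i \<and> t $ i \<le> 2 * T" for i
          proof -
            have "a $ i \<le> s $ i" "s $ i \<le> b $ i" "a $ i \<le> s $ i - t $ i" "s $ i - t $ i \<le> b $ i"
              using s that by (auto simp: D time_box_def)
            then show ?thesis using ab[of i] by linarith
          qed
          then show ?thesis using elim by (simp add: B time_box_def)
        qed
        then show ?case by (auto simp: indicator_def)
      qed
      show "AE t in ?\<nu>. 0 \<le> indicator B t * \<bar>r t\<bar> ^ k" by simp
    qed
    finally show ?thesis using q by (simp add: mult_left_mono)
  qed
  have VV: "V = fact (Suc m) * (LINT t|N. LINT s|N. r (t - s) ^ Suc m)"
  proof -
    have i: "(LINT s|N. r (t - s) ^ Suc m) = q * (LINT s|?\<nu>. indicator ?D s * r (t - s) ^ Suc m)" for t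
      by (subst LN) (auto simp: w_def mult.assoc)
    have m: "(\<lambda>t. LINT s|?\<nu>. indicator ?D s * r (t - s) ^ Suc m) \<in> borel_measurable borel"
      by (rule time.borel_measurable_lebesgue_integral) measurable
    have "(LINT t|N. LINT s|N. r (t - s) ^ Suc m) = (LINT t|?\<nu>. w t * (q * (LINT s|?\<nu>. indicator ?D s * r (t - s) ^ Suc m)))"
      unfolding i by (rule LN) (intro borel_measurable_times m borel_measurable_const)
    also have "\<dots> = (LINT t|?\<nu>. q\<^sup>2 * (indicator ?D t * (LINT s|?\<nu>. indicator ?D s * r (t - s) ^ Suc m)))"
      by (intro Bochner_Integration.integral_cong refl) (simp only: w_def power2_eq_square mult_ac)
    also have "\<dots> = q\<^sup>2 * (LINT t|?\<nu>. indicator ?D t * (LINT s|?\<nu>. indicator ?D s * r (t - s) ^ Suc m))"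
      by (rule integral_mult_right_zero)
    finally show ?thesis unfolding V by (simp only: mult.assoc)
  qed
  have "compact ?D" by (simp add: D compact_time_box)
  from hermite_integral_char[OF N sN this D(2) AEN G Zm' r_measurable r_bounded r0 r_uniformly_continuous Rk Rk, of u m]
  have main: "cmod ((LINT \<omega>|M. cis (u * (LINT t|N. ?H (Z t \<omega>)))) - of_real (exp (- (V * u\<^sup>2 / 2)))) \<le> u\<^sup>2 * sqrt (C * W)"
    unfolding VV[symmetric] C[symmetric] mN W by (simp only: mult.assoc)
  have "(LINT \<omega>|M. cis (u * (q * field_sum c D Q X T \<omega>))) = (LINT \<omega>|M. cis (u * (LINT t|N. ?H (Z t \<omega>))))"
    by (rule Bochner_Integration.integral_cong[OF refl]) (simp only: FS)
  then show "cmod ((LINT \<omega>|M. cis (u * (q * field_sum c D Q X T \<omega>))) - of_real (exp (- (V * u\<^sup>2 / 2)))) \<le> u\<^sup>2 * sqrt (C * W)"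
    using main by simp
qed

text \<open>With x = T^(d/(m+1)) the volume of a box of side of order T is of order x^(m+1). The
  normalized variance converges to V by the overlap argument, and the error W is of the order of the
  square of I_m / x, which tends to 0.\<close>

lemma field_sum_char_limit:
  fixes D :: "real \<Rightarrow> (real ^ 'd) set"
  assumes D: "D \<in> sampling_domains c" and m: "1 \<le> m"
    and int: "integrable (time_measure c) (\<lambda>t. \<bar>r t\<bar> ^ Suc m)"
    and r0: "0 < r 0" and P: "\<And>x. poly Q x = poly (hermite (r 0) (Suc m)) (x - \<mu>)"
    and V: "V = fact (Suc m) * (LINT t|time_measure c. r t ^ Suc m)"
  shows "((\<lambda>T. LINT \<omega>|M. cis (u * (T powr (- real CARD('d) / 2) * field_sum c D Q X T \<omega>))) \<longlongrightarrow> of_real (exp (- (V * u\<^sup>2 / 2)))) at_top"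
    and "eventually (\<lambda>T. field_sum c D Q X T \<in> borel_measurable M) at_top"
proof -
  let ?\<nu> = "time_measure c :: (real ^ 'd) measure"
  let ?d = "CARD('d)"
  obtain a b where ab: "\<And>T. D T = time_box c (a T) (b T)" "\<And>T i. \<bar>b T $ i - a T $ i - T\<bar> \<le> 1" "\<And>T. 2 \<le> T \<Longrightarrow> D T \<noteq> {}"
    using sampling_domain_time_box[OF D] by metis
  define q where "q T = T powr (- real ?d / 2)" for T
  define x where "x T = T powr (real ?d / Suc m)" for T
  define B where "B T = time_box c (\<chi> i. - 2 * T) ((\<chi> i. 2 * T) :: real ^ 'd)" for T
  define I where "I k T = (LINT t|?\<nu>. indicator (B T) t * \<bar>r t\<bar> ^ k)" for k T
  define V' where "V' T = fact (Suc m) * (q T)\<^sup>2 * (LINT t|?\<nu>. indicator (D T) t * (LINT s|?\<nu>. indicator (D T) s * r (t - s) ^ Suc m))" for T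
  define C where "C = (real (Suc m))\<^sup>2 * (4 * real (length (pairings m m m m)))"
  define W where "W T = q T * measure ?\<nu> (D T) * (q T * I 2 T) * (q T * I m T)\<^sup>2" for T
  have bound: "2 \<le> T \<Longrightarrow> cmod ((LINT \<omega>|M. cis (u * (q T * field_sum c D Q X T \<omega>))) - of_real (exp (- (V' T * u\<^sup>2 / 2)))) \<le> u\<^sup>2 * sqrt (C * W T)"
    and meas: "2 \<le> T \<Longrightarrow> field_sum c D Q X T \<in> borel_measurable M" for T
  proof -
    assume T: "2 \<le> T"
    have le: "b T $ i - a T $ i \<le> 2 * T" for i using ab(2)[of T i] T by linarith
    have q0: "0 \<le> q T" by (simp add: q_def)
    show "cmod ((LINT \<omega>|M. cis (u * (q T * field_sum c D Q X T \<omega>))) - of_real (exp (- (V' T * u\<^sup>2 / 2)))) \<le> u\<^sup>2 * sqrt (C * W T)"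
      by (rule field_sum_char_bound(1)[where D=D and T=T, OF ab(1) ab(3)[OF T] le r0 P q0 B_def V'_def C_def W_def[unfolded I_def]])
    show "field_sum c D Q X T \<in> borel_measurable M"
      by (rule field_sum_char_bound(2)[where D=D and T=T, OF ab(1) ab(3)[OF T] le r0 P q0 refl refl refl refl])
  qed
  show "eventually (\<lambda>T. field_sum c D Q X T \<in> borel_measurable M) at_top"
    using eventually_ge_at_top[of 2] by eventually_elim (rule meas)
  have q2: "(q T)\<^sup>2 = 1 / T ^ ?d" if "0 < T" for T
  proof -
    have "(q T)\<^sup>2 = T powr (- real ?d)" unfolding q_def power2_eq_square powr_add[symmetric] by simp
    then show ?thesis using that by (simp add: powr_minus powr_realpow divide_inverse)
  qed
  have xl: "x T ^ Suc m = T ^ ?d" if "0 < T" for T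
  proof -
    have "x T ^ Suc m = T powr (real ?d / Suc m * real (Suc m))"
      using that by (simp only: x_def powr_powr[symmetric] powr_realpow powr_gt_zero)
    also have "\<dots> = T powr real ?d" by simp
    finally show ?thesis using that by (simp add: powr_realpow)
  qed
  have x_top: "filterlim x at_top at_top"
  proof -
    have "filterlim (\<lambda>T. real ?d / Suc m * ln T) at_top at_top"
      by (rule filterlim_tendsto_pos_mult_at_top[OF tendsto_const _ ln_at_top]) simp
    then have "filterlim (\<lambda>T. exp (real ?d / Suc m * ln T)) at_top at_top" by (rule filterlim_compose[OF exp_at_top])
    then show ?thesis
      by (rule filterlim_cong[THEN iffD1, rotated 3])
        (use eventually_gt_at_top[of 0] in \<open>auto simp: x_def powr_def elim: eventually_mono\<close>)
  qed
  have V'_lim: "(V' \<longlongrightarrow> V) at_top"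
  proof -
    have "integrable ?\<nu> (\<lambda>t. r t ^ Suc m)"
      by (rule Bochner_Integration.integrable_bound[OF int]) (auto simp: power_abs simp del: power_Suc)
    from tendsto_mult[OF tendsto_const double_integral_limit[OF this ab(2)], of "fact (Suc m)"]
    have "((\<lambda>T. fact (Suc m) * ((LINT t|?\<nu>. indicator (D T) t * (LINT s|?\<nu>. indicator (D T) s * r (t - s) ^ Suc m)) / T ^ ?d)) \<longlongrightarrow> V) at_top"
      unfolding V ab(1)[symmetric] .
    moreover have "eventually (\<lambda>T. fact (Suc m) * ((LINT t|?\<nu>. indicator (D T) t * (LINT s|?\<nu>. indicator (D T) s * r (t - s) ^ Suc m)) / T ^ ?d) = V' T) at_top"
      using eventually_gt_at_top[of 0] by eventually_elim (simp add: V'_def q2)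
    ultimately show ?thesis by (rule Lim_transform_eventually)
  qed
  \<comment> \<open>A side is at most T + 2, hence at most 3 T for T at least 1; for the larger box
    below it is at most 4 T + 1, hence at most 5 T.\<close>
  have measD: "measure ?\<nu> (D T) \<le> 3 ^ ?d * T ^ ?d" if "1 \<le> T" for T
  proof -
    have "measure ?\<nu> (D T) = (\<Prod>i\<in>UNIV. side c (a T $ i) (b T $ i))" unfolding ab(1) by (rule measure_time_box)
    also have "\<dots> \<le> (\<Prod>i\<in>(UNIV :: 'd set). 3 * T)"
    proof (intro prod_mono conjI side_nonneg)
      fix i show "side c (a T $ i) (b T $ i) \<le> 3 * T"
        using side_approx[of c "a T $ i" "b T $ i"] ab(2)[of T i] that by (auto simp: max_def split: if_splits)
    qed
    finally show ?thesis by (simp add: power_mult_distrib)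
  qed
  have measB: "measure ?\<nu> (B T) \<le> 5 ^ ?d * x T ^ Suc m" if "1 \<le> T" for T
  proof -
    have "measure ?\<nu> (B T) = (\<Prod>i\<in>(UNIV :: 'd set). side c (- 2 * T) (2 * T))" unfolding B_def by (subst measure_time_box) simp
    also have "\<dots> \<le> (\<Prod>i\<in>(UNIV :: 'd set). 5 * T)"
    proof (intro prod_mono conjI side_nonneg)
      show "side c (- 2 * T) (2 * T) \<le> 5 * T"
        using side_approx[of c "- 2 * T" "2 * T"] that by (auto simp: max_def split: if_splits)
    qed
    finally show ?thesis using that by (subst xl) (simp_all add: power_mult_distrib)
  qed
  have Bs: "B T \<in> sets ?\<nu>" "emeasure ?\<nu> (B T) < \<infinity>" for T by (simp_all add: B_def emeasure_time_box)
  define K where "K = (LINT t|?\<nu>. \<bar>r t\<bar> ^ Suc m) + 5 ^ ?d"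
  have rm: "(\<lambda>t. \<bar>r t\<bar>) \<in> borel_measurable ?\<nu>" by measurable
  have ratio: "((\<lambda>T. I m T / x T) \<longlongrightarrow> 0) at_top"
    unfolding I_def
  proof (rule lower_moment_ratio_tendsto_0[OF int _ rm m Bs(1) Bs(2)])
    show "eventually (\<lambda>T. measure ?\<nu> (B T) \<le> 5 ^ ?d * x T ^ Suc m) at_top"
      using eventually_ge_at_top[of 1] by eventually_elim (rule measB)
  qed (simp_all add: x_top)
  have W_lim: "(W \<longlongrightarrow> 0) at_top"
  proof (rule tendsto_sandwich[where f="\<lambda>_. 0" and h="\<lambda>T. 3 ^ ?d * K * (I m T / x T)\<^sup>2"])
    show "((\<lambda>T. 3 ^ ?d * K * (I m T / x T)\<^sup>2) \<longlongrightarrow> 0) at_top"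
      using tendsto_mult[OF tendsto_const tendsto_power[OF ratio], of "3 ^ ?d * K" 2] by simp
    have I0: "0 \<le> I k T" for k T unfolding I_def by (intro Bochner_Integration.integral_nonneg) auto
    show "eventually (\<lambda>T. 0 \<le> W T) at_top"
      unfolding W_def by (intro always_eventually allI mult_nonneg_nonneg I0) (auto simp: q_def)
    show "eventually (\<lambda>T. W T \<le> 3 ^ ?d * K * (I m T / x T)\<^sup>2) at_top"
      using eventually_ge_at_top[of 1]
    proof eventually_elim
      case (elim T)
      have x0: "0 < x T" using elim by (simp add: x_def)
      have T0: "0 < T ^ ?d" using elim by simp
      have I2: "I 2 T \<le> K * x T ^ (m - 1)"
        unfolding I_def K_def by (rule second_moment_le[OF int _ rm m Bs measB[OF elim] x0]) simp
      have "W T = (q T)\<^sup>2 * (q T)\<^sup>2 * (I m T)\<^sup>2 * (measure ?\<nu> (D T) * I 2 T)"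
        unfolding W_def power2_eq_square by (simp only: mult_ac)
      also have "\<dots> \<le> (q T)\<^sup>2 * (q T)\<^sup>2 * (I m T)\<^sup>2 * ((3 ^ ?d * T ^ ?d) * (K * x T ^ (m - 1)))"
        by (intro mult_left_mono mult_mono measD[OF elim] I2 I0) (use elim in auto)
      also have "\<dots> = 3 ^ ?d * K * ((I m T)\<^sup>2 * (x T ^ (m - 1) / T ^ ?d))"
        using elim T0 by (simp add: q2 field_simps)
      \<comment> \<open>Here the powers balance: T^d = x^(m+1) = x^(m-1) x^2. What remains of the
        four factors q, the volume and the second moment is 1 / x^2, which pairs with the square of
        I_m.\<close>
      also have "x T ^ (m - 1) / T ^ ?d = 1 / (x T)\<^sup>2"
      proof -
        have e: "Suc m = (m - 1) + 2" using m by simp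
        have "T ^ ?d = x T ^ (m - 1) * (x T)\<^sup>2" using xl[of T] elim unfolding e power_add by simp
        then show ?thesis using x0 by simp
      qed
      finally show ?case by (simp add: power_divide)
    qed
  qed simp
  have "((\<lambda>T. (LINT \<omega>|M. cis (u * (q T * field_sum c D Q X T \<omega>))) - of_real (exp (- (V' T * u\<^sup>2 / 2)))) \<longlongrightarrow> 0) at_top"
  proof (rule Lim_null_comparison)
    show "eventually (\<lambda>T. norm ((LINT \<omega>|M. cis (u * (q T * field_sum c D Q X T \<omega>))) - of_real (exp (- (V' T * u\<^sup>2 / 2)))) \<le> u\<^sup>2 * sqrt (C * W T)) at_top"
      using eventually_ge_at_top[of 2] by eventually_elim (rule bound)
    show "((\<lambda>T. u\<^sup>2 * sqrt (C * W T)) \<longlongrightarrow> 0) at_top"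
      using tendsto_mult[OF tendsto_const tendsto_real_sqrt[OF tendsto_mult[OF tendsto_const W_lim]], of "u\<^sup>2" C] by simp
  qed
  moreover have "((\<lambda>T. complex_of_real (exp (- (V' T * u\<^sup>2 / 2)))) \<longlongrightarrow> of_real (exp (- (V * u\<^sup>2 / 2)))) at_top"
    by (intro tendsto_intros V'_lim) simp
  ultimately have "((\<lambda>T. LINT \<omega>|M. cis (u * (q T * field_sum c D Q X T \<omega>))) \<longlongrightarrow> of_real (exp (- (V * u\<^sup>2 / 2)))) at_top"
    using tendsto_add by fastforce
  then show "((\<lambda>T. LINT \<omega>|M. cis (u * (T powr (- real CARD('d) / 2) * field_sum c D Q X T \<omega>))) \<longlongrightarrow> of_real (exp (- (V * u\<^sup>2 / 2)))) at_top"
    by (simp only: q_def)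
qed

end

text \<open>Levy's theorem asks that every member of the sequence be a probability law on the line,
  whereas measurability is given only for large T. The sequence is therefore started late, which
  does not affect its limit.\<close>

lemma converges_in_law_at_topI:
  assumes M: "prob_space M" and Z: "eventually (\<lambda>T. Z T \<in> borel_measurable M) at_top" and v: "0 \<le> v"
    and lim: "\<And>u. ((\<lambda>T. LINT \<omega>|M. cis (u * Z T \<omega>)) \<longlongrightarrow> of_real (exp (- (v * u\<^sup>2 / 2)))) at_top"
  shows "converges_in_law_at_top M Z (normal_law 0 v)"
  unfolding converges_in_law_at_top_def
proof (intro allI impI)
  fix \<tau> :: "nat \<Rightarrow> real" assume \<tau>: "filterlim \<tau> at_top sequentially"
  interpret prob_space M by fact
  have "eventually (\<lambda>n. Z (\<tau> n) \<in> borel_measurable M) sequentially"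
    by (rule eventually_compose_filterlim[OF Z \<tau>])
  then obtain N where N: "\<And>n. N \<le> n \<Longrightarrow> Z (\<tau> n) \<in> borel_measurable M" by (auto simp: eventually_sequentially)
  have "weak_conv_m (\<lambda>n. distr M borel (Z (\<tau> (n + N)))) (normal_law 0 v)"
  proof (rule levy_continuity)
    show "real_distribution (distr M borel (Z (\<tau> (n + N))))" for n
      using N[of "n + N"] by (intro real_distribution_distr) simp
    show "real_distribution (normal_law 0 v)" by (rule real_distribution_normal_law[OF v])
    fix u
    have "char (distr M borel (Z (\<tau> (n + N)))) u = (LINT \<omega>|M. cis (u * Z (\<tau> (n + N)) \<omega>))" for n
      using N[of "n + N"] unfolding char_def by (subst integral_distr) (auto simp: cis_conv_exp)
    moreover have "filterlim (\<lambda>n. \<tau> (n + N)) at_top sequentially" using \<tau> by (rule filterlim_compose) (rule filterlim_add_const_nat_at_top)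
    then have "((\<lambda>n. LINT \<omega>|M. cis (u * Z (\<tau> (n + N)) \<omega>)) \<longlongrightarrow> of_real (exp (- (v * u\<^sup>2 / 2)))) sequentially"
      by (rule filterlim_compose[OF lim])
    ultimately show "(\<lambda>n. char (distr M borel (Z (\<tau> (n + N)))) u) \<longlonglongrightarrow> char (normal_law 0 v) u"
      unfolding char_normal_law[OF v] by simp
  qed
  then show "weak_conv_m (\<lambda>n. distr M borel (Z (\<tau> n))) (normal_law 0 v)"
    unfolding weak_conv_m_def weak_conv_def by (blast intro: LIMSEQ_offset)
qed

theorem theorem1p4:
  fixes M :: "'w measure"
    and X :: "real ^ 'd::finite \<Rightarrow> 'w \<Rightarrow> real"
    and f :: "real ^ 'd \<Rightarrow> real"
    and c :: time_case
    and D :: "real \<Rightarrow> (real ^ 'd) set"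
    and P :: "nat \<Rightarrow> real poly"
    and p :: ennreal
    and l :: nat
  assumes "prob_space M"
    and "gaussian_field c M X"
    and "stationary_field c M X"
    and "measurable_field c M X"
    and "has_spectral_density c M X f"
    and "1 \<le> p"
    and "f \<in> Lp_closure c p"
    and "D \<in> sampling_domains c"
    and "\<forall>t\<in>index_set c. appell (distr M borel (X t)) P"
    and "l \<ge> 2"
    and "inverse p \<le> ennreal (1 - 1 / real l)"
  shows "integrable (conv_measure c l) (conv_integrand c l f) \<and>
         (conv_at_0 c l f \<noteq> 0 \<longrightarrow>
          converges_in_law_at_top M
            (\<lambda>T \<omega>. T powr (- real CARD('d) / 2) * field_sum c D (P l) X T \<omega>)
            (normal_law 0 (variance_factor c CARD('d) l * conv_at_0 c l f)))"
proof (intro conjI impI)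
  interpret prob_space M by fact
  interpret G: stationary_gaussian M c X f by unfold_locales fact+
  show "integrable (conv_measure c l) (conv_integrand c l f)"
    by (rule conv_at_0_fourier(1)[OF G.f_integrable]) fact+
  assume nz: "conv_at_0 c l f \<noteq> 0"
  note Ir = G.integral_r_power[OF assms(7,6,10,11)]
  obtain m where m: "l = Suc m" "1 \<le> m" using assms(10) by (cases l) auto
  \<comment> \<open>The Gaussian estimates need a positive variance. If it were 0, all covariances
    at index times would vanish, and the inversion formula would make \<open>conv_at_0 c l f\<close>
    zero.\<close>
  have "G.r 0 \<noteq> 0"
  proof
    assume z: "G.r 0 = 0"
    have "AE t in time_measure c. G.r t ^ l = 0"
      using AE_time_measure by eventually_elim (use G.r_eq_0[OF z] m in simp)
    then have "(LINT t|time_measure c. G.r t ^ l) = 0" by (rule integral_eq_zero_AE)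
    then show False using Ir(2) nz by (auto split: time_case.splits)
  qed
  then have r0: "0 < G.r 0" using G.r_0_nonneg by simp
  have "appell (distr M borel (X 0)) P" using assms(9) index_set_zero by blast
  then have "poly (P l) x = poly (hermite (G.r 0) (Suc m)) (x - G.\<mu>)" for x
    using G.appell_hermite[OF _ r0, of P l] m by (simp add: poly_pcompose)
  note lim = G.field_sum_char_limit[OF assms(8) m(2) Ir(1)[unfolded m(1)] r0 this refl]
  define v where "v = variance_factor c CARD('d) l * conv_at_0 c l f"
  have v: "fact (Suc m) * (LINT t|time_measure c. G.r t ^ Suc m) = v"
    unfolding v_def variance_factor_def using Ir(2) by (simp only: m(1) mult.assoc)
  \<comment> \<open>Characteristic functions have modulus at most 1, so the limit at u = 1 satisfies
    exp (- v / 2) \<le> 1. This yields the nonnegativity of the limiting variance.\<close>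
  have "cmod (of_real (exp (- (v * 1\<^sup>2 / 2)))) \<le> 1"
  proof (rule tendsto_upperbound[OF tendsto_norm[OF lim(1)[unfolded v]]])
    show "eventually (\<lambda>T. cmod (LINT \<omega>|M. cis (1 * (T powr (- real CARD('d) / 2) * field_sum c D (P l) X T \<omega>))) \<le> 1) at_top"
      by (intro always_eventually allI order_trans[OF integral_norm_bound]) (simp add: prob_space)
  qed simp
  then have v0: "0 \<le> v" by simp
  show "converges_in_law_at_top M (\<lambda>T \<omega>. T powr (- real CARD('d) / 2) * field_sum c D (P l) X T \<omega>)
      (normal_law 0 (variance_factor c CARD('d) l * conv_at_0 c l f))"
    unfolding v_def[symmetric]
  proof (rule converges_in_law_at_topI[OF assms(1) _ v0 lim(1)[unfolded v]])
    show "eventually (\<lambda>T. (\<lambda>\<omega>. T powr (- real CARD('d) / 2) * field_sum c D (P l) X T \<omega>) \<in> borel_measurable M) at_top"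
      using lim(2) by eventually_elim measurable
  qed
qed

end
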